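(* Let $q\in(2,\infty)$, $\mu>0$, and let $\Omega\subset\mathbb{R}^2$ be an exterior domain with $C^{2+\mu}$-boundary such that $(x_1,x_2)\in\Omega$ implies $(x_1,-x_2),(-x_1,x_2),(x_2,x_1),(-x_2,-x_1)\in\Omega$. Let $\beta=\beta(\Omega,q,1)>0$ and $\gamma=\gamma(\Omega,q,1)>0$ be constants having Property (Y) stated in the context. Then there exists a constant $\delta=\delta(\Omega)>0$, depending only on $\Omega$, which has Property (U) stated in the context and for which the following holds. Let the external force $f$ be given by $$f_1=\frac{\partial F}{\partial x_1}+\frac{\partial G}{\partial x_2}+\frac{\partial H}{\partial x_2},\qquad f_2=-\frac{\partial F}{\partial x_2}+\frac{\partial G}{\partial x_1}-\frac{\partial H}{\partial x_1}$$ with scalar functions $F,G,H$ on $\Omega$ satisfying the symmetry conditions (S) of the context. Suppose $u\in\dot{H}_{0,\sigma}^{1,S}(\Omega)$ is a symmetric weak solution of the stationary Navier-Stokes equation with force $f$ satisfying the energy inequality $\|\nabla u\|_{L^2(\Omega)}^2\le(f,u)$. If $$\|F\|_{\chi(q,2)}+\|G\|_{\chi(q,2)}+\|H\|_{\chi(q,2)}\le\min\{\beta,\gamma^{-1}\delta\},$$ then $$(|x|+1)|u(x)|\in L^\infty(\Omega)\quad\text{and}\quad\nabla u\in L^r(\Omega)\ \text{ for every } r\in(1,q].$$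
   Context: An exterior domain is a domain in $\mathbb{R}^2$ that is the complement of a nonempty compact set. $C_{0,\sigma}^\infty(\Omega)$ is the set of smooth vector fields with compact support in $\Omega$ and zero divergence; $\dot{H}_{0,\sigma}^1(\Omega)$ is its completion in the norm $\|\nabla\cdot\|_{L^2(\Omega)}$, with dual space $\dot{H}_{0,\sigma}^{-1}(\Omega)$. $\dot{H}_{0,\sigma}^{1,S}(\Omega)$ is the set of $u=(u_1,u_2)\in\dot{H}_{0,\sigma}^1(\Omega)$ such that for each $i=1,2$ either $u_i(x_1,x_2)=-u_i(x_1,-x_2)$ or $u_i(x_1,x_2)=-u_i(-x_1,x_2)$ holds. $(\cdot,\cdot)$ denotes various duality pairings. The stationary Navier-Stokes equation is: $-\Delta u+u\cdot\nabla u+\nabla p=f$, $\operatorname{div}u=0$ in $\Omega$, $u=0$ on $\partial\Omega$, $u(x)\to0$ as $|x|\to\infty$. Given $f\in\dot{H}_{0,\sigma}^{-1}(\Omega)$, a symmetric weak solution is a function $u\in\dot{H}_{0,\sigma}^{1,S}(\Omega)$ such that $(\nabla u,\nabla\varphi)+(u\cdot\nabla u,\varphi)=(f,\varphi)$ for all $\varphi\in C_{0,\sigma}^\infty(\Omega)$, where $(u\cdot\nabla u)_j=\sum_iu_i\partial_iu_j$. Fix $R>0$ with $\partial\Omega\subset B(0,R):=\{|x|<R\}$ and let $\Omega_R:=\Omega\cap B(0,R)$. For $q\in[1,\infty)$ and $\alpha>0$, $\chi(q,\alpha)$ is the Banach space of locally integrable functions $g$ on $\Omega$ with $$\|g\|_{\chi(q,\alpha)}:=\frac{R^{\alpha-2/q}}{\pi^{1/q}}\|g\|_{L^q(\Omega_R)}+\sup_{r\ge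 R}\frac{r^{\alpha-2/q}}{\pi^{1/q}}\|g\|_{L^q(r\le|x|\le4r)}<\infty.$$ If $q>2$, then $\chi(q,2)\subset L^r(\Omega)$ for all $r\in(1,q]$. In particular, if $F,G,H\in\chi(q,2)$, the derivatives defining $f$ are distributional and $f\in\dot{H}_{0,\sigma}^{-1}(\Omega)$. Symmetry conditions (S): $F(x_1,x_2)=F(x_1,-x_2)=F(-x_1,x_2)$ and $F(x_1,x_2)=-F(x_2,x_1)=-F(-x_2,-x_1)$; $G(x_1,x_2)=-G(x_1,-x_2)=-G(-x_1,x_2)$ and $G(x_1,x_2)=G(x_2,x_1)=G(-x_2,-x_1)$; $H(x_1,x_2)=-H(x_1,-x_2)=-H(-x_1,x_2)$ and $H(x_1,x_2)=-H(x_2,x_1)=-H(-x_2,-x_1)$. Property (Y) (a known theorem of Yamazaki guarantees that constants $\beta,\gamma$ depending only on $\Omega,q$ with this property exist): whenever $F,G,H$ satisfy (S) and $\|F\|_{\chi(q,2)}+\|G\|_{\chi(q,2)}+\|H\|_{\chi(q,2)}\le\beta$, and $f$ is defined from $F,G,H$ by the formulas in the claim, the stationary Navier-Stokes equation with force $f$ admits a unique (weak) solution $v$ with $\nabla v\in\chi(q,2)$ and $\sup_{x\in\Omega}(|x|+1)|v(x)|<\infty$ subject to the estimate $$\sup_{x\in\Omega}(|x|+1)|v(x)|+\|\nabla v\|_{\chi(q,2)}\le\gamma\big(\|F\|_{\chi(q,2)}+\|G\|_{\chi(q,2)}+\|H\|_{\chi(q,2)}\big);$$ moreover $v$ satisfies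 $v_1(x_1,x_2)=v_1(x_1,-x_2)=-v_1(-x_1,x_2)$, $v_2(x_1,x_2)=-v_2(x_1,-x_2)=v_2(-x_1,x_2)$ and $v_1(x_2,x_1)=-v_1(-x_2,-x_1)=v_2(x_1,x_2)$, and in particular $v\in\dot{H}_{0,\sigma}^{1,S}(\Omega)$ is a symmetric weak solution. Property (U) of a constant $\delta>0$: for every $f\in\dot{H}_{0,\sigma}^{-1}(\Omega)$ and all symmetric weak solutions $u,v\in\dot{H}_{0,\sigma}^{1,S}(\Omega)$ with the same force $f$ and the same symmetry (for each $i$, either both $u_i,v_i$ are odd in $x_2$ or both are odd in $x_1$), if $\|\nabla u\|_{L^2(\Omega)}^2\le(f,u)$ and $\sup_{x\in\Omega}(|x|+1)|v(x)|\le\delta$, then $u=v$. *)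

theory Defs
  imports "HOL-Analysis.Analysis" "HOL-Probability.Essential_Supremum"
begin

abbreviation pt :: "real \<Rightarrow> real \<Rightarrow> real^2" where
  "pt a b \<equiv> vector [a, b]"

definition exterior_domain :: "(real^2) set \<Rightarrow> bool" where
  "exterior_domain \<Omega> \<longleftrightarrow> open \<Omega> \<and> connected \<Omega> \<and> compact (- \<Omega>) \<and> - \<Omega> \<noteq> {}"

definition reflection_invariant :: "(real^2) set \<Rightarrow> bool" where
  "reflection_invariant \<Omega> \<longleftrightarrow>
    (\<forall>x1 x2. pt x1 x2 \<in> \<Omega> \<longrightarrow>
      pt x1 (- x2) \<in> \<Omega> \<and> pt (- x1) x2 \<in> \<Omega> \<and> pt x2 x1 \<in> \<Omega> \<and> pt (- x2) (- x1) \<in> \<Omega>)"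

text \<open>
  \<open>Holder_class s\<close> is the class $C^s$ of functions on the line: with \<open>k\<close> the integer part of \<open>s\<close>,
  the function is \<open>k\<close> times continuously differentiable and its \<open>k\<close>-th derivative is locally
  Hoelder continuous with exponent \<open>s - k\<close>. For integral \<open>s\<close> this is the usual $C^k$.
\<close>

definition Holder_class :: "real \<Rightarrow> (real \<Rightarrow> real) \<Rightarrow> bool" where
  "Holder_class s h \<longleftrightarrow>
    (let k = nat \<lfloor>s\<rfloor> in
      (\<forall>j<k. \<forall>t. (deriv ^^ j) h field_differentiable at t) \<and>
      continuous_on UNIV ((deriv ^^ k) h) \<and>
      (\<forall>b. \<exists>C. \<forall>t\<in>{-b..b}. \<forall>t'\<in>{-b..b}.
         \<bar>(deriv ^^ k) h t - (deriv ^^ k) h t'\<bar> \<le> C * \<bar>t - t'\<bar> powr (s - real k)))"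

text \<open>Near each boundary point, in suitable orthonormal coordinates, the set is the region strictly
  above the graph of a function of the class.\<close>

definition Holder_boundary :: "real \<Rightarrow> (real^2) set \<Rightarrow> bool" where
  "Holder_boundary s \<Omega> \<longleftrightarrow>
    (\<forall>x0\<in>frontier \<Omega>. \<exists>(T :: real^2 \<Rightarrow> real^2) r h.
       orthogonal_transformation T \<and> r > 0 \<and> Holder_class s h \<and>
       \<Omega> \<inter> ball x0 r = {x \<in> ball x0 r. T (x - x0) $ 2 > h (T (x - x0) $ 1)})"

definition partial :: "2 \<Rightarrow> (real^2 \<Rightarrow> 'b::real_normed_vector) \<Rightarrow> real^2 \<Rightarrow> 'b" where
  "partial i f x = frechet_derivative f (at x) (axis i 1)"

definition smooth :: "(real^2 \<Rightarrow> 'b::real_normed_vector) \<Rightarrow> bool" where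
  "smooth f \<longleftrightarrow> (\<forall>ms x. foldr partial ms f differentiable at x)"

definition test_functions :: "(real^2) set \<Rightarrow> (real^2 \<Rightarrow> 'b::real_normed_vector) set" where
  "test_functions \<Omega> =
    {\<phi>. smooth \<phi> \<and> compact (closure {x. \<phi> x \<noteq> 0}) \<and> closure {x. \<phi> x \<noteq> 0} \<subseteq> \<Omega>}"

text \<open>Gradients of vector fields are matrices with entries $(\nabla u)_{ij} = \partial_i u_j$; the norm
  and the inner product of \<^typ>\<open>real^2^2\<close> are those of Frobenius.\<close>

definition grad :: "(real^2 \<Rightarrow> real^2) \<Rightarrow> real^2 \<Rightarrow> real^2^2" where
  "grad \<phi> x = (\<chi> i j. partial i (\<lambda>y. \<phi> y $ j) x)"

definition solenoidal_test_functions :: "(real^2) set \<Rightarrow> (real^2 \<Rightarrow> real^2) set" where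
  "solenoidal_test_functions \<Omega> =
    {\<phi> \<in> test_functions \<Omega>. \<forall>x. (\<Sum>i\<in>UNIV. partial i (\<lambda>y. \<phi> y $ i) x) = 0}"

definition locally_integrable ::
    "(real^2) set \<Rightarrow> (real^2 \<Rightarrow> 'b::euclidean_space) \<Rightarrow> bool" where
  "locally_integrable \<Omega> g \<longleftrightarrow> (\<forall>K. compact K \<and> K \<subseteq> \<Omega> \<longrightarrow> g absolutely_integrable_on K)"

definition distr_partial ::
    "(real^2) set \<Rightarrow> 2 \<Rightarrow> (real^2 \<Rightarrow> real) \<Rightarrow> (real^2 \<Rightarrow> real) \<Rightarrow> real" where
  "distr_partial \<Omega> i g \<psi> = - (LINT x|lebesgue_on \<Omega>. g x * partial i \<psi> x)"

definition weak_partial ::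
    "(real^2) set \<Rightarrow> 2 \<Rightarrow> (real^2 \<Rightarrow> real) \<Rightarrow> (real^2 \<Rightarrow> real) \<Rightarrow> bool" where
  "weak_partial \<Omega> i g h \<longleftrightarrow>
    locally_integrable \<Omega> g \<and> locally_integrable \<Omega> h \<and>
    (\<forall>\<psi>\<in>test_functions \<Omega>. distr_partial \<Omega> i g \<psi> = (LINT x|lebesgue_on \<Omega>. h x * \<psi> x))"

text \<open>The weak gradient is determined only almost everywhere; \<open>wgrad\<close> picks a representative, and
  it is meaningful only for functions that do have a weak gradient.\<close>

definition wgrad :: "(real^2) set \<Rightarrow> (real^2 \<Rightarrow> real^2) \<Rightarrow> real^2 \<Rightarrow> real^2^2" where
  "wgrad \<Omega> u =
    (SOME A. \<forall>i j. weak_partial \<Omega> i (\<lambda>x. u x $ j) (\<lambda>x. A x $ i $ j))"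

definition Lp_norm ::
    "real \<Rightarrow> (real^2) set \<Rightarrow> (real^2 \<Rightarrow> 'b::real_normed_vector) \<Rightarrow> ennreal" where
  "Lp_norm p S g =
    (let I = (\<integral>\<^sup>+x. ennreal (norm (g x) powr p) \<partial>lebesgue_on S)
     in if I = \<infinity> then \<infinity> else ennreal (enn2real I powr (1 / p)))"

definition in_Lp ::
    "real \<Rightarrow> (real^2) set \<Rightarrow> (real^2 \<Rightarrow> 'b::real_normed_vector) \<Rightarrow> bool" where
  "in_Lp p S g \<longleftrightarrow> g \<in> borel_measurable (lebesgue_on S) \<and> Lp_norm p S g < \<infinity>"

definition chi_norm ::
    "real \<Rightarrow> real \<Rightarrow> real \<Rightarrow> (real^2) set \<Rightarrow> (real^2 \<Rightarrow> 'b::real_normed_vector) \<Rightarrow> ennreal" where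
  "chi_norm R q \<alpha> \<Omega> g =
    ennreal (R powr (\<alpha> - 2 / q) / pi powr (1 / q)) * Lp_norm q (\<Omega> \<inter> ball 0 R) g +
    (SUP r\<in>{R..}. ennreal (r powr (\<alpha> - 2 / q) / pi powr (1 / q)) *
       Lp_norm q {x. r \<le> norm x \<and> norm x \<le> 4 * r} g)"

definition in_chi ::
    "real \<Rightarrow> real \<Rightarrow> real \<Rightarrow> (real^2) set \<Rightarrow> (real^2 \<Rightarrow> 'b::euclidean_space) \<Rightarrow> bool" where
  "in_chi R q \<alpha> \<Omega> g \<longleftrightarrow> locally_integrable \<Omega> g \<and> chi_norm R q \<alpha> \<Omega> g < \<infinity>"

text \<open>The supremum of $(|x|+1)|v(x)|$ over \<open>\<Omega>\<close>. Elements of the spaces below are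
  classes of functions modulo null sets, so it is an essential supremum.\<close>

definition weighted_sup :: "(real^2) set \<Rightarrow> (real^2 \<Rightarrow> real^2) \<Rightarrow> ennreal" where
  "weighted_sup \<Omega> v = esssup (lebesgue_on \<Omega>) (\<lambda>x. ennreal ((norm x + 1) * norm (v x)))"

text \<open>
  The completion of the solenoidal test functions in the Dirichlet norm, realised as a space of
  functions. On the exterior domains considered here the complement has interior points, hence
  the Dirichlet norm of a test function controls its $L^2$ norm on every bounded part of the domain,
  Cauchy sequences in the Dirichlet norm converge in $L^2$ on bounded parts, and a class of
  Cauchy sequences is determined by the limit. Functions are representatives: the values
  outside \<open>\<Omega>\<close> and on null sets are irrelevant.
\<close>

definition H1 :: "(real^2) set \<Rightarrow> (real^2 \<Rightarrow> real^2) set" where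
  "H1 \<Omega> = {u. u \<in> borel_measurable (lebesgue_on \<Omega>) \<and>
     (\<exists>\<phi> :: nat \<Rightarrow> real^2 \<Rightarrow> real^2.
        (\<forall>n. \<phi> n \<in> solenoidal_test_functions \<Omega>) \<and>
        (\<forall>e>0. \<exists>N. \<forall>m\<ge>N. \<forall>n\<ge>N.
           Lp_norm 2 \<Omega> (\<lambda>x. grad (\<phi> m) x - grad (\<phi> n) x) < ennreal e) \<and>
        (\<forall>r>0. (\<lambda>n. Lp_norm 2 (\<Omega> \<inter> ball 0 r) (\<lambda>x. \<phi> n x - u x)) \<longlonglongrightarrow> 0))}"

text \<open>Elements of \<^term>\<open>H1 \<Omega>\<close> have a square integrable weak gradient, so that nothing is lost
  in taking the real value of the norm.\<close>

definition Dirichlet_norm :: "(real^2) set \<Rightarrow> (real^2 \<Rightarrow> real^2) \<Rightarrow> real" where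
  "Dirichlet_norm \<Omega> u = enn2real (Lp_norm 2 \<Omega> (wgrad \<Omega> u))"

text \<open>A functional is a function on representatives; linearity and boundedness make it
  compatible with equality almost everywhere.\<close>

definition H1_dual :: "(real^2) set \<Rightarrow> ((real^2 \<Rightarrow> real^2) \<Rightarrow> real) set" where
  "H1_dual \<Omega> = {f.
     (\<forall>u\<in>H1 \<Omega>. \<forall>v\<in>H1 \<Omega>. f (\<lambda>x. u x + v x) = f u + f v) \<and>
     (\<forall>c. \<forall>u\<in>H1 \<Omega>. f (\<lambda>x. c *\<^sub>R u x) = c * f u) \<and>
     (\<exists>C. \<forall>u\<in>H1 \<Omega>. \<bar>f u\<bar> \<le> C * Dirichlet_norm \<Omega> u)}"

definition odd_x1 :: "(real^2) set \<Rightarrow> (real^2 \<Rightarrow> real) \<Rightarrow> bool" where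
  "odd_x1 \<Omega> g \<longleftrightarrow> (AE x in lebesgue_on \<Omega>. g (pt (x$1) (x$2)) = - g (pt (- (x$1)) (x$2)))"

definition odd_x2 :: "(real^2) set \<Rightarrow> (real^2 \<Rightarrow> real) \<Rightarrow> bool" where
  "odd_x2 \<Omega> g \<longleftrightarrow> (AE x in lebesgue_on \<Omega>. g (pt (x$1) (x$2)) = - g (pt (x$1) (- (x$2))))"

definition H1S :: "(real^2) set \<Rightarrow> (real^2 \<Rightarrow> real^2) set" where
  "H1S \<Omega> = {u \<in> H1 \<Omega>. \<forall>i. odd_x2 \<Omega> (\<lambda>x. u x $ i) \<or> odd_x1 \<Omega> (\<lambda>x. u x $ i)}"

definition same_symmetry ::
    "(real^2) set \<Rightarrow> (real^2 \<Rightarrow> real^2) \<Rightarrow> (real^2 \<Rightarrow> real^2) \<Rightarrow> bool" where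
  "same_symmetry \<Omega> u v \<longleftrightarrow>
    (\<forall>i. odd_x2 \<Omega> (\<lambda>x. u x $ i) \<and> odd_x2 \<Omega> (\<lambda>x. v x $ i) \<or>
         odd_x1 \<Omega> (\<lambda>x. u x $ i) \<and> odd_x1 \<Omega> (\<lambda>x. v x $ i))"

definition force_symmetries ::
    "(real^2) set \<Rightarrow> (real^2 \<Rightarrow> real) \<Rightarrow> (real^2 \<Rightarrow> real) \<Rightarrow> (real^2 \<Rightarrow> real) \<Rightarrow> bool" where
  "force_symmetries \<Omega> F G H \<longleftrightarrow>
    (AE x in lebesgue_on \<Omega>. \<forall>x1 x2. x = pt x1 x2 \<longrightarrow>
       F (pt x1 x2) = F (pt x1 (- x2)) \<and> F (pt x1 (- x2)) = F (pt (- x1) x2) \<and>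
       F (pt x1 x2) = - F (pt x2 x1) \<and> - F (pt x2 x1) = - F (pt (- x2) (- x1)) \<and>
       G (pt x1 x2) = - G (pt x1 (- x2)) \<and> - G (pt x1 (- x2)) = - G (pt (- x1) x2) \<and>
       G (pt x1 x2) = G (pt x2 x1) \<and> G (pt x2 x1) = G (pt (- x2) (- x1)) \<and>
       H (pt x1 x2) = - H (pt x1 (- x2)) \<and> - H (pt x1 (- x2)) = - H (pt (- x1) x2) \<and>
       H (pt x1 x2) = - H (pt x2 x1) \<and> - H (pt x2 x1) = - H (pt (- x2) (- x1)))"

definition velocity_symmetries :: "(real^2) set \<Rightarrow> (real^2 \<Rightarrow> real^2) \<Rightarrow> bool" where
  "velocity_symmetries \<Omega> v \<longleftrightarrow>
    (AE x in lebesgue_on \<Omega>. \<forall>x1 x2. x = pt x1 x2 \<longrightarrow>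
       v (pt x1 x2) $ 1 = v (pt x1 (- x2)) $ 1 \<and>
       v (pt x1 (- x2)) $ 1 = - (v (pt (- x1) x2) $ 1) \<and>
       v (pt x1 x2) $ 2 = - (v (pt x1 (- x2)) $ 2) \<and>
       - (v (pt x1 (- x2)) $ 2) = v (pt (- x1) x2) $ 2 \<and>
       v (pt x2 x1) $ 1 = - (v (pt (- x2) (- x1)) $ 1) \<and>
       - (v (pt (- x2) (- x1)) $ 1) = v (pt x1 x2) $ 2)"

definition convection :: "(real^2) set \<Rightarrow> (real^2 \<Rightarrow> real^2) \<Rightarrow> real^2 \<Rightarrow> real^2" where
  "convection \<Omega> u x = (\<chi> j. \<Sum>i\<in>UNIV. u x $ i * wgrad \<Omega> u x $ i $ j)"

definition weak_solution ::
    "(real^2) set \<Rightarrow> ((real^2 \<Rightarrow> real^2) \<Rightarrow> real) \<Rightarrow> (real^2 \<Rightarrow> real^2) \<Rightarrow> bool" where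
  "weak_solution \<Omega> f u \<longleftrightarrow> u \<in> H1 \<Omega> \<and>
    (\<forall>\<phi>\<in>solenoidal_test_functions \<Omega>.
       (LINT x|lebesgue_on \<Omega>. wgrad \<Omega> u x \<bullet> grad \<phi> x) +
       (LINT x|lebesgue_on \<Omega>. convection \<Omega> u x \<bullet> \<phi> x) = f \<phi>)"

definition symmetric_weak_solution ::
    "(real^2) set \<Rightarrow> ((real^2 \<Rightarrow> real^2) \<Rightarrow> real) \<Rightarrow> (real^2 \<Rightarrow> real^2) \<Rightarrow> bool" where
  "symmetric_weak_solution \<Omega> f u \<longleftrightarrow> u \<in> H1S \<Omega> \<and> weak_solution \<Omega> f u"

definition energy_inequality ::
    "(real^2) set \<Rightarrow> ((real^2 \<Rightarrow> real^2) \<Rightarrow> real) \<Rightarrow> (real^2 \<Rightarrow> real^2) \<Rightarrow> bool" where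
  "energy_inequality \<Omega> f u \<longleftrightarrow> (Dirichlet_norm \<Omega> u)\<^sup>2 \<le> f u"

text \<open>\<open>force_of \<Omega> F G H f\<close>: the functional \<open>f\<close> is the continuous extension to \<^term>\<open>H1 \<Omega>\<close>
  of the distribution with components
  $f_1 = \partial_1 F + \partial_2 G + \partial_2 H$ and
  $f_2 = - \partial_2 F + \partial_1 G - \partial_1 H$.\<close>

definition force_of ::
    "(real^2) set \<Rightarrow> (real^2 \<Rightarrow> real) \<Rightarrow> (real^2 \<Rightarrow> real) \<Rightarrow> (real^2 \<Rightarrow> real) \<Rightarrow>
     ((real^2 \<Rightarrow> real^2) \<Rightarrow> real) \<Rightarrow> bool" where
  "force_of \<Omega> F G H f \<longleftrightarrow> f \<in> H1_dual \<Omega> \<and>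
    (\<forall>\<phi>\<in>solenoidal_test_functions \<Omega>.
       f \<phi> =
         (let \<phi>1 = (\<lambda>x. \<phi> x $ 1); \<phi>2 = (\<lambda>x. \<phi> x $ 2) in
          (distr_partial \<Omega> 1 F \<phi>1 + distr_partial \<Omega> 2 G \<phi>1 + distr_partial \<Omega> 2 H \<phi>1) +
          (- distr_partial \<Omega> 2 F \<phi>2 + distr_partial \<Omega> 1 G \<phi>2 - distr_partial \<Omega> 1 H \<phi>2)))"

definition small_solution ::
    "real \<Rightarrow> real \<Rightarrow> (real^2) set \<Rightarrow> ((real^2 \<Rightarrow> real^2) \<Rightarrow> real) \<Rightarrow> ennreal \<Rightarrow>
     (real^2 \<Rightarrow> real^2) \<Rightarrow> bool" where
  "small_solution R q \<Omega> f b v \<longleftrightarrow>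
    weak_solution \<Omega> f v \<and> in_chi R q 2 \<Omega> (wgrad \<Omega> v) \<and> weighted_sup \<Omega> v < \<infinity> \<and>
    weighted_sup \<Omega> v + chi_norm R q 2 \<Omega> (wgrad \<Omega> v) \<le> b"

definition property_Y :: "real \<Rightarrow> real \<Rightarrow> (real^2) set \<Rightarrow> real \<Rightarrow> real \<Rightarrow> bool" where
  "property_Y R q \<Omega> \<beta> \<gamma> \<longleftrightarrow>
    (\<forall>F G H f.
       in_chi R q 2 \<Omega> F \<and> in_chi R q 2 \<Omega> G \<and> in_chi R q 2 \<Omega> H \<and>
       force_symmetries \<Omega> F G H \<and> force_of \<Omega> F G H f \<and>
       chi_norm R q 2 \<Omega> F + chi_norm R q 2 \<Omega> G + chi_norm R q 2 \<Omega> H \<le> ennreal \<beta> \<longrightarrow>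
       (let b = ennreal \<gamma> * (chi_norm R q 2 \<Omega> F + chi_norm R q 2 \<Omega> G + chi_norm R q 2 \<Omega> H) in
        \<exists>v. small_solution R q \<Omega> f b v \<and>
            (\<forall>w. small_solution R q \<Omega> f b w \<longrightarrow> (AE x in lebesgue_on \<Omega>. w x = v x)) \<and>
            velocity_symmetries \<Omega> v \<and> symmetric_weak_solution \<Omega> f v))"

definition property_U :: "(real^2) set \<Rightarrow> real \<Rightarrow> bool" where
  "property_U \<Omega> \<delta> \<longleftrightarrow>
    (\<forall>f\<in>H1_dual \<Omega>. \<forall>u v.
       symmetric_weak_solution \<Omega> f u \<and> symmetric_weak_solution \<Omega> f v \<and> same_symmetry \<Omega> u v \<and>
       energy_inequality \<Omega> f u \<and> weighted_sup \<Omega> v \<le> ennreal \<delta> \<longrightarrow>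
       (AE x in lebesgue_on \<Omega>. u x = v x))"

end

theory Submission
  imports Defs
begin

text \<open>
  A component of a symmetric field is odd in one of the coordinates, so the one-dimensional Hardy
  inequality gives $\int |u|^2 / (1 + |x|)^2 \le 16 \int |\nabla u|^2$. Truncating stream functions
  then shows that the limit fields themselves may be used as test functions wherever the convection
  terms are controlled by $(1 + |x|) |v| \le \delta$. For $w = u - v$ the energy inequality and the
  antisymmetry of the convection term give
  $\|\nabla w\|^2 \le (w \cdot \nabla w, v) \le 4 \delta \|\nabla w\|^2$, whence $w = 0$ for
  $\delta = 1/8$.

  If \<open>u\<close> has the symmetry of the solution supplied by Property (Y), this identifies the two.
  In each of the remaining symmetry classes parity (together with $\mathrm{div}\, u = 0$) makes every
  term of $(f, u)$ vanish, so the energy inequality forces $u = 0$.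
\<close>

text \<open>Only v decays pointwise; u is known through its Dirichlet integral and Hardy's
  inequality alone. So (u . grad u, u) cannot be formed, and the energy inequality stands in for
  testing the equation of u with u; every other pairing contains v. The obstacle is that the test
  fields approximating v inherit no decay from it, while a cut-off must keep the divergence zero.
  Cutting the stream function P costs an error P grad(cut), and the weight |u| |grad u| / (1 + |x|)
  is integrable with nothing to spare, so an L^2 bound of P is too weak. Instead P is bounded
  pointwise by integrals that depend on one coordinate only. At distance at least k from an axis the
  decay of v bounds them, and what the approximation adds is a function of one variable, against
  which |u|^2 is integrable by a one-dimensional Sobolev estimate. The constants of that estimate
  depend on k without control, so the approximation index tends to infinity before k does. The 16 in
  Hardy's inequality is 4 from the line, doubled by the triangle inequality in the passage to the
  limit and again by the two components.\<close>

abbreviation nn_lborel :: "('a::euclidean_space \<Rightarrow> ennreal) \<Rightarrow> ennreal" (binder "NNINT " 10) where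
  "nn_lborel f \<equiv> nn_integral lborel f"

abbreviation NNset :: "'a::euclidean_space set \<Rightarrow> ('a \<Rightarrow> ennreal) \<Rightarrow> ennreal" where
  "NNset S f \<equiv> set_nn_integral lborel S f"

abbreviation borel_fun :: "('a::topological_space \<Rightarrow> 'b::topological_space) \<Rightarrow> bool" where
  "borel_fun f \<equiv> f \<in> borel_measurable borel"

text \<open>The squared L^2 norm over \<open>lborel\<close>, valued in \<open>ennreal\<close>:
  estimates need no finiteness proviso and no roots. The price is the factor 2 in the triangle
  inequality.\<close>

definition sqi :: "(real^2) set \<Rightarrow> (real^2 \<Rightarrow> 'b::real_normed_vector) \<Rightarrow> ennreal" where
  "sqi S f = NNset S (\<lambda>x. ennreal ((norm (f x))^2))"

text \<open>Squares rather than discs: as products of intervals they suit Fubini and integration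
  along lines, and they are invariant under both reflections and under the exchange of
  coordinates.\<close>

definition square :: "real \<Rightarrow> (real^2) set" where
  "square r = {p. \<bar>p$1\<bar> \<le> r \<and> \<bar>p$2\<bar> \<le> r}"

section \<open>Coordinates and Lebesgue measure in the plane\<close>

lemma pt_nth [simp]: "pt a b $ 1 = a" "pt a b $ 2 = b"
  by (simp_all add: vector_2)

lemma pt_eta [simp]: "pt (p$1) (p$2) = p"
  by (simp add: vec_eq_iff forall_2)

lemma norm_pair: "norm (p::real^2) = sqrt ((p$1)^2 + (p$2)^2)"
  by (simp add: norm_vec_def L2_set_def sum_2)

lemma norm_pair_sq: "(norm (p::real^2))^2 = (p$1)^2 + (p$2)^2"
  by (simp add: norm_pair)

lemma continuous_pt: "continuous_on UNIV (\<lambda>(x,y). pt x y)"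
proof -
  have "(\<lambda>(x,y). pt x y) = (\<lambda>z. fst z *\<^sub>R axis 1 1 + snd z *\<^sub>R axis 2 1)"
    by (auto simp: fun_eq_iff vec_eq_iff forall_2 axis_def)
  then show ?thesis by (simp add: continuous_intros)
qed

lemma measurable_pt [measurable]: "(\<lambda>(x,y). pt x y) \<in> borel_measurable (borel \<Otimes>\<^sub>M borel)"
  using borel_measurable_continuous_onI[OF continuous_pt] by (simp add: borel_prod)

lemma measurable_pt' [measurable]:
  assumes "f \<in> borel_measurable M" "g \<in> borel_measurable M"
  shows "(\<lambda>x. pt (f x) (g x)) \<in> borel_measurable M"
proof -
  have "(\<lambda>x. (f x, g x)) \<in> M \<rightarrow>\<^sub>M borel \<Otimes>\<^sub>M borel" using assms by measurable
  from measurable_compose[OF this measurable_pt] show ?thesis by simp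
qed

lemma measurable_nth2 [measurable (raw)]:
  "f \<in> borel_measurable M \<Longrightarrow> (\<lambda>x. (f x :: 'a::{euclidean_space} ^'n::finite) $ i) \<in> borel_measurable M"
  by (rule measurable_compose[OF _ borel_measurable_continuous_onI]) (auto intro!: continuous_intros)

lemma Basis_pair: "(Basis :: (real^2) set) = {axis 1 1, axis 2 1}"
  by (auto simp: Basis_vec_def UNIV_2)

lemma axis12: "axis (1::2) (1::real) \<noteq> axis 2 1"
  by (simp add: axis_eq_axis)

lemma inner_axis2 [simp]: "(p::real^2) \<bullet> axis i 1 = p $ i"
  by (simp add: inner_axis)

text \<open>Both measures agree on boxes, which determine Lebesgue measure. Since
  \<open>real^2\<close> is not a product type, this is the link through which Fubini's theorem
  reaches integrals over the plane.\<close>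

lemma lborel_plane: "distr (lborel \<Otimes>\<^sub>M lborel) borel (\<lambda>(x,y). pt x y) = lborel"
proof -
  have "emeasure (distr (lborel \<Otimes>\<^sub>M lborel) borel (\<lambda>(x,y). pt x y)) (box l u) = (\<Prod>b\<in>Basis. (u - l) \<bullet> b)"
    if le: "\<And>b. b\<in>Basis \<Longrightarrow> l \<bullet> b \<le> u \<bullet> b" for l u :: "real^2"
  proof -
    have *: "l$1 \<le> u$1" "l$2 \<le> u$2"
      using le[of "axis 1 1"] le[of "axis 2 1"] by (auto simp: Basis_pair)
    have "(\<lambda>(x,y). pt x y) -` box l u \<inter> space (lborel \<Otimes>\<^sub>M lborel) = {l$1<..<u$1} \<times> {l$2<..<u$2}"
      by (auto simp: mem_box Basis_pair space_pair_measure)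
    then have "emeasure (distr (lborel \<Otimes>\<^sub>M lborel) borel (\<lambda>(x,y). pt x y)) (box l u)
      = emeasure (lborel \<Otimes>\<^sub>M lborel) ({l$1<..<u$1} \<times> {l$2<..<u$2})"
      by (subst emeasure_distr) auto
    also have "\<dots> = emeasure lborel {l$1<..<u$1} * emeasure lborel {l$2<..<u$2}"
      by (rule lborel.emeasure_pair_measure_Times) auto
    also have "\<dots> = ennreal ((u$1 - l$1) * (u$2 - l$2))"
      using * by (simp add: ennreal_mult')
    finally show ?thesis using * axis12 by (simp add: Basis_pair)
  qed
  then show ?thesis by (intro lborel_eqI[symmetric]) auto
qed

lemma nn_integral_plane:
  fixes f :: "real^2 \<Rightarrow> ennreal"
  assumes [measurable]: "borel_fun f"
  shows "(NNINT p. f p) = (NNINT y. (NNINT x. f (pt x y)))"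
    and "(NNINT p. f p) = (NNINT x. (NNINT y. f (pt x y)))"
proof -
  have "(NNINT p. f p) = (\<integral>\<^sup>+z. f (case z of (x,y) \<Rightarrow> pt x y) \<partial>(lborel \<Otimes>\<^sub>M lborel))"
    by (subst lborel_plane[symmetric], subst nn_integral_distr) auto
  also have "\<dots> = (\<integral>\<^sup>+z. (case z of (x,y) \<Rightarrow> f (pt x y)) \<partial>(lborel \<Otimes>\<^sub>M lborel))"
    by (simp add: case_prod_beta)
  finally have *: "(NNINT p. f p) = (\<integral>\<^sup>+z. (case z of (x,y) \<Rightarrow> f (pt x y)) \<partial>(lborel \<Otimes>\<^sub>M lborel))" .
  show "(NNINT p. f p) = (NNINT y. (NNINT x. f (pt x y)))"
    unfolding * by (subst lborel_pair.nn_integral_snd[symmetric]) (auto simp: case_prod_beta)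
  show "(NNINT p. f p) = (NNINT x. (NNINT y. f (pt x y)))"
    unfolding * by (subst lborel.nn_integral_fst[symmetric]) auto
qed

lemma integral_plane:
  fixes f :: "real^2 \<Rightarrow> real"
  assumes "integrable lborel f"
  shows "(LBINT p. f p) = (LBINT y. (LBINT x. f (pt x y)))"
    and "(LBINT p. f p) = (LBINT x. (LBINT y. f (pt x y)))"
proof -
  have [measurable]: "borel_fun f" using assms by auto
  have i: "integrable (lborel \<Otimes>\<^sub>M lborel) (\<lambda>z. f (case z of (x,y) \<Rightarrow> pt x y))"
    using assms by (subst (asm) lborel_plane[symmetric], subst (asm) integrable_distr_eq) auto
  then have i': "integrable (lborel \<Otimes>\<^sub>M lborel) (case_prod (\<lambda>x y. f (pt x y)))"
    by (simp add: case_prod_unfold)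
  have *: "(LBINT p. f p) = (\<integral>z. (case z of (x,y) \<Rightarrow> f (pt x y)) \<partial>(lborel \<Otimes>\<^sub>M lborel))"
    by (subst lborel_plane[symmetric], subst integral_distr) (auto simp: case_prod_unfold)
  show "(LBINT p. f p) = (LBINT y. (LBINT x. f (pt x y)))"
    unfolding * using lborel_pair.integral_snd[OF i'] by simp
  show "(LBINT p. f p) = (LBINT x. (LBINT y. f (pt x y)))"
    unfolding * using lborel_pair.integral_fst'[OF i'] by simp
qed

lemma AE_plane:
  assumes P: "AE p in lborel. P (p::real^2)" and [measurable]: "Measurable.pred borel P"
  shows "AE y in lborel. AE x in lborel. P (pt x y)"
    and "AE x in lborel. AE y in lborel. P (pt x y)"
proof -
  have "(NNINT p. indicator {p. \<not> P p} p) = (0::ennreal)"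
    using P by (subst nn_integral_0_iff_AE) (auto elim!: AE_mp simp: indicator_def)
  then have "(NNINT y. (NNINT x. indicator {p. \<not> P p} (pt x y))) = (0::ennreal)"
    "(NNINT x. (NNINT y. indicator {p. \<not> P p} (pt x y))) = (0::ennreal)"
    by (simp_all flip: nn_integral_plane)
  then show "AE y in lborel. AE x in lborel. P (pt x y)"
    "AE x in lborel. AE y in lborel. P (pt x y)"
    by (subst (asm) nn_integral_0_iff_AE; simp add: nn_integral_0_iff_AE indicator_def)+
qed

text \<open>Fubini reduces each map to one dimension: exchanging the coordinates exchanges the order
  of integration, and a reflection is the substitution x -> -x on lines.\<close>

lemma lborel_linear_swaps:
  "distr lborel borel (\<lambda>p::real^2. pt (p$2) (p$1)) = lborel"
  "distr lborel borel (\<lambda>p::real^2. pt (- (p$1)) (p$2)) = lborel"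
  "distr lborel borel (\<lambda>p::real^2. pt (p$1) (- (p$2))) = lborel"
proof -
  have um: "(NNINT x. f (-x)) = (NNINT x. f x)" if [measurable]: "borel_fun f"
    for f :: "real \<Rightarrow> ennreal"
    using nn_integral_real_affine[of f "-1" 0] that by simp
  have eq: "distr lborel borel T = lborel" if [measurable]: "borel_fun T"
    and T: "\<And>f. borel_fun f \<Longrightarrow> (NNINT p. f (T p)) = (NNINT p. f p)"
    for T :: "real^2 \<Rightarrow> real^2"
  proof (rule measure_eqI)
    fix A assume "A \<in> sets (distr lborel borel T)"
    then have [measurable]: "A \<in> sets borel" by simp
    have "emeasure (distr lborel borel T) A = (\<integral>\<^sup>+p. indicator A p \<partial>distr lborel borel T)" by simp
    also have "\<dots> = (NNINT p. indicator A (T p))" by (subst nn_integral_distr) auto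
    also have "\<dots> = (NNINT p. indicator A p)" by (rule T) auto
    finally show "emeasure (distr lborel borel T) A = emeasure lborel A" by simp
  qed auto
  show "distr lborel borel (\<lambda>p::real^2. pt (p$2) (p$1)) = lborel"
  proof (rule eq)
    fix f :: "real^2 \<Rightarrow> ennreal" assume [measurable]: "borel_fun f"
    have "(NNINT p. f (pt ((p::real^2) $ 2) (p $ 1))) = (\<integral>\<^sup>+y. \<integral>\<^sup>+x. f (pt y x) \<partial>lborel \<partial>lborel)"
      by (subst nn_integral_plane(1)) auto
    then show "(NNINT p. f (pt ((p::real^2) $ 2) (p $ 1))) = integral\<^sup>N lborel f"
      by (simp add: nn_integral_plane(2))
  qed auto
  show "distr lborel borel (\<lambda>p::real^2. pt (- (p$1)) (p$2)) = lborel"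
  proof (rule eq)
    fix f :: "real^2 \<Rightarrow> ennreal" assume [measurable]: "borel_fun f"
    have "(NNINT p. f (pt (- ((p::real^2) $ 1)) (p $ 2))) = (\<integral>\<^sup>+y. \<integral>\<^sup>+x. f (pt (-x) y) \<partial>lborel \<partial>lborel)"
      by (subst nn_integral_plane(1)) auto
    also have "\<dots> = (\<integral>\<^sup>+y. \<integral>\<^sup>+x. f (pt x y) \<partial>lborel \<partial>lborel)"
      by (intro nn_integral_cong um) auto
    finally show "(NNINT p. f (pt (- ((p::real^2) $ 1)) (p $ 2))) = integral\<^sup>N lborel f"
      by (simp add: nn_integral_plane(1))
  qed auto
  show "distr lborel borel (\<lambda>p::real^2. pt (p$1) (- (p$2))) = lborel"
  proof (rule eq)
    fix f :: "real^2 \<Rightarrow> ennreal" assume [measurable]: "borel_fun f"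
    have "(NNINT p. f (pt ((p::real^2) $ 1) (- (p $ 2)))) = (\<integral>\<^sup>+x. \<integral>\<^sup>+y. f (pt x (-y)) \<partial>lborel \<partial>lborel)"
      by (subst nn_integral_plane(2)) auto
    also have "\<dots> = (\<integral>\<^sup>+x. \<integral>\<^sup>+y. f (pt x y) \<partial>lborel \<partial>lborel)"
      by (intro nn_integral_cong um) auto
    finally show "(NNINT p. f (pt ((p::real^2) $ 1) (- (p $ 2)))) = integral\<^sup>N lborel f"
      by (simp add: nn_integral_plane(2))
  qed auto
qed

lemma foldr_partial_snoc: "foldr partial (ms @ [i]) f = foldr partial ms (partial i f)"
  by simp

section \<open>Smooth functions and cut-offs\<close>

lemma smooth_differentiable: "smooth f \<Longrightarrow> f differentiable at x"
  unfolding smooth_def by (metis foldr.simps(1) id_apply)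

lemma smooth_partial: "smooth f \<Longrightarrow> smooth (partial i f)"
  unfolding smooth_def by (metis foldr_partial_snoc)

text \<open>The list of derivatives is peeled off at its right end, which is the derivative taken
  first, because that is the one about which closure of \<open>X\<close> speaks. Later closure
  properties only exhibit a suitable \<open>X\<close> and need no induction over lists.\<close>

lemma smooth_coinduct:
  assumes "f \<in> X" and "\<And>g x. g \<in> X \<Longrightarrow> g differentiable at x" and "\<And>g i. g \<in> X \<Longrightarrow> partial i g \<in> X"
  shows "smooth f"
proof -
  have "\<forall>f\<in>X. \<forall>x. foldr partial ms f differentiable at x" for ms
    by (induction ms rule: rev_induct) (use assms in auto)
  then show ?thesis using assms(1) by (auto simp: smooth_def)
qed

lemma partialI:
  assumes "(f has_derivative f') (at x)" shows "partial i f x = f' (axis i 1)"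
  using frechet_derivative_at[OF assms] by (simp add: partial_def)

lemma has_derivative_partial:
  assumes "f differentiable at x"
  shows "(f has_derivative (\<lambda>h. \<Sum>i\<in>UNIV. h $ i *\<^sub>R partial i f x)) (at x)"
proof -
  define f' where "f' = frechet_derivative f (at x)"
  have f': "(f has_derivative f') (at x)"
    using assms by (simp add: f'_def frechet_derivative_works)
  interpret linear f' using f' by (rule has_derivative_linear)
  have "f' h = (\<Sum>i\<in>UNIV. h $ i *\<^sub>R partial i f x)" for h
  proof -
    have "h = (\<Sum>i\<in>UNIV. h $ i *\<^sub>R axis i 1)"
      by (simp add: vec_eq_iff axis_def if_distrib cong: if_cong)
    then have "f' h = f' (\<Sum>i\<in>UNIV. h $ i *\<^sub>R axis i 1)" by simp
    then show ?thesis by (simp add: sum scaleR partial_def flip: f'_def)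
  qed
  then show ?thesis using f' by (metis (no_types, lifting) ext)
qed

lemma smooth_has_derivative:
  "smooth f \<Longrightarrow> (f has_derivative (\<lambda>h. \<Sum>i\<in>UNIV. h $ i *\<^sub>R partial i f x)) (at x)"
  by (intro has_derivative_partial smooth_differentiable)

lemma smooth_continuous: "smooth f \<Longrightarrow> continuous_on UNIV f"
  by (simp add: continuous_at_imp_continuous_on differentiable_imp_continuous_within smooth_differentiable)

lemma smooth_measurable [measurable_dest]: "smooth f \<Longrightarrow> borel_fun f"
  by (intro borel_measurable_continuous_onI smooth_continuous)

lemma partial_add:
  assumes "f differentiable at x" "g differentiable at x"
  shows "partial i (\<lambda>x. f x + g x) x = partial i f x + partial i g x"
  using partialI[OF has_derivative_add[OF assms[THEN has_derivative_partial]]]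
  by (simp add: axis_def if_distrib if_distribR cong: if_cong)

lemma partial_diff:
  assumes "f differentiable at x" "g differentiable at x"
  shows "partial i (\<lambda>x. f x - g x) x = partial i f x - partial i g x"
  using partialI[OF has_derivative_diff[OF assms[THEN has_derivative_partial]]]
  by (simp add: axis_def if_distrib if_distribR cong: if_cong)

lemma partial_mult:
  fixes f g :: "real^2 \<Rightarrow> real"
  assumes "f differentiable at x" "g differentiable at x"
  shows "partial i (\<lambda>x. f x * g x) x = partial i f x * g x + f x * partial i g x"
  using partialI[OF has_derivative_mult[OF assms[THEN has_derivative_partial]]]
  by (simp add: axis_def if_distrib if_distribR cong: if_cong)

lemma partial_const [simp]: "partial i (\<lambda>x. c) x = 0"
  by (rule partialI[where f'="\<lambda>_. 0"]) auto

lemma partial_cmult: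
  fixes f :: "real^2 \<Rightarrow> real"
  assumes "f differentiable at x"
  shows "partial i (\<lambda>x. c * f x) x = c * partial i f x"
  using partial_mult[OF differentiable_const assms] by simp

lemma partial_linear:
  assumes "bounded_linear L" "f differentiable at x"
  shows "partial i (\<lambda>x. L (f x)) x = L (partial i f x)"
proof -
  have "((\<lambda>x. L (f x)) has_derivative (\<lambda>h. L (\<Sum>i\<in>UNIV. h $ i *\<^sub>R partial i f x))) (at x)"
    using bounded_linear.has_derivative[OF assms(1) has_derivative_partial[OF assms(2)]] .
  from partialI[OF this] show ?thesis
    by (simp add: axis_def if_distrib if_distribR cong: if_cong)
qed

lemma smooth_linear:
  assumes "bounded_linear L" "smooth f" shows "smooth (\<lambda>x. L (f x))"
proof (rule smooth_coinduct[where X="{\<lambda>x. L (g x) |g. smooth g}"])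
  fix g' i assume "g' \<in> {\<lambda>x. L (g x) |g. smooth g}"
  then obtain g where g: "g' = (\<lambda>x. L (g x))" "smooth g" by auto
  have "partial i g' = (\<lambda>x. L (partial i g x))"
    unfolding g(1) using g(2) by (simp add: fun_eq_iff partial_linear[OF assms(1)] smooth_differentiable)
  then show "partial i g' \<in> {\<lambda>x. L (g x) |g. smooth g}" using smooth_partial[OF g(2)] by auto
next
  fix g' x assume "g' \<in> {\<lambda>x. L (g x) |g. smooth g}"
  then obtain g where g: "g' = (\<lambda>x. L (g x))" "smooth g" by auto
  show "g' differentiable at x" unfolding g
    using bounded_linear.has_derivative[OF assms(1) smooth_has_derivative[OF g(2)]] differentiableI by blast
qed (use assms in auto)

lemma smooth_const [simp]: "smooth (\<lambda>x. c)"
proof (rule smooth_coinduct[where X="range (\<lambda>c x. c)"])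
  fix g :: "real^2 \<Rightarrow> 'a" and i assume "g \<in> range (\<lambda>c x. c)"
  then have "partial i g = (\<lambda>x. 0)" by (auto simp: fun_eq_iff)
  then show "partial i g \<in> range (\<lambda>c x. c)" by auto
qed auto

text \<open>Products alone are not invariant under partial derivatives, since the Leibniz rule
  produces sums; the invariant set for \<open>smooth_coinduct\<close> must therefore contain sums of
  products.\<close>

inductive_set prods :: "(real^2 \<Rightarrow> real) set" where
  "smooth f \<Longrightarrow> smooth g \<Longrightarrow> (\<lambda>x. f x * g x) \<in> prods"
| "f \<in> prods \<Longrightarrow> g \<in> prods \<Longrightarrow> (\<lambda>x. f x + g x) \<in> prods"

lemma prods_step:
  assumes "f \<in> prods" shows "(\<forall>x. f differentiable at x) \<and> (\<forall>i. partial i f \<in> prods)"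
  using assms
proof induction
  case (1 f g)
  have "partial i (\<lambda>x. f x * g x) = (\<lambda>x. partial i f x * g x + f x * partial i g x)" for i
    using 1 by (simp add: fun_eq_iff partial_mult smooth_differentiable)
  moreover have "(\<lambda>x. partial i f x * g x + f x * partial i g x) \<in> prods" for i
    by (intro prods.intros smooth_partial 1)
  moreover have "(\<lambda>x. f x * g x) differentiable at x" for x
    using 1 by (intro derivative_intros smooth_differentiable)
  ultimately show ?case by simp
next
  case (2 f g)
  have "partial i (\<lambda>x. f x + g x) = (\<lambda>x. partial i f x + partial i g x)" for i
    using 2 by (simp add: fun_eq_iff partial_add)
  then show ?case using 2 by (auto intro!: prods.intros derivative_intros)
qed

lemma prods_smooth: "f \<in> prods \<Longrightarrow> smooth f"
  by (rule smooth_coinduct[where X=prods]) (use prods_step in auto)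

lemma smooth_mult [intro]:
  fixes f g :: "real^2 \<Rightarrow> real"
  shows "smooth f \<Longrightarrow> smooth g \<Longrightarrow> smooth (\<lambda>x. f x * g x)"
  by (rule prods_smooth[OF prods.intros(1)])

lemma smooth_add [intro]:
  fixes f g :: "real^2 \<Rightarrow> real"
  assumes "smooth f" "smooth g" shows "smooth (\<lambda>x. f x + g x)"
proof -
  have "(\<lambda>x. 1 * f x) \<in> prods" "(\<lambda>x. 1 * g x) \<in> prods"
    by (rule prods.intros(1)[OF smooth_const]; fact)+
  from prods_smooth[OF prods.intros(2)[OF this]] show ?thesis by simp
qed

lemma smooth_cmult: "smooth f \<Longrightarrow> smooth (\<lambda>x. c * f x)" for f :: "real^2 \<Rightarrow> real"
  by (intro smooth_mult smooth_const)

lemma smooth_diff [intro]: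
  fixes f g :: "real^2 \<Rightarrow> real"
  assumes "smooth f" "smooth g" shows "smooth (\<lambda>x. f x - g x)"
  using smooth_add[OF assms(1) smooth_cmult[OF assms(2), of "-1"]] by simp

lemma smooth_nth: "smooth f \<Longrightarrow> smooth (\<lambda>x. f x $ i)"
  using smooth_linear[OF bounded_linear_vec_nth] .

lemma smooth_pt:
  fixes f g :: "real^2 \<Rightarrow> real"
  assumes "smooth f" "smooth g" shows "smooth (\<lambda>x. pt (f x) (g x))"
proof -
  have eq: "pt a b = a *\<^sub>R axis 1 1 + b *\<^sub>R axis 2 1" for a b
    by (auto simp: vec_eq_iff forall_2 axis_def)
  have d: "((\<lambda>x. pt (f x) (g x)) has_derivative
      (\<lambda>h. pt (\<Sum>i\<in>UNIV. h $ i *\<^sub>R partial i f x) (\<Sum>i\<in>UNIV. h $ i *\<^sub>R partial i g x))) (at x)"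
    if "smooth f" "smooth g" for f g :: "real^2 \<Rightarrow> real" and x
    unfolding eq by (intro derivative_intros smooth_has_derivative that)
  show ?thesis
  proof (rule smooth_coinduct[where X="{\<lambda>x. pt (f x) (g x) |f g. smooth f \<and> smooth g}"])
    fix h :: "real^2 \<Rightarrow> real^2" and i assume "h \<in> {\<lambda>x. pt (f x) (g x) |f g. smooth f \<and> smooth g}"
    then obtain f g where h: "h = (\<lambda>x. pt (f x) (g x))" "smooth f" "smooth g" by auto
    have "partial i h = (\<lambda>x. pt (partial i f x) (partial i g x))"
      unfolding h(1) using partialI[OF d[OF h(2,3)]]
      by (auto simp: fun_eq_iff axis_def if_distrib if_distribR cong: if_cong)
    then show "partial i h \<in> {\<lambda>x. pt (f x) (g x) |f g. smooth f \<and> smooth g}"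
      using smooth_partial h by fast
  qed (use assms d in \<open>auto intro: differentiableI\<close>)
qed

text \<open>Smoothness of a function of one variable is expressed through its lift to the plane, so
  that a single notion of smoothness suffices. In the coinduction for the first claim the extra
  constant \<open>c\<close> absorbs the factor \<open>a\<close> which the chain rule produces at
  each derivative.\<close>

lemma smooth_comp_affine:
  fixes h :: "real \<Rightarrow> real"
  assumes "smooth (\<lambda>p::real^2. h (p$1))"
  shows "smooth (\<lambda>p::real^2. h (a * p$i + b))"
    and "(h has_real_derivative partial 1 (\<lambda>p::real^2. h (p$1)) (pt t 0)) (at t)"
    and "smooth (\<lambda>p::real^2. deriv h (p$1))"
proof -
  let ?L = "\<lambda>h p. h ((p::real^2)$1) :: real"
  have D: "(h has_real_derivative partial 1 (?L h) (pt t 0)) (at t)"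
    if h: "smooth (?L h)" for h :: "real \<Rightarrow> real" and t
  proof -
    have "((\<lambda>t. pt t 0) has_derivative (\<lambda>t. pt t 0)) (at t)"
    proof -
      have "pt t 0 = t *\<^sub>R axis 1 1" for t by (auto simp: vec_eq_iff forall_2 axis_def)
      then show ?thesis by (auto intro!: derivative_eq_intros)
    qed
    from has_derivative_compose[OF this smooth_has_derivative[OF h]]
    have "(h has_derivative (\<lambda>s. s * partial 1 (?L h) (pt t 0))) (at t)"
      by (simp add: sum_2)
    then show ?thesis by (simp add: has_field_derivative_def mult_commute_abs)
  qed
  have P: "partial i (\<lambda>p::real^2. h (a * p$j + b)) p = (if i = j then a * deriv h (a * p$j + b) else 0)"
      "(\<lambda>p::real^2. h (a * p$j + b)) differentiable at p"
    if h: "smooth (?L h)" for h :: "real \<Rightarrow> real" and a b i j p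
  proof -
    have dh: "(h has_derivative (\<lambda>s. deriv h t * s)) (at t)" for t
      using D[OF h, of t] DERIV_imp_deriv[OF D[OF h, of t]] by (simp add: has_field_derivative_def)
    have "((\<lambda>p::real^2. a * p$j + b) has_derivative (\<lambda>s. a * s$j)) (at p)"
      by (auto intro!: derivative_eq_intros bounded_linear.has_derivative[OF bounded_linear_vec_nth])
    from has_derivative_compose[OF this dh]
    have *: "((\<lambda>p::real^2. h (a * p$j + b)) has_derivative (\<lambda>s. deriv h (a * p$j+b) * (a * s$j))) (at p)" .
    show "partial i (\<lambda>p::real^2. h (a * p$j + b)) p = (if i = j then a * deriv h (a * p$j + b) else 0)"
      using partialI[OF *, of i] by (auto simp: axis_def)
    show "(\<lambda>p::real^2. h (a * p$j + b)) differentiable at p" using * by (auto intro: differentiableI)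
  qed
  have S: "smooth (?L (deriv h))" if h: "smooth (?L h)" for h :: "real \<Rightarrow> real"
  proof -
    have "?L (deriv h) = partial 1 (?L h)"
      using P(1)[OF h, of 1 1 1 0] by (auto simp: fun_eq_iff)
    then show ?thesis using smooth_partial[OF h] by simp
  qed
  show "smooth (?L (deriv h))" by (rule S[OF assms])
  show "(h has_real_derivative partial 1 (?L h) (pt t 0)) (at t)" by (rule D[OF assms])
  show "smooth (\<lambda>p::real^2. h (a * p$i + b))"
  proof (rule smooth_coinduct[where X="{\<lambda>p::real^2. c * h (a * p$i + b) |c h. smooth (?L h)}"])
    fix g j assume "g \<in> {\<lambda>p::real^2. c * h (a * p$i + b) |c h. smooth (?L h)}"
    then obtain c h where g: "g = (\<lambda>p::real^2. c * h (a * p$i + b))" "smooth (?L h)" by auto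
    have "partial j g = (\<lambda>p. (if j = i then c * a else 0) * deriv h (a * p$i + b))"
      unfolding g(1) using P[OF g(2)] by (auto simp: fun_eq_iff partial_cmult)
    then show "partial j g \<in> {\<lambda>p::real^2. c * h (a * p$i + b) |c h. smooth (?L h)}"
      using S[OF g(2)] by blast
  next
    fix g x assume "g \<in> {\<lambda>p::real^2. c * h (a * p$i + b) |c h. smooth (?L h)}"
    then obtain c h where g: "g = (\<lambda>p::real^2. c * h (a * p$i + b))" "smooth (?L h)" by auto
    show "g differentiable at x" unfolding g(1) by (intro derivative_intros P[OF g(2)])
  next
    show "(\<lambda>p. h (a * p $ i + b)) \<in> {\<lambda>p::real^2. c * h (a * p$i + b) |c h. smooth (?L h)}"
      using assms by (intro CollectI exI[of _ 1] exI[of _ h]) auto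
  qed
qed

lemma smooth_lift_partial:
  fixes h :: "real \<Rightarrow> real"
  assumes "smooth (\<lambda>p::real^2. h (p$1))"
  shows "(h has_real_derivative deriv h t) (at t)"
    and "partial i (\<lambda>p::real^2. h (p$j)) p = (if i = j then deriv h (p$j) else 0)"
proof -
  note D = smooth_comp_affine(2)[OF assms]
  show dh: "(h has_real_derivative deriv h t) (at t)" for t
    using D[of t] DERIV_imp_deriv[OF D[of t]] by simp
  have "((\<lambda>p::real^2. p$j) has_derivative (\<lambda>s. s$j)) (at p)"
    by (auto intro!: derivative_eq_intros bounded_linear.has_derivative[OF bounded_linear_vec_nth])
  from has_derivative_compose[OF this dh[unfolded has_field_derivative_def]]
  show "partial i (\<lambda>p::real^2. h (p$j)) p = (if i = j then deriv h (p$j) else 0)"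
    using partialI by (fastforce simp: axis_def)
qed

text \<open>Makes a primitive of a smooth function smooth, as needed for a step function that is
  defined by an integral.\<close>

lemma smooth_liftI:
  fixes h h' :: "real \<Rightarrow> real"
  assumes h: "\<And>t. (h has_real_derivative h' t) (at t)" and h': "smooth (\<lambda>p::real^2. h' (p$1))"
  shows "smooth (\<lambda>p::real^2. h (p$1))"
proof -
  have "((\<lambda>p::real^2. p$1) has_derivative (\<lambda>s. s$1)) (at p)" for p
    by (auto intro!: derivative_eq_intros bounded_linear.has_derivative[OF bounded_linear_vec_nth])
  from has_derivative_compose[OF this h[unfolded has_field_derivative_def]]
  have d: "((\<lambda>p::real^2. h (p$1)) has_derivative (\<lambda>s. h' (p$1) * s$1)) (at p)" for p .
  have "smooth (partial i (\<lambda>p::real^2. h (p$1)))" for i :: 2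
  proof -
    have "partial i (\<lambda>p::real^2. h (p$1)) = (if i = 1 then (\<lambda>p. h' (p$1)) else (\<lambda>p. 0))"
      using partialI[OF d] by (auto simp: fun_eq_iff axis_def)
    then show ?thesis using h' by auto
  qed
  then show ?thesis
    by (intro smooth_coinduct[where X="insert (\<lambda>p::real^2. h (p$1)) {f. smooth f}"])
       (use d in \<open>auto intro: differentiableI smooth_differentiable smooth_partial\<close>)
qed

section \<open>A smooth plateau function\<close>

definition flat_exp :: "real poly \<Rightarrow> real \<Rightarrow> real" where
  "flat_exp p t = (if t > 0 then poly p (1/t) * exp (- (1/t)) else 0)"

lemma poly_exp_tendsto_0: "((\<lambda>x. poly p x * exp (- x)) \<longlongrightarrow> 0) (at_top :: real filter)"
proof -
  have "((\<lambda>x. \<Sum>i\<le>degree p. coeff p i * (x ^ i / exp x)) \<longlongrightarrow> (\<Sum>i\<le>degree p. coeff p i * 0)) (at_top :: real filter)"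
    by (intro tendsto_sum tendsto_mult tendsto_const tendsto_power_div_exp_0)
  then show ?thesis
    by (simp add: poly_altdef sum_distrib_right exp_minus divide_inverse mult.assoc)
qed

text \<open>The polynomial prefactor in s = 1/t makes the family exp(-1/t) closed under
  differentiation: d/dt = -s^2 d/ds turns p exp(-s) into (p - p') s^2 exp(-s), and
  \<open>[:0,0,1:]\<close> is s^2. At t = 0 the exponential beats every polynomial in s.\<close>

lemma flat_exp_deriv:
  "(flat_exp p has_real_derivative flat_exp ((p - pderiv p) * [:0,0,1:]) t) (at t)"
proof (cases t "0::real" rule: linorder_cases)
  case greater
  have "((\<lambda>t. poly p (1/t) * exp (- (1/t))) has_real_derivative
      poly ((p - pderiv p) * [:0,0,1:]) (1/t) * exp (- (1/t))) (at t)"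
    using greater by (auto intro!: derivative_eq_intros simp: field_simps power2_eq_square)
  then have "(flat_exp p has_real_derivative poly ((p - pderiv p) * [:0,0,1:]) (1/t) * exp (- (1/t))) (at t)"
    by (rule has_field_derivative_transform_within[where d=t]) (use greater in \<open>auto simp: flat_exp_def dist_real_def\<close>)
  then show ?thesis using greater by (simp add: flat_exp_def)
next
  case less
  have "(flat_exp p has_real_derivative 0) (at t)"
    by (rule has_field_derivative_transform_within[where d="-t" and f="\<lambda>_. 0"]) (use less in \<open>auto simp: flat_exp_def dist_real_def\<close>)
  then show ?thesis using less by (simp add: flat_exp_def)
next
  case equal
  have "((\<lambda>t. flat_exp p t / t) \<longlongrightarrow> 0) (at_left 0)"
    by (rule tendsto_eventually) (auto simp: eventually_at_left_real flat_exp_def intro!: eventually_at_leftI[where a="-1"])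
  moreover have "((\<lambda>t. flat_exp p t / t) \<longlongrightarrow> 0) (at_right 0)"
  proof -
    \<comment> \<open>The difference quotient at 0 divides by t, which is one more factor 1/t in the
      polynomial.\<close>
    have "((\<lambda>t. poly (p * [:0,1:]) (inverse t) * exp (- (inverse t))) \<longlongrightarrow> 0) (at_right (0::real))"
      by (rule filterlim_compose[OF poly_exp_tendsto_0 filterlim_inverse_at_top_right])
    then show ?thesis
      by (rule Lim_transform_eventually)
         (auto simp: flat_exp_def field_simps intro!: eventually_at_rightI[where b=1])
  qed
  ultimately have "((\<lambda>t. flat_exp p t / t) \<longlongrightarrow> 0) (at 0)"
    by (simp add: filterlim_split_at_real)
  then have "(flat_exp p has_real_derivative 0) (at 0)"
    by (simp add: has_field_derivative_iff flat_exp_def)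
  then show ?thesis using equal by (simp add: flat_exp_def)
qed

lemma smooth_flat_exp: "smooth (\<lambda>q::real^2. flat_exp p (q$1))"
proof (rule smooth_coinduct[where X="insert (\<lambda>_. 0) (range (\<lambda>p (q::real^2). flat_exp p (q$1)))"])
  have "((\<lambda>p::real^2. p$1) has_derivative (\<lambda>s. s$1)) (at q)" for q
    by (auto intro!: derivative_eq_intros bounded_linear.has_derivative[OF bounded_linear_vec_nth])
  from has_derivative_compose[OF this flat_exp_deriv[unfolded has_field_derivative_def]]
  have d: "((\<lambda>q. flat_exp p (q$1)) has_derivative
    (\<lambda>s. flat_exp ((p - pderiv p) * [:0,0,1:]) (q$1) * s$1)) (at q)" for p and q :: "real^2" .
  fix g :: "real^2 \<Rightarrow> real" and x i
  assume g: "g \<in> insert (\<lambda>_. 0) (range (\<lambda>p (q::real^2). flat_exp p (q$1)))"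
  then show "g differentiable at x" using d by (auto intro: differentiableI)
  show "partial i g \<in> insert (\<lambda>_. 0) (range (\<lambda>p (q::real^2). flat_exp p (q$1)))"
  proof (cases "g = (\<lambda>_. 0)")
    case True
    then have "partial i g = (\<lambda>_. 0)" unfolding True by (simp add: fun_eq_iff)
    then show ?thesis by simp
  next
    case False
    then obtain p where p: "g = (\<lambda>q. flat_exp p (q$1))" using g by auto
    have "partial i g = (if i = 1 then (\<lambda>q. flat_exp ((p - pderiv p) * [:0,0,1:]) (q$1)) else (\<lambda>_. 0))"
      unfolding p using partialI[OF d] by (auto simp: fun_eq_iff axis_def)
    then show ?thesis by auto
  qed
qed auto

definition smoothstep_density :: "real \<Rightarrow> real" where
  "smoothstep_density t = flat_exp 1 t * flat_exp 1 (1 - t)"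

text \<open>The lower limit -1 lies to the left of the support of the density, so that each t \<ge>
  0 is interior to an interval on which the fundamental theorem of calculus applies.\<close>

definition smoothstep :: "real \<Rightarrow> real" where
  "smoothstep t = integral {-1..t} smoothstep_density / integral {-1..1} smoothstep_density"

lemma smooth_smoothstep_density: "smooth (\<lambda>q::real^2. smoothstep_density (q$1))"
  unfolding smoothstep_density_def
  using smooth_comp_affine(1)[OF smooth_flat_exp[of 1], of "-1" 1 1]
  by (intro smooth_mult smooth_flat_exp) simp

lemma smoothstep_density_cont: "continuous_on S smoothstep_density"
  using smooth_lift_partial(1)[OF smooth_smoothstep_density]
  by (meson DERIV_isCont continuous_at_imp_continuous_on)

lemma smoothstep_density_nonneg: "0 \<le> smoothstep_density t"
  by (simp add: smoothstep_density_def flat_exp_def)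

lemma smoothstep_density_zero: "t \<le> 0 \<or> t \<ge> 1 \<Longrightarrow> smoothstep_density t = 0"
  by (auto simp: smoothstep_density_def flat_exp_def)

lemma smoothstep_density_integrable: "smoothstep_density integrable_on {a..b}"
  by (intro integrable_continuous_real smoothstep_density_cont)

lemma smoothstep_mass_pos: "0 < integral {-1..1} smoothstep_density"
proof -
  have "0 \<le> integral {-1..1} smoothstep_density"
    by (intro integral_nonneg smoothstep_density_integrable smoothstep_density_nonneg)
  moreover have "integral {-1..1} smoothstep_density \<noteq> 0"
  proof
    assume "integral {-1..1} smoothstep_density = 0"
    then have "smoothstep_density (1/2) = 0"
      using integral_eq_0_iff[of "-1" 1 smoothstep_density] smoothstep_density_cont smoothstep_density_nonneg by auto
    then show False by (simp add: smoothstep_density_def flat_exp_def)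
  qed
  ultimately show ?thesis by simp
qed

lemma smoothstep_0: "t \<le> 0 \<Longrightarrow> smoothstep t = 0"
proof -
  assume t: "t \<le> 0"
  have "integral {-1..t} smoothstep_density = integral {-1..t} (\<lambda>_. 0)"
    using t by (intro integral_cong smoothstep_density_zero) auto
  then show ?thesis by (simp add: smoothstep_def)
qed

lemma smoothstep_1: "t \<ge> 1 \<Longrightarrow> smoothstep t = 1"
proof -
  assume t: "t \<ge> 1"
  have "integral {1..t} smoothstep_density = integral {1..t} (\<lambda>_. 0)"
    using t by (intro integral_cong smoothstep_density_zero) auto
  moreover have "integral {-1..1} smoothstep_density + integral {1..t} smoothstep_density
      = integral {-1..t} smoothstep_density"
    using t by (intro Henstock_Kurzweil_Integration.integral_combine smoothstep_density_integrable) auto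
  ultimately show ?thesis using smoothstep_mass_pos by (simp add: smoothstep_def)
qed

lemma smoothstep_deriv:
  "(smoothstep has_real_derivative smoothstep_density t / integral {-1..1} smoothstep_density) (at t)"
proof (cases "t < 0")
  case True
  have "(smoothstep has_real_derivative 0) (at t)"
    by (rule has_field_derivative_transform_within[where d="-t" and f="\<lambda>_. 0"]) (use True smoothstep_0 in \<open>auto simp: dist_real_def\<close>)
  then show ?thesis using True by (simp add: smoothstep_density_zero)
next
  case False
  have "((\<lambda>t. integral {-1..t} smoothstep_density) has_real_derivative smoothstep_density t) (at t within {-1..t+1})"
    using False by (intro integral_has_real_derivative smoothstep_density_cont) auto
  then have "((\<lambda>t. integral {-1..t} smoothstep_density) has_real_derivative smoothstep_density t) (at t)"
    using False by (subst (asm) at_within_Icc_at) auto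
  then show ?thesis unfolding smoothstep_def[abs_def] by (rule DERIV_cdivide)
qed

lemma smoothstep_mono: "s \<le> t \<Longrightarrow> smoothstep s \<le> smoothstep t"
  using smoothstep_mass_pos smoothstep_density_nonneg
  by (intro DERIV_nonneg_imp_nondecreasing[of s t smoothstep]) (auto intro!: exI smoothstep_deriv)

lemma smoothstep_bounds: "0 \<le> smoothstep t" "smoothstep t \<le> 1"
  using smoothstep_mono[of "min t 0" t] smoothstep_mono[of t "max t 1"] smoothstep_0 smoothstep_1 by force+

lemma smooth_smoothstep: "smooth (\<lambda>q::real^2. smoothstep (q$1))"
  by (rule smooth_liftI[OF smoothstep_deriv])
     (use smooth_cmult[OF smooth_smoothstep_density, of "inverse (integral {-1..1} smoothstep_density)"]
      in \<open>simp add: field_simps\<close>)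

definition plateau :: "real \<Rightarrow> real" where
  "plateau t = smoothstep (2 - t) * smoothstep (2 + t)"

lemma smooth_plateau: "smooth (\<lambda>q::real^2. plateau (q$1))"
  unfolding plateau_def
  using smooth_comp_affine(1)[OF smooth_smoothstep, of "-1" 1 2] smooth_comp_affine(1)[OF smooth_smoothstep, of 1 1 2]
  by (intro smooth_mult) (simp_all add: add.commute)

lemma plateau_1: "\<bar>t\<bar> \<le> 1 \<Longrightarrow> plateau t = 1"
  by (simp add: plateau_def smoothstep_1 abs_le_iff)

lemma plateau_0: "\<bar>t\<bar> \<ge> 2 \<Longrightarrow> plateau t = 0"
  using smoothstep_0[of "2 - t"] smoothstep_0[of "2 + t"] by (cases "t \<ge> 0") (auto simp: plateau_def)

lemma plateau_bounds: "0 \<le> plateau t" "plateau t \<le> 1"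
  by (simp_all add: plateau_def smoothstep_bounds mult_le_one)

lemma deriv_plateau_0:
  assumes "\<bar>t\<bar> < 1 \<or> \<bar>t\<bar> > 2" shows "deriv plateau t = 0" "deriv (deriv plateau) t = 0"
proof -
  have z: "deriv plateau t = 0" if "\<bar>t\<bar> < 1 \<or> \<bar>t\<bar> > 2" for t
    using that
  proof
    assume t: "\<bar>t\<bar> < 1"
    have "(plateau has_real_derivative 0) (at t)"
      by (rule has_field_derivative_transform_within[where d="1 - \<bar>t\<bar>" and f="\<lambda>_. 1"])
         (use t plateau_1 in \<open>auto simp: dist_real_def\<close>)
    then show ?thesis by (rule DERIV_imp_deriv)
  next
    assume t: "\<bar>t\<bar> > 2"
    have "(plateau has_real_derivative 0) (at t)"
      by (rule has_field_derivative_transform_within[where d="\<bar>t\<bar> - 2" and f="\<lambda>_. 0"])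
         (use t plateau_0 in \<open>auto simp: dist_real_def\<close>)
    then show ?thesis by (rule DERIV_imp_deriv)
  qed
  then show "deriv plateau t = 0" using assms by simp
  \<comment> \<open>The maximum is the positive one of the two distances, so one radius serves both
    cases.\<close>
  have "(deriv plateau has_real_derivative 0) (at t)"
    by (rule has_field_derivative_transform_within[where d="max (1 - \<bar>t\<bar>) (\<bar>t\<bar> - 2)" and f="\<lambda>_. 0"])
       (use assms in \<open>auto simp: dist_real_def max_def abs_if split: if_splits intro!: z\<close>)
  then show "deriv (deriv plateau) t = 0" by (rule DERIV_imp_deriv)
qed

lemma plateau_deriv_bounds:
  obtains C where "C > 0" "\<And>t. \<bar>deriv plateau t\<bar> \<le> C" "\<And>t. \<bar>deriv (deriv plateau) t\<bar> \<le> C"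
proof -
  have bd: "\<exists>C. \<forall>t. \<bar>h t\<bar> \<le> C" if c: "continuous_on UNIV h" and z: "\<And>t. \<bar>t\<bar> > 2 \<Longrightarrow> h t = 0" for h :: "real \<Rightarrow> real"
  proof -
    have "bounded (h ` {-2..2})"
      by (intro compact_imp_bounded compact_continuous_image continuous_on_subset[OF c]) auto
    then obtain C where "\<forall>t\<in>{-2..2}. \<bar>h t\<bar> \<le> C" by (auto simp: bounded_iff)
    then have "\<bar>h t\<bar> \<le> max C 0" for t
      using z[of t] by (cases "t \<in> {-2..2}") (force simp: le_max_iff_disj)+
    then show ?thesis by blast
  qed
  note s1 = smooth_comp_affine(3)[OF smooth_plateau]
  have c: "continuous_on UNIV h" if "smooth (\<lambda>q::real^2. h (q$1))" for h :: "real \<Rightarrow> real"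
    using smooth_lift_partial(1)[OF that] by (meson DERIV_isCont continuous_at_imp_continuous_on)
  obtain C1 where C1: "\<And>t. \<bar>deriv plateau t\<bar> \<le> C1"
    using bd[OF c[OF s1]] deriv_plateau_0 by blast
  obtain C2 where C2: "\<And>t. \<bar>deriv (deriv plateau) t\<bar> \<le> C2"
    using bd[OF c[OF smooth_comp_affine(3)[OF s1]]] deriv_plateau_0 by blast
  show ?thesis
    by (rule that[of "max 1 (max C1 C2)"]) (use C1 C2 in \<open>auto simp: le_max_iff_disj\<close>)
qed

section \<open>Square integrals\<close>

lemma sqi_mono_set: "S \<subseteq> T \<Longrightarrow> sqi S f \<le> sqi T f"
  unfolding sqi_def by (intro nn_integral_mono) (auto simp: indicator_def)

lemma sqi_mono:
  assumes "AE x\<in>S in lborel. norm (f x) \<le> norm (g x)" shows "sqi S f \<le> sqi S g"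
  unfolding sqi_def using assms
  by (intro nn_integral_mono_AE) (auto elim!: AE_mp simp: indicator_def intro!: ennreal_leI power_mono)

lemma sqi_cong:
  assumes "AE x\<in>S in lborel. norm (f x) = norm (g x)" shows "sqi S f = sqi S g"
  by (intro antisym sqi_mono) (use assms in auto)

lemma sqi_nth: "sqi S (\<lambda>x. f x $ i) \<le> sqi S f" for f :: "_ \<Rightarrow> 'a::real_normed_vector^'n"
  by (intro sqi_mono AE_I2) (simp add: Finite_Cartesian_Product.norm_nth_le)

lemma sqi_cmult:
  fixes f :: "_ \<Rightarrow> real"
  assumes [measurable]: "borel_fun f" "S \<in> sets borel"
  shows "sqi S (\<lambda>x. c * f x) = ennreal (c^2) * sqi S f"
  unfolding sqi_def by (subst nn_integral_cmult[symmetric]) (auto simp: power_mult_distrib ennreal_mult' mult.assoc)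

lemma norm_sum_sq: "(norm (a + b))^2 \<le> 2 * (norm a)^2 + 2 * (norm b)^2"
proof -
  have "(norm (a + b))^2 \<le> (norm a + norm b)^2" by (intro power_mono norm_triangle_ineq) auto
  also have "\<dots> \<le> 2 * (norm a)^2 + 2 * (norm b)^2"
    using zero_le_power2[of "norm a - norm b"] by (simp add: power2_eq_square algebra_simps)
  finally show ?thesis .
qed

lemma sqi_triangle':
  fixes f g h :: "real^2 \<Rightarrow> 'b::euclidean_space"
  assumes [measurable]: "borel_fun g" "borel_fun h" "S \<in> sets borel"
  assumes fgh: "AE x\<in>S in lborel. norm (f x) \<le> norm (g x + h x)"
  shows "sqi S f \<le> 2 * sqi S g + 2 * sqi S h"
proof -
  have "sqi S f \<le> sqi S (\<lambda>x. g x + h x)" by (intro sqi_mono fgh)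
  also have "\<dots> \<le> (NNINT x. 2 * (ennreal ((norm (g x))^2) * indicator S x) + 2 * (ennreal ((norm (h x))^2) * indicator S x))"
    unfolding sqi_def
  proof (intro nn_integral_mono)
    fix x
    have "ennreal ((norm (g x + h x))^2) \<le> ennreal (2 * (norm (g x))^2 + 2 * (norm (h x))^2)"
      by (intro ennreal_leI norm_sum_sq)
    also have "\<dots> = 2 * ennreal ((norm (g x))^2) + 2 * ennreal ((norm (h x))^2)"
      by (simp add: ennreal_mult)
    finally show "ennreal ((norm (g x + h x))^2) * indicator S x \<le> 2 * (ennreal ((norm (g x))^2) * indicator S x) + 2 * (ennreal ((norm (h x))^2) * indicator S x)"
      by (auto simp: indicator_def)
  qed
  also have "\<dots> = 2 * sqi S g + 2 * sqi S h"
    by (simp add: sqi_def nn_integral_add nn_integral_cmult)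
  finally show ?thesis .
qed

lemma sqi_triangle:
  fixes f g :: "real^2 \<Rightarrow> 'b::euclidean_space"
  assumes "borel_fun g" "borel_fun h" "S \<in> sets borel"
  assumes "\<And>x. f x = g x + h x"
  shows "sqi S f \<le> 2 * sqi S g + 2 * sqi S h"
  using assms by (intro sqi_triangle') auto

lemma sqi_minus: "sqi S (\<lambda>x. f x - g x) = sqi S (\<lambda>x. g x - f x)"
  by (simp add: sqi_def norm_minus_commute)

lemma ennreal_square_tendsto_0:
  fixes X Y :: "nat \<Rightarrow> ennreal"
  assumes "\<And>n. (X n)^2 \<le> Y n" "Y \<longlonglongrightarrow> 0"
  shows "X \<longlonglongrightarrow> 0"
proof (rule order_tendstoI)
  fix a :: ennreal assume a: "0 < a"
  then have "0 < a^2" by (simp add: power2_eq_square ennreal_zero_less_mult_iff)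
  with assms(2) have "\<forall>\<^sub>F n in sequentially. Y n < a^2" by (rule order_tendstoD)
  then show "\<forall>\<^sub>F n in sequentially. X n < a"
  proof eventually_elim
    case (elim n)
    then have "(X n)^2 < a^2" using assms(1)[of n] by simp
    then show ?case by (metis linorder_not_le mult_mono power2_eq_square zero_le)
  qed
qed auto

lemma ennreal_mult_tendsto_0:
  fixes X :: "nat \<Rightarrow> ennreal"
  assumes "X \<longlonglongrightarrow> 0" "c < top" shows "(\<lambda>n. c * X n) \<longlonglongrightarrow> 0"
  using ennreal_tendsto_cmult[OF assms(2,1)] by simp

lemma ennreal_squeeze_0:
  fixes X Y :: "nat \<Rightarrow> ennreal"
  assumes "Y \<longlonglongrightarrow> 0" "\<And>n. X n \<le> Y n" shows "X \<longlonglongrightarrow> 0"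
  by (rule tendsto_sandwich[of "\<lambda>_. 0" X sequentially Y 0]) (use assms in auto)

lemma sqi_bdd_of_tendsto:
  fixes f :: "nat \<Rightarrow> real^2 \<Rightarrow> 'b::euclidean_space"
  assumes [measurable]: "\<And>n. borel_fun (f n)" "borel_fun g" "S \<in> sets borel"
  and "\<And>n. sqi S (f n) < top" "(\<lambda>n. sqi S (\<lambda>x. f n x - g x)) \<longlonglongrightarrow> 0"
  shows "sqi S g < top"
proof -
  have "\<forall>\<^sub>F n in sequentially. sqi S (\<lambda>x. f n x - g x) < 1"
    using order_tendstoD(2)[OF assms(5), of 1] by simp
  then obtain n where n: "sqi S (\<lambda>x. f n x - g x) < 1" by (auto simp: eventually_sequentially)
  have "sqi S g \<le> 2 * sqi S (f n) + 2 * sqi S (\<lambda>x. g x - f n x)"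
    by (rule sqi_triangle) auto
  also have "\<dots> < top"
    using assms(4)[of n] n by (subst sqi_minus) (auto simp: ennreal_mult_less_top order.strict_trans)
  finally show ?thesis .
qed

lemma sqi_Cauchy_Schwarz:
  assumes [measurable]: "borel_fun f" "borel_fun g" "S \<in> sets borel"
  shows "(NNset S (\<lambda>x. ennreal (norm (f x) * norm (g x))))^2 \<le> sqi S f * sqi S g"
proof -
  have eq1: "NNset S (\<lambda>x. ennreal (norm (f x) * norm (g x)))
     = (NNINT x. (ennreal (norm (f x)) * indicator S x) * (ennreal (norm (g x)) * indicator S x))"
    by (intro nn_integral_cong) (auto simp: indicator_def ennreal_mult)
  have eq2: "sqi S h = (NNINT x. (ennreal (norm (h x)) * indicator S x)^2)" for h :: "real^2 \<Rightarrow> 'c::real_normed_vector"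
    unfolding sqi_def by (intro nn_integral_cong) (auto simp: indicator_def ennreal_power)
  show ?thesis unfolding eq1 eq2[of f] eq2[of g] by (rule Cauchy_Schwarz_nn_integral) measurable
qed

lemma L2_pairing:
  fixes f :: "real^2 \<Rightarrow> 'a::euclidean_space" and g :: "real^2 \<Rightarrow> 'b::euclidean_space" and h :: "real^2 \<Rightarrow> real"
  assumes [measurable]: "borel_fun f" "borel_fun g" "S \<in> sets borel" "borel_fun h"
    and h: "AE x in lborel. \<bar>h x\<bar> \<le> indicator S x * (norm (f x) * norm (g x))"
  shows "(NNINT x. ennreal \<bar>h x\<bar>)^2 \<le> sqi S f * sqi S g"
    and "sqi S f < top \<Longrightarrow> sqi S g < top \<Longrightarrow> integrable lborel h"
    and "ennreal ((LBINT x. h x)^2) \<le> sqi S f * sqi S g"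
proof -
  have "(NNINT x. ennreal \<bar>h x\<bar>) \<le> NNset S (\<lambda>x. ennreal (norm (f x) * norm (g x)))"
    using h by (intro nn_integral_mono_AE) (auto elim!: AE_mp simp: indicator_def intro!: ennreal_leI)
  then show *: "(NNINT x. ennreal \<bar>h x\<bar>)^2 \<le> sqi S f * sqi S g"
    using sqi_Cauchy_Schwarz[OF assms(1-3)] by (meson order_trans power_mono zero_le)
  show "integrable lborel h" if "sqi S f < top" "sqi S g < top"
  proof -
    have "(NNINT x. ennreal \<bar>h x\<bar>)^2 < top"
      using * that by (metis ennreal_mult_less_top le_less_trans)
    then have "(NNINT x. ennreal \<bar>h x\<bar>) < top" by (simp add: power_less_top_ennreal)
    then show ?thesis by (intro integrableI_bounded) auto
  qed
  show "ennreal ((LBINT x. h x)^2) \<le> sqi S f * sqi S g"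
  proof (cases "integrable lborel h")
    case True
    have "ennreal ((LBINT x. h x)^2) = (ennreal (norm (LBINT x. h x)))^2"
      by (simp add: ennreal_power)
    also have "\<dots> \<le> (NNINT x. ennreal \<bar>h x\<bar>)^2"
      using integral_norm_bound_ennreal[OF True] by (intro power_mono) auto
    finally show ?thesis using * by simp
  next
    case False then show ?thesis by (simp add: not_integrable_integral_eq)
  qed
qed

text \<open>With errors f = F n - F' and g = G n - G', the difference of the products is f g + f G'
  + g F', and Cauchy-Schwarz sends each term to zero. The bounded weight \<open>w\<close> localises
  to \<open>S\<close>, so convergence in L^2 on bounded sets is enough.\<close>

lemma L2_product_tendsto:
  fixes F G :: "nat \<Rightarrow> real^2 \<Rightarrow> real"
  assumes [measurable]: "\<And>n. borel_fun (F n)" "\<And>n. borel_fun (G n)"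
    "borel_fun F'" "borel_fun G'" "S \<in> sets borel" "borel_fun w"
  and conv: "(\<lambda>n. sqi S (\<lambda>x. F n x - F' x)) \<longlonglongrightarrow> 0" "(\<lambda>n. sqi S (\<lambda>x. G n x - G' x)) \<longlonglongrightarrow> 0"
  and fin: "\<And>n. sqi S (F n) < top" "\<And>n. sqi S (G n) < top"
  and w: "\<And>x. \<bar>w x\<bar> \<le> M" "\<And>x. x \<notin> S \<Longrightarrow> w x = 0"
  shows "(\<lambda>n. LBINT x. w x * (F n x * G n x)) \<longlonglongrightarrow> (LBINT x. w x * (F' x * G' x))"
proof -
  have M: "M \<ge> 0" using w(1)[of 0] by linarith
  have fin': "sqi S F' < top" "sqi S G' < top"
    by (rule sqi_bdd_of_tendsto[of F] sqi_bdd_of_tendsto[of G]; use assms in auto)+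
  have bd: "\<bar>w x * (a * b)\<bar> \<le> indicator S x * (norm (M * a) * norm b)" for x a b
    using w(1)[of x] w(2)[of x] M by (auto simp: indicator_def abs_mult mult.assoc intro!: mult_right_mono)
  have finM: "sqi S (\<lambda>x. M * f x) < top" if "sqi S f < top" "borel_fun f" for f :: "real^2 \<Rightarrow> real"
    using that by (simp add: sqi_cmult ennreal_mult_less_top)
  have int: "integrable lborel (\<lambda>x. w x * (f x * g x))"
    if [measurable]: "borel_fun f" "borel_fun g" and "sqi S f < top" "sqi S g < top" for f g
    by (rule L2_pairing(2)[where f="\<lambda>x. M * f x" and g=g and S=S]) (use that bd finM in auto)
  have lim: "(\<lambda>n. NNINT x. ennreal \<bar>w x * (f n x * g n x)\<bar>) \<longlonglongrightarrow> 0"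
    if [measurable]: "\<And>n. borel_fun (f n)" "\<And>n. borel_fun (g n)"
      and lim0: "(\<lambda>n. sqi S (f n) * sqi S (g n)) \<longlonglongrightarrow> 0" for f g
  proof (rule ennreal_square_tendsto_0)
    show "(NNINT x. ennreal \<bar>w x * (f n x * g n x)\<bar>)^2 \<le> ennreal (M^2) * (sqi S (f n) * sqi S (g n))" for n
      using L2_pairing(1)[where f="\<lambda>x. M * f n x" and g="g n" and S=S and h="\<lambda>x. w x * (f n x * g n x)"] bd
      by (auto simp: sqi_cmult mult.assoc)
    show "(\<lambda>n. ennreal (M^2) * (sqi S (f n) * sqi S (g n))) \<longlonglongrightarrow> 0"
      by (rule ennreal_mult_tendsto_0[OF lim0]) simp
  qed
  have m: "(\<lambda>n. sqi S (f n) * sqi S (g n)) \<longlonglongrightarrow> 0"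
    if "(\<lambda>n. sqi S (f n)) \<longlonglongrightarrow> 0" "(\<lambda>n. sqi S (g n)) \<longlonglongrightarrow> c" "c < top" for f g :: "nat \<Rightarrow> real^2 \<Rightarrow> real" and c
    using tendsto_mult_ennreal[OF that(1,2)] that(3) by auto
  have l1: "(\<lambda>n. NNINT x. ennreal \<bar>w x * ((F n x - F' x) * (G n x - G' x))\<bar>) \<longlonglongrightarrow> 0"
    by (intro lim m[where c=0] conv) auto
  have l2: "(\<lambda>n. NNINT x. ennreal \<bar>w x * ((F n x - F' x) * G' x)\<bar>) \<longlonglongrightarrow> 0"
    by (intro lim[where g="\<lambda>_. G'"] m[where c="sqi S G'"] conv) (use fin' in auto)
  have l3: "(\<lambda>n. NNINT x. ennreal \<bar>w x * ((G n x - G' x) * F' x)\<bar>) \<longlonglongrightarrow> 0"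
    by (intro lim[where g="\<lambda>_. F'"] m[where c="sqi S F'"] conv) (use fin' in auto)
  show ?thesis
  proof (rule tendsto_L1_int, unfold real_norm_def)
    show "(\<lambda>n. NNINT x. ennreal \<bar>w x * (F n x * G n x) - w x * (F' x * G' x)\<bar>) \<longlonglongrightarrow> 0"
    proof (rule ennreal_squeeze_0)
      show "(\<lambda>n. ((NNINT x. ennreal \<bar>w x * ((F n x - F' x) * (G n x - G' x))\<bar>) +
         (NNINT x. ennreal \<bar>w x * ((F n x - F' x) * G' x)\<bar>)) +
         (NNINT x. ennreal \<bar>w x * ((G n x - G' x) * F' x)\<bar>)) \<longlonglongrightarrow> 0"
        using tendsto_add[OF tendsto_add[OF l1 l2] l3] by simp
      fix n
      have "ennreal \<bar>w x * (F n x * G n x) - w x * (F' x * G' x)\<bar> \<le>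
        ennreal \<bar>w x * ((F n x - F' x) * (G n x - G' x))\<bar> + ennreal \<bar>w x * ((F n x - F' x) * G' x)\<bar> + ennreal \<bar>w x * ((G n x - G' x) * F' x)\<bar>" for x
      proof -
        have "w x * (F n x * G n x) - w x * (F' x * G' x) =
           w x * ((F n x - F' x) * (G n x - G' x)) + w x * ((F n x - F' x) * G' x) + w x * ((G n x - G' x) * F' x)"
          by (simp add: algebra_simps)
        then show ?thesis by (simp del: ennreal_plus add: ennreal_plus[symmetric] ennreal_leI)
      qed
      then have "(NNINT x. ennreal \<bar>w x * (F n x * G n x) - w x * (F' x * G' x)\<bar>) \<le>
        (NNINT x. ennreal \<bar>w x * ((F n x - F' x) * (G n x - G' x))\<bar> + ennreal \<bar>w x * ((F n x - F' x) * G' x)\<bar> + ennreal \<bar>w x * ((G n x - G' x) * F' x)\<bar>)"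
        by (rule nn_integral_mono)
      then show "(NNINT x. ennreal \<bar>w x * (F n x * G n x) - w x * (F' x * G' x)\<bar>) \<le>
         ((NNINT x. ennreal \<bar>w x * ((F n x - F' x) * (G n x - G' x))\<bar>) +
         (NNINT x. ennreal \<bar>w x * ((F n x - F' x) * G' x)\<bar>)) +
         (NNINT x. ennreal \<bar>w x * ((G n x - G' x) * F' x)\<bar>)"
        by (simp add: nn_integral_add)
    qed
  qed (use fin fin' int in auto)
qed

text \<open>Along a subsequence with squared errors below 2^-k, the sum of the squared errors has a
  finite integral, hence is finite almost everywhere, and its terms tend to zero.\<close>

lemma sqi_AE_subseq:
  fixes f :: "nat \<Rightarrow> real^2 \<Rightarrow> 'b::euclidean_space"
  assumes [measurable]: "\<And>n. borel_fun (f n)" "borel_fun g" "S \<in> sets borel"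
    and conv: "(\<lambda>n. sqi S (\<lambda>x. f n x - g x)) \<longlonglongrightarrow> 0"
  shows "\<exists>r. strict_mono r \<and> (AE x\<in>S in lborel. (\<lambda>n. f (r n) x) \<longlonglongrightarrow> g x)"
proof -
  have ev: "\<exists>N. \<forall>n\<ge>N. sqi S (\<lambda>x. f n x - g x) < ennreal ((1/2)^k)" for k
    using order_tendstoD(2)[OF conv, of "ennreal ((1/2)^k)"] by (auto simp: eventually_sequentially)
  have "\<exists>r. \<forall>k. sqi S (\<lambda>x. f (r k) x - g x) < ennreal ((1/2)^k) \<and> r k < r (Suc k)"
  proof (rule dependent_nat_choice)
    show "\<exists>n. sqi S (\<lambda>x. f n x - g x) < ennreal ((1/2)^0)" using ev[of 0] by auto
    show "\<exists>m. sqi S (\<lambda>x. f m x - g x) < ennreal ((1/2)^(Suc k)) \<and> n < m" for n k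
    proof -
      obtain N where "\<forall>n\<ge>N. sqi S (\<lambda>x. f n x - g x) < ennreal ((1/2)^Suc k)" using ev by blast
      then show ?thesis by (intro exI[of _ "max N (Suc n)"]) auto
    qed
  qed
  then obtain r where r: "\<And>k. sqi S (\<lambda>x. f (r k) x - g x) < ennreal ((1/2)^k)" "strict_mono r"
    unfolding strict_mono_Suc_iff by blast
  have "(NNINT x. (\<Sum>k. ennreal ((norm (f (r k) x - g x))^2) * indicator S x))
      = (\<Sum>k. sqi S (\<lambda>x. f (r k) x - g x))"
    unfolding sqi_def by (rule nn_integral_suminf) auto
  also have "\<dots> \<le> (\<Sum>k. ennreal ((1/2)^k))"
    using r(1) by (intro suminf_le) (auto intro: less_imp_le)
  also have "\<dots> = ennreal (\<Sum>k. (1/2)^k)"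
    by (rule suminf_ennreal2) (auto intro: summable_geometric)
  also have "\<dots> < top" by (rule ennreal_less_top)
  finally have "AE x in lborel. (\<Sum>k. ennreal ((norm (f (r k) x - g x))^2) * indicator S x) \<noteq> \<infinity>"
    by (intro nn_integral_PInf_AE) auto
  then have "AE x\<in>S in lborel. (\<lambda>n. f (r n) x) \<longlonglongrightarrow> g x"
  proof (rule AE_mp, intro AE_I2 impI)
    fix x assume "(\<Sum>k. ennreal ((norm (f (r k) x - g x))^2) * indicator S x) \<noteq> \<infinity>" "x \<in> S"
    then have "(\<Sum>k. ennreal ((norm (f (r k) x - g x))^2)) \<noteq> top" by simp
    then have "summable (\<lambda>k. (norm (f (r k) x - g x))^2)" by (intro summable_suminf_not_top) auto
    then have "(\<lambda>k. (norm (f (r k) x - g x))^2) \<longlonglongrightarrow> 0" by (rule summable_LIMSEQ_zero)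
    then have "(\<lambda>k. sqrt ((norm (f (r k) x - g x))^2)) \<longlonglongrightarrow> sqrt 0" by (rule tendsto_real_sqrt)
    then show "(\<lambda>n. f (r n) x) \<longlonglongrightarrow> g x" using LIM_zero_cancel tendsto_norm_zero_cancel by fastforce
  qed
  with r show ?thesis by blast
qed

text \<open>The weight may be infinite, where multiplication is not continuous. An inequality
  survives: for \<open>w = top\<close> the left side is zero if l = 0, and otherwise the products
  are eventually infinite.\<close>

lemma liminf_mult_ennreal:
  fixes a :: "nat \<Rightarrow> ennreal"
  assumes "a \<longlonglongrightarrow> l" shows "w * l \<le> liminf (\<lambda>n. w * a n)"
proof (cases "w = top")
  case False
  then have "(\<lambda>n. w * a n) \<longlonglongrightarrow> w * l" by (intro ennreal_tendsto_cmult assms) (auto simp: less_top)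
  then show ?thesis by (metis lim_imp_Liminf order_refl sequentially_bot)
next
  case True
  show ?thesis
  proof (cases "l = 0")
    case False
    then have "\<forall>\<^sub>F n in sequentially. a n > 0" using order_tendstoD(1)[OF assms, of 0] False by (simp add: zero_less_iff_neq_zero)
    then have "\<forall>\<^sub>F n in sequentially. w * a n = top"
      by eventually_elim (auto simp: True ennreal_top_mult)
    then have "(\<lambda>n. w * a n) \<longlonglongrightarrow> top" by (rule tendsto_eventually)
    then show ?thesis by (metis lim_imp_Liminf sequentially_bot top_greatest)
  qed simp
qed

text \<open>Fatou's lemma along an almost everywhere convergent subsequence. It carries estimates
  from test fields to their limits for arbitrary, even infinite, Borel weights, where convergence in
  L^2 alone says nothing.\<close>

lemma weighted_bound_closed:
  fixes f :: "nat \<Rightarrow> real^2 \<Rightarrow> 'b::euclidean_space"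
  assumes [measurable]: "\<And>n. borel_fun (f n)" "borel_fun g" "S \<in> sets borel" "borel_fun w"
    and conv: "(\<lambda>n. sqi S (\<lambda>x. f n x - g x)) \<longlonglongrightarrow> 0"
    and bd: "\<And>n. (NNset S (\<lambda>x. w x * ennreal ((norm (f n x))^2))) \<le> B n" and B: "B \<longlonglongrightarrow> b"
  shows "NNset S (\<lambda>x. w x * ennreal ((norm (g x))^2)) \<le> b"
proof -
  obtain r where r: "strict_mono r" "AE x\<in>S in lborel. (\<lambda>n. f (r n) x) \<longlonglongrightarrow> g x"
    using sqi_AE_subseq[OF assms(1-3) conv] by auto
  have "NNset S (\<lambda>x. w x * ennreal ((norm (g x))^2))
     \<le> (NNINT x. liminf (\<lambda>n. w x * ennreal ((norm (f (r n) x))^2) * indicator S x))"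
  proof (rule nn_integral_mono_AE, use r(2) in eventually_elim)
    fix x assume *: "x \<in> S \<longrightarrow> (\<lambda>n. f (r n) x) \<longlonglongrightarrow> g x"
    show "w x * ennreal ((norm (g x))^2) * indicator S x \<le> liminf (\<lambda>n. w x * ennreal ((norm (f (r n) x))^2) * indicator S x)"
    proof (cases "x \<in> S")
      case True
      then have "(\<lambda>n. ennreal ((norm (f (r n) x))^2)) \<longlonglongrightarrow> ennreal ((norm (g x))^2)"
        using * by (auto intro!: tendsto_intros)
      from liminf_mult_ennreal[OF this] show ?thesis using True by simp
    qed simp
  qed
  also have "\<dots> \<le> liminf (\<lambda>n. NNset S (\<lambda>x. w x * ennreal ((norm (f (r n) x))^2)))"
    by (rule nn_integral_liminf) auto
  also have "\<dots> \<le> liminf (\<lambda>n. B (r n))"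
    by (intro Liminf_mono always_eventually allI bd)
  also have "\<dots> = b"
    using LIMSEQ_subseq_LIMSEQ[OF B r(1)] by (intro lim_imp_Liminf) (auto simp: o_def)
  finally show ?thesis .
qed

text \<open>Boxes form a generator of the Borel sets stable under intersection, so the sets over
  which g integrates to zero are all Borel sets. The vanishing total integral is what closes that
  class under complements.\<close>

lemma zero_AE_of_boxes:
  fixes g :: "'a::euclidean_space \<Rightarrow> real"
  assumes int: "integrable lborel g" and box: "\<And>a b. (LINT x:box a b|lborel. g x) = 0" and tot: "(LINT x|lborel. g x) = 0"
  shows "AE x in lborel. g x = 0"
proof (rule sigma_finite_measure.density_zero[OF sigma_finite_lborel int])
  have si: "set_integrable lborel A g" if "A \<in> sets borel" for A
    unfolding set_integrable_def using int that by (intro integrable_mult_indicator) auto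
  fix A assume "A \<in> sets (lborel :: 'a measure)"
  then have A: "A \<in> sigma_sets UNIV (range (\<lambda>(a,b). box a b))"
    by (metis borel_eq_box sets_lborel sets_measure_of top_greatest Pow_UNIV)
  have sig: "sigma_sets UNIV (range (\<lambda>(a,b). box a b :: 'a set)) = sets borel"
    by (metis borel_eq_box sets_measure_of top_greatest Pow_UNIV)
  have st: "Int_stable (range (\<lambda>(a,b). box a b :: 'a set))"
    by (auto simp: Int_stable_def Int_interval box_Int_box)
  show "(LINT x:A|lborel. g x) = 0"
    using st Pow_UNIV[THEN equalityD2, THEN subset_trans[OF subset_UNIV]] A
  proof (induction rule: sigma_sets_induct_disjoint)
    case (basic A) then show ?case using box by auto
  next
    case empty show ?case by (simp add: set_lebesgue_integral_def)
  next
    case (compl A)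
    then have A: "A \<in> sets borel" using sig by auto
    have "(LINT x:UNIV|lborel. g x) = (LINT x:A|lborel. g x) + (LINT x:UNIV - A|lborel. g x)"
      using set_integral_Un[of A "UNIV - A" lborel g] A si by (simp add: Un_Diff_cancel)
    moreover have "(LINT x:UNIV|lborel. g x) = 0"
      using tot by (simp add: set_lebesgue_integral_def)
    ultimately show ?case using compl by simp
  next
    case (union A)
    then have m: "A i \<in> sets borel" for i using sig by auto
    have "(LINT x:(\<Union>i. A i)|lborel. g x) = (\<Sum>i. LINT x:A i|lborel. g x)"
    proof (rule lebesgue_integral_countable_add)
      show "set_integrable lborel (\<Union>i. A i) g" using m by (intro si) auto
    qed (use union m in \<open>auto simp: disjoint_family_on_def\<close>)
    then show ?case using union by simp
  qed
qed

section \<open>Test functions\<close>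

lemma zero_off_support: "x \<notin> closure {x. f x \<noteq> 0} \<Longrightarrow> f x = 0"
  using closure_subset[of "{x. f x \<noteq> 0}"] by auto

lemma compact_support_square:
  fixes f :: "real^2 \<Rightarrow> 'b::real_normed_vector"
  assumes "compact (closure {x. f x \<noteq> 0})"
  obtains r where "r > 0" "\<And>x. x \<notin> square r \<Longrightarrow> f x = 0"
proof -
  obtain B where B: "B > 0" "\<And>x. x \<in> closure {x. f x \<noteq> 0} \<Longrightarrow> norm x \<le> B"
    using compact_imp_bounded[OF assms] bounded_pos by metis
  have "f x = 0" if "x \<notin> square B" for x
  proof (rule ccontr)
    assume "f x \<noteq> 0"
    then have "norm x \<le> B" using B(2) zero_off_support[of x f] by blast
    then have "\<bar>x$1\<bar> \<le> B" "\<bar>x$2\<bar> \<le> B" using component_le_norm_cart order_trans by blast+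
    then show False using that by (simp add: square_def)
  qed
  with B(1) that show ?thesis by blast
qed

lemma square_cbox: "square r = cbox (pt (-r) (-r)) (pt r r)"
  by (auto simp: square_def cbox_def Basis_pair abs_le_iff)

lemma square_borel [measurable]: "square r \<in> sets borel"
  by (simp add: square_cbox)

lemma compact_square: "compact (square r)"
  by (simp add: square_cbox)

lemma square_mono: "r \<le> s \<Longrightarrow> square r \<subseteq> square s"
  by (auto simp: square_def)

lemma square_ball: "r > 0 \<Longrightarrow> square r \<subseteq> ball 0 (2 * r)"
proof
  fix x assume r: "r > 0" and "x \<in> square r"
  then have "\<bar>x$1\<bar> \<le> r" "\<bar>x$2\<bar> \<le> r" by (auto simp: square_def)
  then have "norm x \<le> sqrt (r^2 + r^2)"
    unfolding norm_pair by (intro real_sqrt_le_mono add_mono) (metis abs_le_square_iff abs_of_pos r)+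
  also have "\<dots> < sqrt ((2*r)^2)" using r by (intro real_sqrt_less_mono) (simp add: power2_eq_square)
  also have "\<dots> = 2 * r" by (subst real_sqrt_abs) (use r in simp)
  finally show "x \<in> ball 0 (2 * r)" using r by simp
qed

lemma in_squareI: "norm x \<le> r \<Longrightarrow> x \<in> square r"
  using component_le_norm_cart[of x 1] component_le_norm_cart[of x 2] by (simp add: square_def)

lemma test_functionsD:
  assumes "\<phi> \<in> test_functions \<Omega>"
  shows "smooth \<phi>" "compact (closure {x. \<phi> x \<noteq> 0})" "x \<notin> \<Omega> \<Longrightarrow> \<phi> x = 0"
  using assms zero_off_support[of x \<phi>] by (auto simp: test_functions_def)

lemma test_functionsI:
  assumes "smooth f" "closed K" "bounded K" "K \<subseteq> \<Omega>" "\<And>x. x \<notin> K \<Longrightarrow> f x = 0"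
  shows "f \<in> test_functions \<Omega>"
proof -
  have "closure {x. f x \<noteq> 0} \<subseteq> K" using assms by (intro closure_minimal) auto
  then show ?thesis using assms unfolding test_functions_def
    by (auto intro: compact_closure[THEN iffD2] bounded_subset closure_subset)
qed

lemma test_functions_dominated:
  assumes "\<phi> \<in> test_functions \<Omega>" "smooth f" "\<And>x. x \<notin> closure {x. \<phi> x \<noteq> 0} \<Longrightarrow> f x = 0"
  shows "f \<in> test_functions \<Omega>"
  by (rule test_functionsI[OF assms(2), of "closure {x. \<phi> x \<noteq> 0}"])
     (use assms(1,3) in \<open>auto simp: test_functions_def compact_imp_bounded\<close>)

lemma test_functions_partial:
  assumes "\<phi> \<in> test_functions \<Omega>" shows "partial i \<phi> \<in> test_functions \<Omega>"
proof (rule test_functions_dominated[OF assms])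
  show "smooth (partial i \<phi>)" using assms by (auto intro: smooth_partial test_functionsD)
  fix x assume x: "x \<notin> closure {x. \<phi> x \<noteq> 0}"
  have "(\<phi> has_derivative (\<lambda>_. 0)) (at x)"
  proof (rule has_derivative_transform_within_open[of "\<lambda>_. 0"])
    show "open (- closure {x. \<phi> x \<noteq> 0})" by (intro open_Compl closed_closure)
    show "x \<in> - closure {x. \<phi> x \<noteq> 0}" using x by simp
    fix y assume "y \<in> - closure {x. \<phi> x \<noteq> 0}"
    then show "0 = \<phi> y" using zero_off_support[of y \<phi>] by simp
  qed simp
  from partialI[OF this] show "partial i \<phi> x = 0" by simp
qed

lemma test_functions_nth:
  assumes "\<phi> \<in> test_functions \<Omega>" shows "(\<lambda>x. \<phi> x $ j) \<in> test_functions \<Omega>"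
proof (rule test_functions_dominated[OF assms])
  show "smooth (\<lambda>x. \<phi> x $ j)" using assms by (intro smooth_nth test_functionsD)
  fix x assume x: "x \<notin> closure {x. \<phi> x \<noteq> 0}"
  then have "\<phi> x = 0" by (rule zero_off_support)
  then show "\<phi> x $ j = 0" by simp
qed

lemma test_functions_mult:
  fixes \<phi> :: "real^2 \<Rightarrow> real"
  assumes "\<phi> \<in> test_functions \<Omega>" "smooth f" shows "(\<lambda>x. \<phi> x * f x) \<in> test_functions \<Omega>"
proof (rule test_functions_dominated[OF assms(1)])
  show "smooth (\<lambda>x. \<phi> x * f x)" by (rule smooth_mult[OF test_functionsD(1)[OF assms(1)] assms(2)])
  fix x assume x: "x \<notin> closure {x. \<phi> x \<noteq> 0}"
  then have "\<phi> x = 0" by (rule zero_off_support)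
  then show "\<phi> x * f x = 0" by simp
qed

lemma test_functions_bounded:
  assumes "\<phi> \<in> test_functions \<Omega>" obtains M where "M > 0" "\<And>x. norm (\<phi> x) \<le> M"
proof -
  let ?K = "closure {x. \<phi> x \<noteq> 0}"
  have "bounded (\<phi> ` ?K)"
    by (intro compact_imp_bounded compact_continuous_image continuous_on_subset[OF smooth_continuous] test_functionsD(1,2)[OF assms] subset_UNIV)
  then obtain M where M: "M > 0" "\<forall>x\<in>?K. norm (\<phi> x) \<le> M" by (auto simp: bounded_pos)
  have "norm (\<phi> x) \<le> M" for x
  proof (cases "x \<in> ?K")
    case False then have "\<phi> x = 0" by (rule zero_off_support)
    then show ?thesis using M by simp
  qed (use M in auto)
  with M that show ?thesis by blast
qed

lemma test_functions_measurable:
  "\<phi> \<in> test_functions \<Omega> \<Longrightarrow> borel_fun \<phi>"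
  using smooth_measurable test_functionsD(1) by blast

lemma test_functions_integrable:
  fixes \<phi> :: "real^2 \<Rightarrow> 'b::euclidean_space"
  assumes "\<phi> \<in> test_functions \<Omega>" shows "integrable lborel \<phi>"
proof -
  obtain r where r: "r > 0" "\<And>x. x \<notin> square r \<Longrightarrow> \<phi> x = 0"
    using compact_support_square test_functionsD(2)[OF assms] by blast
  have "integrable lborel (\<lambda>x. indicator (square r) x *\<^sub>R \<phi> x)"
    by (rule borel_integrable_compact[OF compact_square continuous_on_subset[OF smooth_continuous[OF test_functionsD(1)[OF assms]] subset_UNIV]])
  moreover have "(\<lambda>x. indicator (square r) x *\<^sub>R \<phi> x) = \<phi>"
    using r(2) by (auto simp: fun_eq_iff indicator_def)
  ultimately show ?thesis by (simp add: set_integrable_def)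
qed

lemma sqi_finite_bounded:
  assumes "\<And>x. norm (f x) \<le> M" shows "sqi (square r) f < top"
proof -
  have "sqi (square r) f \<le> NNset (square r) (\<lambda>x. ennreal (M^2))"
    unfolding sqi_def using assms by (intro nn_integral_mono mult_right_mono ennreal_leI power_mono) auto
  also have "\<dots> = ennreal (M^2) * emeasure lborel (square r)"
    by (subst nn_integral_cmult_indicator) auto
  also have "\<dots> < top"
    using emeasure_bounded_finite[OF compact_imp_bounded[OF compact_square]] by (simp add: ennreal_mult_less_top)
  finally show ?thesis .
qed

lemma sqi_supported:
  assumes "\<And>x. x \<notin> S \<Longrightarrow> f x = 0" shows "sqi UNIV f = sqi S f"
  unfolding sqi_def by (intro nn_integral_cong) (auto simp: indicator_def assms)

lemma sqi_test_finite:
  assumes "\<phi> \<in> test_functions \<Omega>" shows "sqi S \<phi> < top"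
proof -
  obtain r where r: "r > 0" "\<And>x. x \<notin> square r \<Longrightarrow> \<phi> x = 0"
    using compact_support_square test_functionsD(2)[OF assms] by blast
  obtain M where M: "\<And>x. norm (\<phi> x) \<le> M" using test_functions_bounded[OF assms] by blast
  have "sqi S \<phi> \<le> sqi UNIV \<phi>" by (rule sqi_mono_set) auto
  also have "\<dots> = sqi (square r) \<phi>" by (rule sqi_supported) (use r in auto)
  finally show ?thesis using sqi_finite_bounded[of \<phi> M r] M by (metis le_less_trans)
qed

lemma has_derivative_pt:
  assumes "f differentiable at (pt x y)"
  shows "((\<lambda>t. f (pt t y)) has_vector_derivative partial 1 f (pt x y)) (at x within S)"
    and "((\<lambda>t. f (pt x t)) has_vector_derivative partial 2 f (pt x y)) (at y within S)"
proof -
  have p: "pt t s = t *\<^sub>R axis 1 1 + s *\<^sub>R axis 2 1" for t s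
    by (auto simp: vec_eq_iff forall_2 axis_def)
  have 1: "((\<lambda>t. pt t y) has_derivative (\<lambda>h. h *\<^sub>R axis 1 1)) (at x within S)"
    unfolding p by (auto intro!: derivative_eq_intros)
  have 2: "((\<lambda>t. pt x t) has_derivative (\<lambda>h. h *\<^sub>R axis 2 1)) (at y within S)"
    unfolding p by (auto intro!: derivative_eq_intros)
  show "((\<lambda>t. f (pt t y)) has_vector_derivative partial 1 f (pt x y)) (at x within S)"
    using has_derivative_compose[OF 1 has_derivative_partial[OF assms]]
    by (simp add: has_vector_derivative_def sum_2 axis_def)
  show "((\<lambda>t. f (pt x t)) has_vector_derivative partial 2 f (pt x y)) (at y within S)"
    using has_derivative_compose[OF 2 has_derivative_partial[OF assms]]
    by (simp add: has_vector_derivative_def sum_2 axis_def)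
qed

lemma continuous_pt1: "continuous_on S (\<lambda>t. pt t y)" and continuous_pt2: "continuous_on S (\<lambda>t. pt x t)"
  by (rule continuous_on_compose2[OF continuous_pt, of S "\<lambda>t. (t,y)", simplified]; intro continuous_intros)
     (rule continuous_on_compose2[OF continuous_pt, of S "\<lambda>t. (x,t)", simplified]; intro continuous_intros)

lemma continuous_on_pt1: "continuous_on UNIV f \<Longrightarrow> continuous_on S (\<lambda>t. f (pt t y))"
  and continuous_on_pt2: "continuous_on UNIV f \<Longrightarrow> continuous_on S (\<lambda>t. f (pt x t))"
  using continuous_on_compose2[OF _ continuous_pt1] continuous_on_compose2[OF _ continuous_pt2] by blast+

text \<open>Fubini with the inner integral in the direction of the derivative, where the fundamental
  theorem of calculus gives zero.\<close>

lemma integral_partial_zero: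
  fixes \<phi> :: "real^2 \<Rightarrow> real"
  assumes "\<phi> \<in> test_functions \<Omega>" shows "(LBINT x. partial i \<phi> x) = 0"
proof -
  note t = test_functions_partial[OF assms, of i]
  obtain r where r: "r > 0" "\<And>x. x \<notin> square r \<Longrightarrow> \<phi> x = 0"
    using compact_support_square test_functionsD(2)[OF assms] by blast
  note D = smooth_differentiable[OF test_functionsD(1)[OF assms]]
  note C = smooth_continuous[OF test_functionsD(1)[OF test_functions_partial[OF assms]]]
  have z: "partial i \<phi> x = 0" if "x \<notin> square r" for x i
  proof -
    have "(\<phi> has_derivative (\<lambda>_. 0)) (at x)"
      by (rule has_derivative_transform_within_open[of "\<lambda>_. 0" _ _ _ "- square r"])
         (use that r compact_imp_closed[OF compact_square] in \<open>auto simp: open_Compl\<close>)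
    from partialI[OF this] show ?thesis by simp
  qed
  have FTC: "(LBINT s. h' s) = 0"
    if h: "\<And>s. (h has_vector_derivative h' s) (at s)" "continuous_on UNIV h'"
      and 0: "\<And>s. \<bar>s\<bar> > r \<Longrightarrow> h s = 0 \<and> h' s = 0" for h h' :: "real \<Rightarrow> real"
  proof -
    \<comment> \<open>The interval is longer by 1 on either side because vanishing is known for |s|
      > r only, not at the end points of the support.\<close>
    have "(LBINT s. h' s * indicator {-(r+1)..r+1} s) = h (r+1) - h (-(r+1))"
      by (rule integral_FTC_Icc_real) (use r h in \<open>auto simp: continuous_on_eq_continuous_within has_real_derivative_iff_has_vector_derivative\<close>)
    moreover have "(\<lambda>s. h' s * indicator {-(r+1)..r+1} s) = h'"
    proof
      fix s show "h' s * indicator {-(r+1)..r+1} s = h' s"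
        using 0[of s] by (cases "\<bar>s\<bar> \<le> r") (auto simp: indicator_def)
    qed
    ultimately show ?thesis using 0[of "r+1"] 0[of "-(r+1)"] r by simp
  qed
  consider "i = 1" | "i = 2" using exhaust_2 by blast
  then show ?thesis
  proof cases
    case 1
    have "(LBINT x. partial 1 \<phi> (pt x y)) = 0" for y
      by (rule FTC[of "\<lambda>x. \<phi> (pt x y)"])
         (use D C z r in \<open>auto intro!: has_derivative_pt continuous_on_pt1 simp: square_def\<close>)
    then show ?thesis using integral_plane(1)[OF test_functions_integrable[OF t]] 1 by simp
  next
    case 2
    have "(LBINT y. partial 2 \<phi> (pt x y)) = 0" for x
      by (rule FTC[of "\<lambda>y. \<phi> (pt x y)"])
         (use D C z r in \<open>auto intro!: has_derivative_pt continuous_on_pt2 simp: square_def\<close>)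
    then show ?thesis using integral_plane(2)[OF test_functions_integrable[OF t]] 2 by simp
  qed
qed

lemma integration_by_parts:
  fixes f \<psi> :: "real^2 \<Rightarrow> real"
  assumes "smooth f" "\<psi> \<in> test_functions \<Omega>"
  shows "(LBINT x. f x * partial i \<psi> x) = - (LBINT x. partial i f x * \<psi> x)"
proof -
  have "partial i (\<lambda>x. \<psi> x * f x) = (\<lambda>x. partial i \<psi> x * f x + \<psi> x * partial i f x)"
    using assms by (simp add: fun_eq_iff partial_mult smooth_differentiable test_functionsD)
  then have "(LBINT x. partial i \<psi> x * f x + \<psi> x * partial i f x) = 0"
    using integral_partial_zero[OF test_functions_mult[OF assms(2,1)], of i] by simp
  moreover have "integrable lborel (\<lambda>x. partial i \<psi> x * f x)" "integrable lborel (\<lambda>x. \<psi> x * partial i f x)"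
    by (intro test_functions_integrable[of _ \<Omega>] test_functions_mult test_functions_partial smooth_partial assms)+
  ultimately show ?thesis by (simp add: Bochner_Integration.integral_add mult.commute)
qed

section \<open>The fundamental lemma of the calculus of variations\<close>

definition box_bump :: "real^2 \<Rightarrow> real^2 \<Rightarrow> nat \<Rightarrow> real^2 \<Rightarrow> real" where
  "box_bump a b n p = smoothstep (real n * p$1 + - real n * a$1) * smoothstep (- real n * p$1 + real n * b$1) *
     (smoothstep (real n * p$2 + - real n * a$2) * smoothstep (- real n * p$2 + real n * b$2))"

lemma box_bump_smooth: "smooth (box_bump a b n)"
  unfolding box_bump_def[abs_def] by (intro smooth_mult smooth_comp_affine(1)[OF smooth_smoothstep])

lemma box_bump_bounds: "0 \<le> box_bump a b n p" "box_bump a b n p \<le> 1"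
  by (auto simp: box_bump_def smoothstep_bounds intro!: mult_le_one)

lemma box_bump_outside: assumes "p \<notin> box a b" shows "box_bump a b n p = 0"
proof -
  have "\<not> (a$1 < p$1 \<and> p$1 < b$1 \<and> a$2 < p$2 \<and> p$2 < b$2)"
    using assms by (auto simp: mem_box Basis_pair)
  then consider "\<not> a$1 < p$1" | "\<not> p$1 < b$1" | "\<not> a$2 < p$2" | "\<not> p$2 < b$2" by blast
  moreover have "smoothstep (real n * x + - real n * y) = 0" if "\<not> y < x" for x y :: real
    using that by (intro smoothstep_0) (simp add: mult_left_mono)
  moreover have "smoothstep (- real n * x + real n * y) = 0" if "\<not> x < y" for x y :: real
    using that by (intro smoothstep_0) (simp add: mult_left_mono)
  ultimately show ?thesis unfolding box_bump_def by cases simp_all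
qed

lemma box_bump_tendsto: "(\<lambda>n. box_bump a b n p) \<longlonglongrightarrow> indicator (box a b) p"
proof (cases "p \<in> box a b")
  case True
  then have *: "a$1 < p$1" "p$1 < b$1" "a$2 < p$2" "p$2 < b$2" by (auto simp: mem_box Basis_pair)
  have ev: "\<forall>\<^sub>F n in sequentially. smoothstep (real n * d) = 1" if "d > 0" for d
  proof -
    obtain N :: nat where N: "1 / d \<le> N" using real_arch_simple by blast
    show ?thesis
    proof (rule eventually_sequentiallyI[of N])
      fix n assume "N \<le> n"
      then have "1 / d \<le> real n" using N by (meson of_nat_mono order_trans)
      then show "smoothstep (real n * d) = 1" using that by (intro smoothstep_1) (simp add: field_simps)
    qed
  qed
  have ev2: "\<forall>\<^sub>F n in sequentially. smoothstep (real n * (y - x)) = 1" if "x < y" for x y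
    using ev[of "y - x"] that by simp
  have "\<forall>\<^sub>F n in sequentially. box_bump a b n p = 1"
    using ev2[OF *(1)] ev2[OF *(2)] ev2[OF *(3)] ev2[OF *(4)]
  proof eventually_elim
    case (elim n)
    then show ?case by (simp add: box_bump_def algebra_simps)
  qed
  then show ?thesis using True by (simp add: tendsto_eventually)
next
  case False then show ?thesis by (simp add: box_bump_outside)
qed

text \<open>Dominated convergence replaces the bumps by indicators of open boxes; then
  \<open>zero_AE_of_boxes\<close> applies to g cut off to the box, since the intersection of two
  boxes is a box.\<close>

lemma fundamental_lemma_box:
  fixes g :: "real^2 \<Rightarrow> real"
  assumes K: "cbox c d \<subseteq> \<Omega>" and [measurable]: "borel_fun g"
    and int: "set_integrable lborel (cbox c d) g"
    and z: "\<And>\<psi>. \<psi> \<in> test_functions \<Omega> \<Longrightarrow> (LBINT x. g x * \<psi> x) = 0"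
  shows "AE x in lborel. x \<in> box c d \<longrightarrow> g x = 0"
proof -
  have sub: "(LBINT x. indicator (box a b) x * g x) = 0" if ab: "box a b \<subseteq> box c d" for a b
  proof (cases "box a b = {}")
    case True then show ?thesis by simp
  next
    case False
    then have cab: "cbox a b \<subseteq> cbox c d"
      using ab by (metis closed_cbox closure_box closure_minimal box_subset_cbox subset_trans)
    have t: "box_bump a b n \<in> test_functions \<Omega>" for n
      by (rule test_functionsI[where K="cbox a b"])
         (use cab K box_subset_cbox[of a b] in \<open>auto simp: box_bump_smooth intro!: box_bump_outside\<close>)
    have "(\<lambda>n. LBINT x. g x * box_bump a b n x) \<longlonglongrightarrow> (LBINT x. g x * indicator (box a b) x)"
    proof (rule integral_dominated_convergence[where w="\<lambda>x. \<bar>indicator (cbox c d) x * g x\<bar>"])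
      show "integrable lborel (\<lambda>x. \<bar>indicator (cbox c d) x * g x\<bar>)"
        using int by (simp add: set_integrable_def)
      show "AE x in lborel. (\<lambda>n. g x * box_bump a b n x) \<longlonglongrightarrow> g x * indicator (box a b) x"
        by (intro AE_I2 tendsto_mult tendsto_const box_bump_tendsto)
      show "AE x in lborel. norm (g x * box_bump a b n x) \<le> \<bar>indicator (cbox c d) x * g x\<bar>" for n
      proof (rule AE_I2)
        fix x show "norm (g x * box_bump a b n x) \<le> \<bar>indicator (cbox c d) x * g x\<bar>"
          using box_bump_bounds[of a b n x] box_bump_outside[of x a b n] cab box_subset_cbox[of a b]
          by (cases "x \<in> box a b") (auto simp: abs_mult mult_left_le)
      qed
      show "(\<lambda>x. g x * box_bump a b n x) \<in> borel_measurable lborel" for n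
        using smooth_measurable[OF box_bump_smooth[of a b n]] by measurable
    qed measurable
    then have "(\<lambda>n. 0) \<longlonglongrightarrow> (LBINT x. g x * indicator (box a b) x)"
      using z[OF t] by simp
    then show ?thesis by (simp add: LIMSEQ_const_iff mult.commute)
  qed
  have "AE x in lborel. indicator (box c d) x * g x = 0"
  proof (rule zero_AE_of_boxes)
    show "integrable lborel (\<lambda>x. indicator (box c d) x * g x)"
      using set_integrable_subset[OF int, of "box c d"] box_subset_cbox by (auto simp: set_integrable_def)
    show "(LBINT x. indicator (box c d) x * g x) = 0" by (rule sub) simp
    show "(LINT x:box a b|lborel. indicator (box c d) x * g x) = 0" for a b
    proof -
      obtain l u where lu: "box a b \<inter> box c d = box l u" by (rule that[OF box_Int_box])
      have "(LINT x:box a b|lborel. indicator (box c d) x * g x) = (LBINT x. indicator (box l u) x * g x)"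
        unfolding set_lebesgue_integral_def lu[symmetric] by (simp add: indicator_inter_arith mult.assoc)
      also have "\<dots> = 0" by (rule sub) (use lu in auto)
      finally show ?thesis .
    qed
  qed
  then show ?thesis by (auto elim!: AE_mp simp: indicator_def)
qed

text \<open>Boxes with rational corners. That even the closed boxes lie in the open set matters,
  because local integrability gives information on compact subsets only.\<close>

lemma open_countable_boxes:
  assumes "open (\<Omega> :: 'a::euclidean_space set)"
  obtains D where "countable D" "\<And>a b. (a,b) \<in> D \<Longrightarrow> cbox a b \<subseteq> \<Omega>" "\<Omega> = (\<Union>(a,b)\<in>D. box a b)"
proof -
  let ?a' = "\<lambda>f::'a \<Rightarrow> real \<times> real. (\<Sum>(i::'a)\<in>Basis. fst (f i) *\<^sub>R i)"
  let ?b' = "\<lambda>f::'a \<Rightarrow> real \<times> real. (\<Sum>(i::'a)\<in>Basis. snd (f i) *\<^sub>R i)"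
  define I where "I = {f\<in>Basis \<rightarrow>\<^sub>E \<rat> \<times> \<rat>. cbox (?a' f) (?b' f) \<subseteq> \<Omega>}"
  have "countable I" unfolding I_def
    by (rule countable_subset[OF _ countable_PiE[of Basis "\<lambda>_. \<rat> \<times> \<rat>"]]) (auto intro: countable_rat)
  moreover have "\<Omega> \<subseteq> (\<Union>f\<in>I. box (?a' f) (?b' f))"
  proof
    fix x assume x: "x \<in> \<Omega>"
    obtain e where e: "e > 0" "ball x e \<subseteq> \<Omega>" using assms x openE by blast
    obtain a b where ab: "\<forall>i\<in>Basis. a \<bullet> i \<in> \<rat> \<and> b \<bullet> i \<in> \<rat>" "x \<in> box a b" "cbox a b \<subseteq> ball x e"
    proof -
      \<comment> \<open>Half the radius leaves room for the closure of the box.\<close>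
      obtain a b where ab: "\<forall>i\<in>Basis. a \<bullet> i \<in> \<rat> \<and> b \<bullet> i \<in> \<rat>" "x \<in> box a b" "box a b \<subseteq> ball x (e/2)"
        using rational_boxes[of "e/2" x] e(1) by auto
      then have "cbox a b = closure (box a b)" by (metis closure_box empty_iff)
      also have "\<dots> \<subseteq> cball x (e/2)" using ab(3) by (intro closure_minimal) auto
      also have "\<dots> \<subseteq> ball x e" using e(1) by auto
      finally show ?thesis using that ab by blast
    qed
    let ?f = "\<lambda>i\<in>Basis. (a \<bullet> i, b \<bullet> i)"
    have "?a' ?f = a" "?b' ?f = b" by (simp_all add: euclidean_representation cong: sum.cong)
    then have "?f \<in> I" "x \<in> box (?a' ?f) (?b' ?f)" using ab e unfolding I_def by auto
    then show "x \<in> (\<Union>f\<in>I. box (?a' f) (?b' f))" by blast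
  qed
  moreover have "(\<Union>f\<in>I. box (?a' f) (?b' f)) \<subseteq> \<Omega>"
    using box_subset_cbox by (fastforce simp: I_def)
  ultimately show ?thesis
    by (intro that[of "(\<lambda>f. (?a' f, ?b' f)) ` I"]) (auto simp: I_def)
qed

lemma fundamental_lemma:
  fixes g :: "real^2 \<Rightarrow> real"
  assumes "open \<Omega>" "borel_fun g"
    and "\<And>a b. cbox a b \<subseteq> \<Omega> \<Longrightarrow> set_integrable lborel (cbox a b) g"
    and "\<And>\<psi>. \<psi> \<in> test_functions \<Omega> \<Longrightarrow> (LBINT x. g x * \<psi> x) = 0"
  shows "AE x\<in>\<Omega> in lborel. g x = 0"
proof -
  obtain D where D: "countable D" "\<And>a b. (a,b) \<in> D \<Longrightarrow> cbox a b \<subseteq> \<Omega>" "\<Omega> = (\<Union>(a,b)\<in>D. box a b)"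
    using open_countable_boxes[OF assms(1)] by blast
  have "AE x in lborel. \<forall>ab\<in>D. x \<in> box (fst ab) (snd ab) \<longrightarrow> g x = 0"
    using D(1,2) by (subst AE_ball_countable) (fastforce intro!: fundamental_lemma_box[where \<Omega>=\<Omega>] assms(2-4))+
  then show ?thesis by (rule AE_mp) (use D(3) in \<open>fastforce intro!: AE_I2\<close>)
qed

text \<open>Continuity of one partial derivative turns partial into total differentiability. The
  stream function below, defined by an integral, has its two partial derivatives computed by
  different means.\<close>

lemma differentiable_of_partials:
  fixes \<psi> :: "real \<Rightarrow> real \<Rightarrow> real"
  assumes 1: "\<And>x y. ((\<lambda>t. \<psi> t y) has_real_derivative a x y) (at x)"
    and 2: "\<And>x y. ((\<lambda>t. \<psi> x t) has_real_derivative b x y) (at y)"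
    and c: "continuous_on UNIV (\<lambda>p::real^2. b (p$1) (p$2))"
  shows "((\<lambda>p::real^2. \<psi> (p$1) (p$2)) has_derivative (\<lambda>h. a (p$1) (p$2) * h$1 + b (p$1) (p$2) * h$2)) (at p)"
proof -
  have cb: "continuous_on UNIV (\<lambda>(x,y). b x y)"
  proof -
    have "continuous_on UNIV (\<lambda>z. (\<lambda>p::real^2. b (p$1) (p$2)) (case z of (x,y) \<Rightarrow> pt x y))"
      by (rule continuous_on_compose2[OF c continuous_pt]) auto
    then show ?thesis by (simp add: case_prod_unfold)
  qed
  have "((\<lambda>(x,y). \<psi> x y) has_derivative (\<lambda>(tx,ty). a (p$1) (p$2) * tx + blinfun_apply (b (p$1) (p$2) *\<^sub>R id_blinfun) ty))
      (at (p$1,p$2) within UNIV \<times> UNIV)"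
  proof (rule has_derivative_partialsI)
    show "((\<lambda>x. \<psi> x (p$2)) has_derivative (\<lambda>tx. a (p$1) (p$2) * tx)) (at (p$1) within UNIV)"
      using 1 by (simp add: has_field_derivative_def)
    show "((\<lambda>y. \<psi> x y) has_derivative blinfun_apply (b x y *\<^sub>R id_blinfun)) (at y within UNIV)" for x y
      using 2[of x y] by (simp add: has_field_derivative_def scaleR_blinfun.rep_eq)
    show "continuous (at (p$1,p$2) within UNIV \<times> UNIV) (\<lambda>(x,y). b x y *\<^sub>R (id_blinfun :: real \<Rightarrow>\<^sub>L real))"
      using cb unfolding case_prod_unfold
      by (intro continuous_intros) (simp add: continuous_on_eq_continuous_within)
  qed auto
  then have "((\<lambda>z. \<psi> (fst z) (snd z)) has_derivative (\<lambda>z. a (p$1) (p$2) * fst z + b (p$1) (p$2) * snd z)) (at (p$1,p$2))"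
    by (simp add: case_prod_unfold scaleR_blinfun.rep_eq)
  moreover have "((\<lambda>p::real^2. (p$1,p$2)) has_derivative (\<lambda>h. (h$1,h$2))) (at p)"
    by (auto intro!: derivative_eq_intros bounded_linear.has_derivative[OF bounded_linear_vec_nth])
  ultimately show ?thesis using has_derivative_compose by fastforce
qed

text \<open>The first velocity component is integrated upwards from below its support. The
  derivative across the direction of integration follows from the Leibniz rule and the vanishing
  divergence. The potential is global although the domain has a hole, because the field, extended by
  zero, is solenoidal on the whole plane.\<close>

lemma stream_function:
  assumes \<phi>: "\<phi> \<in> solenoidal_test_functions \<Omega>"
  obtains \<psi> where "smooth \<psi>" "\<And>x. partial 1 \<psi> x = - (\<phi> x $ 2)" "\<And>x. partial 2 \<psi> x = \<phi> x $ 1"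
proof -
  have t: "\<phi> \<in> test_functions \<Omega>" and div: "\<And>x. partial 1 (\<lambda>y. \<phi> y $ 1) x + partial 2 (\<lambda>y. \<phi> y $ 2) x = 0"
    using \<phi> by (auto simp: solenoidal_test_functions_def sum_2)
  define f g where "f = (\<lambda>x. \<phi> x $ 1)" and "g = (\<lambda>x. \<phi> x $ 2)"
  have fg: "f \<in> test_functions \<Omega>" "g \<in> test_functions \<Omega>"
    using t by (auto simp: f_def g_def intro: test_functions_nth)
  note sm = test_functionsD(1)[OF fg(1)] test_functionsD(1)[OF fg(2)]
  obtain r where r: "r > 0" "\<And>x. x \<notin> square r \<Longrightarrow> \<phi> x = 0"
    using compact_support_square test_functionsD(2)[OF t] by blast
  have z: "f (pt x y) = 0" "g (pt x y) = 0" if "y < - r" for x y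
    using r(2)[of "pt x y"] that r(1) by (auto simp: square_def f_def g_def)
  \<comment> \<open>One unit below the support, so that every y \<ge> -r is interior to the interval
    {a..y+1} used for differentiating in y.\<close>
  define a where "a = - (r + 1)"
  define \<Psi> where "\<Psi> = (\<lambda>x y. integral {a..y} (\<lambda>s. f (pt x s)))"
  have zero: "\<Psi> x y = 0" if "y < - r" for x y
  proof -
    have "\<Psi> x y = integral {a..y} (\<lambda>s. 0)"
      unfolding \<Psi>_def using z that by (intro integral_cong) auto
    then show ?thesis by simp
  qed
  have d2: "((\<lambda>t. \<Psi> x t) has_real_derivative f (pt x y)) (at y)" for x y
  proof (cases "y < - r")
    case True
    have "((\<lambda>t. \<Psi> x t) has_real_derivative 0) (at y)"
      by (rule has_field_derivative_transform_within[where d="- r - y" and f="\<lambda>_. 0"])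
         (use True zero in \<open>auto simp: dist_real_def\<close>)
    then show ?thesis using z[OF True] by simp
  next
    case False
    have "((\<lambda>t. \<Psi> x t) has_real_derivative f (pt x y)) (at y within {a..y+1})"
      unfolding \<Psi>_def using False
      by (intro integral_has_real_derivative continuous_on_pt2 smooth_continuous sm) (auto simp: a_def)
    then show ?thesis using False by (subst (asm) at_within_Icc_at) (auto simp: a_def)
  qed
  have d1: "((\<lambda>t. \<Psi> t y) has_real_derivative - g (pt x y)) (at x)" for x y
  proof (cases "y < - r")
    case True
    then have "(\<lambda>t. \<Psi> t y) = (\<lambda>_. 0)" using zero by auto
    then show ?thesis using z[OF True] by simp
  next
    case False
    have "((\<lambda>t. integral (cbox a y) (\<lambda>s. f (pt t s))) has_real_derivative integral (cbox a y) (\<lambda>s. partial 1 f (pt x s))) (at x within UNIV)"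
    proof (rule leibniz_rule_field_derivative)
      show "((\<lambda>x. f (pt x t)) has_real_derivative partial 1 f (pt x t)) (at x within UNIV)" for x t
        using has_derivative_pt(1)[OF smooth_differentiable[OF sm(1)]]
        by (simp add: has_real_derivative_iff_has_vector_derivative)
      show "(\<lambda>s. f (pt x s)) integrable_on cbox a y" for x
        by (intro integrable_continuous continuous_on_pt2 smooth_continuous sm)
      have "continuous_on UNIV (\<lambda>z. partial 1 f (case z of (x,t) \<Rightarrow> pt x t))"
        by (rule continuous_on_compose2[OF smooth_continuous[OF smooth_partial[OF sm(1)]] continuous_pt]) auto
      then show "continuous_on (UNIV \<times> cbox a y) (\<lambda>(x, t). partial 1 f (pt x t))"
        by (auto simp: case_prod_unfold intro: continuous_on_subset)
    qed auto
    moreover have "integral (cbox a y) (\<lambda>s. partial 1 f (pt x s)) = - g (pt x y)"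
    proof -
      have "((\<lambda>s. partial 2 g (pt x s)) has_integral (g (pt x y) - g (pt x a))) {a..y}"
        using False by (intro fundamental_theorem_of_calculus has_derivative_pt(2) smooth_differentiable sm) (auto simp: a_def)
      then have "integral {a..y} (\<lambda>s. partial 2 g (pt x s)) = g (pt x y)"
        using z(2)[of a x] r(1) by (auto simp: a_def intro!: integral_unique)
      moreover have "partial 1 f p = - partial 2 g p" for p
        using div[of p] by (simp add: f_def g_def)
      ultimately show ?thesis by simp
    qed
    ultimately show ?thesis by (simp add: \<Psi>_def)
  qed
  define \<psi> where "\<psi> = (\<lambda>p::real^2. \<Psi> (p$1) (p$2))"
  have D: "(\<psi> has_derivative (\<lambda>h. - g p * h$1 + f p * h$2)) (at p)" for p
    unfolding \<psi>_def using differentiable_of_partials[of \<Psi> "\<lambda>x y. - g (pt x y)" "\<lambda>x y. f (pt x y)" p] d1 d2 smooth_continuous[OF sm(1)]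
    by simp
  have p: "partial 1 \<psi> = (\<lambda>x. (-1) * g x)" "partial 2 \<psi> = f"
    using partialI[OF D] by (auto simp: fun_eq_iff axis_def)
  have "smooth (partial i \<psi>)" for i
    using exhaust_2[of i] sm smooth_cmult[OF sm(2), of "-1"] p by auto
  then have "smooth \<psi>"
    by (intro smooth_coinduct[where X="insert \<psi> {f. smooth f}"])
       (use D in \<open>auto intro: differentiableI smooth_differentiable smooth_partial\<close>)
  with that[of \<psi>] p show ?thesis by (simp add: f_def g_def)
qed

section \<open>Truncation of solenoidal fields\<close>

definition swp :: "real^2 \<Rightarrow> real^2" where "swp p = pt (p$2) (p$1)"

lemma swp_simps [simp]: "swp p $ 1 = p $ 2" "swp p $ 2 = p $ 1" "swp (swp p) = p" "swp (pt x y) = pt y x"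
  by (simp_all add: swp_def)

lemma norm_swp [simp]: "norm (swp p) = norm p"
  by (simp add: norm_pair add.commute)

lemma swp_measurable [measurable]: "borel_fun swp"
  unfolding swp_def by measurable

lemma nn_integral_swp:
  "borel_fun f \<Longrightarrow> (NNINT p. f (swp p)) = (NNINT p. f p)" for f :: "_ \<Rightarrow> ennreal"
  using lborel_linear_swaps(1) by (subst (2) lborel_linear_swaps(1)[symmetric], subst nn_integral_distr) (auto simp: swp_def)

lemma AE_swp:
  assumes "AE p in lborel. P p" and [measurable]: "Measurable.pred borel P" shows "AE p in lborel. P (swp p)"
  using assms(1) by (subst (asm) lborel_linear_swaps(1)[symmetric], subst (asm) AE_distr_iff) (auto simp: swp_def)

lemma sqi_swp:
  assumes [measurable]: "borel_fun f"
  shows "sqi (square r) (\<lambda>p. f (swp p)) = sqi (square r) f"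
proof -
  have "sqi (square r) (\<lambda>p. f (swp p)) = (NNINT p. ennreal ((norm (f (swp p)))^2) * indicator (square r) (swp p))"
    unfolding sqi_def by (intro nn_integral_cong) (auto simp: indicator_def square_def)
  also have "\<dots> = sqi (square r) f" unfolding sqi_def by (subst nn_integral_swp) auto
  finally show ?thesis .
qed

definition strip :: "real \<Rightarrow> (real^2) set" where
  "strip k = {p. k \<le> p$1 \<and> p$1 \<le> 2*k \<and> \<bar>p$2\<bar> \<le> 2*k}"

text \<open>A bound for the oscillation of a stream function with velocity \<open>f\<close> on the horizontal line
  at height \<open>y\<close>: travel along this line to a vertical line \<open>x = s\<close> with \<open>k \<le> s \<le> 2k\<close>, then along the latter.\<close>

definition osc :: "real \<Rightarrow> (real^2 \<Rightarrow> 'b::real_normed_vector) \<Rightarrow> real \<Rightarrow> ennreal" where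
  "osc k f y = NNset {-2*k..2*k} (\<lambda>x. ennreal (norm (f (pt x y)))) +
     ennreal (1/k) * NNset (strip k) (\<lambda>p. ennreal (norm (f p)))"

lemma strip_cbox: "strip k = cbox (pt k (-2*k)) (pt (2*k) (2*k))"
  by (auto simp: strip_def cbox_def Basis_pair abs_le_iff)

lemma strip_borel [measurable]: "strip k \<in> sets borel"
  by (simp add: strip_cbox)

lemma osc_measurable [measurable]:
  assumes [measurable]: "borel_fun f" shows "borel_fun (osc k f)"
  unfolding osc_def by measurable

lemma increment_bound:
  fixes h :: "real \<Rightarrow> real"
  assumes h: "\<And>x. (h has_vector_derivative h' x) (at x)" and c: "continuous_on UNIV h'"
    and ab: "a \<in> {l..u}" "b \<in> {l..u}"
  shows "ennreal \<bar>h a - h b\<bar> \<le> NNset {l..u} (\<lambda>x. ennreal \<bar>h' x\<bar>)"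
proof -
  have *: "ennreal \<bar>h d - h c\<bar> \<le> NNset {l..u} (\<lambda>x. ennreal \<bar>h' x\<bar>)"
    if cd: "c \<in> {l..u}" "d \<in> {l..u}" "c \<le> d" for c d
  proof -
    have i: "integrable lborel (\<lambda>x. h' x * indicator {c..d} x)"
      using borel_integrable_compact[OF compact_Icc continuous_on_subset[OF c subset_UNIV], of c d]
      by (simp add: mult.commute)
    have i2: "(LBINT x. h' x * indicator {c..d} x) = h d - h c"
      using integral_FTC_Icc_real[of c d h h'] h c cd(3)
      by (auto simp: has_real_derivative_iff_has_vector_derivative continuous_on_eq_continuous_within)
    have "ennreal \<bar>h d - h c\<bar> \<le> (NNINT x. ennreal (norm (h' x * indicator {c..d} x)))"
      using integral_norm_bound_ennreal[OF i] i2 by simp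
    also have "\<dots> \<le> NNset {l..u} (\<lambda>x. ennreal \<bar>h' x\<bar>)"
      using cd by (intro nn_integral_mono) (auto simp: indicator_def)
    finally show ?thesis .
  qed
  show ?thesis
    using *[OF ab] *[OF ab(2,1)] by (cases "a \<le> b") (auto simp: abs_minus_commute)
qed

lemma emeasure_cbox2:
  "a$1 \<le> b$1 \<Longrightarrow> a$2 \<le> b$2 \<Longrightarrow> emeasure lborel (cbox a (b::real^2)) = ennreal ((b$1 - a$1) * (b$2 - a$2))"
  using axis12 by (subst emeasure_lborel_cbox) (auto simp: Basis_pair)

text \<open>The point (x,y) is joined to a point p of [k,2k]^2 by a horizontal and then a vertical
  segment, and p is averaged over that square. The vertical part depends on the first coordinate of
  p only, so the averaging gives the strip integral with the factor k / k^2 = 1/k.\<close>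

lemma osc_bound_aux:
  fixes \<psi> :: "real^2 \<Rightarrow> real"
  assumes k: "k > 0"
    and d1: "\<And>x y. ((\<lambda>t. \<psi> (pt t y)) has_vector_derivative a (pt x y)) (at x)"
    and d2: "\<And>x y. ((\<lambda>t. \<psi> (pt x t)) has_vector_derivative b (pt x y)) (at y)"
    and c: "continuous_on UNIV a" "continuous_on UNIV b" "continuous_on UNIV \<psi>"
    and bd: "\<And>p. \<bar>a p\<bar> \<le> norm (f p)" "\<And>p. \<bar>b p\<bar> \<le> norm (f p)"
    and [measurable]: "borel_fun f"
    and xy: "\<bar>x\<bar> \<le> 2*k" "\<bar>y\<bar> \<le> 2*k"
  shows "ennreal \<bar>\<psi> (pt x y) - (LBINT p. indicator (cbox (pt k k) (pt (2*k) (2*k))) p * \<psi> p) / k^2\<bar> \<le> osc k f y"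
proof -
  have [measurable]: "borel_fun a" "borel_fun b" "borel_fun \<psi>"
    using c by (auto intro: borel_measurable_continuous_onI)
  let ?Q = "cbox (pt k k) (pt (2*k) (2*k))"
  have eQ: "emeasure lborel ?Q = ennreal (k^2)" using k by (subst emeasure_cbox2) (auto simp: power2_eq_square)
  define N where "N s = NNset {-2*k..2*k} (\<lambda>t. ennreal (norm (f (pt s t))))" for s
  define M where "M = NNset {-2*k..2*k} (\<lambda>t. ennreal (norm (f (pt t y))))"
  have [measurable]: "borel_fun N" unfolding N_def by measurable
  have pw: "ennreal \<bar>\<psi> (pt x y) - \<psi> p\<bar> \<le> M + N (p$1)" if "p \<in> ?Q" for p
  proof -
    have p: "k \<le> p$1" "p$1 \<le> 2*k" "k \<le> p$2" "p$2 \<le> 2*k" using that by (auto simp: mem_box Basis_pair)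
    have "ennreal \<bar>\<psi> (pt x y) - \<psi> (pt (p$1) y)\<bar> \<le> NNset {-2*k..2*k} (\<lambda>t. ennreal \<bar>a (pt t y)\<bar>)"
      by (rule increment_bound[where h="\<lambda>t. \<psi> (pt t y)", OF d1 continuous_on_pt1[OF c(1)]]) (use xy p k in \<open>auto simp: abs_le_iff\<close>)
    also have "\<dots> \<le> M" unfolding M_def by (intro nn_integral_mono mult_right_mono ennreal_leI bd) auto
    finally have 1: "ennreal \<bar>\<psi> (pt x y) - \<psi> (pt (p$1) y)\<bar> \<le> M" .
    have "ennreal \<bar>\<psi> (pt (p$1) y) - \<psi> (pt (p$1) (p$2))\<bar> \<le> NNset {-2*k..2*k} (\<lambda>t. ennreal \<bar>b (pt (p$1) t)\<bar>)"
      by (rule increment_bound[where h="\<lambda>t. \<psi> (pt (p$1) t)", OF d2 continuous_on_pt2[OF c(2)]]) (use xy p k in \<open>auto simp: abs_le_iff\<close>)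
    also have "\<dots> \<le> N (p$1)" unfolding N_def by (intro nn_integral_mono mult_right_mono ennreal_leI bd) auto
    finally have 2: "ennreal \<bar>\<psi> (pt (p$1) y) - \<psi> p\<bar> \<le> N (p$1)" by simp
    have "ennreal \<bar>\<psi> (pt x y) - \<psi> p\<bar> \<le> ennreal (\<bar>\<psi> (pt x y) - \<psi> (pt (p$1) y)\<bar> + \<bar>\<psi> (pt (p$1) y) - \<psi> p\<bar>)"
      by (intro ennreal_leI) linarith
    also have "\<dots> \<le> M + N (p$1)" using add_mono[OF 1 2] by simp
    finally show ?thesis .
  qed
  have i: "integrable lborel (\<lambda>p. indicator ?Q p * g p)" if "continuous_on UNIV g" for g :: "real^2 \<Rightarrow> real"
    using borel_integrable_compact[OF compact_cbox continuous_on_subset[OF that subset_UNIV], of "pt k k" "pt (2*k) (2*k)"] by simp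
  have mQ: "(LBINT p. indicator ?Q p * \<psi> (pt x y)) = k^2 * \<psi> (pt x y)"
    using eQ by (simp add: measure_def)
  have eq: "k^2 * (\<psi> (pt x y) - (LBINT p. indicator ?Q p * \<psi> p) / k^2) = (LBINT p. indicator ?Q p * (\<psi> (pt x y) - \<psi> p))"
  proof -
    have "(LBINT p. indicator ?Q p * (\<psi> (pt x y) - \<psi> p))
      = (LBINT p. indicator ?Q p * \<psi> (pt x y)) - (LBINT p. indicator ?Q p * \<psi> p)"
      unfolding right_diff_distrib by (intro Bochner_Integration.integral_diff i c continuous_on_const)
    then show ?thesis unfolding mQ using k by (simp add: right_diff_distrib)
  qed
  have "k^2 * \<bar>\<psi> (pt x y) - (LBINT p. indicator ?Q p * \<psi> p) / k^2\<bar> = norm (LBINT p. indicator ?Q p * (\<psi> (pt x y) - \<psi> p))"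
    unfolding eq[symmetric] by (simp add: abs_mult)
  then have "ennreal (k^2 * \<bar>\<psi> (pt x y) - (LBINT p. indicator ?Q p * \<psi> p) / k^2\<bar>)
      \<le> (NNINT p. ennreal (norm (indicator ?Q p * (\<psi> (pt x y) - \<psi> p))))"
    using integral_norm_bound_ennreal[OF i[of "\<lambda>p. \<psi> (pt x y) - \<psi> p"]] c(3) by (simp add: continuous_intros)
  also have "\<dots> \<le> (NNINT p. M * indicator ?Q p + N (p$1) * indicator ?Q p)"
    using pw by (intro nn_integral_mono) (auto simp: indicator_def)
  also have "\<dots> = M * ennreal (k^2) + NNset ?Q (\<lambda>p. N (p$1))"
    by (subst nn_integral_add) (auto simp: nn_integral_cmult_indicator eQ)
  also have "NNset ?Q (\<lambda>p. N (p$1)) = (\<integral>\<^sup>+s. \<integral>\<^sup>+t. (N s * indicator {k..2*k} s) * indicator {k..2*k} t \<partial>lborel \<partial>lborel)"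
    by (subst nn_integral_plane(2)) (auto intro!: nn_integral_cong simp: indicator_def mem_box Basis_pair)
  also have "\<dots> = (NNINT s. N s * indicator {k..2*k} s * ennreal k)"
    using k by (intro nn_integral_cong) (subst nn_integral_cmult_indicator, auto)
  also have "\<dots> = ennreal k * NNset {k..2*k} (\<lambda>s. N s)"
    by (subst nn_integral_cmult[symmetric]) (auto simp: mult.commute)
  also have "NNset {k..2*k} (\<lambda>s. N s) = (\<integral>\<^sup>+s. \<integral>\<^sup>+t. ennreal (norm (f (pt s t))) * indicator (strip k) (pt s t) \<partial>lborel \<partial>lborel)"
    unfolding N_def by (subst nn_integral_multc[symmetric]) (auto intro!: nn_integral_cong simp: indicator_def strip_def abs_le_iff)
  also have "\<dots> = NNset (strip k) (\<lambda>p. ennreal (norm (f p)))"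
    by (subst nn_integral_plane(2)) auto
  finally have *: "ennreal (k^2 * \<bar>\<psi> (pt x y) - (LBINT p. indicator ?Q p * \<psi> p) / k^2\<bar>)
     \<le> M * ennreal (k^2) + ennreal k * NNset (strip k) (\<lambda>p. ennreal (norm (f p)))" .
  have "ennreal \<bar>\<psi> (pt x y) - (LBINT p. indicator ?Q p * \<psi> p) / k^2\<bar>
     = ennreal (1/k^2) * ennreal (k^2 * \<bar>\<psi> (pt x y) - (LBINT p. indicator ?Q p * \<psi> p) / k^2\<bar>)"
    using k by (subst ennreal_mult[symmetric]) auto
  also have "\<dots> \<le> ennreal (1/k^2) * (M * ennreal (k^2) + ennreal k * NNset (strip k) (\<lambda>p. ennreal (norm (f p))))"
    by (intro mult_left_mono *) auto
  also have "\<dots> = (ennreal (1/k^2) * ennreal (k^2)) * M + (ennreal (1/k^2) * ennreal k) * NNset (strip k) (\<lambda>p. ennreal (norm (f p)))"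
    by (simp add: distrib_left mult_ac)
  also have "\<dots> = osc k f y"
    using k by (subst (1 2) ennreal_mult[symmetric]) (auto simp: osc_def M_def power2_eq_square)
  finally show ?thesis .
qed

text \<open>The averaging square [k,2k]^2 is symmetric under \<open>swp\<close>, so the same mean
  value serves the estimate along horizontal and along vertical lines. A common constant is
  essential, since only one normalisation of the stream function can be truncated.\<close>

lemma osc_bound:
  fixes \<psi> :: "real^2 \<Rightarrow> real"
  assumes k: "k > 0" and \<psi>: "smooth \<psi>"
    and bd: "\<And>p. \<bar>partial 1 \<psi> p\<bar> \<le> norm (f p)" "\<And>p. \<bar>partial 2 \<psi> p\<bar> \<le> norm (f p)"
    and [measurable]: "borel_fun f"
  obtains c where "\<And>p. p \<in> square (2*k) \<Longrightarrow> ennreal \<bar>\<psi> p - c\<bar> \<le> osc k f (p$2)"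
    "\<And>p. p \<in> square (2*k) \<Longrightarrow> ennreal \<bar>\<psi> p - c\<bar> \<le> osc k (\<lambda>p. f (swp p)) (p$1)"
proof -
  let ?Q = "cbox (pt k k) (pt (2*k) (2*k))"
  define c where "c = (LBINT p. indicator ?Q p * \<psi> p) / k^2"
  note C = smooth_continuous[OF smooth_partial[OF \<psi>]] smooth_continuous[OF \<psi>]
  note D = has_derivative_pt[OF smooth_differentiable[OF \<psi>]]
  have [measurable]: "borel_fun \<psi>" using smooth_measurable[OF \<psi>] .
  have cs: "continuous_on UNIV (\<lambda>p. g (swp p))" if "continuous_on UNIV g" for g :: "real^2 \<Rightarrow> real"
  proof (rule continuous_on_compose2[OF that])
    have eq: "swp = (\<lambda>p. p$2 *\<^sub>R axis 1 1 + p$1 *\<^sub>R axis 2 1)"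
      by (auto simp: fun_eq_iff swp_def vec_eq_iff forall_2 axis_def)
    show "continuous_on UNIV swp" unfolding eq by (intro continuous_intros)
  qed auto
  have 1: "ennreal \<bar>\<psi> p - c\<bar> \<le> osc k f (p$2)" if "p \<in> square (2*k)" for p
    using osc_bound_aux[OF k D C(1,1,2) bd(1,2), of "p$1" "p$2"] that by (auto simp: c_def square_def)
  have c': "c = (LBINT p. indicator ?Q p * \<psi> (swp p)) / k^2"
  proof -
    have "(LBINT p. indicator ?Q p * \<psi> p) = (LBINT p. indicator ?Q (swp p) * \<psi> (swp p))"
      by (subst lborel_linear_swaps(1)[symmetric], subst integral_distr) (auto simp: swp_def)
    also have "(\<lambda>p. indicator ?Q (swp p) :: real) = indicator ?Q"
      by (auto simp: fun_eq_iff indicator_def mem_box Basis_pair)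
    finally show ?thesis unfolding c_def by (metis (no_types, lifting))
  qed
  have 2: "ennreal \<bar>\<psi> p - c\<bar> \<le> osc k (\<lambda>p. f (swp p)) (p$1)" if "p \<in> square (2*k)" for p
    using osc_bound_aux[where \<psi>="\<lambda>p. \<psi> (swp p)" and a="\<lambda>p. partial 2 \<psi> (swp p)" and b="\<lambda>p. partial 1 \<psi> (swp p)"
      and f="\<lambda>p. f (swp p)" and x="p$2" and y="p$1", OF k] that D cs C bd
    by (auto simp: c' square_def)
  show ?thesis using that[of c] 1 2 by blast
qed

lemma sq_sum_ennreal: "(a + b)^2 \<le> 2 * a^2 + 2 * (b::ennreal)^2"
proof (cases "a = top \<or> b = top")
  case True then show ?thesis by (auto simp: power2_eq_square ennreal_top_mult ennreal_mult_top)
next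
  case False
  then obtain x y where "a = ennreal x" "x \<ge> 0" "b = ennreal y" "y \<ge> 0"
    by (metis ennreal_cases)
  moreover have "(x + y)^2 \<le> 2 * x^2 + 2 * y^2"
    using zero_le_power2[of "x - y"] by (simp add: power2_eq_square algebra_simps)
  ultimately show ?thesis
    by (simp add: ennreal_power flip: ennreal_plus ennreal_mult ennreal_numeral)
qed

lemma nn_integral_indicator_sq:
  fixes f :: "'a::euclidean_space \<Rightarrow> 'b::euclidean_space"
  assumes [measurable]: "borel_fun f" "A \<in> sets borel"
  shows "(NNset A (\<lambda>x. ennreal (norm (f x))))^2
      \<le> emeasure lborel A * NNset A (\<lambda>x. ennreal ((norm (f x))^2))"
proof -
  have "NNset A (\<lambda>x. ennreal (norm (f x))) = (NNINT x. indicator A x * (ennreal (norm (f x)) * indicator A x))"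
    by (intro nn_integral_cong) (auto simp: indicator_def)
  moreover have "emeasure lborel A = (NNINT x. (indicator A x)^2)"
  proof -
    have "(indicator A x)^2 = (indicator A x :: ennreal)" for x by (simp add: indicator_def)
    then show ?thesis by simp
  qed
  moreover have "NNset A (\<lambda>x. ennreal ((norm (f x))^2)) = (NNINT x. (ennreal (norm (f x)) * indicator A x)^2)"
    by (intro nn_integral_cong) (auto simp: indicator_def ennreal_power)
  ultimately show ?thesis by (simp only:) (rule Cauchy_Schwarz_nn_integral; measurable)
qed

text \<open>Cauchy-Schwarz on a segment of length 4k and on the strip of area 4 k^2. After splitting
  the square with factors 2, the segment contributes 8k and the strip 8, the latter integrated over
  an interval of length 4k: 8k + 32k = 40k.\<close>

lemma osc_sq_integral:
  fixes f :: "real^2 \<Rightarrow> 'b::euclidean_space"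
  assumes k: "k > 0" and [measurable]: "borel_fun f"
  shows "NNset {-2*k..2*k} (\<lambda>y. (osc k f y)^2) \<le> ennreal (40 * k) * sqi (square (2*k)) f"
proof -
  define M where "M y = NNset {-2*k..2*k} (\<lambda>x. ennreal (norm (f (pt x y))))" for y
  define D where "D = NNset (strip k) (\<lambda>p. ennreal (norm (f p)))"
  have [measurable]: "borel_fun M" unfolding M_def by measurable
  have "strip k \<subseteq> square (2*k)" using k by (auto simp: strip_def square_def)
  have "emeasure lborel (strip k) = ennreal (4 * k^2)"
    using k unfolding strip_cbox by (subst emeasure_cbox2) (auto simp: power2_eq_square)
  then have D2: "D^2 \<le> ennreal (4 * k^2) * sqi (square (2*k)) f"
    using order_trans[OF nn_integral_indicator_sq[of f "strip k"] mult_left_mono[OF sqi_mono_set[OF \<open>strip k \<subseteq> square (2*k)\<close>, of f, unfolded sqi_def[of "strip k"]]]]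
    unfolding D_def by simp
  have M2: "(M y)^2 \<le> ennreal (4 * k) * NNset {-2*k..2*k} (\<lambda>x. ennreal ((norm (f (pt x y)))^2))" for y
    using nn_integral_indicator_sq[of "\<lambda>x. f (pt x y)" "{-2*k..2*k}"] k unfolding M_def by simp
  have "(osc k f y)^2 \<le> 2 * (M y)^2 + 2 * (ennreal (1/k) * D)^2" for y
    unfolding osc_def M_def[symmetric] D_def[symmetric] by (rule sq_sum_ennreal)
  also have "\<dots> y \<le> 2 * (ennreal (4 * k) * NNset {-2*k..2*k} (\<lambda>x. ennreal ((norm (f (pt x y)))^2))) + 2 * (4 * sqi (square (2*k)) f)" for y
  proof (intro add_mono mult_left_mono M2)
    have "(ennreal (1/k) * D)^2 = ennreal (1/k^2) * D^2"
      using k by (simp add: power_mult_distrib ennreal_power power_divide)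
    also have "\<dots> \<le> ennreal (1/k^2) * (ennreal (4 * k^2) * sqi (square (2*k)) f)" by (intro mult_left_mono D2) auto
    also have "\<dots> = 4 * sqi (square (2*k)) f"
      using k by (subst mult.assoc[symmetric], subst ennreal_mult[symmetric]) auto
    finally show "(ennreal (1/k) * D)^2 \<le> 4 * sqi (square (2*k)) f" .
  qed auto
  finally have pw: "(osc k f y)^2 \<le> ennreal (8*k) * NNset {-2*k..2*k} (\<lambda>x. ennreal ((norm (f (pt x y)))^2)) + 8 * sqi (square (2*k)) f" for y
    using k by (simp add: mult.assoc[symmetric] flip: ennreal_mult ennreal_numeral)
  have "NNset {-2*k..2*k} (\<lambda>y. (osc k f y)^2)
     \<le> (NNINT y. ennreal (8*k) * ((NNset {-2*k..2*k} (\<lambda>x. ennreal ((norm (f (pt x y)))^2))) * indicator {-2*k..2*k} y) + (8 * sqi (square (2*k)) f) * indicator {-2*k..2*k} y)"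
    using pw by (intro nn_integral_mono) (auto simp: indicator_def)
  also have "\<dots> = ennreal (8*k) * NNset {-2*k..2*k} (\<lambda>y. NNset {-2*k..2*k} (\<lambda>x. ennreal ((norm (f (pt x y)))^2))) + 8 * sqi (square (2*k)) f * ennreal (4*k)"
    using k by (subst nn_integral_add) (auto simp: nn_integral_cmult nn_integral_cmult_indicator)
  also have "NNset {-2*k..2*k} (\<lambda>y. NNset {-2*k..2*k} (\<lambda>x. ennreal ((norm (f (pt x y)))^2))) = sqi (square (2*k)) f"
    unfolding sqi_def by (subst nn_integral_plane(1), measurable, subst nn_integral_multc[symmetric])
      (auto intro!: nn_integral_cong simp: indicator_def square_def abs_le_iff)
  also have "ennreal (8*k) * sqi (square (2*k)) f + 8 * sqi (square (2*k)) f * ennreal (4*k) = (ennreal (8*k) + 8 * ennreal (4*k)) * sqi (square (2*k)) f"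
    by (simp only: distrib_left distrib_right mult_ac)
  also have "ennreal (8*k) + 8 * ennreal (4*k) = ennreal (40*k)"
    using k by (simp flip: ennreal_plus ennreal_mult ennreal_numeral)
  finally show ?thesis .
qed

lemma osc_triangle:
  fixes f g h :: "real^2 \<Rightarrow> 'b::euclidean_space"
  assumes [measurable]: "borel_fun g" "borel_fun h"
    and "\<And>x. f x = g x + h x"
  shows "osc k f y \<le> osc k g y + osc k h y"
proof -
  have le: "ennreal (norm (g p + h p)) \<le> ennreal (norm (g p)) + ennreal (norm (h p))" for p
    by (subst ennreal_plus[symmetric]) (auto intro!: ennreal_leI norm_triangle_ineq simp del: ennreal_plus)
  have "NNset {-2*k..2*k} (\<lambda>x. ennreal (norm (f (pt x y))))
    \<le> (NNINT x. ennreal (norm (g (pt x y))) * indicator {-2*k..2*k} x + ennreal (norm (h (pt x y))) * indicator {-2*k..2*k} x)"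
    using le by (intro nn_integral_mono) (auto simp: assms(3) indicator_def)
  moreover have "NNset (strip k) (\<lambda>p. ennreal (norm (f p)))
    \<le> (NNINT p. ennreal (norm (g p)) * indicator (strip k) p + ennreal (norm (h p)) * indicator (strip k) p)"
    using le by (intro nn_integral_mono) (auto simp: assms(3) indicator_def)
  ultimately have "osc k f y \<le> ((NNset {-2*k..2*k} (\<lambda>x. ennreal (norm (g (pt x y))))) + NNset {-2*k..2*k} (\<lambda>x. ennreal (norm (h (pt x y)))))
    + ennreal (1/k) * ((NNset (strip k) (\<lambda>p. ennreal (norm (g p)))) + NNset (strip k) (\<lambda>p. ennreal (norm (h p))))"
    unfolding osc_def by (simp add: nn_integral_add add_mono mult_left_mono)
  then show ?thesis by (simp add: osc_def distrib_left add_ac)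
qed

text \<open>At height |y| \<ge> k and on the strip one has |f| \<le> M/k. A segment of length 4k
  then contributes 4M, and the strip, of area 4 k^2 and with prefactor 1/k, another 4M. The bound
  does not depend on k, which is what the decay of f buys.\<close>

lemma osc_decay:
  fixes f :: "real^2 \<Rightarrow> 'b::euclidean_space"
  assumes k: "k > 0" and [measurable]: "borel_fun f"
    and f: "AE p in lborel. (norm p + 1) * norm (f p) \<le> M"
  shows "AE y in lborel. \<bar>y\<bar> \<ge> k \<longrightarrow> osc k f y \<le> ennreal (8 * M)"
proof -
  have M: "M \<ge> 0"
  proof -
    have "AE p in (lborel :: (real^2) measure). M \<ge> 0"
      using f
    proof eventually_elim
      case (elim p)
      have "0 \<le> (norm p + 1) * norm (f p)" by (intro mult_nonneg_nonneg) auto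
      then show ?case using elim by linarith
    qed
    moreover have "ae_filter (lborel :: (real^2) measure) \<noteq> bot"
      by (simp add: ae_filter_eq_bot_iff)
    ultimately show ?thesis by (simp add: eventually_const)
  qed
  have le: "norm (f p) \<le> M / k" if "(norm p + 1) * norm (f p) \<le> M" "k \<le> \<bar>p$1\<bar> \<or> k \<le> \<bar>p$2\<bar>" for p
  proof -
    have "k \<le> norm p + 1" using that(2) component_le_norm_cart[of p 1] component_le_norm_cart[of p 2] by auto
    then have "k * norm (f p) \<le> M" using that(1) mult_right_mono[of k "norm p + 1" "norm (f p)"] by auto
    then show ?thesis using k by (simp add: field_simps)
  qed
  have "NNset (strip k) (\<lambda>p. ennreal (norm (f p))) \<le> NNset (strip k) (\<lambda>p. ennreal (M/k))"
  proof (rule nn_integral_mono_AE, use f in eventually_elim)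
    fix p assume "(norm p + 1) * norm (f p) \<le> M"
    then show "ennreal (norm (f p)) * indicator (strip k) p \<le> ennreal (M / k) * indicator (strip k) p"
      by (auto simp: indicator_def strip_def intro!: ennreal_leI le)
  qed
  also have "\<dots> = ennreal (M/k) * ennreal (4*k^2)"
    using k by (subst nn_integral_cmult_indicator, simp, subst strip_cbox, subst emeasure_cbox2) (auto simp: power2_eq_square mult_ac)
  also have "\<dots> = ennreal (4 * M * k)"
    using k M by (subst ennreal_mult[symmetric]) (auto simp: power2_eq_square field_simps)
  finally have "ennreal (1/k) * NNset (strip k) (\<lambda>p. ennreal (norm (f p))) \<le> ennreal (1/k) * ennreal (4 * M * k)"
    by (intro mult_left_mono) auto
  also have "\<dots> = ennreal (4 * M)" using k M by (subst ennreal_mult[symmetric]) auto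
  finally have D: "ennreal (1/k) * NNset (strip k) (\<lambda>p. ennreal (norm (f p))) \<le> ennreal (4 * M)" .
  have "AE y in lborel. AE x in lborel. (norm (pt x y) + 1) * norm (f (pt x y)) \<le> M"
    by (rule AE_plane(1)[OF f]) measurable
  then show ?thesis
  proof (rule AE_mp, intro AE_I2 impI)
    fix y assume y: "AE x in lborel. (norm (pt x y) + 1) * norm (f (pt x y)) \<le> M" and ky: "k \<le> \<bar>y\<bar>"
    have "NNset {-2*k..2*k} (\<lambda>x. ennreal (norm (f (pt x y)))) \<le> NNset {-2*k..2*k} (\<lambda>x. ennreal (M/k))"
    proof (rule nn_integral_mono_AE, use y in eventually_elim)
      fix x assume "(norm (pt x y) + 1) * norm (f (pt x y)) \<le> M"
      then show "ennreal (norm (f (pt x y))) * indicator {-2*k..2*k} x \<le> ennreal (M / k) * indicator {-2*k..2*k} x"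
        using ky by (auto simp: indicator_def intro!: ennreal_leI le)
    qed
    also have "\<dots> = ennreal (M/k) * ennreal (4*k)"
      using k by (subst nn_integral_cmult_indicator) auto
    also have "\<dots> = ennreal (4 * M)" using k M by (subst ennreal_mult[symmetric]) auto
    finally have "osc k f y \<le> ennreal (4 * M) + ennreal (4 * M)"
      unfolding osc_def using D by (intro add_mono)
    also have "\<dots> = ennreal (8 * M)" using M by (simp flip: ennreal_plus)
    finally show "osc k f y \<le> ennreal (8 * M)" .
  qed
qed

text \<open>Contains the supports of the derivatives of the cut-off at radius k; on it |x| is
  comparable with k.\<close>

definition ring_region :: "real \<Rightarrow> (real^2) set" where
  "ring_region k = {p \<in> square (2*k). k \<le> \<bar>p$1\<bar> \<or> k \<le> \<bar>p$2\<bar>}"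

lemma ring_region_borel [measurable]: "ring_region k \<in> sets borel"
  unfolding ring_region_def by measurable

text \<open>A Poincare inequality: a stream function, normalised on the square, is bounded in L^2 by
  k times its velocity. The bound depends on the second coordinate alone, so the first one
  contributes the length 4k, and 4k times 40k is 160 k^2.\<close>

lemma sqi_osc:
  fixes f :: "real^2 \<Rightarrow> 'b::euclidean_space" and P :: "real^2 \<Rightarrow> real"
  assumes k: "k > 0" and [measurable]: "borel_fun f" "borel_fun P"
    and P: "\<And>p. p \<in> square (2*k) \<Longrightarrow> ennreal \<bar>P p\<bar> \<le> osc k f (p$2)"
  shows "sqi (square (2*k)) P \<le> ennreal (160 * k^2) * sqi (square (2*k)) f"
proof -
  have "sqi (square (2*k)) P \<le> (NNINT p. (osc k f ((p::real^2)$2))^2 * indicator {-2*k..2*k} (p$2) * indicator {-2*k..2*k} (p$1))"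
    unfolding sqi_def
  proof (intro nn_integral_mono)
    fix p
    show "ennreal ((norm (P p))^2) * indicator (square (2*k)) p \<le> (osc k f (p$2))^2 * indicator {-2*k..2*k} (p$2) * indicator {-2*k..2*k} (p$1)"
    proof (cases "p \<in> square (2*k)")
      case True
      have "ennreal ((norm (P p))^2) = (ennreal \<bar>P p\<bar>)^2" by (simp add: ennreal_power)
      also have "\<dots> \<le> (osc k f (p$2))^2" by (intro power_mono P True) auto
      finally show ?thesis using True by (auto simp: square_def abs_le_iff)
    qed auto
  qed
  also have "\<dots> = (\<integral>\<^sup>+y. \<integral>\<^sup>+x. ((osc k f y)^2 * indicator {-2*k..2*k} y) * indicator {-2*k..2*k} x \<partial>lborel \<partial>lborel)"
    by (subst nn_integral_plane(1)) auto
  also have "\<dots> = (NNINT y. ((osc k f y)^2 * indicator {-2*k..2*k} y) * ennreal (4*k))"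
    using k by (intro nn_integral_cong) (subst nn_integral_cmult_indicator, auto)
  also have "\<dots> = ennreal (4*k) * NNset {-2*k..2*k} (\<lambda>y. (osc k f y)^2)"
    by (subst nn_integral_cmult[symmetric]) (auto simp: mult.commute)
  also have "\<dots> \<le> ennreal (4*k) * (ennreal (40 * k) * sqi (square (2*k)) f)"
    by (intro mult_left_mono osc_sq_integral k) auto
  also have "\<dots> = ennreal (160 * k^2) * sqi (square (2*k)) f"
    using k by (subst mult.assoc[symmetric], subst ennreal_mult[symmetric]) (auto simp: power2_eq_square)
  finally show ?thesis .
qed

section \<open>Truncated stream functions\<close>

definition cut :: "real \<Rightarrow> real^2 \<Rightarrow> real" where
  "cut k p = plateau (p$1 / k) * plateau (p$2 / k)"

definition cut_grad :: "real \<Rightarrow> 2 \<Rightarrow> real^2 \<Rightarrow> real" where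
  "cut_grad k i = partial i (cut k)"

text \<open>The rotated gradient of \<open>cut k * P\<close>, where \<open>P\<close> is a stream function of \<open>\<phi>\<close>.\<close>

definition trunc :: "real \<Rightarrow> (real^2 \<Rightarrow> real) \<Rightarrow> (real^2 \<Rightarrow> real^2) \<Rightarrow> real^2 \<Rightarrow> real^2" where
  "trunc k P \<phi> p = pt (cut k p * \<phi> p $ 1 + P p * cut_grad k 2 p) (cut k p * \<phi> p $ 2 - P p * cut_grad k 1 p)"

lemma plateau_scaled:
  "smooth (\<lambda>p::real^2. plateau (p$1 / k))"
  "deriv (\<lambda>t. plateau (t / k)) = (\<lambda>t. deriv plateau (t / k) / k)"
  "deriv (deriv (\<lambda>t. plateau (t / k))) = (\<lambda>t. deriv (deriv plateau) (t / k) / k^2)"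
proof -
  show "smooth (\<lambda>p::real^2. plateau (p$1 / k))"
    using smooth_comp_affine(1)[OF smooth_plateau, of "1/k" 1 0] by simp
  have 0: "((\<lambda>t. h (t / k)) has_real_derivative deriv h (t / k) / k) (at t)"
    if "smooth (\<lambda>p::real^2. h (p$1))" for h t
    using DERIV_chain2[OF smooth_lift_partial(1)[OF that] DERIV_cdivide[OF DERIV_ident], of k t UNIV]
    by simp
  have 1: "deriv (\<lambda>t. h (t / k)) t = deriv h (t / k) / k" if "smooth (\<lambda>p::real^2. h (p$1))" for h t
    by (intro DERIV_imp_deriv 0 that)
  have s': "smooth (\<lambda>p::real^2. deriv plateau (p$1))" by (rule smooth_comp_affine(3)[OF smooth_plateau])
  show d1: "deriv (\<lambda>t. plateau (t / k)) = (\<lambda>t. deriv plateau (t / k) / k)"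
    using 1[OF smooth_plateau] by auto
  have "deriv (\<lambda>t. deriv plateau (t / k) / k) t = deriv (deriv plateau) (t / k) / k^2" for t
    using DERIV_cdivide[OF 0[OF s'], of k t] by (intro DERIV_imp_deriv) (simp add: power2_eq_square)
  then show "deriv (deriv (\<lambda>t. plateau (t / k))) = (\<lambda>t. deriv (deriv plateau) (t / k) / k^2)"
    unfolding d1 by auto
qed

lemma smooth_lift2:
  fixes h :: "real \<Rightarrow> real"
  assumes "smooth (\<lambda>p::real^2. h (p$1))" shows "smooth (\<lambda>p::real^2. h (p$i))"
  using smooth_comp_affine(1)[OF assms, of 1 i 0] by simp

lemma partial_lift_prod:
  fixes g h :: "real \<Rightarrow> real"
  assumes "smooth (\<lambda>p::real^2. g (p$1))" "smooth (\<lambda>p::real^2. h (p$1))"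
  shows "partial 1 (\<lambda>p::real^2. g (p$1) * h (p$2)) = (\<lambda>p. deriv g (p$1) * h (p$2))"
    "partial 2 (\<lambda>p::real^2. g (p$1) * h (p$2)) = (\<lambda>p. g (p$1) * deriv h (p$2))"
  using smooth_lift_partial(2)[OF assms(1)] smooth_lift_partial(2)[OF assms(2)]
  by (simp_all add: fun_eq_iff partial_mult smooth_differentiable smooth_lift2 assms)

lemma cut_smooth: "smooth (cut k)" "smooth (cut_grad k i)"
proof -
  show "smooth (cut k)"
    unfolding cut_def[abs_def] by (intro smooth_mult smooth_lift2[OF plateau_scaled(1)])
  then show "smooth (cut_grad k i)" unfolding cut_grad_def by (rule smooth_partial)
qed

lemma cut_derivs:
  "cut_grad k 1 p = deriv plateau (p$1/k) / k * plateau (p$2/k)"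
  "cut_grad k 2 p = plateau (p$1/k) * (deriv plateau (p$2/k) / k)"
  "partial 1 (cut_grad k 1) p = deriv (deriv plateau) (p$1/k) / k^2 * plateau (p$2/k)"
  "partial 2 (cut_grad k 1) p = deriv plateau (p$1/k) / k * (deriv plateau (p$2/k) / k)"
  "partial 1 (cut_grad k 2) p = deriv plateau (p$1/k) / k * (deriv plateau (p$2/k) / k)"
  "partial 2 (cut_grad k 2) p = plateau (p$1/k) * (deriv (deriv plateau) (p$2/k) / k^2)"
proof -
  note s = plateau_scaled(1)[of k] smooth_comp_affine(3)[OF plateau_scaled(1)[of k]]
  note d = plateau_scaled(2,3)[of k]
  have 1: "cut_grad k 1 = (\<lambda>p. deriv (\<lambda>t. plateau (t/k)) (p$1) * plateau (p$2/k))"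
    unfolding cut_grad_def cut_def[abs_def] using partial_lift_prod(1)[OF s(1) s(1)] .
  have 2: "cut_grad k 2 = (\<lambda>p. plateau (p$1/k) * deriv (\<lambda>t. plateau (t/k)) (p$2))"
    unfolding cut_grad_def cut_def[abs_def] using partial_lift_prod(2)[OF s(1) s(1)] .
  show "cut_grad k 1 p = deriv plateau (p$1/k) / k * plateau (p$2/k)"
    "cut_grad k 2 p = plateau (p$1/k) * (deriv plateau (p$2/k) / k)"
    unfolding 1 2 d by auto
  show "partial 1 (cut_grad k 1) p = deriv (deriv plateau) (p$1/k) / k^2 * plateau (p$2/k)"
    "partial 2 (cut_grad k 1) p = deriv plateau (p$1/k) / k * (deriv plateau (p$2/k) / k)"
    unfolding 1 partial_lift_prod[OF s(2) s(1)] unfolding d(2) unfolding d(1) by auto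
  show "partial 1 (cut_grad k 2) p = deriv plateau (p$1/k) / k * (deriv plateau (p$2/k) / k)"
    "partial 2 (cut_grad k 2) p = plateau (p$1/k) * (deriv (deriv plateau) (p$2/k) / k^2)"
    unfolding 2 partial_lift_prod[OF s(1) s(2)] unfolding d(2) unfolding d(1) by auto
qed

lemma cut_bounds: "0 \<le> cut k p" "cut k p \<le> 1"
  by (auto simp: cut_def plateau_bounds intro!: mult_le_one)

lemma cut_values:
  assumes "k > 0"
  shows "p \<in> square k \<Longrightarrow> cut k p = 1" "p \<notin> square (2*k) \<Longrightarrow> cut k p = 0"
proof -
  show "cut k p = 1" if "p \<in> square k"
    using that assms by (simp add: cut_def square_def plateau_1)
  show "cut k p = 0" if "p \<notin> square (2*k)"
  proof -
    from that have "\<bar>p$1/k\<bar> \<ge> 2 \<or> \<bar>p$2/k\<bar> \<ge> 2" using assms by (auto simp: square_def field_simps)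
    then show ?thesis using plateau_0 by (auto simp: cut_def)
  qed
qed

lemma scaled_bounds:
  assumes "k > 0"
  shows "\<bar>t\<bar> < k \<Longrightarrow> deriv plateau (t/k) = 0" "2*k < \<bar>t\<bar> \<Longrightarrow> deriv plateau (t/k) = 0"
    "\<bar>t\<bar> < k \<Longrightarrow> deriv (deriv plateau) (t/k) = 0" "2*k < \<bar>t\<bar> \<Longrightarrow> deriv (deriv plateau) (t/k) = 0"
    "2*k < \<bar>t\<bar> \<Longrightarrow> plateau (t/k) = 0"
  using assms by (auto intro!: deriv_plateau_0 plateau_0 simp: field_simps)

lemma cut_grad_support:
  assumes "k > 0"
  shows "cut_grad k 1 p \<noteq> 0 \<Longrightarrow> p \<in> square (2*k) \<and> k \<le> \<bar>p$1\<bar>"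
    "cut_grad k 2 p \<noteq> 0 \<Longrightarrow> p \<in> square (2*k) \<and> k \<le> \<bar>p$2\<bar>"
    "p \<notin> ring_region k \<Longrightarrow> cut_grad k i p = 0"
    "p \<notin> ring_region k \<Longrightarrow> partial i (cut_grad k j) p = 0"
proof -
  show 1: "p \<in> square (2*k) \<and> k \<le> \<bar>p$1\<bar>" if "cut_grad k 1 p \<noteq> 0"
    using that scaled_bounds[OF assms] unfolding cut_derivs square_def by (auto simp: not_less[symmetric])
  show 2: "p \<in> square (2*k) \<and> k \<le> \<bar>p$2\<bar>" if "cut_grad k 2 p \<noteq> 0"
    using that scaled_bounds[OF assms] unfolding cut_derivs square_def by (auto simp: not_less[symmetric])
  show "cut_grad k i p = 0" if "p \<notin> ring_region k"
    using 1 2 that exhaust_2[of i] unfolding ring_region_def by auto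
  have *: "(2*k < \<bar>p$1\<bar> \<or> 2*k < \<bar>p$2\<bar>) \<or> (\<bar>p$1\<bar> < k \<and> \<bar>p$2\<bar> < k)" if "p \<notin> ring_region k"
    using that by (auto simp: ring_region_def square_def)
  show "partial i (cut_grad k j) p = 0" if "p \<notin> ring_region k"
    using *[OF that] scaled_bounds[OF assms] exhaust_2[of i] exhaust_2[of j] by (auto simp: cut_derivs)
qed

text \<open>A common bound for two derivatives, chosen at least 1 so that its square dominates the
  second derivative as well as products of first derivatives.\<close>

definition plateau_const :: real where
  "plateau_const = (SOME C. C \<ge> 1 \<and> (\<forall>t. \<bar>deriv plateau t\<bar> \<le> C) \<and> (\<forall>t. \<bar>deriv (deriv plateau) t\<bar> \<le> C))"

lemma plateau_const: "plateau_const \<ge> 1" "\<bar>deriv plateau t\<bar> \<le> plateau_const" "\<bar>deriv (deriv plateau) t\<bar> \<le> plateau_const"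
proof -
  obtain C where C: "\<And>t. \<bar>deriv plateau t\<bar> \<le> C" "\<And>t. \<bar>deriv (deriv plateau) t\<bar> \<le> C"
    by (rule plateau_deriv_bounds) blast
  have "\<exists>C. C \<ge> 1 \<and> (\<forall>t. \<bar>deriv plateau t\<bar> \<le> C) \<and> (\<forall>t. \<bar>deriv (deriv plateau) t\<bar> \<le> C)"
    using C by (intro exI[of _ "max 1 C"]) (auto simp: le_max_iff_disj)
  from someI_ex[OF this, folded plateau_const_def]
  show "plateau_const \<ge> 1" "\<bar>deriv plateau t\<bar> \<le> plateau_const" "\<bar>deriv (deriv plateau) t\<bar> \<le> plateau_const" by auto
qed

lemma cut_grad_bounds:
  assumes k: "k > 0"
  shows "\<bar>cut_grad k i p\<bar> \<le> plateau_const / k" "\<bar>partial j (cut_grad k i) p\<bar> \<le> plateau_const^2 / k^2"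
proof -
  let ?C = plateau_const
  have C: "?C \<le> ?C^2" using plateau_const(1) by (simp add: power2_eq_square)
  have pl: "\<bar>plateau t\<bar> \<le> 1" for t using plateau_bounds[of t] by simp
  have d1: "\<bar>deriv plateau t / k\<bar> \<le> ?C / k" for t
    using plateau_const(2)[of t] k by (simp add: abs_divide divide_right_mono)
  have d2: "\<bar>deriv (deriv plateau) t / k^2\<bar> \<le> ?C^2 / k^2" for t
    using plateau_const(3)[of t] k C by (simp add: abs_divide divide_right_mono)
  have m: "\<bar>a * b\<bar> \<le> c" if "\<bar>a\<bar> \<le> c" "\<bar>b\<bar> \<le> 1" for a b c :: real
    using mult_mono[OF that] that by (auto simp: abs_mult)
  have m': "\<bar>b * a\<bar> \<le> c" if "\<bar>a\<bar> \<le> c" "\<bar>b\<bar> \<le> 1" for a b c :: real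
    using m[OF that] by (simp add: mult.commute)
  have mm: "\<bar>deriv plateau s / k * (deriv plateau t / k)\<bar> \<le> ?C^2 / k^2" for s t
    using mult_mono[OF d1[of s] d1[of t]] k plateau_const(1) by (simp add: abs_mult power2_eq_square)
  show "\<bar>cut_grad k i p\<bar> \<le> plateau_const / k"
    using exhaust_2[of i] m[OF d1 pl] m'[OF d1 pl] by (auto simp: cut_derivs)
  show "\<bar>partial j (cut_grad k i) p\<bar> \<le> plateau_const^2 / k^2"
    using exhaust_2[of i] exhaust_2[of j] m[OF d2 pl] m'[OF d2 pl] mm by (auto simp: cut_derivs)
qed

text \<open>In the divergence, the terms with the derivatives of P cancel against grad(cut) .
  \<phi>, and the terms with P cancel because the mixed derivatives of the cut-off coincide.\<close>

lemma trunc_solenoidal: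
  assumes \<phi>: "\<phi> \<in> solenoidal_test_functions \<Omega>" and k: "k > 0" and \<Omega>: "- \<Omega> \<subseteq> {p. \<bar>p$1\<bar> < k \<and> \<bar>p$2\<bar> < k}"
    and P: "smooth P" "\<And>p. partial 1 P p = - (\<phi> p $ 2)" "\<And>p. partial 2 P p = \<phi> p $ 1"
  shows "trunc k P \<phi> \<in> solenoidal_test_functions \<Omega>"
    and "partial i (\<lambda>p. trunc k P \<phi> p $ 1) p = cut k p * partial i (\<lambda>p. \<phi> p $ 1) p + cut_grad k i p * \<phi> p $ 1
       + partial i P p * cut_grad k 2 p + P p * partial i (cut_grad k 2) p"
    and "partial i (\<lambda>p. trunc k P \<phi> p $ 2) p = cut k p * partial i (\<lambda>p. \<phi> p $ 2) p + cut_grad k i p * \<phi> p $ 2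
       - partial i P p * cut_grad k 1 p - P p * partial i (cut_grad k 1) p"
proof -
  have t: "\<phi> \<in> test_functions \<Omega>" and div: "\<And>x. partial 1 (\<lambda>y. \<phi> y $ 1) x + partial 2 (\<lambda>y. \<phi> y $ 2) x = 0"
    using \<phi> by (auto simp: solenoidal_test_functions_def sum_2)
  note sm\<phi> = smooth_nth[OF test_functionsD(1)[OF t]]
  note sm = sm\<phi>[of 1] sm\<phi>[of 2] P(1) cut_smooth(1)[of k] cut_smooth(2)[of k 1] cut_smooth(2)[of k 2]
  note sd = sm[THEN smooth_differentiable]
  show p1: "partial i (\<lambda>p. trunc k P \<phi> p $ 1) p = cut k p * partial i (\<lambda>p. \<phi> p $ 1) p + cut_grad k i p * \<phi> p $ 1
       + partial i P p * cut_grad k 2 p + P p * partial i (cut_grad k 2) p" for i p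
    by (simp add: trunc_def partial_add partial_mult sd cut_grad_def[symmetric] algebra_simps derivative_intros)
  show p2: "partial i (\<lambda>p. trunc k P \<phi> p $ 2) p = cut k p * partial i (\<lambda>p. \<phi> p $ 2) p + cut_grad k i p * \<phi> p $ 2
       - partial i P p * cut_grad k 1 p - P p * partial i (cut_grad k 1) p" for i p
    by (simp add: trunc_def partial_diff partial_mult sd cut_grad_def[symmetric] algebra_simps derivative_intros)
  have divT: "partial 1 (\<lambda>p. trunc k P \<phi> p $ 1) x + partial 2 (\<lambda>p. trunc k P \<phi> p $ 2) x = 0" for x
  proof -
    have "partial 2 (\<lambda>y. \<phi> y $ 2) x = - partial 1 (\<lambda>y. \<phi> y $ 1) x" using div[of x] by linarith
    then show ?thesis unfolding p1 p2 P(2,3) by (simp add: cut_derivs(4,5) algebra_simps)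
  qed
  \<comment> \<open>The truncation need not vanish where \<phi> does: in the ring P may be a nonzero
    constant. The ring is nevertheless contained in \<Omega>, as the complement of \<Omega> lies in
    the open square of half side k.\<close>
  let ?K = "closure {x. \<phi> x \<noteq> 0} \<union> (square (2*k) \<inter> {p. k \<le> \<bar>p$1\<bar> \<or> k \<le> \<bar>p$2\<bar>})"
  have "trunc k P \<phi> \<in> test_functions \<Omega>"
  proof (rule test_functionsI[where K="?K"])
    show "smooth (trunc k P \<phi>)"
      unfolding trunc_def[abs_def] using sm by (intro smooth_pt smooth_add smooth_diff smooth_mult)
    have "closed {p::real^2. k \<le> \<bar>p$1\<bar> \<or> k \<le> \<bar>p$2\<bar>}"
      by (intro closed_Collect_disj closed_Collect_le continuous_intros)
    then show "closed ?K" using compact_imp_closed[OF compact_square] by (intro closed_Un closed_Int closed_closure)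
    show "bounded ?K"
      using compact_imp_bounded[OF test_functionsD(2)[OF t]] compact_imp_bounded[OF compact_square]
      by (intro bounded_Un[THEN iffD2] conjI bounded_Int) auto
    have "{p. k \<le> \<bar>p$1\<bar> \<or> k \<le> \<bar>p$2\<bar>} \<subseteq> \<Omega>" using \<Omega> by force
    then show "?K \<subseteq> \<Omega>" using t by (auto simp: test_functions_def)
    fix p assume p: "p \<notin> ?K"
    then have "\<phi> p = 0" using zero_off_support[of p \<phi>] by auto
    moreover have "cut_grad k i p = 0" for i
      using p cut_grad_support(3)[OF k, of p i] by (auto simp: ring_region_def)
    ultimately show "trunc k P \<phi> p = 0" by (simp add: trunc_def vec_eq_iff forall_2)
  qed
  then show "trunc k P \<phi> \<in> solenoidal_test_functions \<Omega>"
    using divT by (simp add: solenoidal_test_functions_def sum_2)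
qed

lemma norm_matrix_le: "norm (A::real^2^2) \<le> \<bar>A$1$1\<bar> + \<bar>A$1$2\<bar> + \<bar>A$2$1\<bar> + \<bar>A$2$2\<bar>"
proof -
  have "norm A \<le> (\<Sum>i\<in>UNIV. norm (A$i))" unfolding norm_vec_def by (rule L2_set_le_sum) auto
  also have "\<dots> \<le> (\<Sum>i\<in>UNIV. \<Sum>j\<in>UNIV. \<bar>A$i$j\<bar>)" by (intro sum_mono norm_le_l1_cart)
  finally show ?thesis by (simp add: sum_2)
qed

lemma grad_nth: "grad \<phi> x $ i $ j = partial i (\<lambda>y. \<phi> y $ j) x"
  by (simp add: grad_def)

lemma matrix_nth_le: "\<bar>A$i$j\<bar> \<le> norm (A::real^2^2)"
  by (metis Finite_Cartesian_Product.norm_nth_le order_trans real_norm_def)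

text \<open>Each entry of the difference is at most m = a + 2 (C/k) b + (C^2/k^2) c, where a, b, c
  are the localised sizes of grad \<phi>, \<phi>, P. Four entries give the norm bound 4m, and the
  square of three summands costs a factor 3: 16 * 3 = 48, and 48 * 4 = 192 for the doubled middle
  term.\<close>

lemma trunc_grad_pointwise:
  assumes \<phi>: "\<phi> \<in> solenoidal_test_functions \<Omega>" and k: "k > 0" and \<Omega>: "- \<Omega> \<subseteq> {p. \<bar>p$1\<bar> < k \<and> \<bar>p$2\<bar> < k}"
    and P: "smooth P" "\<And>p. partial 1 P p = - (\<phi> p $ 2)" "\<And>p. partial 2 P p = \<phi> p $ 1"
  shows "(norm (grad (trunc k P \<phi>) p - grad \<phi> p))^2 \<le> 48 * (indicator (- square k) p * (norm (grad \<phi> p))^2)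
     + 192 * plateau_const^2 * (1/k^2) * (indicator (square (2*k)) p * (norm (\<phi> p))^2)
     + 48 * plateau_const ^ 4 * (1/k^4) * (indicator (square (2*k)) p * (P p)^2)"
proof -
  let ?C = plateau_const
  define a where "a = indicator (- square k) p * norm (grad \<phi> p)"
  define b where "b = indicator (square (2*k)) p * norm (\<phi> p)"
  define c where "c = indicator (square (2*k)) p * \<bar>P p\<bar>"
  note tr = trunc_solenoidal(2,3)[OF \<phi> k \<Omega> P]
  have cut: "\<bar>(cut k p - 1) * x\<bar> \<le> a" if "\<bar>x\<bar> \<le> norm (grad \<phi> p)" for x
  proof (cases "p \<in> square k")
    case True then show ?thesis using cut_values(1)[OF k] by (simp add: a_def)
  next
    case False
    have "\<bar>cut k p - 1\<bar> * \<bar>x\<bar> \<le> 1 * norm (grad \<phi> p)"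
      using cut_bounds[of k p] that by (intro mult_mono) auto
    then show ?thesis using False by (simp add: a_def abs_mult)
  qed
  have cg: "\<bar>cut_grad k i p * x\<bar> \<le> ?C / k * b" if "\<bar>x\<bar> \<le> norm (\<phi> p)" for i x
  proof (cases "p \<in> square (2*k)")
    case False then show ?thesis using cut_grad_support(3)[OF k, of p i] by (auto simp: ring_region_def b_def)
  next
    case True
    then show ?thesis using mult_mono[OF cut_grad_bounds(1)[OF k, of i p] that] k plateau_const(1) by (auto simp: b_def abs_mult)
  qed
  have cg2: "\<bar>P p * partial i (cut_grad k j) p\<bar> \<le> ?C^2 / k^2 * c" for i j
  proof (cases "p \<in> square (2*k)")
    case False then show ?thesis using cut_grad_support(4)[OF k, of p i j] by (auto simp: ring_region_def c_def)
  next
    case True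
    then show ?thesis using mult_mono[OF cut_grad_bounds(2)[OF k, of i j p] order_refl[of "\<bar>P p\<bar>"]] by (auto simp: c_def abs_mult mult.commute)
  qed
  have comp: "\<bar>\<phi> p $ i\<bar> \<le> norm (\<phi> p)" for i by (rule component_le_norm_cart)
  have dP: "\<bar>partial i P p\<bar> \<le> norm (\<phi> p)" for i
    using exhaust_2[of i] comp by (auto simp: P(2,3))
  have ent: "\<bar>grad (trunc k P \<phi>) p $ i $ j - grad \<phi> p $ i $ j\<bar> \<le> a + 2 * (?C / k * b) + ?C^2/k^2 * c" for i j
  proof -
    have g: "\<bar>partial i (\<lambda>y. \<phi> y $ j) p\<bar> \<le> norm (grad \<phi> p)" for i j
      using matrix_nth_le[of "grad \<phi> p" i j] by (simp add: grad_nth)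
    consider "j = 1" | "j = 2" using exhaust_2 by blast
    then show ?thesis
    proof cases
      case 1
      have "grad (trunc k P \<phi>) p $ i $ j - grad \<phi> p $ i $ j = (cut k p - 1) * partial i (\<lambda>p. \<phi> p $ 1) p
         + cut_grad k i p * \<phi> p $ 1 + cut_grad k 2 p * partial i P p + P p * partial i (cut_grad k 2) p"
        by (simp add: 1 grad_nth tr algebra_simps)
      then show ?thesis
        using cut[OF g[of i 1]] cg[OF comp[of 1], of i] cg[OF dP[of i], of 2] cg2[of i 2] by linarith
    next
      case 2
      have "grad (trunc k P \<phi>) p $ i $ j - grad \<phi> p $ i $ j = (cut k p - 1) * partial i (\<lambda>p. \<phi> p $ 2) p
         + cut_grad k i p * \<phi> p $ 2 - cut_grad k 1 p * partial i P p - P p * partial i (cut_grad k 1) p"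
        by (simp add: 2 grad_nth tr algebra_simps)
      then show ?thesis
        using cut[OF g[of i 2]] cg[OF comp[of 2], of i] cg[OF dP[of i], of 1] cg2[of i 1] by linarith
    qed
  qed
  define m where "m = a + 2 * (?C / k * b) + ?C^2/k^2 * c"
  have "norm (grad (trunc k P \<phi>) p - grad \<phi> p) \<le> 4 * m"
    using norm_matrix_le[of "grad (trunc k P \<phi>) p - grad \<phi> p"] ent[folded m_def] by (smt (verit) vector_minus_component)
  then have "(norm (grad (trunc k P \<phi>) p - grad \<phi> p))^2 \<le> (4 * m)^2" by (intro power_mono) auto
  also have "(4 * m)^2 = 16 * m^2" by (simp add: power_mult_distrib)
  also have "m^2 \<le> 3 * (a^2 + (2 * (?C / k * b))^2 + (?C^2/k^2 * c)^2)"
  proof -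
    have "(x + y + z)^2 \<le> 3 * (x^2 + y^2 + z^2)" for x y z :: real
      using zero_le_power2[of "x - y"] zero_le_power2[of "y - z"] zero_le_power2[of "x - z"]
      by (simp add: power2_eq_square algebra_simps)
    then show ?thesis unfolding m_def by blast
  qed
  finally have "(norm (grad (trunc k P \<phi>) p - grad \<phi> p))^2 \<le> 48 * (a^2 + (2 * (?C / k * b))^2 + (?C^2/k^2 * c)^2)" by simp
  also have "\<dots> = 48 * a^2 + 192 * ?C^2 * (1/k^2) * b^2 + 48 * ?C^4 * (1/k^4) * c^2"
    by (simp add: power_mult_distrib power_divide algebra_simps)
  finally have "(norm (grad (trunc k P \<phi>) p - grad \<phi> p))^2 \<le> 48 * a^2 + 192 * ?C^2 * (1/k^2) * b^2 + 48 * ?C^4 * (1/k^4) * c^2" .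
  then show ?thesis
  proof -
    assume *: "(norm (grad (trunc k P \<phi>) p - grad \<phi> p))^2 \<le> 48 * a^2 + 192 * ?C^2 * (1/k^2) * b^2 + 48 * ?C^4 * (1/k^4) * c^2"
    have i: "(indicator A p * x)^2 = indicator A p * x^2" for A and x :: real
      by (simp add: indicator_def)
    show ?thesis using * unfolding a_def b_def c_def i power2_abs .
  qed
qed

text \<open>The first two coefficients are those of the pointwise bound; 7680 = 48 * 160, where 160
  is the constant by which P is estimated through its velocity.\<close>

definition trunc_const :: real where
  "trunc_const = 48 + 192 * plateau_const^2 + 7680 * plateau_const ^ 4"

lemma grad_measurable:
  assumes "\<phi> \<in> test_functions \<Omega>" shows "borel_fun (grad \<phi>)"
proof -
  have "borel_fun (\<lambda>x. grad \<phi> x $ i $ j)" for i j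
    unfolding grad_nth by (intro smooth_measurable smooth_partial smooth_nth test_functionsD[OF assms])
  then show ?thesis
    by (subst borel_measurable_euclidean_space) (auto simp: Basis_vec_def inner_axis axis_def[symmetric])
qed

text \<open>The Poincare inequality \<open>sqi_osc\<close> gives the term with P the same form as
  the term with \<phi>. What is left is a tail of the Dirichlet integral and k^-2 times the integral
  of |\<phi>|^2, both of which become small for a limit field satisfying Hardy's inequality.\<close>

lemma trunc_grad_estimate:
  assumes \<phi>: "\<phi> \<in> solenoidal_test_functions \<Omega>" and k: "k > 0" and \<Omega>: "- \<Omega> \<subseteq> {p. \<bar>p$1\<bar> < k \<and> \<bar>p$2\<bar> < k}"
    and P: "smooth P" "\<And>p. partial 1 P p = - (\<phi> p $ 2)" "\<And>p. partial 2 P p = \<phi> p $ 1"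
    and osc: "\<And>p. p \<in> square (2*k) \<Longrightarrow> ennreal \<bar>P p\<bar> \<le> osc k \<phi> (p$2)"
  shows "sqi UNIV (\<lambda>p. grad (trunc k P \<phi>) p - grad \<phi> p)
    \<le> ennreal trunc_const * (sqi (- square k) (grad \<phi>) + ennreal (1/k^2) * sqi (square (2*k)) \<phi>)"
proof -
  let ?C = plateau_const
  have t: "\<phi> \<in> test_functions \<Omega>" using \<phi> by (auto simp: solenoidal_test_functions_def)
  have [measurable]: "borel_fun (grad \<phi>)" "borel_fun \<phi>" "borel_fun P"
    using grad_measurable[OF t] test_functions_measurable[OF t] smooth_measurable[OF P(1)] by auto
  have C: "?C \<ge> 1" by (rule plateau_const)
  have "sqi UNIV (\<lambda>p. grad (trunc k P \<phi>) p - grad \<phi> p) \<le>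
    (NNINT p. ennreal 48 * (ennreal ((norm (grad \<phi> p))^2) * indicator (- square k) p)
     + ennreal (192 * ?C^2 * (1/k^2)) * (ennreal ((norm (\<phi> p))^2) * indicator (square (2*k)) p)
     + ennreal (48 * ?C ^ 4 * (1/k^4)) * (ennreal ((norm (P p))^2) * indicator (square (2*k)) p))"
    unfolding sqi_def
  proof (intro nn_integral_mono)
    fix p :: "real^2"
    have ind: "ennreal x * indicator A p = ennreal (indicator A p * x)" for x A by (simp add: indicator_def)
    show "ennreal ((norm (grad (trunc k P \<phi>) p - grad \<phi> p))^2) * indicator UNIV p \<le>
       ennreal 48 * (ennreal ((norm (grad \<phi> p))^2) * indicator (- square k) p)
     + ennreal (192 * ?C^2 * (1/k^2)) * (ennreal ((norm (\<phi> p))^2) * indicator (square (2*k)) p)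
     + ennreal (48 * ?C ^ 4 * (1/k^4)) * (ennreal ((norm (P p))^2) * indicator (square (2*k)) p)"
    proof -
      have "ennreal ((norm (grad (trunc k P \<phi>) p - grad \<phi> p))^2) \<le> ennreal (48 * (indicator (- square k) p * (norm (grad \<phi> p))^2))
        + ennreal (192 * plateau_const^2 * (1/k^2) * (indicator (square (2*k)) p * (norm (\<phi> p))^2))
        + ennreal (48 * plateau_const ^ 4 * (1/k^4) * (indicator (square (2*k)) p * (norm (P p))^2))"
        using ennreal_leI[OF trunc_grad_pointwise[OF \<phi> k \<Omega> P, of p]] by (simp add: ennreal_plus)
      then show ?thesis
        unfolding ind by (subst (1 2 3) ennreal_mult[symmetric]) auto
    qed
  qed
  also have "\<dots> = ennreal 48 * sqi (- square k) (grad \<phi>) + ennreal (192 * ?C^2 * (1/k^2)) * sqi (square (2*k)) \<phi>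
     + ennreal (48 * ?C ^ 4 * (1/k^4)) * sqi (square (2*k)) P"
    unfolding sqi_def by (simp add: nn_integral_add nn_integral_cmult)
  also have "\<dots> \<le> ennreal 48 * sqi (- square k) (grad \<phi>) + ennreal (192 * ?C^2 * (1/k^2)) * sqi (square (2*k)) \<phi>
     + ennreal (48 * ?C ^ 4 * (1/k^4)) * (ennreal (160 * k^2) * sqi (square (2*k)) \<phi>)"
    by (intro add_mono order_refl mult_left_mono sqi_osc k osc) auto
  also have "ennreal (48 * ?C ^ 4 * (1/k^4)) * (ennreal (160 * k^2) * sqi (square (2*k)) \<phi>)
    = ennreal (7680 * ?C ^ 4) * (ennreal (1/k^2) * sqi (square (2*k)) \<phi>)"
    using k C by (subst (1 2) mult.assoc[symmetric], subst (1 2) ennreal_mult[symmetric]) (auto simp: power2_eq_square power4_eq_xxxx mult.assoc)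
  also have "ennreal (192 * ?C^2 * (1/k^2)) * sqi (square (2*k)) \<phi> = ennreal (192 * ?C^2) * (ennreal (1/k^2) * sqi (square (2*k)) \<phi>)"
    by (subst mult.assoc[symmetric], subst ennreal_mult[symmetric]) auto
  also have "ennreal 48 * sqi (- square k) (grad \<phi>) + ennreal (192 * ?C^2) * (ennreal (1/k^2) * sqi (square (2*k)) \<phi>) + ennreal (7680 * ?C ^ 4) * (ennreal (1/k^2) * sqi (square (2*k)) \<phi>)
     \<le> ennreal trunc_const * sqi (- square k) (grad \<phi>) + ennreal trunc_const * (ennreal (1/k^2) * sqi (square (2*k)) \<phi>)"
  proof -
    have "ennreal (192 * ?C^2) + ennreal (7680 * ?C ^ 4) \<le> ennreal trunc_const"
      by (subst ennreal_plus[symmetric]) (auto simp: trunc_const_def intro!: ennreal_leI simp del: ennreal_plus)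
    moreover have "ennreal 48 \<le> ennreal trunc_const" by (intro ennreal_leI) (auto simp: trunc_const_def)
    ultimately show ?thesis
      unfolding add.assoc distrib_right[symmetric] by (intro add_mono mult_right_mono) auto
  qed
  finally show ?thesis by (simp add: distrib_left)
qed

section \<open>Limits of solenoidal test functions\<close>

text \<open>\<open>z\<close> and \<open>A\<close> are Borel representatives on the whole plane of an element of \<open>H1 \<Omega>\<close> and its gradient.\<close>

definition appr :: "(real^2) set \<Rightarrow> (real^2 \<Rightarrow> real^2) \<Rightarrow> (real^2 \<Rightarrow> real^2^2) \<Rightarrow> (nat \<Rightarrow> real^2 \<Rightarrow> real^2) \<Rightarrow> bool" where
  "appr \<Omega> z A \<phi> \<longleftrightarrow> borel_fun z \<and> borel_fun A \<and>
    (\<forall>n. \<phi> n \<in> solenoidal_test_functions \<Omega>) \<and>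
    (\<forall>r. (\<lambda>n. sqi (square r) (\<lambda>p. \<phi> n p - z p)) \<longlonglongrightarrow> 0) \<and>
    (\<lambda>n. sqi UNIV (\<lambda>p. grad (\<phi> n) p - A p)) \<longlonglongrightarrow> 0"

lemma solenoidal_test: "\<phi> \<in> solenoidal_test_functions \<Omega> \<Longrightarrow> \<phi> \<in> test_functions \<Omega>"
  by (simp add: solenoidal_test_functions_def)

lemma grad_supported:
  assumes "\<phi> \<in> test_functions \<Omega>" "p \<notin> closure {x. \<phi> x \<noteq> 0}"
  shows "grad \<phi> p = 0"
proof -
  have "partial i (\<lambda>y. \<phi> y $ j) p = 0" for i j
  proof -
    have "closure {x. \<phi> x $ j \<noteq> 0} \<subseteq> closure {x. \<phi> x \<noteq> 0}" by (intro closure_mono) auto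
    moreover have "closure {x. partial i (\<lambda>y. \<phi> y $ j) x \<noteq> 0} \<subseteq> closure {x. \<phi> x $ j \<noteq> 0}"
    proof (intro closure_minimal closed_closure subsetI)
      fix x assume "x \<in> {x. partial i (\<lambda>y. \<phi> y $ j) x \<noteq> 0}"
      show "x \<in> closure {x. \<phi> x $ j \<noteq> 0}"
      proof (rule ccontr)
        assume x: "x \<notin> closure {x. \<phi> x $ j \<noteq> 0}"
        have "((\<lambda>x. \<phi> x $ j) has_derivative (\<lambda>_. 0)) (at x)"
        proof (rule has_derivative_transform_within_open[of "\<lambda>_. 0"])
          show "open (- closure {x. \<phi> x $ j \<noteq> 0})" by (intro open_Compl closed_closure)
          show "x \<in> - closure {x. \<phi> x $ j \<noteq> 0}" using x by simp
          fix y assume "y \<in> - closure {x. \<phi> x $ j \<noteq> 0}"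
          then show "0 = \<phi> y $ j" using zero_off_support[of y "\<lambda>x. \<phi> x $ j"] by simp
        qed simp
        from partialI[OF this] \<open>x \<in> {x. partial i (\<lambda>y. \<phi> y $ j) x \<noteq> 0}\<close> show False by simp
      qed
    qed
    ultimately show ?thesis using assms(2) zero_off_support[of p "partial i (\<lambda>y. \<phi> y $ j)"] by blast
  qed
  then show ?thesis by (simp add: vec_eq_iff grad_nth)
qed

lemma grad_finite:
  assumes "\<phi> \<in> test_functions \<Omega>" shows "sqi S (grad \<phi>) < top"
proof -
  obtain r where r: "r > 0" "\<And>x. x \<notin> square r \<Longrightarrow> \<phi> x = 0"
    using compact_support_square test_functionsD(2)[OF assms] by blast
  have "closure {x. \<phi> x \<noteq> 0} \<subseteq> square r"
    using r(2) compact_imp_closed[OF compact_square] by (intro closure_minimal) auto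
  then have z: "grad \<phi> x = 0" if "x \<notin> square r" for x
    using that grad_supported[OF assms] by blast
  have "\<exists>M. \<forall>x. \<bar>grad \<phi> x $ i $ j\<bar> \<le> M" for i j
    by (rule test_functions_bounded[OF test_functions_partial[OF test_functions_nth[OF assms, of j], of i]])
       (auto simp: grad_nth)
  then have "\<forall>i j. \<exists>M. \<forall>x. \<bar>grad \<phi> x $ i $ j\<bar> \<le> M" by blast
  then obtain M where M: "\<And>x i j. \<bar>grad \<phi> x $ i $ j\<bar> \<le> M i j" unfolding choice_iff by blast
  have "norm (grad \<phi> x) \<le> M 1 1 + M 1 2 + M 2 1 + M 2 2" for x
    using norm_matrix_le[of "grad \<phi> x"] M[of x 1 1] M[of x 1 2] M[of x 2 1] M[of x 2 2] by linarith
  note b = sqi_finite_bounded[OF this, of r]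
  have "sqi S (grad \<phi>) \<le> sqi UNIV (grad \<phi>)" by (rule sqi_mono_set) auto
  also have "\<dots> = sqi (square r) (grad \<phi>)" by (rule sqi_supported[OF z])
  finally show ?thesis using b by (rule le_less_trans)
qed

lemma apprD:
  assumes "appr \<Omega> z A \<phi>"
  shows "borel_fun z" "borel_fun A" "\<phi> n \<in> solenoidal_test_functions \<Omega>"
    "\<phi> n \<in> test_functions \<Omega>" "borel_fun (\<phi> n)" "borel_fun (grad (\<phi> n))"
    "(\<lambda>n. sqi (square r) (\<lambda>p. \<phi> n p - z p)) \<longlonglongrightarrow> 0"
    "(\<lambda>n. sqi UNIV (\<lambda>p. grad (\<phi> n) p - A p)) \<longlonglongrightarrow> 0"
    "sqi (square r) z < top" "sqi UNIV A < top"
proof -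
  show 1: "borel_fun z" "borel_fun A" "\<phi> n \<in> solenoidal_test_functions \<Omega>" for n
    using assms by (auto simp: appr_def)
  show 2: "\<phi> n \<in> test_functions \<Omega>" for n using solenoidal_test[OF 1(3)] .
  show 3: "borel_fun (\<phi> n)" "borel_fun (grad (\<phi> n))" for n
    using test_functions_measurable[OF 2] grad_measurable[OF 2] by auto
  show 4: "(\<lambda>n. sqi (square r) (\<lambda>p. \<phi> n p - z p)) \<longlonglongrightarrow> 0"
    "(\<lambda>n. sqi UNIV (\<lambda>p. grad (\<phi> n) p - A p)) \<longlonglongrightarrow> 0"
    using assms by (auto simp: appr_def)
  show "sqi (square r) z < top"
    by (rule sqi_bdd_of_tendsto[OF 3(1) 1(1) square_borel sqi_test_finite[OF 2] 4(1)])
  show "sqi UNIV A < top"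
    by (rule sqi_bdd_of_tendsto[OF 3(2) 1(2) _ grad_finite[OF 2] 4(2)]) auto
qed

section \<open>Integration against weights depending on one coordinate\<close>

lemma segment_sup:
  fixes h :: "real \<Rightarrow> real"
  assumes l: "l > 0" and h: "\<And>x. (h has_vector_derivative h' x) (at x)" and c: "continuous_on UNIV h'"
    and x: "x \<in> {-l..l}"
  shows "ennreal ((h x)^2) \<le> NNset {-l..l} (\<lambda>t. ennreal (1/(2*l) + 1) * ennreal ((h t)^2) + ennreal ((h' t)^2))"
proof -
  have ch: "continuous_on UNIV h"
    using h by (metis continuous_at_imp_continuous_on has_vector_derivative_continuous)
  have [measurable]: "borel_fun h" "borel_fun h'"
    using ch c by (auto intro: borel_measurable_continuous_onI)
  define J where "J = NNset {-l..l} (\<lambda>t. ennreal ((h t)^2) + ennreal ((h' t)^2))"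
  \<comment> \<open>The derivative 2 h h' of h^2 is at most h^2 + h'^2. Averaging over y afterwards
    removes the value at the reference point.\<close>
  have inc: "ennreal ((h x)^2) \<le> ennreal ((h y)^2) + J" if y: "y \<in> {-l..l}" for y
  proof -
    have "((\<lambda>x. (h x)^2) has_vector_derivative (2 * h x * h' x)) (at x)" for x
      using h[of x] by (auto simp flip: has_real_derivative_iff_has_vector_derivative intro!: derivative_eq_intros)
    moreover have "continuous_on UNIV (\<lambda>x. 2 * h x * h' x)" using c ch by (intro continuous_intros)
    ultimately have "ennreal \<bar>(h x)^2 - (h y)^2\<bar> \<le> NNset {-l..l} (\<lambda>t. ennreal \<bar>2 * h t * h' t\<bar>)"
      using x y by (rule increment_bound)
    also have "\<dots> \<le> J" unfolding J_def
    proof (intro nn_integral_mono mult_right_mono)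
      fix t
      have "\<bar>2 * h t * h' t\<bar> \<le> (h t)^2 + (h' t)^2"
        using zero_le_power2[of "\<bar>h t\<bar> - \<bar>h' t\<bar>"] by (simp add: power2_diff abs_mult)
      then show "ennreal \<bar>2 * h t * h' t\<bar> \<le> ennreal ((h t)^2) + ennreal ((h' t)^2)"
        by (subst ennreal_plus[symmetric]) (auto intro!: ennreal_leI simp del: ennreal_plus)
    qed auto
    finally have 1: "ennreal \<bar>(h x)^2 - (h y)^2\<bar> \<le> J" .
    have "ennreal ((h x)^2) \<le> ennreal ((h y)^2 + \<bar>(h x)^2 - (h y)^2\<bar>)" by (intro ennreal_leI) linarith
    also have "\<dots> = ennreal ((h y)^2) + ennreal \<bar>(h x)^2 - (h y)^2\<bar>" by simp
    also have "\<dots> \<le> ennreal ((h y)^2) + J" by (intro add_mono 1) auto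
    finally show ?thesis .
  qed
  have e: "emeasure lborel {-l..l} = ennreal (2*l)" using l by simp
  have "ennreal ((h x)^2) * ennreal (2*l) = NNset {-l..l} (\<lambda>y. ennreal ((h x)^2))"
    by (subst nn_integral_cmult_indicator) (auto simp: e)
  also have "\<dots> \<le> (NNINT y. ennreal ((h y)^2) * indicator {-l..l} y + J * indicator {-l..l} y)"
    using inc by (intro nn_integral_mono) (auto simp: indicator_def)
  also have "\<dots> = NNset {-l..l} (\<lambda>y. ennreal ((h y)^2)) + J * ennreal (2*l)"
    by (subst nn_integral_add) (auto simp: nn_integral_cmult_indicator e)
  finally have *: "ennreal ((h x)^2) * ennreal (2*l) \<le> NNset {-l..l} (\<lambda>y. ennreal ((h y)^2)) + J * ennreal (2*l)" .
  have 1: "ennreal (1/(2*l)) * ennreal (2*l) = 1"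
    using l by (subst ennreal_mult[symmetric]) auto
  have "ennreal ((h x)^2) = ennreal (1/(2*l)) * (ennreal ((h x)^2) * ennreal (2*l))"
    by (metis "1" mult.commute mult.left_commute mult_1)
  also have "\<dots> \<le> ennreal (1/(2*l)) * ((NNset {-l..l} (\<lambda>y. ennreal ((h y)^2))) + J * ennreal (2*l))"
    by (intro mult_left_mono *) auto
  also have "\<dots> = ennreal (1/(2*l)) * NNset {-l..l} (\<lambda>y. ennreal ((h y)^2)) + J"
    using 1 by (simp only: distrib_left mult.left_commute[of _ J]) simp
  also have "\<dots> = (NNINT t. (ennreal (1/(2*l)) * ennreal ((h t)^2)) * indicator {-l..l} t + (ennreal ((h t)^2) + ennreal ((h' t)^2)) * indicator {-l..l} t)"
    unfolding J_def by (subst nn_integral_add) (auto simp: nn_integral_cmult[symmetric] mult.assoc)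
  also have "\<dots> = NNset {-l..l} (\<lambda>t. ennreal (1/(2*l) + 1) * ennreal ((h t)^2) + ennreal ((h' t)^2))"
    using l by (intro nn_integral_cong) (simp add: distrib_right ennreal_plus add.assoc)
  finally show ?thesis .
qed

text \<open>A finite Dirichlet integral does not bound a function in the plane pointwise. It does
  bound the supremum along lines, integrated over the parallel lines, so the square may be
  integrated against any integrable weight of the coordinate that runs along those lines.\<close>

lemma smooth_weight_bound:
  fixes \<alpha> :: "real^2 \<Rightarrow> real" and m :: "real \<Rightarrow> ennreal"
  assumes l: "l > 0" and \<alpha>: "smooth \<alpha>" and [measurable]: "borel_fun m"
  shows "NNset (square l) (\<lambda>p. m (p$2) * ennreal ((\<alpha> p)^2))
     \<le> (ennreal (1/(2*l) + 1) * sqi (square l) \<alpha> + sqi (square l) (partial 2 \<alpha>)) * NNset {-l..l} m"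
    and "NNset (square l) (\<lambda>p. m (p$1) * ennreal ((\<alpha> p)^2))
     \<le> (ennreal (1/(2*l) + 1) * sqi (square l) \<alpha> + sqi (square l) (partial 1 \<alpha>)) * NNset {-l..l} m"
proof -
  note [measurable] = smooth_measurable[OF \<alpha>] smooth_measurable[OF smooth_partial[OF \<alpha>]]
  note D = has_derivative_pt[OF smooth_differentiable[OF \<alpha>]]
  note C = smooth_continuous[OF smooth_partial[OF \<alpha>]]
  let ?c = "ennreal (1/(2*l) + 1)"
  have ind: "indicator (square l) (pt x y) = (indicator {-l..l} x * indicator {-l..l} y :: ennreal)" for x y
    by (auto simp: indicator_def square_def abs_le_iff)
  have fin: "NNset (square l) (\<lambda>p. ?c * ennreal ((\<alpha> p)^2) + ennreal ((partial i \<alpha> p)^2))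
     = ?c * sqi (square l) \<alpha> + sqi (square l) (partial i \<alpha>)" for i
    unfolding sqi_def by (simp add: distrib_right nn_integral_add nn_integral_cmult mult.assoc)
  show "NNset (square l) (\<lambda>p. m (p$2) * ennreal ((\<alpha> p)^2))
     \<le> (?c * sqi (square l) \<alpha> + sqi (square l) (partial 2 \<alpha>)) * NNset {-l..l} m"
  proof -
    define J where "J x = NNset {-l..l} (\<lambda>t. ?c * ennreal ((\<alpha> (pt x t))^2) + ennreal ((partial 2 \<alpha> (pt x t))^2))" for x
    have [measurable]: "borel_fun J" unfolding J_def by measurable
    have J: "ennreal ((\<alpha> (pt x y))^2) \<le> J x" if "y \<in> {-l..l}" for x y
      unfolding J_def by (rule segment_sup[OF l D(2) continuous_on_pt2[OF C] that])
    have "NNset (square l) (\<lambda>p. m (p$2) * ennreal ((\<alpha> p)^2))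
       = (\<integral>\<^sup>+x. \<integral>\<^sup>+y. m y * ennreal ((\<alpha> (pt x y))^2) * (indicator {-l..l} x * indicator {-l..l} y) \<partial>lborel \<partial>lborel)"
      by (subst nn_integral_plane(2)) (auto simp: ind)
    also have "\<dots> \<le> (\<integral>\<^sup>+x. \<integral>\<^sup>+y. (J x * indicator {-l..l} x) * (m y * indicator {-l..l} y) \<partial>lborel \<partial>lborel)"
      using mult_right_mono[OF J, of _ "m _"] by (intro nn_integral_mono) (auto simp: indicator_def mult.commute[of "m _"])
    also have "\<dots> = NNset {-l..l} (\<lambda>x. J x) * NNset {-l..l} m"
      by (simp add: nn_integral_cmult nn_integral_multc)
    also have "NNset {-l..l} (\<lambda>x. J x) = NNset (square l) (\<lambda>p. ?c * ennreal ((\<alpha> p)^2) + ennreal ((partial 2 \<alpha> p)^2))"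
      unfolding J_def by (subst nn_integral_plane(2), measurable, subst nn_integral_multc[symmetric]) (auto simp: ind mult_ac)
    finally show ?thesis unfolding fin .
  qed
  show "NNset (square l) (\<lambda>p. m (p$1) * ennreal ((\<alpha> p)^2))
     \<le> (?c * sqi (square l) \<alpha> + sqi (square l) (partial 1 \<alpha>)) * NNset {-l..l} m"
  proof -
    define J where "J y = NNset {-l..l} (\<lambda>t. ?c * ennreal ((\<alpha> (pt t y))^2) + ennreal ((partial 1 \<alpha> (pt t y))^2))" for y
    have [measurable]: "borel_fun J" unfolding J_def by measurable
    have J: "ennreal ((\<alpha> (pt x y))^2) \<le> J y" if "x \<in> {-l..l}" for x y
      unfolding J_def by (rule segment_sup[OF l D(1) continuous_on_pt1[OF C] that])
    have "NNset (square l) (\<lambda>p. m (p$1) * ennreal ((\<alpha> p)^2))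
       = (\<integral>\<^sup>+y. \<integral>\<^sup>+x. m x * ennreal ((\<alpha> (pt x y))^2) * (indicator {-l..l} x * indicator {-l..l} y) \<partial>lborel \<partial>lborel)"
      by (subst nn_integral_plane(1)) (auto simp: ind)
    also have "\<dots> \<le> (\<integral>\<^sup>+y. \<integral>\<^sup>+x. (J y * indicator {-l..l} y) * (m x * indicator {-l..l} x) \<partial>lborel \<partial>lborel)"
      using mult_right_mono[OF J, of _ "m _"] by (intro nn_integral_mono) (auto simp: indicator_def mult.commute[of "m _"])
    also have "\<dots> = NNset {-l..l} (\<lambda>y. J y) * NNset {-l..l} (\<lambda>x. m x)"
      by (simp add: nn_integral_cmult nn_integral_multc)
    also have "NNset {-l..l} (\<lambda>y. J y) = NNset (square l) (\<lambda>p. ?c * ennreal ((\<alpha> p)^2) + ennreal ((partial 1 \<alpha> p)^2))"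
      unfolding J_def by (subst nn_integral_plane(1), measurable, subst nn_integral_multc[symmetric]) (auto simp: ind mult_ac)
    finally show ?thesis unfolding fin .
  qed
qed

lemma sqi_triangle_diff:
  fixes f g h :: "real^2 \<Rightarrow> 'b::euclidean_space"
  assumes [measurable]: "borel_fun f" "borel_fun g" "borel_fun h" "S \<in> sets borel"
  shows "sqi S (\<lambda>p. f p - h p) \<le> 2 * sqi S (\<lambda>p. f p - g p) + 2 * sqi S (\<lambda>p. h p - g p)"
  unfolding sqi_minus[of S h g] by (rule sqi_triangle) auto

lemma sqi_triangle_add:
  fixes f g :: "real^2 \<Rightarrow> 'b::euclidean_space"
  assumes [measurable]: "borel_fun f" "borel_fun g" "S \<in> sets borel"
  shows "sqi S f \<le> 2 * sqi S (\<lambda>p. f p - g p) + 2 * sqi S g"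
  by (rule sqi_triangle) auto

lemma norm_vec2_sq: "ennreal ((norm (v::real^2))^2) = ennreal ((v$1)^2) + ennreal ((v$2)^2)"
  by (simp add: norm_pair_sq)

text \<open>The estimate for smooth functions, uniform along the tail of the approximating sequence
  where the errors are below 1, and carried to the limit by Fatou. \<open>K\<close> depends on the
  square but not on the weight \<open>m\<close>.\<close>

lemma appr_weight:
  assumes ap: "appr \<Omega> z A \<phi>" and l: "l > 0"
  obtains K :: ennreal where "K < top"
    "\<And>m. borel_fun m \<Longrightarrow> (NNset (square l) (\<lambda>p. m (p$2) * ennreal ((norm (z p))^2))) \<le> K * NNset {-l..l} m"
    "\<And>m. borel_fun m \<Longrightarrow> (NNset (square l) (\<lambda>p. m (p$1) * ennreal ((norm (z p))^2))) \<le> K * NNset {-l..l} m"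
proof -
  note D = apprD[OF ap]
  note [measurable] = D(1,2,5,6)
  let ?c = "ennreal (1/(2*l) + 1)"
  define K where "K = 2 * (?c * (2 * 1 + 2 * sqi (square l) z)) + 2 * (2 * 1 + 2 * sqi UNIV A)"
  have K: "K < top" unfolding K_def using D(9)[of l] D(10) by (auto simp: ennreal_mult_less_top)
  have "\<forall>\<^sub>F n in sequentially. sqi (square l) (\<lambda>p. \<phi> n p - z p) < 1 \<and> sqi UNIV (\<lambda>p. grad (\<phi> n) p - A p) < 1"
    using order_tendstoD(2)[OF D(7)[of l], of 1] order_tendstoD(2)[OF D(8), of 1] by (simp add: eventually_conj)
  then obtain N where N: "\<And>n. n \<ge> N \<Longrightarrow> sqi (square l) (\<lambda>p. \<phi> n p - z p) < 1 \<and> sqi UNIV (\<lambda>p. grad (\<phi> n) p - A p) < 1"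
    by (auto simp: eventually_sequentially)
  have K_bd: "2 * (?c * sqi (square l) (\<phi> n)) + 2 * sqi UNIV (grad (\<phi> n)) \<le> K" if "n \<ge> N" for n
  proof -
    have "sqi (square l) (\<phi> n) \<le> 2 * sqi (square l) (\<lambda>p. \<phi> n p - z p) + 2 * sqi (square l) z"
      by (rule sqi_triangle_add) auto
    also have "\<dots> \<le> 2 * 1 + 2 * sqi (square l) z" using N[OF that] by (intro add_mono mult_left_mono) auto
    finally have 1: "sqi (square l) (\<phi> n) \<le> 2 * 1 + 2 * sqi (square l) z" .
    have "sqi UNIV (grad (\<phi> n)) \<le> 2 * sqi UNIV (\<lambda>p. grad (\<phi> n) p - A p) + 2 * sqi UNIV A"
      by (rule sqi_triangle_add) auto
    also have "\<dots> \<le> 2 * 1 + 2 * sqi UNIV A" using N[OF that] by (intro add_mono mult_left_mono) auto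
    finally show ?thesis unfolding K_def using 1 by (intro add_mono mult_left_mono) auto
  qed
  have comp: "?c * sqi (square l) (\<lambda>p. \<phi> n p $ j) + sqi (square l) (partial i (\<lambda>p. \<phi> n p $ j))
      \<le> ?c * sqi (square l) (\<phi> n) + sqi UNIV (grad (\<phi> n))" for i j n
  proof (intro add_mono mult_left_mono sqi_nth)
    have "sqi (square l) (partial i (\<lambda>p. \<phi> n p $ j)) \<le> sqi UNIV (partial i (\<lambda>p. \<phi> n p $ j))" by (rule sqi_mono_set) auto
    also have "\<dots> \<le> sqi UNIV (grad (\<phi> n))"
      by (rule sqi_mono) (auto simp: grad_nth[symmetric] matrix_nth_le)
    finally show "sqi (square l) (partial i (\<lambda>p. \<phi> n p $ j)) \<le> sqi UNIV (grad (\<phi> n))" .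
  qed auto
  have sm: "smooth (\<lambda>p. \<phi> n p $ j)" for n j by (intro smooth_nth test_functionsD(1)[OF D(4)])
  have split: "NNset (square l) (\<lambda>p. w p * ennreal ((norm (\<phi> n p))^2))
    = NNset (square l) (\<lambda>p. w p * ennreal ((\<phi> n p $ 1)^2)) + NNset (square l) (\<lambda>p. w p * ennreal ((\<phi> n p $ 2)^2))"
    if [measurable]: "borel_fun w" for n and w :: "real^2 \<Rightarrow> ennreal"
    by (subst nn_integral_add[symmetric]) (auto simp: norm_vec2_sq distrib_left distrib_right)
  have fin: "X1 + X2 \<le> K * I" if "X1 \<le> (?c * sqi (square l) (\<lambda>p. \<phi> n p $ 1) + sqi (square l) (partial i (\<lambda>p. \<phi> n p $ 1))) * I"
    "X2 \<le> (?c * sqi (square l) (\<lambda>p. \<phi> n p $ 2) + sqi (square l) (partial i (\<lambda>p. \<phi> n p $ 2))) * I" "n \<ge> N" for X1 X2 I :: ennreal and i n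
  proof -
    let ?s = "?c * sqi (square l) (\<phi> n) + sqi UNIV (grad (\<phi> n))"
    have "X1 + X2 \<le> ?s * I + ?s * I"
      using that(1,2) comp[where i=i and n=n] by (intro add_mono) (meson mult_right_mono order_trans zero_le)+
    also have "\<dots> = (2 * (?c * sqi (square l) (\<phi> n)) + 2 * sqi UNIV (grad (\<phi> n))) * I"
      by (simp only: mult_2[symmetric] distrib_left distrib_right mult_ac)
    also have "\<dots> \<le> K * I" using K_bd[OF that(3)] by (rule mult_right_mono) auto
    finally show ?thesis .
  qed
  have conv: "(\<lambda>n. sqi (square l) (\<lambda>p. \<phi> (n + N) p - z p)) \<longlonglongrightarrow> 0"
    using LIMSEQ_ignore_initial_segment[OF D(7)] by simp
  show ?thesis
  proof (rule that[OF K])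
    fix m :: "real \<Rightarrow> ennreal" assume [measurable]: "borel_fun m"
    let ?I = "NNset {-l..l} m"
    show "NNset (square l) (\<lambda>p. m (p$2) * ennreal ((norm (z p))^2)) \<le> K * ?I"
      by (rule weighted_bound_closed[where f="\<lambda>n. \<phi> (n + N)" and B="\<lambda>_. K * ?I", OF _ _ _ _ conv])
         (auto simp: split intro!: fin smooth_weight_bound(1)[OF l sm])
    show "NNset (square l) (\<lambda>p. m (p$1) * ennreal ((norm (z p))^2)) \<le> K * ?I"
      by (rule weighted_bound_closed[where f="\<lambda>n. \<phi> (n + N)" and B="\<lambda>_. K * ?I", OF _ _ _ _ conv])
         (auto simp: split intro!: fin smooth_weight_bound(2)[OF l sm])
  qed
qed

text \<open>The counterpart of the previous estimate: the square of a smooth function is itself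
  dominated by a weight of one coordinate whose integral is controlled.\<close>

lemma smooth_slice:
  fixes \<beta> :: "real^2 \<Rightarrow> real"
  assumes l: "l > 0" and \<beta>: "smooth \<beta>"
  obtains m :: "real \<Rightarrow> ennreal" where "borel_fun m" "\<And>p. p \<in> square l \<Longrightarrow> ennreal ((\<beta> p)^2) \<le> m (p$2)"
    "NNset {-l..l} m = ennreal (1/(2*l) + 1) * sqi (square l) \<beta> + sqi (square l) (partial 1 \<beta>)"
proof -
  note [measurable] = smooth_measurable[OF \<beta>] smooth_measurable[OF smooth_partial[OF \<beta>]]
  note D = has_derivative_pt[OF smooth_differentiable[OF \<beta>]]
  note C = smooth_continuous[OF smooth_partial[OF \<beta>]]
  let ?c = "ennreal (1/(2*l) + 1)"
  define J where "J y = NNset {-l..l} (\<lambda>t. ?c * ennreal ((\<beta> (pt t y))^2) + ennreal ((partial 1 \<beta> (pt t y))^2))" for y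
  have [measurable]: "borel_fun J" unfolding J_def by measurable
  have ind: "indicator (square l) (pt x y) = (indicator {-l..l} x * indicator {-l..l} y :: ennreal)" for x y
    by (auto simp: indicator_def square_def abs_le_iff)
  show ?thesis
  proof (rule that)
    show "ennreal ((\<beta> p)^2) \<le> J (p$2)" if "p \<in> square l" for p
      using segment_sup[OF l D(1) continuous_on_pt1[OF C], of "p$1" "p$2"] that unfolding J_def
      by (auto simp: square_def abs_le_iff)
    have "NNset {-l..l} (\<lambda>y. J y) = NNset (square l) (\<lambda>p. ?c * ennreal ((\<beta> p)^2) + ennreal ((partial 1 \<beta> p)^2))"
      unfolding J_def by (subst nn_integral_plane(1), measurable, subst nn_integral_multc[symmetric]) (auto simp: ind mult_ac)
    also have "\<dots> = ?c * sqi (square l) \<beta> + sqi (square l) (partial 1 \<beta>)"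
      unfolding sqi_def by (simp add: distrib_right nn_integral_add nn_integral_cmult mult.assoc)
    finally show "NNset {-l..l} (\<lambda>y. J y) = ?c * sqi (square l) \<beta> + sqi (square l) (partial 1 \<beta>)" .
  qed measurable
qed

text \<open>The squared difference of two approximants is dominated by a weight of the second
  coordinate, and |a|^2 may be integrated against such weights. Thus the product of two fields with
  finite Dirichlet integral is locally in L^2, continuously in one factor.\<close>

lemma appr_product:
  assumes a: "appr \<Omega> a A' \<phi>'" and z: "appr \<Omega> z A \<phi>" and l: "l > 0"
  shows "(\<lambda>n. NNset (square l) (\<lambda>p. ennreal ((norm (a p))^2) * ennreal ((norm (\<phi> n p - z p))^2))) \<longlonglongrightarrow> 0"
proof -
  note D = apprD[OF z]
  note [measurable] = D(1,2,5,6) apprD(1)[OF a]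
  let ?c = "ennreal (1/(2*l) + 1)"
  obtain K where K: "K < top" "\<And>m. borel_fun m \<Longrightarrow> (NNset (square l) (\<lambda>p. m (p$2) * ennreal ((norm (a p))^2))) \<le> K * NNset {-l..l} m"
    by (rule appr_weight[OF a l]) (rule that)
  have sm: "smooth (\<lambda>p. \<phi> n p $ j)" for n j by (intro smooth_nth test_functionsD(1)[OF D(4)])
  let ?e = "\<lambda>n. sqi (square l) (\<lambda>p. \<phi> n p - z p)" and ?g = "\<lambda>n. sqi UNIV (\<lambda>p. grad (\<phi> n) p - A p)"
  define B where "B n m = 2 * (K * (?c * (2 * ?e n + 2 * ?e m) + (2 * ?g n + 2 * ?g m)))" for n m
  have comp: "NNset (square l) (\<lambda>p. ennreal ((norm (a p))^2) * ennreal ((\<phi> n p $ j - \<phi> m p $ j)^2))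
      \<le> K * (?c * (2 * ?e n + 2 * ?e m) + (2 * ?g n + 2 * ?g m))" for n m j
  proof -
    obtain w where w: "borel_fun w" "\<And>p. p \<in> square l \<Longrightarrow> ennreal ((\<phi> n p $ j - \<phi> m p $ j)^2) \<le> w (p$2)"
      "NNset {-l..l} (\<lambda>y. w y) = ?c * sqi (square l) (\<lambda>p. \<phi> n p $ j - \<phi> m p $ j) + sqi (square l) (partial 1 (\<lambda>p. \<phi> n p $ j - \<phi> m p $ j))"
      by (rule smooth_slice[OF l smooth_diff[OF sm[of n j] sm[of m j]]]) (rule that)
    have "NNset (square l) (\<lambda>p. ennreal ((norm (a p))^2) * ennreal ((\<phi> n p $ j - \<phi> m p $ j)^2))
      \<le> NNset (square l) (\<lambda>p. w (p$2) * ennreal ((norm (a p))^2))"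
      using w(2) by (intro nn_integral_mono) (auto simp: indicator_def mult.commute[of "w _"] intro!: mult_left_mono)
    also have "\<dots> \<le> K * (?c * sqi (square l) (\<lambda>p. \<phi> n p $ j - \<phi> m p $ j) + sqi (square l) (partial 1 (\<lambda>p. \<phi> n p $ j - \<phi> m p $ j)))"
      using K(2)[OF w(1)] unfolding w(3) .
    also have "\<dots> \<le> K * (?c * (2 * ?e n + 2 * ?e m) + (2 * ?g n + 2 * ?g m))"
    proof (intro mult_left_mono add_mono)
      have "sqi (square l) (\<lambda>p. (\<phi> n p - \<phi> m p) $ j) \<le> sqi (square l) (\<lambda>p. \<phi> n p - \<phi> m p)" by (rule sqi_nth)
      also have "\<dots> \<le> 2 * ?e n + 2 * ?e m" by (rule sqi_triangle_diff) auto
      finally show "sqi (square l) (\<lambda>p. \<phi> n p $ j - \<phi> m p $ j) \<le> 2 * ?e n + 2 * ?e m" by simp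
      have "partial 1 (\<lambda>p. \<phi> n p $ j - \<phi> m p $ j) = (\<lambda>p. (grad (\<phi> n) p - grad (\<phi> m) p) $ 1 $ j)"
        by (simp add: fun_eq_iff partial_diff grad_nth smooth_differentiable[OF sm])
      then have "sqi (square l) (partial 1 (\<lambda>p. \<phi> n p $ j - \<phi> m p $ j)) = sqi (square l) (\<lambda>p. (grad (\<phi> n) p - grad (\<phi> m) p) $ 1 $ j)" by simp
      also have "\<dots> \<le> sqi UNIV (\<lambda>p. (grad (\<phi> n) p - grad (\<phi> m) p) $ 1 $ j)" by (rule sqi_mono_set) auto
      also have "\<dots> \<le> sqi UNIV (\<lambda>p. grad (\<phi> n) p - grad (\<phi> m) p)" by (rule sqi_mono) (auto simp: matrix_nth_le simp del: vector_minus_component)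
      also have "\<dots> \<le> 2 * ?g n + 2 * ?g m" by (rule sqi_triangle_diff) auto
      finally show "sqi (square l) (partial 1 (\<lambda>p. \<phi> n p $ j - \<phi> m p $ j)) \<le> 2 * ?g n + 2 * ?g m" .
    qed auto
    finally show ?thesis .
  qed
  have pair: "NNset (square l) (\<lambda>p. ennreal ((norm (a p))^2) * ennreal ((norm (\<phi> n p - \<phi> m p))^2)) \<le> B n m" for n m
  proof -
    have "NNset (square l) (\<lambda>p. ennreal ((norm (a p))^2) * ennreal ((norm (\<phi> n p - \<phi> m p))^2))
     = NNset (square l) (\<lambda>p. ennreal ((norm (a p))^2) * ennreal ((\<phi> n p $ 1 - \<phi> m p $ 1)^2))
     + NNset (square l) (\<lambda>p. ennreal ((norm (a p))^2) * ennreal ((\<phi> n p $ 2 - \<phi> m p $ 2)^2))"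
      by (subst nn_integral_add[symmetric]) (auto simp: norm_vec2_sq distrib_left distrib_right)
    also have "\<dots> \<le> B n m" unfolding B_def mult_2 by (intro add_mono comp[unfolded mult_2])
    finally show ?thesis .
  qed
  have Blim: "(\<lambda>m. B n m) \<longlonglongrightarrow> 2 * (K * (?c * (2 * ?e n + 2 * 0) + (2 * ?g n + 2 * 0)))" for n
    unfolding B_def using K(1)
    by (intro ennreal_tendsto_cmult tendsto_add tendsto_const D(7,8)) auto
  \<comment> \<open>With n fixed, Fatou in m replaces the second approximant by its limit z.\<close>
  have bd: "NNset (square l) (\<lambda>p. ennreal ((norm (a p))^2) * ennreal ((norm (\<phi> n p - z p))^2)) \<le> 2 * (K * (?c * (2 * ?e n + 2 * 0) + (2 * ?g n + 2 * 0)))" for n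
  proof (rule weighted_bound_closed[where f="\<lambda>m p. \<phi> n p - \<phi> m p", OF _ _ _ _ _ pair Blim])
    have "(\<lambda>m. ?e m) \<longlonglongrightarrow> 0" by (rule D(7))
    then show "(\<lambda>m. sqi (square l) (\<lambda>x. \<phi> n x - \<phi> m x - (\<phi> n x - z x))) \<longlonglongrightarrow> 0"
      by (simp add: sqi_minus[of _ z])
  qed auto
  have "(\<lambda>n. 2 * (K * (?c * (2 * ?e n + 2 * 0) + (2 * ?g n + 2 * 0)))) \<longlonglongrightarrow> 2 * (K * (?c * (2 * 0 + 2 * 0) + (2 * 0 + 2 * 0)))"
    using K(1) by (intro ennreal_tendsto_cmult tendsto_add tendsto_const D(7,8)) auto
  then have "(\<lambda>n. 2 * (K * (?c * (2 * ?e n + 2 * 0) + (2 * ?g n + 2 * 0)))) \<longlonglongrightarrow> 0"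
    by (simp only: mult_zero_right add_0_right)
  from ennreal_squeeze_0[OF this bd] show ?thesis .
qed

lemma nn_integral_tail:
  fixes f :: "real^2 \<Rightarrow> ennreal"
  assumes [measurable]: "borel_fun f" "\<And>k. S k \<in> sets borel" and fin: "(NNINT p. f p) < top"
    and S: "\<And>p. \<forall>\<^sub>F k in sequentially. p \<notin> S k"
  shows "(\<lambda>k. NNset (S k) (\<lambda>p. f p)) \<longlonglongrightarrow> 0"
proof -
  have "(\<lambda>k. NNset (S k) (\<lambda>p. f p)) \<longlonglongrightarrow> (\<integral>\<^sup>+p. 0 \<partial>(lborel :: (real^2) measure))"
  proof (rule nn_integral_dominated_convergence[where w=f])
    show "AE p in lborel. (\<lambda>k. f p * indicator (S k) p) \<longlonglongrightarrow> 0"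
    proof (rule AE_I2)
      fix p show "(\<lambda>k. f p * indicator (S k) p) \<longlonglongrightarrow> 0"
        by (rule tendsto_eventually) (use S[of p] in eventually_elim, simp)
    qed
  qed (use fin in \<open>auto simp: indicator_def\<close>)
  then show ?thesis by simp
qed

lemma eventually_in_square: "\<forall>\<^sub>F k in sequentially. p \<in> square (real k)" "\<forall>\<^sub>F k in sequentially. p \<notin> ring_region (real k)"
proof -
  obtain N :: nat where N: "norm p < N" using reals_Archimedean2 by blast
  have c: "\<bar>p$i\<bar> \<le> norm p" for i by (rule component_le_norm_cart)
  show "\<forall>\<^sub>F k in sequentially. p \<in> square (real k)"
    by (rule eventually_sequentiallyI[of N]) (use N c[of 1] c[of 2] in \<open>auto simp: square_def\<close>)
  show "\<forall>\<^sub>F k in sequentially. p \<notin> ring_region (real k)"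
    by (rule eventually_sequentiallyI[of N]) (use N c[of 1] c[of 2] in \<open>auto simp: ring_region_def\<close>)
qed

text \<open>On the square of half side 2k, for k \<ge> 1, one has |x| + 1 \<le> 5k. Hence k^-2 |z|^2
  is dominated by 25 |z|^2 / (|x| + 1)^2, which Hardy's inequality makes integrable, while it tends
  to zero pointwise.\<close>

lemma weighted_tail:
  fixes z :: "real^2 \<Rightarrow> real^2"
  assumes [measurable]: "borel_fun z" and H: "sqi UNIV (\<lambda>p. z p /\<^sub>R (norm p + 1)) < top"
  shows "(\<lambda>k. ennreal (1 / (real k)^2) * sqi (square (2 * real k)) z) \<longlonglongrightarrow> 0"
proof -
  let ?f = "\<lambda>k p. ennreal (1 / (real k)^2) * (ennreal ((norm (z p))^2) * indicator (square (2 * real k)) p)"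
  have "(\<lambda>k. NNINT p. ?f k p) \<longlonglongrightarrow> (\<integral>\<^sup>+p. 0 \<partial>(lborel :: (real^2) measure))"
  proof (rule nn_integral_dominated_convergence[where w="\<lambda>p. 25 * ennreal ((norm (z p /\<^sub>R (norm p + 1)))^2)"])
    show "AE p in lborel. ?f k p \<le> 25 * ennreal ((norm (z p /\<^sub>R (norm p + 1)))^2)" for k
    proof (rule AE_I2)
      fix p
      show "?f k p \<le> 25 * ennreal ((norm (z p /\<^sub>R (norm p + 1)))^2)"
      proof (cases "p \<in> square (2 * real k) \<and> k > 0")
        case True
        then have "norm p + 1 \<le> 5 * real k"
          using square_ball[of "2 * real k"] by (auto simp: subset_iff)
        then have "(norm p + 1)^2 \<le> (5 * real k)^2" by (intro power_mono) auto
        then have "1 / (real k)^2 \<le> 25 / (norm p + 1)^2"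
          using True by (simp add: field_simps power_mult_distrib add_nonneg_eq_0_iff)
        then have "1 / (real k)^2 * (norm (z p))^2 \<le> 25 / (norm p + 1)^2 * (norm (z p))^2" by (rule mult_right_mono) auto
        also have "\<dots> = 25 * (norm (z p /\<^sub>R (norm p + 1)))^2" by (simp add: power_mult_distrib power_divide divide_inverse power_inverse)
        finally have "ennreal (1 / (real k)^2 * (norm (z p))^2) \<le> ennreal (25 * (norm (z p /\<^sub>R (norm p + 1)))^2)" by (rule ennreal_leI)
        also have "ennreal (25 * (norm (z p /\<^sub>R (norm p + 1)))^2) = 25 * ennreal ((norm (z p /\<^sub>R (norm p + 1)))^2)"
          by (subst ennreal_mult) auto
        also have "ennreal (1 / (real k)^2 * (norm (z p))^2) = ennreal (1 / (real k)^2) * ennreal ((norm (z p))^2)"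
          by (rule ennreal_mult) auto
        finally show ?thesis using True by simp
      qed auto
    qed
    show "(NNINT p. 25 * ennreal ((norm (z p /\<^sub>R (norm p + 1)))^2)) < \<infinity>"
      using H unfolding sqi_def by (simp add: nn_integral_cmult ennreal_mult_less_top)
    show "AE p in lborel. (\<lambda>k. ?f k p) \<longlonglongrightarrow> 0"
    proof (rule AE_I2)
      fix p
      have "(\<lambda>k. 1 / (real k)^2 * (norm (z p))^2) \<longlonglongrightarrow> 0 * (norm (z p))^2"
        by (intro tendsto_mult tendsto_const) (use lim_inverse_n'[THEN tendsto_power, of 2] in \<open>simp add: power_divide\<close>)
      then have "(\<lambda>k. ennreal (1 / (real k)^2 * (norm (z p))^2)) \<longlonglongrightarrow> 0" by (simp add: ennreal_tendsto_0_iff)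
      then show "(\<lambda>k. ?f k p) \<longlonglongrightarrow> 0"
        by (rule ennreal_squeeze_0) (auto simp: indicator_def simp flip: ennreal_mult)
    qed
  qed measurable
  then show ?thesis unfolding sqi_def by (simp add: nn_integral_cmult)
qed

section \<open>Passing from test fields to limit fields\<close>

abbreviation cut_slope :: "real \<Rightarrow> real^2 \<Rightarrow> real" where
  "cut_slope k p \<equiv> \<bar>cut_grad k 1 p\<bar> + \<bar>cut_grad k 2 p\<bar>"

text \<open>Quantified over all P because the constant normalising the stream function depends on
  \<phi> and k. Both oscillation bounds are needed: the derivative of the cut-off in direction i
  lives where the i-th coordinate is at least k in size, and there the bound depending on that same
  coordinate profits from decay.\<close>

definition trunc_error_bound :: "real \<Rightarrow> (real^2 \<Rightarrow> real^2) \<Rightarrow> (real^2 \<Rightarrow> real) \<Rightarrow> ennreal \<Rightarrow> bool" where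
  "trunc_error_bound k \<phi> \<gamma> B \<longleftrightarrow> (\<forall>P. borel_fun P \<longrightarrow>
     (\<forall>p\<in>square (2 * k). ennreal \<bar>P p\<bar> \<le> osc k \<phi> (p$2)) \<longrightarrow>
     (\<forall>p\<in>square (2 * k). ennreal \<bar>P p\<bar> \<le> osc k (\<lambda>p. \<phi> (swp p)) (p$1)) \<longrightarrow>
     (NNINT p. ennreal (\<gamma> p * (\<bar>P p\<bar> * cut_slope k p)))^2 \<le> B)"

text \<open>\<open>admissible z \<phi> \<gamma>\<close>: the integrals against a field bounded by \<open>\<gamma>\<close> of the truncations of \<open>\<phi> n\<close> at
  radius \<open>k\<close> converge to the integral against \<open>z\<close> when first \<open>n\<close> and then \<open>k\<close> tends to infinity;
  the last conjunct controls the part of the truncation that contains the stream function.\<close>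

definition admissible :: "(real^2 \<Rightarrow> real^2) \<Rightarrow> (nat \<Rightarrow> real^2 \<Rightarrow> real^2) \<Rightarrow> (real^2 \<Rightarrow> real) \<Rightarrow> bool" where
  "admissible z \<phi> \<gamma> \<longleftrightarrow> borel_fun \<gamma> \<and> (\<forall>p. 0 \<le> \<gamma> p) \<and>
     (NNINT p. ennreal (\<gamma> p * norm (z p))) < top \<and>
     (\<forall>r>0. (\<lambda>n. NNset (square r) (\<lambda>p. ennreal (\<gamma> p * norm (\<phi> n p - z p)))) \<longlonglongrightarrow> 0) \<and>
     (\<exists>X Y. X \<longlonglongrightarrow> 0 \<and> (\<forall>k. Y k \<longlonglongrightarrow> 0) \<and>
       (\<forall>k\<ge>1. \<forall>n. trunc_error_bound (real k) (\<phi> n) \<gamma> (X k + Y k n)))"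

lemma cut_grad_measurable [measurable]: "borel_fun (cut_grad k i)"
  using smooth_measurable[OF cut_smooth(2)] .

lemma admissible_add:
  assumes 1: "admissible z \<phi> \<gamma>1" and 2: "admissible z \<phi> \<gamma>2"
    and [measurable]: "borel_fun z" "\<And>n. borel_fun (\<phi> n)"
  shows "admissible z \<phi> (\<lambda>p. \<gamma>1 p + \<gamma>2 p)"
proof -
  have [measurable]: "borel_fun \<gamma>1" "borel_fun \<gamma>2" and pos: "\<And>p. \<gamma>1 p \<ge> 0" "\<And>p. \<gamma>2 p \<ge> 0"
    using 1 2 by (auto simp: admissible_def)
  have add: "(NNINT p. ennreal ((\<gamma>1 p + \<gamma>2 p) * h p) * w p) =
     (NNINT p. ennreal (\<gamma>1 p * h p) * w p) + (NNINT p. ennreal (\<gamma>2 p * h p) * w p)"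
    if [measurable]: "borel_fun h" "borel_fun w" and "\<And>p. h p \<ge> 0" for h and w :: "real^2 \<Rightarrow> ennreal"
    using that(3) pos by (subst nn_integral_add[symmetric]) (auto simp: distrib_right ennreal_plus)
  note add1 = add[where w="\<lambda>_. 1", simplified]
  obtain X1 Y1 where f1: "X1 \<longlonglongrightarrow> 0" "\<And>k. Y1 k \<longlonglongrightarrow> 0" "\<And>k n. k \<ge> 1 \<Longrightarrow> trunc_error_bound (real k) (\<phi> n) \<gamma>1 (X1 k + Y1 k n)"
    using 1 unfolding admissible_def by blast
  obtain X2 Y2 where f2: "X2 \<longlonglongrightarrow> 0" "\<And>k. Y2 k \<longlonglongrightarrow> 0" "\<And>k n. k \<ge> 1 \<Longrightarrow> trunc_error_bound (real k) (\<phi> n) \<gamma>2 (X2 k + Y2 k n)"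
    using 2 unfolding admissible_def by blast
  show ?thesis
    unfolding admissible_def
  proof (intro conjI allI impI)
    show "(NNINT p. ennreal ((\<gamma>1 p + \<gamma>2 p) * norm (z p))) < top"
      using 1 2 by (subst add1) (auto simp: admissible_def)
    show "(\<lambda>n. NNset (square r) (\<lambda>p. ennreal ((\<gamma>1 p + \<gamma>2 p) * norm (\<phi> n p - z p)))) \<longlonglongrightarrow> 0" if "r > 0" for r
    proof (subst add)
      show "(\<lambda>n. NNset (square r) (\<lambda>p. ennreal (\<gamma>1 p * norm (\<phi> n p - z p)))
          + NNset (square r) (\<lambda>p. ennreal (\<gamma>2 p * norm (\<phi> n p - z p)))) \<longlonglongrightarrow> 0"
        using tendsto_add[of _ 0 _ _ 0] 1 2 that unfolding admissible_def by fastforce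
    qed auto
    show "\<exists>X Y. X \<longlonglongrightarrow> 0 \<and> (\<forall>k. Y k \<longlonglongrightarrow> 0) \<and>
       (\<forall>k\<ge>1. \<forall>n. trunc_error_bound (real k) (\<phi> n) (\<lambda>p. \<gamma>1 p + \<gamma>2 p) (X k + Y k n))"
    proof (intro exI conjI allI impI)
      show "(\<lambda>k. 2 * X1 k + 2 * X2 k) \<longlonglongrightarrow> 0"
        using tendsto_add[OF ennreal_mult_tendsto_0[OF f1(1), of 2] ennreal_mult_tendsto_0[OF f2(1), of 2]] by simp
      show "(\<lambda>n. 2 * Y1 k n + 2 * Y2 k n) \<longlonglongrightarrow> 0" for k
        using tendsto_add[OF ennreal_mult_tendsto_0[OF f1(2), of 2] ennreal_mult_tendsto_0[OF f2(2), of 2]] by simp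
      fix k n :: nat assume k: "1 \<le> k"
      show "trunc_error_bound (real k) (\<phi> n) (\<lambda>p. \<gamma>1 p + \<gamma>2 p) (2 * X1 k + 2 * X2 k + (2 * Y1 k n + 2 * Y2 k n))"
        unfolding trunc_error_bound_def
      proof (intro allI impI)
      fix P assume *: "borel_fun P" "\<forall>p\<in>square (2 * real k). ennreal \<bar>P p\<bar> \<le> osc (real k) (\<phi> n) (p$2)"
        "\<forall>p\<in>square (2 * real k). ennreal \<bar>P p\<bar> \<le> osc (real k) (\<lambda>p. \<phi> n (swp p)) (p$1)"
      note [measurable] = *(1)
      let ?I = "\<lambda>\<gamma>. NNINT p. ennreal (\<gamma> p * (\<bar>P p\<bar> * cut_slope (real k) p))"
      have "(?I (\<lambda>p. \<gamma>1 p + \<gamma>2 p))^2 = (?I \<gamma>1 + ?I \<gamma>2)^2" by (subst add1) auto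
      also have "\<dots> \<le> 2 * (?I \<gamma>1)^2 + 2 * (?I \<gamma>2)^2" by (rule sq_sum_ennreal)
      also have "\<dots> \<le> 2 * (X1 k + Y1 k n) + 2 * (X2 k + Y2 k n)"
        using f1(3)[OF k, of n] f2(3)[OF k, of n] * unfolding trunc_error_bound_def by (intro add_mono mult_left_mono) auto
      also have "\<dots> = 2 * X1 k + 2 * X2 k + (2 * Y1 k n + 2 * Y2 k n)" by (simp add: distrib_left add_ac)
      finally show "(?I (\<lambda>p. \<gamma>1 p + \<gamma>2 p))^2 \<le> 2 * X1 k + 2 * X2 k + (2 * Y1 k n + 2 * Y2 k n)" .
      qed
    qed
  qed (use pos in auto)
qed

lemma cut_grad_sum_bound:
  assumes "k > 0"
  shows "cut_slope k p \<le> 2 * plateau_const / k * indicator (ring_region k) p"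
  using cut_grad_bounds(1)[OF assms, of 1 p] cut_grad_bounds(1)[OF assms, of 2 p] cut_grad_support(3)[OF assms, of p 1]
    cut_grad_support(3)[OF assms, of p 2] by (auto simp: indicator_def)

lemma ring_region_norm:
  assumes "p \<in> ring_region k" "k \<ge> 1" shows "k \<le> norm p" "norm p + 1 \<le> 5 * k"
proof -
  show "k \<le> norm p" using assms component_le_norm_cart[of p 1] component_le_norm_cart[of p 2] by (auto simp: ring_region_def)
  show "norm p + 1 \<le> 5 * k" using assms square_ball[of "2*k"] by (auto simp: ring_region_def subset_iff)
qed

lemma weighted_pair_finite:
  fixes z :: "real^2 \<Rightarrow> 'b::euclidean_space" and \<gamma> :: "real^2 \<Rightarrow> real"
  assumes [measurable]: "borel_fun z" "borel_fun \<gamma>" and "\<And>p. \<gamma> p \<ge> 0"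
    and G: "sqi UNIV (\<lambda>p. (norm p + 1) * \<gamma> p) < top" and H: "sqi UNIV (\<lambda>p. z p /\<^sub>R (norm p + 1)) < top"
  shows "(NNINT p. ennreal (\<gamma> p * norm (z p))) < top"
proof -
  have n: "norm p + 1 \<noteq> 0" for p :: "real^2" using norm_ge_zero[of p] by linarith
  have e: "(norm p + 1) * (\<gamma> p * (inverse (norm p + 1) * norm (z p))) = \<gamma> p * norm (z p)" for p
    using n[of p] by (simp add: field_simps)
  have "(NNINT p. ennreal \<bar>\<gamma> p * norm (z p)\<bar>)^2 \<le> sqi UNIV (\<lambda>p. (norm p + 1) * \<gamma> p) * sqi UNIV (\<lambda>p. z p /\<^sub>R (norm p + 1))"
  proof (rule L2_pairing(1))
    have "\<bar>\<gamma> p * norm (z p)\<bar> = norm ((norm p + 1) * \<gamma> p) * norm (z p /\<^sub>R (norm p + 1))" for p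
      using e[of p] assms(3)[of p] by (simp add: abs_mult mult.assoc)
    then show "AE p in lborel. \<bar>\<gamma> p * norm (z p)\<bar> \<le> indicator UNIV p * (norm ((norm p + 1) * \<gamma> p) * norm (z p /\<^sub>R (norm p + 1)))"
      by (intro AE_I2) simp
  qed measurable
  also have "\<dots> < top" using G H by (simp add: ennreal_mult_less_top)
  finally show ?thesis using assms(3) by (simp add: power_less_top_ennreal)
qed

text \<open>For weights strong enough that Cauchy-Schwarz works: on the ring |grad(cut)| \<le> 2C/k
  \<le> 2C (|x| + 1) / k^2, and the factor |x| + 1 is given to \<gamma>. The remaining (2C/k^2)^2
  times 160 k^2 from \<open>sqi_osc\<close> is 640 C^2 / k^2. The test field requires only Hardy's
  inequality, no pointwise decay.\<close>

lemma admissible_L2: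
  assumes ap: "appr \<Omega> z A \<phi>" and H: "sqi UNIV (\<lambda>p. z p /\<^sub>R (norm p + 1)) < top"
    and [measurable]: "borel_fun \<gamma>" and pos: "\<And>p. \<gamma> p \<ge> 0"
    and G: "sqi UNIV (\<lambda>p. (norm p + 1) * \<gamma> p) < top"
  shows "admissible z \<phi> \<gamma>"
proof -
  note D = apprD[OF ap]
  note [measurable] = D(1,2,5,6)
  have G': "sqi S \<gamma> < top" for S
  proof -
    have "sqi S \<gamma> \<le> sqi S (\<lambda>p. (norm p + 1) * \<gamma> p)"
      by (intro sqi_mono AE_I2) (auto simp: abs_mult pos distrib_right)
    also have "\<dots> \<le> sqi UNIV (\<lambda>p. (norm p + 1) * \<gamma> p)" by (rule sqi_mono_set) auto
    finally show ?thesis using G by (rule le_less_trans)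
  qed
  let ?G = "sqi UNIV (\<lambda>p. (norm p + 1) * \<gamma> p)"
  let ?C = plateau_const
  define K where "K = ?G * ennreal (640 * ?C^2)"
  have K: "K < top" using G by (simp add: K_def ennreal_mult_less_top)
  show ?thesis
    unfolding admissible_def
  proof (intro conjI allI impI)
    show "(NNINT p. ennreal (\<gamma> p * norm (z p))) < top" by (rule weighted_pair_finite[OF _ _ pos G H]) auto
    show "(\<lambda>n. NNset (square r) (\<lambda>p. ennreal (\<gamma> p * norm (\<phi> n p - z p)))) \<longlonglongrightarrow> 0" for r
    proof (rule ennreal_square_tendsto_0)
      show "(NNset (square r) (\<lambda>p. ennreal (\<gamma> p * norm (\<phi> n p - z p))))^2 \<le> sqi (square r) \<gamma> * sqi (square r) (\<lambda>p. \<phi> n p - z p)" for n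
        using sqi_Cauchy_Schwarz[of \<gamma> "\<lambda>p. \<phi> n p - z p" "square r"] pos by simp
      show "(\<lambda>n. sqi (square r) \<gamma> * sqi (square r) (\<lambda>p. \<phi> n p - z p)) \<longlonglongrightarrow> 0"
        by (rule ennreal_mult_tendsto_0[OF D(7) G'])
    qed
    show "\<exists>X Y. X \<longlonglongrightarrow> 0 \<and> (\<forall>k. Y k \<longlonglongrightarrow> 0) \<and>
       (\<forall>k\<ge>1. \<forall>n. trunc_error_bound (real k) (\<phi> n) \<gamma> (X k + Y k n))"
    proof (intro exI conjI allI impI)
      show "(\<lambda>k. (K * 2) * (ennreal (1 / (real k)^2) * sqi (square (2 * real k)) z)) \<longlonglongrightarrow> 0"
        using K by (intro ennreal_mult_tendsto_0 weighted_tail H) (auto simp: ennreal_mult_less_top)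
      show "(\<lambda>n. (K * 2 * ennreal (1 / (real k)^2)) * sqi (square (2 * real k)) (\<lambda>p. \<phi> n p - z p)) \<longlonglongrightarrow> 0" for k
        using K by (intro ennreal_mult_tendsto_0 D(7)) (auto simp: ennreal_mult_less_top)
      fix k n :: nat assume k: "1 \<le> k"
      show "trunc_error_bound (real k) (\<phi> n) \<gamma> ((K * 2) * (ennreal (1 / (real k)^2) * sqi (square (2 * real k)) z) + (K * 2 * ennreal (1 / (real k)^2)) * sqi (square (2 * real k)) (\<lambda>p. \<phi> n p - z p))"
        unfolding trunc_error_bound_def
      proof (intro allI impI)
      fix P assume *: "borel_fun P" "\<forall>p\<in>square (2 * real k). ennreal \<bar>P p\<bar> \<le> osc (real k) (\<phi> n) (p$2)"
      note [measurable] = *(1)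
      define l where "l = real k"
      have l: "l \<ge> 1" "l > 0" using k by (auto simp: l_def)
      let ?S = "\<lambda>p. \<bar>cut_grad l 1 p\<bar> + \<bar>cut_grad l 2 p\<bar>"
      have "(NNINT p. ennreal \<bar>\<gamma> p * (\<bar>P p\<bar> * ?S p)\<bar>)^2 \<le> sqi (square (2*l)) (\<lambda>p. (norm p + 1) * \<gamma> p) * sqi (square (2*l)) (\<lambda>p. 2 * ?C / l^2 * P p)"
      proof (rule L2_pairing(1))
        show "AE p in lborel. \<bar>\<gamma> p * (\<bar>P p\<bar> * ?S p)\<bar> \<le> indicator (square (2*l)) p * (norm ((norm p + 1) * \<gamma> p) * norm (2 * ?C / l^2 * P p))"
        proof (rule AE_I2)
          fix p
          show "\<bar>\<gamma> p * (\<bar>P p\<bar> * ?S p)\<bar> \<le> indicator (square (2*l)) p * (norm ((norm p + 1) * \<gamma> p) * norm (2 * ?C / l^2 * P p))"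
          proof (cases "p \<in> ring_region l")
            case True
            have "?S p \<le> 2 * ?C / l" using cut_grad_sum_bound[OF l(2), of p] True by simp
            also have "\<dots> = 2 * ?C / l^2 * l" using l by (simp add: power2_eq_square)
            also have "\<dots> \<le> 2 * ?C / l^2 * (norm p + 1)"
              using ring_region_norm(1)[OF True l(1)] plateau_const(1) by (intro mult_left_mono) auto
            finally have "\<bar>\<gamma> p\<bar> * (\<bar>P p\<bar> * ?S p) \<le> \<bar>\<gamma> p\<bar> * (\<bar>P p\<bar> * (2 * ?C / l^2 * (norm p + 1)))"
              by (intro mult_left_mono) auto
            then show ?thesis using True plateau_const(1) by (simp add: ring_region_def abs_mult mult_ac)
          next
            case False
            then have "cut_grad l 1 p = 0" "cut_grad l 2 p = 0" using cut_grad_support(3)[OF l(2)] by auto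
            then show ?thesis by simp
          qed
        qed
      qed measurable
      also have "\<dots> \<le> ?G * (ennreal ((2 * ?C / l^2)^2) * (ennreal (160 * l^2) * sqi (square (2*l)) (\<phi> n)))"
      proof (intro mult_mono sqi_mono_set)
        show "sqi (square (2*l)) (\<lambda>p. 2 * ?C / l^2 * P p) \<le> ennreal ((2 * ?C / l^2)^2) * (ennreal (160 * l^2) * sqi (square (2*l)) (\<phi> n))"
          using *(2) l by (subst sqi_cmult) (auto intro!: mult_left_mono sqi_osc simp: l_def)
      qed auto
      also have "\<dots> = K * (ennreal (1/l^2) * sqi (square (2*l)) (\<phi> n))"
      proof -
        have "ennreal ((2 * ?C / l^2)^2) * ennreal (160 * l^2) = ennreal (640 * ?C^2) * ennreal (1/l^2)"
        proof -
          have "(2 * ?C / l^2)^2 * (160 * l^2) = (640 * ?C^2) * (1/l^2)"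
            using l by (simp add: power2_eq_square field_simps)
          then show ?thesis by (metis ennreal_mult divide_nonneg_nonneg mult_nonneg_nonneg zero_le_numeral zero_le_one zero_le_power2)
        qed
        then show ?thesis unfolding K_def by (metis (no_types, lifting) mult.assoc)
      qed
      also have "\<dots> \<le> K * (ennreal (1/l^2) * (2 * sqi (square (2*l)) (\<lambda>p. \<phi> n p - z p) + 2 * sqi (square (2*l)) z))"
        by (intro mult_left_mono sqi_triangle_add) auto
      also have "\<dots> = (K * 2) * (ennreal (1 / l^2) * sqi (square (2 * l)) z) + (K * 2 * ennreal (1 / l^2)) * sqi (square (2 * l)) (\<lambda>p. \<phi> n p - z p)"
        by (simp add: distrib_left mult_ac add_ac)
      finally show "(NNINT p. ennreal (\<gamma> p * (\<bar>P p\<bar> * cut_slope (real k) p)))^2 \<le>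
          (K * 2) * (ennreal (1 / (real k)^2) * sqi (square (2 * real k)) z) + (K * 2 * ennreal (1 / (real k)^2)) * sqi (square (2 * real k)) (\<lambda>p. \<phi> n p - z p)"
        using pos by (simp add: l_def abs_mult)
      qed
    qed
  qed (use pos in auto)
qed

lemma ennreal_power2_tendsto_0:
  fixes X :: "nat \<Rightarrow> ennreal"
  assumes "X \<longlonglongrightarrow> 0" shows "(\<lambda>n. (X n)^2) \<longlonglongrightarrow> 0"
proof (rule tendsto_sandwich[of "\<lambda>_. 0" _ _ X])
  have "\<forall>\<^sub>F n in sequentially. X n < 1" using order_tendstoD(2)[OF assms, of 1] by simp
  then show "\<forall>\<^sub>F n in sequentially. (X n)^2 \<le> X n"
  proof eventually_elim
    case (elim n)
    then have "X n * X n \<le> X n * 1" by (intro mult_left_mono) auto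
    then show ?case by (simp add: power2_eq_square)
  qed
qed (use assms in auto)

lemma weighted_product_bound:
  fixes a :: "real^2 \<Rightarrow> real^2" and B :: "real^2 \<Rightarrow> real" and w :: "real^2 \<Rightarrow> ennreal"
  assumes [measurable]: "borel_fun a" "borel_fun B" "borel_fun w" "S \<in> sets borel"
    and B: "\<And>p. B p \<ge> 0"
  shows "(NNset S (\<lambda>p. ennreal (norm (a p) * B p) * w p))^2
    \<le> sqi UNIV B * NNset S (\<lambda>p. (w p)^2 * ennreal ((norm (a p))^2))"
proof -
  have "NNset S (\<lambda>p. ennreal (norm (a p) * B p) * w p)
      = (NNINT p. ennreal (B p) * (ennreal (norm (a p)) * w p * indicator S p))"
    using B by (intro nn_integral_cong) (simp add: ennreal_mult mult_ac)
  then have "(NNset S (\<lambda>p. ennreal (norm (a p) * B p) * w p))^2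
      \<le> (NNINT p. (ennreal (B p))^2) * (NNINT p. (ennreal (norm (a p)) * w p * indicator S p)^2)"
    using Cauchy_Schwarz_nn_integral[of "\<lambda>p. ennreal (B p)" lborel "\<lambda>p. ennreal (norm (a p)) * w p * indicator S p"] by simp
  also have "(NNINT p. (ennreal (B p))^2) = sqi UNIV B"
    using B by (simp add: sqi_def ennreal_power)
  also have "(NNINT p. (ennreal (norm (a p)) * w p * indicator S p)^2) = NNset S (\<lambda>p. (w p)^2 * ennreal ((norm (a p))^2))"
    by (intro nn_integral_cong) (auto simp: power_mult_distrib ennreal_power indicator_def mult_ac)
  finally show ?thesis .
qed

text \<open>Splits g into the decaying field f and the error g - f, and turns a statement about
  almost every line into one about almost every point.\<close>

lemma osc_AE_decay:
  fixes f g :: "real^2 \<Rightarrow> real^2"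
  assumes l: "l > 0" and [measurable]: "borel_fun f" "borel_fun g" and f: "AE p in lborel. (norm p + 1) * norm (f p) \<le> M"
  shows "AE p in (lborel :: (real^2) measure). l \<le> \<bar>p$i\<bar> \<longrightarrow> osc l g (p$i) \<le> ennreal (8 * M) + osc l (\<lambda>p. g p - f p) (p$i)"
proof -
  let ?N = "{y. \<not> (l \<le> \<bar>y\<bar> \<longrightarrow> osc l f y \<le> ennreal (8 * M))}"
  have "AE y in lborel. l \<le> \<bar>y\<bar> \<longrightarrow> osc l f y \<le> ennreal (8 * M)" by (rule osc_decay[OF l _ f]) measurable
  then have 0: "(NNINT y. indicator ?N y) = (0::ennreal)" by (subst nn_integral_0_iff_AE) (auto elim!: eventually_mono)
  have "(NNINT p::real^2. indicator ?N (p$i)) = (0::ennreal)"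
  proof (cases "i = 1")
    case True
    show ?thesis unfolding True using 0 by (subst nn_integral_plane(1)) auto
  next
    case False
    then have i: "i = 2" using exhaust_2 by blast
    show ?thesis unfolding i using 0 by (subst nn_integral_plane(2)) auto
  qed
  then have "AE p in (lborel :: (real^2) measure). l \<le> \<bar>p$i\<bar> \<longrightarrow> osc l f (p$i) \<le> ennreal (8 * M)"
    by (subst (asm) nn_integral_0_iff_AE) (auto elim!: eventually_mono simp: indicator_def split: if_splits)
  then show ?thesis
  proof eventually_elim
    case (elim p)
    have "osc l g (p$i) \<le> osc l f (p$i) + osc l (\<lambda>p. g p - f p) (p$i)" by (rule osc_triangle) auto
    then show ?case using elim by (meson add_right_mono order_trans)
  qed
qed

text \<open>Here only |a| B / (1 + |x|) is integrable, so the decay of z must be used, which the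
  approximants lack. Their oscillation is at most that of z plus that of the error. The former is at
  most 8M on the relevant lines and leaves an integral over the ring, which vanishes as k grows. The
  latter is a function of one coordinate whose square has integral at most 40k times the squared
  error, and \<open>appr_weight\<close> integrates |a|^2 against that square. The constant so
  obtained depends on k in an unknown way, but for fixed k the error vanishes with n.\<close>

lemma admissible_product:
  assumes z: "appr \<Omega> z A \<phi>" and M: "AE p in lborel. (norm p + 1) * norm (z p) \<le> M"
    and a: "appr \<Omega> a A' \<phi>'" and Ha: "sqi UNIV (\<lambda>p. a p /\<^sub>R (norm p + 1)) < top"
    and [measurable]: "borel_fun B" and B: "\<And>p. B p \<ge> 0" "sqi UNIV B < top"
  shows "admissible z \<phi> (\<lambda>p. norm (a p) * B p)"
proof -
  note D = apprD[OF z]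
  note [measurable] = D(1,2,5,6) apprD(1)[OF a]
  define C where "C = plateau_const"
  have C: "C \<ge> 1" unfolding C_def by (rule plateau_const)
  let ?\<gamma> = "\<lambda>p. norm (a p) * B p"
  have n: "norm p + 1 > 0" for p :: "real^2" using norm_ge_zero[of p] by linarith
  define M' where "M' = max M 0"
  have M': "M' \<ge> 0" "AE p in lborel. (norm p + 1) * norm (z p) \<le> M'"
    using M by (auto simp: M'_def elim!: eventually_mono)
  have G1: "(NNINT p. ennreal (?\<gamma> p / (norm p + 1))) < top"
  proof -
    have "(NNINT p. ennreal \<bar>?\<gamma> p / (norm p + 1)\<bar>)^2 \<le> sqi UNIV (\<lambda>p. a p /\<^sub>R (norm p + 1)) * sqi UNIV B"
      by (rule L2_pairing(1)) (use B in \<open>auto simp: abs_mult divide_inverse mult_ac\<close>)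
    also have "\<dots> < top" using Ha B by (simp add: ennreal_mult_less_top)
    finally show ?thesis using B by (simp add: power_less_top_ennreal)
  qed
  \<comment> \<open>Collects what \<open>appr_weight\<close> supplies on the square of half side 2k,
    so that the constants can be chosen for all k at once.\<close>
  define Q where "Q K k \<longleftrightarrow> K < top \<and> (\<forall>m. borel_fun m \<longrightarrow> NNset (square (2 * real k)) (\<lambda>p. m (p$2) * ennreal ((norm (a p))^2)) \<le> K * NNset {-2 * real k..2 * real k} m) \<and>
     (\<forall>m. borel_fun m \<longrightarrow> NNset (square (2 * real k)) (\<lambda>p. m (p$1) * ennreal ((norm (a p))^2)) \<le> K * NNset {-2 * real k..2 * real k} m)" for K and k :: nat
  have "\<exists>K. \<forall>k. 1 \<le> k \<longrightarrow> Q (K k) k"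
  proof (rule choice, rule allI)
    fix k :: nat
    show "\<exists>K. 1 \<le> k \<longrightarrow> Q K k"
    proof (cases "1 \<le> k")
      case True
      show ?thesis
      proof (rule appr_weight[OF a, of "2 * real k"])
        show "2 * real k > 0" using True by simp
      qed (use True in \<open>auto simp: Q_def intro!: exI\<close>)
    qed simp
  qed
  then obtain K where K: "\<And>k. 1 \<le> k \<Longrightarrow> Q (K k) k" by blast
  \<comment> \<open>80 = 5 * 16: each of the two directions contributes 8 M', and on the ring 1/k
    \<le> 5 / (|p| + 1).\<close>
  define x where "x k = ennreal (80 * M' * C) * NNset (ring_region (real k)) (\<lambda>p. ennreal (?\<gamma> p / (norm p + 1)))" for k :: nat
  have x: "x \<longlonglongrightarrow> 0" unfolding x_def
    by (intro ennreal_mult_tendsto_0 nn_integral_tail G1 eventually_in_square) auto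
  define L where "L k = (if 1 \<le> k then sqi UNIV B * (K k * ennreal (40 * real k)) else 0)" for k
  have L: "L k < top" for k unfolding L_def using B K by (auto simp: Q_def ennreal_mult_less_top)
  let ?e = "\<lambda>k n. sqi (square (2 * real k)) (\<lambda>p. \<phi> n p - z p)"
  show ?thesis
    unfolding admissible_def
  proof (intro conjI allI impI)
    show "(NNINT p. ennreal (?\<gamma> p * norm (z p))) < top"
    proof -
      have "(NNINT p. ennreal (?\<gamma> p * norm (z p))) \<le> (NNINT p. ennreal M' * ennreal (?\<gamma> p / (norm p + 1)))"
      proof (rule nn_integral_mono_AE, use M'(2) in eventually_elim)
        fix p assume "(norm p + 1) * norm (z p) \<le> M'"
        then have "?\<gamma> p / (norm p + 1) * ((norm p + 1) * norm (z p)) \<le> ?\<gamma> p / (norm p + 1) * M'"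
          using B n[of p] by (intro mult_left_mono divide_nonneg_pos) auto
        then have "?\<gamma> p * norm (z p) \<le> M' * (?\<gamma> p / (norm p + 1))" using n[of p] by (simp add: mult_ac)
        then have "ennreal (?\<gamma> p * norm (z p)) \<le> ennreal (M' * (?\<gamma> p / (norm p + 1)))" by (rule ennreal_leI)
        also have "\<dots> = ennreal M' * ennreal (?\<gamma> p / (norm p + 1))" using B M' n[of p] by (intro ennreal_mult) auto
        finally show "ennreal (?\<gamma> p * norm (z p)) \<le> ennreal M' * ennreal (?\<gamma> p / (norm p + 1))" .
      qed
      also have "\<dots> < top" using G1 by (simp add: nn_integral_cmult ennreal_mult_less_top)
      finally show ?thesis .
    qed
    show "(\<lambda>n. NNset (square r) (\<lambda>p. ennreal (?\<gamma> p * norm (\<phi> n p - z p)))) \<longlonglongrightarrow> 0" if r: "r > 0" for r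
    proof (rule ennreal_square_tendsto_0)
      show "(NNset (square r) (\<lambda>p. ennreal (?\<gamma> p * norm (\<phi> n p - z p))))^2
         \<le> sqi UNIV B * NNset (square r) (\<lambda>p. ennreal ((norm (a p))^2) * ennreal ((norm (\<phi> n p - z p))^2))" for n
        using weighted_product_bound[of a B "\<lambda>p. ennreal (norm (\<phi> n p - z p))" "square r"] B(1)
        by (simp add: ennreal_mult ennreal_power mult_ac)
      show "(\<lambda>n. sqi UNIV B * NNset (square r) (\<lambda>p. ennreal ((norm (a p))^2) * ennreal ((norm (\<phi> n p - z p))^2))) \<longlonglongrightarrow> 0"
        by (rule ennreal_mult_tendsto_0[OF appr_product[OF a z r] B(2)])
    qed
    show "\<exists>X Y. X \<longlonglongrightarrow> 0 \<and> (\<forall>k. Y k \<longlonglongrightarrow> 0) \<and> (\<forall>k\<ge>1. \<forall>n. trunc_error_bound (real k) (\<phi> n) ?\<gamma> (X k + Y k n))"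
    proof (intro exI conjI allI impI)
      show "(\<lambda>k. 2 * (x k)^2) \<longlonglongrightarrow> 0"
        by (intro ennreal_mult_tendsto_0 ennreal_power2_tendsto_0 x) simp
      show "(\<lambda>n. (8 * (ennreal (C / real k))^2 * L k) * ?e k n) \<longlonglongrightarrow> 0" for k
        using L by (intro ennreal_mult_tendsto_0 D(7)) (auto simp: ennreal_mult_less_top power_less_top_ennreal)
      fix k n :: nat assume k: "1 \<le> k"
      define l where "l = real k"
      have l: "l \<ge> 1" "l > 0" using k by (auto simp: l_def)
      define m2 where "m2 = osc l (\<lambda>p. \<phi> n p - z p)"
      define m1 where "m1 = osc l (\<lambda>p. \<phi> n (swp p) - z (swp p))"
      have [measurable]: "borel_fun m1" "borel_fun m2"
        unfolding m1_def m2_def by measurable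
      have o2: "AE p in (lborel :: (real^2) measure). l \<le> \<bar>p$2\<bar> \<longrightarrow> osc l (\<phi> n) (p$2) \<le> ennreal (8 * M') + m2 (p$2)"
        unfolding m2_def by (rule osc_AE_decay[OF l(2) _ _ M'(2)]) measurable
      have "AE p in lborel. (norm (swp p) + 1) * norm (z (swp p)) \<le> M'" by (rule AE_swp[OF M'(2)]) measurable
      then have Ms: "AE p in lborel. (norm p + 1) * norm (z (swp p)) \<le> M'" by simp
      have o1: "AE p in (lborel :: (real^2) measure). l \<le> \<bar>p$1\<bar> \<longrightarrow> osc l (\<lambda>p. \<phi> n (swp p)) (p$1) \<le> ennreal (8 * M') + m1 (p$1)"
        unfolding m1_def by (rule osc_AE_decay[OF l(2) _ _ Ms]) measurable
      show "trunc_error_bound (real k) (\<phi> n) ?\<gamma> (2 * (x k)^2 + (8 * (ennreal (C / real k))^2 * L k) * ?e k n)"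
        unfolding trunc_error_bound_def l_def[symmetric]
      proof (intro allI impI)
        fix P assume *: "borel_fun P" "\<forall>p\<in>square (2*l). ennreal \<bar>P p\<bar> \<le> osc l (\<phi> n) (p$2)"
          "\<forall>p\<in>square (2*l). ennreal \<bar>P p\<bar> \<le> osc l (\<lambda>p. \<phi> n (swp p)) (p$1)"
        note [measurable] = *(1)
        let ?I1 = "NNset (square (2*l)) (\<lambda>p. ennreal (?\<gamma> p) * m1 (p$1))"
        let ?I2 = "NNset (square (2*l)) (\<lambda>p. ennreal (?\<gamma> p) * m2 (p$2))"
        have "(NNINT p. ennreal (?\<gamma> p * (\<bar>P p\<bar> * cut_slope l p))) \<le>
          (NNINT p. ennreal (80 * M' * C) * (ennreal (?\<gamma> p / (norm p + 1)) * indicator (ring_region l) p)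
             + (ennreal (C/l) * (ennreal (?\<gamma> p) * m1 (p$1) * indicator (square (2*l)) p) + ennreal (C/l) * (ennreal (?\<gamma> p) * m2 (p$2) * indicator (square (2*l)) p)))"
        proof (rule nn_integral_mono_AE, use o1 o2 in eventually_elim)
          fix p :: "real^2" assume o: "l \<le> \<bar>p$1\<bar> \<longrightarrow> osc l (\<lambda>p. \<phi> n (swp p)) (p$1) \<le> ennreal (8 * M') + m1 (p$1)"
            "l \<le> \<bar>p$2\<bar> \<longrightarrow> osc l (\<phi> n) (p$2) \<le> ennreal (8 * M') + m2 (p$2)"
          show "ennreal (?\<gamma> p * (\<bar>P p\<bar> * cut_slope l p)) \<le> ennreal (80 * M' * C) * (ennreal (?\<gamma> p / (norm p + 1)) * indicator (ring_region l) p)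
             + (ennreal (C/l) * (ennreal (?\<gamma> p) * m1 (p$1) * indicator (square (2*l)) p) + ennreal (C/l) * (ennreal (?\<gamma> p) * m2 (p$2) * indicator (square (2*l)) p))"
          proof (cases "p \<in> ring_region l")
            case False
            then have "cut_grad l 1 p = 0" "cut_grad l 2 p = 0" using cut_grad_support(3)[OF l(2)] by auto
            then show ?thesis by simp
          next
            case True
            then have sq: "p \<in> square (2*l)" by (simp add: ring_region_def)
            have b1: "ennreal (\<bar>P p\<bar> * \<bar>cut_grad l 1 p\<bar>) \<le> ennreal (C/l) * (ennreal (8 * M') + m1 (p$1))"
            proof (cases "cut_grad l 1 p = 0")
              case False
              then have "ennreal \<bar>P p\<bar> \<le> ennreal (8 * M') + m1 (p$1)"
                using cut_grad_support(1)[OF l(2), of p] o(1) *(3) sq by (meson order_trans)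
              moreover have "ennreal \<bar>cut_grad l 1 p\<bar> \<le> ennreal (C/l)" unfolding C_def by (intro ennreal_leI cut_grad_bounds l)
              ultimately have "ennreal \<bar>P p\<bar> * ennreal \<bar>cut_grad l 1 p\<bar> \<le> (ennreal (8 * M') + m1 (p$1)) * ennreal (C/l)"
                by (rule mult_mono) auto
              then show ?thesis unfolding mult.commute[of "ennreal (C/l)"] by (simp add: ennreal_mult)
            qed simp
            have b2: "ennreal (\<bar>P p\<bar> * \<bar>cut_grad l 2 p\<bar>) \<le> ennreal (C/l) * (ennreal (8 * M') + m2 (p$2))"
            proof (cases "cut_grad l 2 p = 0")
              case False
              then have "ennreal \<bar>P p\<bar> \<le> ennreal (8 * M') + m2 (p$2)"
                using cut_grad_support(2)[OF l(2), of p] o(2) *(2) sq by (meson order_trans)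
              moreover have "ennreal \<bar>cut_grad l 2 p\<bar> \<le> ennreal (C/l)" unfolding C_def by (intro ennreal_leI cut_grad_bounds l)
              ultimately have "ennreal \<bar>P p\<bar> * ennreal \<bar>cut_grad l 2 p\<bar> \<le> (ennreal (8 * M') + m2 (p$2)) * ennreal (C/l)"
                by (rule mult_mono) auto
              then show ?thesis unfolding mult.commute[of "ennreal (C/l)"] by (simp add: ennreal_mult)
            qed simp
            have main: "ennreal (?\<gamma> p) * (ennreal (C/l) * ennreal (16 * M')) \<le> ennreal (80 * M' * C) * ennreal (?\<gamma> p / (norm p + 1))"
            proof -
              have "1/l \<le> 5 / (norm p + 1)" using ring_region_norm(2)[OF True l(1)] l n[of p] by (simp add: field_simps)
              then have "(?\<gamma> p * 16 * M' * C) * (1/l) \<le> (?\<gamma> p * 16 * M' * C) * (5 / (norm p + 1))"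
                using B M' C by (intro mult_left_mono) auto
              then have "ennreal (?\<gamma> p * ((C/l) * (16 * M'))) \<le> ennreal ((80 * M' * C) * (?\<gamma> p / (norm p + 1)))"
                by (intro ennreal_leI) (simp add: mult_ac)
              moreover have "ennreal (?\<gamma> p * ((C/l) * (16 * M'))) = ennreal (?\<gamma> p) * (ennreal (C/l) * ennreal (16 * M'))"
              proof -
                have "ennreal ((C/l) * (16 * M')) = ennreal (C/l) * ennreal (16 * M')"
                  using C M' l by (intro ennreal_mult) auto
                moreover have "ennreal (?\<gamma> p * ((C/l) * (16 * M'))) = ennreal (?\<gamma> p) * ennreal ((C/l) * (16 * M'))"
                  using B M' C l by (intro ennreal_mult mult_nonneg_nonneg divide_nonneg_nonneg) auto
                ultimately show ?thesis by simp
              qed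
              moreover have "ennreal ((80 * M' * C) * (?\<gamma> p / (norm p + 1))) = ennreal (80 * M' * C) * ennreal (?\<gamma> p / (norm p + 1))"
                using B M' C n[of p] by (intro ennreal_mult) auto
              ultimately show ?thesis by simp
            qed
            have "ennreal (?\<gamma> p * (\<bar>P p\<bar> * cut_slope l p))
              = ennreal (?\<gamma> p) * (ennreal (\<bar>P p\<bar> * \<bar>cut_grad l 1 p\<bar>) + ennreal (\<bar>P p\<bar> * \<bar>cut_grad l 2 p\<bar>))"
              using B(1) by (subst ennreal_plus[symmetric], simp, simp, subst ennreal_mult[symmetric]) (auto simp: distrib_left)
            also have "\<dots> \<le> ennreal (?\<gamma> p) * (ennreal (C/l) * (ennreal (8 * M') + m1 (p$1)) + ennreal (C/l) * (ennreal (8 * M') + m2 (p$2)))"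
              by (intro mult_left_mono add_mono b1 b2) auto
            also have "\<dots> = ennreal (?\<gamma> p) * (ennreal (C/l) * (ennreal (8 * M') + ennreal (8 * M'))) + (ennreal (C/l) * (ennreal (?\<gamma> p) * m1 (p$1)) + ennreal (C/l) * (ennreal (?\<gamma> p) * m2 (p$2)))"
              by (simp only: distrib_left mult_ac add_ac)
            also have "ennreal (8 * M') + ennreal (8 * M') = ennreal (16 * M')" using M' by (simp flip: ennreal_plus)
            also have "ennreal (?\<gamma> p) * (ennreal (C/l) * ennreal (16 * M')) + (ennreal (C/l) * (ennreal (?\<gamma> p) * m1 (p$1)) + ennreal (C/l) * (ennreal (?\<gamma> p) * m2 (p$2)))
              \<le> ennreal (80 * M' * C) * ennreal (?\<gamma> p / (norm p + 1)) + (ennreal (C/l) * (ennreal (?\<gamma> p) * m1 (p$1)) + ennreal (C/l) * (ennreal (?\<gamma> p) * m2 (p$2)))"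
              by (intro add_right_mono main)
            finally show ?thesis using True sq by simp
          qed
        qed
        also have "\<dots> = x k + (ennreal (C/l) * ?I1 + ennreal (C/l) * ?I2)"
          unfolding x_def l_def[symmetric] by (simp add: nn_integral_add nn_integral_cmult)
        finally have main: "(NNINT p. ennreal (?\<gamma> p * (\<bar>P p\<bar> * cut_slope l p))) \<le> x k + (ennreal (C/l) * ?I1 + ennreal (C/l) * ?I2)" .
        have I2: "?I2^2 \<le> L k * ?e k n"
        proof -
          have "?I2^2 \<le> sqi UNIV B * NNset (square (2*l)) (\<lambda>p. (m2 (p$2))^2 * ennreal ((norm (a p))^2))"
            by (rule weighted_product_bound) (use B in auto)
          also have "\<dots> \<le> sqi UNIV B * (K k * NNset {-2*l..2*l} (\<lambda>y. (m2 y)^2))"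
            using K[OF k, unfolded Q_def, THEN conjunct2, THEN conjunct1, rule_format, of "\<lambda>y. (m2 y)^2"] by (intro mult_left_mono) (auto simp: l_def)
          also have "\<dots> \<le> sqi UNIV B * (K k * (ennreal (40 * l) * ?e k n))"
            unfolding m2_def l_def using l by (intro mult_left_mono osc_sq_integral) (auto simp: l_def)
          finally show ?thesis using k by (simp add: L_def l_def mult.assoc)
        qed
        have I1: "?I1^2 \<le> L k * ?e k n"
        proof -
          have "?I1^2 \<le> sqi UNIV B * NNset (square (2*l)) (\<lambda>p. (m1 (p$1))^2 * ennreal ((norm (a p))^2))"
            by (rule weighted_product_bound) (use B in auto)
          also have "\<dots> \<le> sqi UNIV B * (K k * NNset {-2*l..2*l} (\<lambda>y. (m1 y)^2))"
            using K[OF k, unfolded Q_def, THEN conjunct2, THEN conjunct2, rule_format, of "\<lambda>y. (m1 y)^2"] by (intro mult_left_mono) (auto simp: l_def)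
          also have "\<dots> \<le> sqi UNIV B * (K k * (ennreal (40 * l) * sqi (square (2*l)) (\<lambda>p. \<phi> n (swp p) - z (swp p))))"
            unfolding m1_def using l by (intro mult_left_mono osc_sq_integral) auto
          also have "sqi (square (2*l)) (\<lambda>p. \<phi> n (swp p) - z (swp p)) = sqi (square (2*l)) (\<lambda>p. \<phi> n p - z p)"
            by (rule sqi_swp) measurable
          finally show ?thesis using k by (simp add: L_def l_def mult.assoc)
        qed
        have "(NNINT p. ennreal (?\<gamma> p * (\<bar>P p\<bar> * cut_slope l p)))^2 \<le> (x k + (ennreal (C/l) * ?I1 + ennreal (C/l) * ?I2))^2"
          by (intro power_mono main) auto
        also have "\<dots> \<le> 2 * (x k)^2 + 2 * (ennreal (C/l) * ?I1 + ennreal (C/l) * ?I2)^2" by (rule sq_sum_ennreal)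
        \<comment> \<open>Two splittings of a square and two equal contributions, one per
          coordinate, make up the factor 8.\<close>
        also have "\<dots> \<le> 2 * (x k)^2 + 2 * (2 * (ennreal (C/l) * ?I1)^2 + 2 * (ennreal (C/l) * ?I2)^2)"
          by (intro add_left_mono mult_left_mono sq_sum_ennreal) auto
        also have "\<dots> \<le> 2 * (x k)^2 + 2 * (2 * ((ennreal (C/l))^2 * (L k * ?e k n)) + 2 * ((ennreal (C/l))^2 * (L k * ?e k n)))"
          unfolding power_mult_distrib by (intro add_left_mono mult_left_mono add_mono I1 I2) auto
        also have "\<dots> = 2 * (x k)^2 + (8 * (ennreal (C/l))^2 * L k) * ?e k n"
          by (simp add: mult_2[symmetric] mult.assoc[symmetric])
        finally show "(NNINT p. ennreal (?\<gamma> p * (\<bar>P p\<bar> * cut_slope l p)))^2 \<le> 2 * (x k)^2 + (8 * (ennreal (C/l))^2 * L k) * sqi (square (2*l)) (\<lambda>p. \<phi> n p - z p)"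
          by (simp add: l_def)
      qed
    qed
  qed (use B in auto)
qed

lemma trunc_norm_diff:
  assumes k: "k > 0"
  shows "norm (trunc k P \<phi> p - z p) \<le> indicator (square (2*k)) p * norm (\<phi> p - z p) + indicator (- square k) p * norm (z p)
    + \<bar>P p\<bar> * cut_slope k p"
proof -
  have eq: "trunc k P \<phi> p - z p = cut k p *\<^sub>R (\<phi> p - z p) + (cut k p - 1) *\<^sub>R z p + P p *\<^sub>R pt (cut_grad k 2 p) (- cut_grad k 1 p)"
    by (simp add: trunc_def vec_eq_iff forall_2 algebra_simps)
  have "norm (trunc k P \<phi> p - z p) \<le> norm (cut k p *\<^sub>R (\<phi> p - z p)) + norm ((cut k p - 1) *\<^sub>R z p) + norm (P p *\<^sub>R pt (cut_grad k 2 p) (- cut_grad k 1 p))"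
    unfolding eq using norm_triangle_ineq add_mono norm_triangle_mono order_refl by metis
  moreover have "norm (cut k p *\<^sub>R (\<phi> p - z p)) \<le> indicator (square (2*k)) p * norm (\<phi> p - z p)"
    using cut_bounds[of k p] cut_values(2)[OF k, of p] by (cases "p \<in> square (2*k)") (auto intro: mult_left_le_one_le)
  moreover have "norm ((cut k p - 1) *\<^sub>R z p) \<le> indicator (- square k) p * norm (z p)"
    using cut_bounds[of k p] cut_values(1)[OF k, of p] by (cases "p \<in> square k") (auto intro: mult_left_le_one_le)
  moreover have "norm (P p *\<^sub>R pt (cut_grad k 2 p) (- cut_grad k 1 p)) \<le> \<bar>P p\<bar> * cut_slope k p"
  proof -
    have "norm (pt (cut_grad k 2 p) (- cut_grad k 1 p)) \<le> \<bar>cut_grad k 1 p\<bar> + \<bar>cut_grad k 2 p\<bar>"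
      using norm_le_l1_cart[of "pt (cut_grad k 2 p) (- cut_grad k 1 p)"] by (simp add: sum_2)
    then show ?thesis by (simp add: mult_left_mono)
  qed
  ultimately show ?thesis by linarith
qed

lemma compact_compl_bound:
  assumes "compact (- \<Omega> :: (real^2) set)"
  obtains k0 :: nat where "k0 \<ge> 1" "\<And>k. k \<ge> k0 \<Longrightarrow> - \<Omega> \<subseteq> {p. \<bar>p$1\<bar> < real k \<and> \<bar>p$2\<bar> < real k}"
proof -
  obtain B where B: "\<And>p. p \<in> - \<Omega> \<Longrightarrow> norm p \<le> B"
    using compact_imp_bounded[OF assms] by (meson bounded_iff)
  obtain k0 :: nat where k0: "B < k0" using reals_Archimedean2 by blast
  show ?thesis
  proof (rule that[of "max 1 k0"])
    fix k assume "max 1 k0 \<le> k"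
    then have "B < real k" using k0 by linarith
    then show "- \<Omega> \<subseteq> {p. \<bar>p$1\<bar> < real k \<and> \<bar>p$2\<bar> < real k}"
      using B component_le_norm_cart order_trans by (fastforce intro: le_less_trans)
  qed auto
qed

text \<open>\<tau> is the value that the identity should give at z. The hypothesis on test fields
  says that they miss it by at most their Dirichlet distance to z, and the truncation of the n-th
  approximant at radius k is such a test field. Its distance to z is controlled by
  \<open>trunc_grad_estimate\<close>, and its pairing with g by admissibility.\<close>

lemma test_with_limit:
  assumes \<Omega>: "compact (- \<Omega>)" and ap: "appr \<Omega> z A \<phi>" and H: "sqi UNIV (\<lambda>p. z p /\<^sub>R (norm p + 1)) < top"
    and adm: "admissible z \<phi> \<gamma>" and [measurable]: "borel_fun g"
    and g: "AE p in lborel. norm (g p) \<le> \<gamma> p"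
    and T: "\<And>\<Phi>. \<Phi> \<in> solenoidal_test_functions \<Omega> \<Longrightarrow> ennreal (((LBINT p. g p \<bullet> \<Phi> p) - \<tau>)^2) \<le> K * sqi UNIV (\<lambda>p. grad \<Phi> p - A p)"
    and K: "K < top"
  shows "(LBINT p. g p \<bullet> z p) = \<tau>"
proof -
  let ?I = "LBINT p. g p \<bullet> z p"
  note D = apprD[OF ap]
  note [measurable] = D(1,2,5,6)
  have [measurable]: "borel_fun \<gamma>" and pos: "\<And>p. \<gamma> p \<ge> 0" and gz: "(NNINT p. ennreal (\<gamma> p * norm (z p))) < top"
    and gc: "\<And>r. r > 0 \<Longrightarrow> (\<lambda>n. NNset (square r) (\<lambda>p. ennreal (\<gamma> p * norm (\<phi> n p - z p)))) \<longlonglongrightarrow> 0"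
    using adm by (auto simp: admissible_def)
  obtain X Y where XY: "X \<longlonglongrightarrow> 0" "\<And>k. Y k \<longlonglongrightarrow> 0" "\<And>k n. k \<ge> 1 \<Longrightarrow> trunc_error_bound (real k) (\<phi> n) \<gamma> (X k + Y k n)"
    using adm unfolding admissible_def by blast
  obtain k0 :: nat where k0: "k0 \<ge> 1" "\<And>k. k \<ge> k0 \<Longrightarrow> - \<Omega> \<subseteq> {p. \<bar>p$1\<bar> < real k \<and> \<bar>p$2\<bar> < real k}"
    by (rule compact_compl_bound[OF \<Omega>]) (rule that)
  define C where "C = ennreal trunc_const"
  have C: "C < top" by (simp add: C_def)
  define t where "t k = NNset (- square (real k)) (\<lambda>p. ennreal (\<gamma> p * norm (z p)))" for k :: nat
  have t: "t \<longlonglongrightarrow> 0" unfolding t_def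
    using eventually_in_square(1) by (intro nn_integral_tail gz) (auto simp: borel_closed)
  define c where "c k n = NNset (square (2 * real k)) (\<lambda>p. ennreal (\<gamma> p * norm (\<phi> n p - z p)))" for k n :: nat
  define s where "s k = sqi (- square (real k)) A" for k :: nat
  have s: "s \<longlonglongrightarrow> 0" unfolding s_def sqi_def
    using D(10) eventually_in_square(1) by (intro nn_integral_tail) (auto simp: sqi_def)
  define y where "y k = ennreal (1 / (real k)^2) * sqi (square (2 * real k)) z" for k :: nat
  have y: "y \<longlonglongrightarrow> 0" unfolding y_def by (rule weighted_tail[OF _ H]) measurable
  define e where "e k n = ennreal (1 / (real k)^2) * sqi (square (2 * real k)) (\<lambda>p. \<phi> n p - z p)" for k n :: nat
  have e: "(\<lambda>n. e k n) \<longlonglongrightarrow> 0" for k unfolding e_def by (intro ennreal_mult_tendsto_0 D(7)) auto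
  define d where "d n = sqi UNIV (\<lambda>p. grad (\<phi> n) p - A p)" for n
  have d: "d \<longlonglongrightarrow> 0" unfolding d_def by (rule D(8))
  \<comment> \<open>All errors are sorted into those that depend on k alone and those that vanish
    with n for each fixed k.\<close>
  define U where "U k = 2 * (2 * (2 * (t k)^2) + 2 * X k) + 2 * (K * (2 * (C * (2 * s k + 2 * y k))))" for k
  define V where "V k n = 2 * (2 * (2 * (c k n)^2) + 2 * Y k n) + 2 * (K * (2 * (C * (2 * d n + 2 * e k n)) + 2 * d n))" for k n
  have U: "U \<longlonglongrightarrow> 0"
  proof -
    have "U \<longlonglongrightarrow> 2 * (2 * (2 * 0) + 2 * 0) + 2 * (K * (2 * (C * (2 * 0 + 2 * 0))))"
      unfolding U_def using K C by (intro tendsto_add ennreal_tendsto_cmult ennreal_power2_tendsto_0 t XY(1) s y) auto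
    then show ?thesis by simp
  qed
  have V: "(\<lambda>n. V k n) \<longlonglongrightarrow> 0" if "k \<ge> k0" for k
  proof -
    have "(\<lambda>n. c k n) \<longlonglongrightarrow> 0" unfolding c_def by (rule gc) (use that k0(1) in auto)
    then have "(\<lambda>n. V k n) \<longlonglongrightarrow> 2 * (2 * (2 * 0) + 2 * 0) + 2 * (K * (2 * (C * (2 * 0 + 2 * 0)) + 2 * 0))"
      unfolding V_def using K C by (intro tendsto_add ennreal_tendsto_cmult ennreal_power2_tendsto_0 XY(2) d e) auto
    then show ?thesis by simp
  qed
  have gb: "ennreal (norm (a \<bullet> b)) \<le> ennreal (c * norm b)" if "norm a \<le> c" for a b :: "real^2" and c
    using order_trans[OF Cauchy_Schwarz_ineq2 mult_right_mono[OF that norm_ge_zero], of b] by (intro ennreal_leI) simp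
  have main: "ennreal ((?I - \<tau>)^2) \<le> U k + V k n" if k: "k \<ge> k0" for k n
  proof -
    have k': "k \<ge> 1" "real k > 0" using k k0(1) by auto
    obtain \<psi> where \<psi>: "smooth \<psi>" "\<And>x. partial 1 \<psi> x = - (\<phi> n x $ 2)" "\<And>x. partial 2 \<psi> x = \<phi> n x $ 1"
      by (rule stream_function[OF D(3)[of n]]) (rule that)
    have "\<bar>partial 1 \<psi> p\<bar> \<le> norm (\<phi> n p)" "\<bar>partial 2 \<psi> p\<bar> \<le> norm (\<phi> n p)" for p
      using component_le_norm_cart[of "\<phi> n p"] by (auto simp: \<psi>)
    then obtain c0 where c0: "\<And>p. p \<in> square (2 * real k) \<Longrightarrow> ennreal \<bar>\<psi> p - c0\<bar> \<le> osc (real k) (\<phi> n) (p$2)"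
      "\<And>p. p \<in> square (2 * real k) \<Longrightarrow> ennreal \<bar>\<psi> p - c0\<bar> \<le> osc (real k) (\<lambda>p. \<phi> n (swp p)) (p$1)"
      using osc_bound[OF k'(2) \<psi>(1), of "\<phi> n"] D(5) by metis
    \<comment> \<open>The truncation depends on the additive constant of the stream function; this
      choice turns the oscillation bounds into bounds of P itself.\<close>
    define P where "P = (\<lambda>p. \<psi> p - c0)"
    have P: "smooth P" "\<And>p. partial 1 P p = - (\<phi> n p $ 2)" "\<And>p. partial 2 P p = \<phi> n p $ 1"
      unfolding P_def using \<psi> by (auto simp: partial_diff smooth_differentiable)
    note [measurable] = smooth_measurable[OF P(1)]
    let ?\<Phi> = "trunc (real k) P (\<phi> n)"
    let ?J = "LBINT p. g p \<bullet> ?\<Phi> p"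
    have \<Phi>: "?\<Phi> \<in> solenoidal_test_functions \<Omega>" by (rule trunc_solenoidal(1)[OF D(3) k'(2) k0(2)[OF k] P])
    note [measurable] = test_functions_measurable[OF solenoidal_test[OF \<Phi>]]
    have "sqi UNIV (\<lambda>p. grad ?\<Phi> p - grad (\<phi> n) p) \<le> C * (sqi (- square (real k)) (grad (\<phi> n)) + ennreal (1/(real k)^2) * sqi (square (2 * real k)) (\<phi> n))"
      unfolding C_def by (rule trunc_grad_estimate[OF D(3) k'(2) k0(2)[OF k] P]) (use c0 in \<open>simp add: P_def\<close>)
    also have "\<dots> \<le> C * ((2 * d n + 2 * s k) + (2 * e k n + 2 * y k))"
    proof (intro mult_left_mono add_mono)
      have "sqi (- square (real k)) (grad (\<phi> n)) \<le> 2 * sqi (- square (real k)) (\<lambda>p. grad (\<phi> n) p - A p) + 2 * sqi (- square (real k)) A"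
        by (rule sqi_triangle_add) auto
      also have "\<dots> \<le> 2 * d n + 2 * s k"
        unfolding d_def s_def by (intro add_mono mult_left_mono sqi_mono_set) auto
      finally show "sqi (- square (real k)) (grad (\<phi> n)) \<le> 2 * d n + 2 * s k" .
      have "sqi (square (2 * real k)) (\<phi> n) \<le> 2 * sqi (square (2 * real k)) (\<lambda>p. \<phi> n p - z p) + 2 * sqi (square (2 * real k)) z"
        by (rule sqi_triangle_add) auto
      then have "ennreal (1/(real k)^2) * sqi (square (2 * real k)) (\<phi> n) \<le> ennreal (1/(real k)^2) * (2 * sqi (square (2 * real k)) (\<lambda>p. \<phi> n p - z p) + 2 * sqi (square (2 * real k)) z)"
        by (rule mult_left_mono) auto
      also have "\<dots> = 2 * e k n + 2 * y k" unfolding e_def y_def by (simp only: distrib_left mult_ac)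
      finally show "ennreal (1/(real k)^2) * sqi (square (2 * real k)) (\<phi> n) \<le> 2 * e k n + 2 * y k" .
    qed auto
    finally have gr: "sqi UNIV (\<lambda>p. grad ?\<Phi> p - grad (\<phi> n) p) \<le> C * ((2 * d n + 2 * s k) + (2 * e k n + 2 * y k))" .
    have "sqi UNIV (\<lambda>p. grad ?\<Phi> p - A p) \<le> 2 * sqi UNIV (\<lambda>p. grad ?\<Phi> p - grad (\<phi> n) p) + 2 * d n"
      unfolding d_def sqi_minus[of UNIV "grad (\<phi> n)" A]
      using sqi_triangle_diff[of "grad ?\<Phi>" "grad (\<phi> n)" A UNIV] grad_measurable[OF solenoidal_test[OF \<Phi>]] by simp
    also have "\<dots> \<le> 2 * (C * ((2 * d n + 2 * s k) + (2 * e k n + 2 * y k))) + 2 * d n"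
      by (intro add_mono mult_left_mono gr) auto
    finally have E2: "ennreal ((?J - \<tau>)^2) \<le> K * (2 * (C * ((2 * d n + 2 * s k) + (2 * e k n + 2 * y k))) + 2 * d n)"
      using T[OF \<Phi>] by (meson mult_left_mono order_trans zero_le)
    define q where "q = (NNINT p. ennreal (\<gamma> p * (\<bar>P p\<bar> * cut_slope (real k) p)))"
    have q: "q^2 \<le> X k + Y k n"
      unfolding q_def using c0
      by (intro XY(3)[OF k'(1), of n, unfolded trunc_error_bound_def, rule_format]) (auto simp: P_def[symmetric] fun_cong[OF P_def, symmetric])
    have "(NNINT p. ennreal (\<gamma> p * norm (?\<Phi> p - z p))) \<le> (NNINT p. ennreal (\<gamma> p * norm (\<phi> n p - z p)) * indicator (square (2 * real k)) p
       + ennreal (\<gamma> p * norm (z p)) * indicator (- square (real k)) p + ennreal (\<gamma> p * (\<bar>P p\<bar> * cut_slope (real k) p)))"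
    proof (intro nn_integral_mono)
      fix p
      have ind: "ennreal x * indicator S p = ennreal (x * indicator S p)" for x and S :: "(real^2) set" by (simp add: indicator_def)
      have "\<gamma> p * norm (?\<Phi> p - z p) \<le> \<gamma> p * (indicator (square (2 * real k)) p * norm (\<phi> n p - z p) + indicator (- square (real k)) p * norm (z p)
        + \<bar>P p\<bar> * cut_slope (real k) p)"
        by (intro mult_left_mono trunc_norm_diff k' pos)
      also have "\<dots> = \<gamma> p * norm (\<phi> n p - z p) * indicator (square (2 * real k)) p + \<gamma> p * norm (z p) * indicator (- square (real k)) p
         + \<gamma> p * (\<bar>P p\<bar> * cut_slope (real k) p)"
        by (simp add: algebra_simps)
      finally show "ennreal (\<gamma> p * norm (?\<Phi> p - z p)) \<le> ennreal (\<gamma> p * norm (\<phi> n p - z p)) * indicator (square (2 * real k)) p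
       + ennreal (\<gamma> p * norm (z p)) * indicator (- square (real k)) p + ennreal (\<gamma> p * (\<bar>P p\<bar> * cut_slope (real k) p))"
        unfolding ind using pos[of p] by (simp add: ennreal_plus[symmetric] ennreal_leI del: ennreal_plus)
    qed
    also have "\<dots> = c k n + t k + q"
      unfolding c_def t_def q_def by (subst nn_integral_add, measurable, subst nn_integral_add) (auto simp: borel_closed)
    finally have E0: "(NNINT p. ennreal (\<gamma> p * norm (?\<Phi> p - z p))) \<le> t k + c k n + q" by (simp add: add_ac)
    have E1: "ennreal \<bar>?I - ?J\<bar> \<le> t k + c k n + q"
    proof (cases "(NNINT p. ennreal (\<gamma> p * norm (?\<Phi> p - z p))) < top")
      case True
      have int: "integrable lborel (\<lambda>p. g p \<bullet> h p)" if [measurable]: "borel_fun h" and "(NNINT p. ennreal (\<gamma> p * norm (h p))) < top" for h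
      proof (rule integrableI_bounded)
        have "(NNINT p. ennreal (norm (g p \<bullet> h p))) \<le> (NNINT p. ennreal (\<gamma> p * norm (h p)))"
          by (rule nn_integral_mono_AE, use g in eventually_elim)
             (rule gb)
        then show "(NNINT p. ennreal (norm (g p \<bullet> h p))) < \<infinity>" using that(2) by (simp add: le_less_trans)
      qed measurable
      have i1: "integrable lborel (\<lambda>p. g p \<bullet> z p)" and i2: "integrable lborel (\<lambda>p. g p \<bullet> (?\<Phi> p - z p))"
        using int[of z] int[of "\<lambda>p. ?\<Phi> p - z p"] gz True by auto
      have "?J = (LBINT p. g p \<bullet> (?\<Phi> p - z p) + g p \<bullet> z p)"
        by (simp add: inner_diff_right)
      also have "\<dots> = (LBINT p. g p \<bullet> (?\<Phi> p - z p)) + ?I"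
        by (rule Bochner_Integration.integral_add[OF i2 i1])
      finally have "\<bar>?I - ?J\<bar> = norm (LBINT p. g p \<bullet> (?\<Phi> p - z p))" by simp
      then have "ennreal \<bar>?I - ?J\<bar> \<le> (NNINT p. ennreal (norm (g p \<bullet> (?\<Phi> p - z p))))"
        using integral_norm_bound_ennreal[OF i2] by simp
      also have "\<dots> \<le> (NNINT p. ennreal (\<gamma> p * norm (?\<Phi> p - z p)))"
        by (rule nn_integral_mono_AE, use g in eventually_elim)
           (rule gb)
      finally show ?thesis using E0 by (rule order_trans)
    next
      case False
      then have tt: "t k + c k n + q = top" using E0 by (simp add: less_top[symmetric] top_unique)
      show ?thesis unfolding tt by (rule top_greatest)
    qed
    have "(?I - \<tau>)^2 \<le> 2 * \<bar>?I - ?J\<bar>^2 + 2 * (?J - \<tau>)^2"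
      using norm_sum_sq[of "?I - ?J" "?J - \<tau>"] by simp
    then have "ennreal ((?I - \<tau>)^2) \<le> ennreal (2 * \<bar>?I - ?J\<bar>^2 + 2 * (?J - \<tau>)^2)"
      by (rule ennreal_leI)
    also have "\<dots> = 2 * (ennreal \<bar>?I - ?J\<bar>)^2 + 2 * ennreal ((?J - \<tau>)^2)"
      by (simp add: ennreal_mult ennreal_power ennreal_plus)
    also have "\<dots> \<le> 2 * (t k + c k n + q)^2 + 2 * (K * (2 * (C * ((2 * d n + 2 * s k) + (2 * e k n + 2 * y k))) + 2 * d n))"
      by (intro add_mono mult_left_mono power_mono E1 E2) auto
    also have "\<dots> \<le> 2 * (2 * (2 * (t k)^2 + 2 * (c k n)^2) + 2 * (X k + Y k n)) + 2 * (K * (2 * (C * ((2 * d n + 2 * s k) + (2 * e k n + 2 * y k))) + 2 * d n))"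
    proof (intro add_right_mono mult_left_mono)
      have "(t k + c k n + q)^2 \<le> 2 * (t k + c k n)^2 + 2 * q^2" by (rule sq_sum_ennreal)
      also have "\<dots> \<le> 2 * (2 * (t k)^2 + 2 * (c k n)^2) + 2 * (X k + Y k n)"
        by (intro add_mono mult_left_mono sq_sum_ennreal q) auto
      finally show "(t k + c k n + q)^2 \<le> 2 * (2 * (t k)^2 + 2 * (c k n)^2) + 2 * (X k + Y k n)" .
    qed auto
    also have "\<dots> = U k + V k n" unfolding U_def V_def by (simp only: distrib_left add_ac)
    finally show ?thesis .
  qed
  \<comment> \<open>First n tends to infinity with the radius fixed, and only then the
    radius.\<close>
  have "ennreal ((?I - \<tau>)^2) \<le> U k" if "k \<ge> k0" for k
  proof -
    have "(\<lambda>n. U k + V k n) \<longlonglongrightarrow> U k + 0" by (intro tendsto_add tendsto_const V that)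
    then show ?thesis using main[OF that] LIMSEQ_le_const by fastforce
  qed
  then have "ennreal ((?I - \<tau>)^2) \<le> 0"
    using LIMSEQ_le_const[OF U] by blast
  then have "(?I - \<tau>)^2 \<le> 0" by (simp add: ennreal_le_iff2 del: power2_less_eq_zero_iff)
  then show ?thesis by simp
qed

section \<open>Hardy inequality for odd functions\<close>

text \<open>The derivative of h^2 / (1 + x) is integrated; the boundary terms vanish since h is zero
  at 0 and r. With g = h / (1 + x) this says that the integral of g^2 equals that of 2 g h', and 2 g
  h' \<le> g^2/2 + 2 h'^2. Absorbing half of the left side leaves the factor 4.\<close>

lemma Hardy_half_line:
  fixes h :: "real \<Rightarrow> real"
  assumes h: "\<And>x. (h has_vector_derivative h' x) (at x)" and c: "continuous_on UNIV h'"
    and h0: "h 0 = 0" and r: "r > 0" "\<And>x. x \<ge> r \<Longrightarrow> h x = 0"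
  shows "NNset {0..r} (\<lambda>x. ennreal ((h x / (1 + x))^2)) \<le> 4 * NNset {0..r} (\<lambda>x. ennreal ((h' x)^2))"
proof -
  have ch: "continuous_on UNIV h"
    using h by (metis continuous_at_imp_continuous_on has_vector_derivative_continuous)
  have ci: "continuous_on {0..r} (\<lambda>x. 1 + x :: real)" by (intro continuous_intros)
  have nz: "1 + x \<noteq> 0" if "x \<in> {0..r}" for x :: real using that by auto
  let ?f = "\<lambda>x. (h x / (1 + x))^2" and ?g = "\<lambda>x. (h' x)^2"
  have cf: "continuous_on {0..r} ?f" by (intro continuous_intros continuous_on_subset[OF ch] nz) auto
  have cg: "continuous_on {0..r} ?g" by (intro continuous_intros continuous_on_subset[OF c]) auto
  have cm: "continuous_on {0..r} (\<lambda>x. 2 * (h x / (1 + x)) * h' x)"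
    by (intro continuous_intros continuous_on_subset[OF ch] continuous_on_subset[OF c] nz) auto
  have if': "?f integrable_on {0..r}" and ig: "?g integrable_on {0..r}" and im: "(\<lambda>x. 2 * (h x / (1 + x)) * h' x) integrable_on {0..r}"
    by (intro integrable_continuous_real cf cg cm)+
  have "((\<lambda>x. 2 * (h x / (1 + x)) * h' x - ?f x) has_integral ((h r)^2 / (1 + r) - (h 0)^2 / (1 + 0))) {0..r}"
  proof (rule fundamental_theorem_of_calculus)
    fix x assume x: "x \<in> {0..r}"
    have "(h has_real_derivative h' x) (at x within {0..r})"
      using h[of x] by (simp add: has_real_derivative_iff_has_vector_derivative has_vector_derivative_at_within)
    then have "((\<lambda>x. (h x)^2 / (1 + x)) has_real_derivative (2 * h x * h' x * (1 + x) - (h x)^2) / (1 + x)^2) (at x within {0..r})"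
      using x by (auto intro!: derivative_eq_intros simp: power2_eq_square)
    moreover have "(2 * h x * h' x * (1 + x) - (h x)^2) / (1 + x)^2 = 2 * (h x / (1 + x)) * h' x - ?f x"
      using nz[OF x] by (simp add: diff_divide_distrib power_divide power2_eq_square)
    ultimately show "((\<lambda>x. (h x)^2 / (1 + x)) has_vector_derivative 2 * (h x / (1 + x)) * h' x - ?f x) (at x within {0..r})"
      by (simp add: has_real_derivative_iff_has_vector_derivative)
  qed (use r in auto)
  then have "integral {0..r} (\<lambda>x. 2 * (h x / (1 + x)) * h' x - ?f x) = 0"
    using h0 r by (simp add: integral_unique)
  then have e: "integral {0..r} ?f = integral {0..r} (\<lambda>x. 2 * (h x / (1 + x)) * h' x)"
    using Henstock_Kurzweil_Integration.integral_diff[OF im if'] by simp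
  have "integral {0..r} (\<lambda>x. 2 * (h x / (1 + x)) * h' x) \<le> integral {0..r} (\<lambda>x. 1/2 * ?f x + 2 * ?g x)"
  proof (rule integral_le[OF im])
    show "(\<lambda>x. 1/2 * ?f x + 2 * ?g x) integrable_on {0..r}"
      by (intro integrable_continuous_real continuous_intros cf cg continuous_on_subset[OF c]
         continuous_on_subset[OF ch] nz) auto
    fix x
    have "0 \<le> 1/2 * (h x / (1 + x) - 2 * h' x)^2" by simp
    also have "\<dots> = 1/2 * ?f x + 2 * ?g x - 2 * (h x / (1 + x)) * h' x" by (simp add: power2_eq_square algebra_simps)
    finally show "2 * (h x / (1 + x)) * h' x \<le> 1/2 * ?f x + 2 * ?g x" by simp
  qed
  also have "\<dots> = 1/2 * integral {0..r} ?f + 2 * integral {0..r} ?g"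
    using Henstock_Kurzweil_Integration.integral_add[OF integrable_on_cmult_left[OF if', of "1/2"] integrable_on_cmult_left[OF ig, of 2]] by simp
  finally have le: "integral {0..r} ?f \<le> 4 * integral {0..r} ?g" using e by simp
  have nn: "NNset {0..r} (\<lambda>x. ennreal (F x)) = ennreal (integral {0..r} F)"
    if "continuous_on {0..r} F" "\<And>x. F x \<ge> 0" for F
  proof -
    have i: "integrable lborel (\<lambda>x. indicator {0..r} x *\<^sub>R F x)" by (rule borel_integrable_compact[OF compact_Icc that(1)])
    have "NNset {0..r} (\<lambda>x. ennreal (F x)) = (NNINT x. ennreal (indicator {0..r} x *\<^sub>R F x))"
      by (intro nn_integral_cong) (auto simp: indicator_def)
    also have "\<dots> = ennreal (LBINT x. indicator {0..r} x *\<^sub>R F x)"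
      by (rule nn_integral_eq_integral[OF i]) (use that in auto)
    also have "(LBINT x. indicator {0..r} x *\<^sub>R F x) = integral {0..r} F"
      using set_borel_integral_eq_integral(2)[of "{0..r}" F] i by (simp add: set_integrable_def set_lebesgue_integral_def)
    finally show ?thesis .
  qed
  have g0: "0 \<le> integral {0..r} ?g" by (intro integral_nonneg ig) auto
  show ?thesis unfolding nn[OF cf zero_le_power2] nn[OF cg zero_le_power2]
    using ennreal_leI[OF le] g0 by (simp add: ennreal_mult)
qed

lemma Hardy_line:
  fixes h :: "real \<Rightarrow> real"
  assumes h: "\<And>x. (h has_vector_derivative h' x) (at x)" and c: "continuous_on UNIV h'"
    and h0: "h 0 = 0" and r: "r > 0" "\<And>x. \<bar>x\<bar> \<ge> r \<Longrightarrow> h x = 0"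
  shows "(NNINT x. ennreal ((h x / (1 + \<bar>x\<bar>))^2)) \<le> 4 * (NNINT x. ennreal ((h' x)^2))"
proof -
  have ch: "continuous_on UNIV h"
    using h by (metis continuous_at_imp_continuous_on has_vector_derivative_continuous)
  have [measurable]: "borel_fun h" "borel_fun h'"
    using ch c by (auto intro: borel_measurable_continuous_onI)
  have refl: "(NNINT x. f (-x)) = (NNINT x. f x)" if [measurable]: "borel_fun f"
    for f :: "real \<Rightarrow> ennreal"
    using nn_integral_real_affine[of f "-1" 0] that by simp
  have 1: "NNset {0..r} (\<lambda>x. ennreal ((h x / (1 + x))^2)) \<le> 4 * NNset {0..r} (\<lambda>x. ennreal ((h' x)^2))"
    by (rule Hardy_half_line[OF h c h0 r(1)]) (use r in auto)
  have hm: "((\<lambda>x. h (- x)) has_vector_derivative - h' (- x)) (at x)" for x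
    using h[of "-x"] DERIV_mirror[of h "h' (-x)" x] by (simp add: has_real_derivative_iff_has_vector_derivative)
  have cm: "continuous_on UNIV (\<lambda>x. - h' (- x))"
    by (intro continuous_intros continuous_on_compose2[OF c]) auto
  have 2: "NNset {0..r} (\<lambda>x. ennreal ((h (- x) / (1 + x))^2)) \<le> 4 * NNset {0..r} (\<lambda>x. ennreal ((- h' (- x))^2))"
    by (rule Hardy_half_line[OF hm cm _ r(1)]) (use r h0 in auto)
  have "(NNINT x. ennreal ((h x / (1 + \<bar>x\<bar>))^2)) \<le> (NNINT x. ennreal ((h x / (1 + x))^2) * indicator {0..r} x + ennreal ((h x / (1 - x))^2) * indicator {0..r} (- x))"
  proof (intro nn_integral_mono)
    fix x show "ennreal ((h x / (1 + \<bar>x\<bar>))^2) \<le> ennreal ((h x / (1 + x))^2) * indicator {0..r} x + ennreal ((h x / (1 - x))^2) * indicator {0..r} (- x)"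
    proof (cases "\<bar>x\<bar> \<ge> r")
      case True then show ?thesis using r by simp
    next
      case False then show ?thesis by (cases "x \<ge> 0") (auto simp: indicator_def)
    qed
  qed
  also have "\<dots> = NNset {0..r} (\<lambda>x. ennreal ((h x / (1 + x))^2)) + NNset {0..r} (\<lambda>x. ennreal ((h (- x) / (1 + x))^2))"
    by (subst nn_integral_add, measurable) (subst refl[symmetric, of "\<lambda>x. ennreal ((h x / (1 - x))^2) * indicator {0..r} (- x)"], auto)
  also have "\<dots> \<le> 4 * NNset {0..r} (\<lambda>x. ennreal ((h' x)^2)) + 4 * NNset {0..r} (\<lambda>x. ennreal ((- h' (- x))^2))"
    by (intro add_mono 1 2)
  also have "NNset {0..r} (\<lambda>x. ennreal ((- h' (- x))^2)) = (NNINT x. ennreal ((h' x)^2) * indicator {0..r} (- x))"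
    by (subst refl[symmetric]) auto
  also have "4 * NNset {0..r} (\<lambda>x. ennreal ((h' x)^2)) + 4 * (NNINT x. ennreal ((h' x)^2) * indicator {0..r} (- x))
     = 4 * (NNINT x. ennreal ((h' x)^2) * indicator {0..r} x + ennreal ((h' x)^2) * indicator {0..r} (- x))"
    by (subst nn_integral_add) (auto simp: distrib_left)
  also have "\<dots> \<le> 4 * (NNINT x. ennreal ((h' x)^2))"
  proof (intro mult_left_mono nn_integral_mono_AE)
    have "AE x in lborel. x \<noteq> (0::real)" by (rule AE_lborel_singleton)
    then show "AE x in lborel. ennreal ((h' x)^2) * indicator {0..r} x + ennreal ((h' x)^2) * indicator {0..r} (- x) \<le> ennreal ((h' x)^2)"
      by eventually_elim (auto simp: indicator_def)
  qed auto
  finally show ?thesis .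
qed

section \<open>Reflections and odd fields\<close>

definition mir :: "2 \<Rightarrow> real^2 \<Rightarrow> real^2" where
  "mir j p = (\<chi> i. if i = j then - (p $ i) else p $ i)"

lemma mir_pt: "mir 1 p = pt (- (p$1)) (p$2)" "mir 2 p = pt (p$1) (- (p$2))"
  by (auto simp: mir_def vec_eq_iff forall_2)

lemma mir_nth: "mir j p $ i = (if i = j then - (p $ i) else p $ i)"
  by (simp add: mir_def)

lemma mir_mir [simp]: "mir j (mir j p) = p"
  by (simp add: mir_def vec_eq_iff)

lemma mir_eq: "mir j = (\<lambda>p. p - (2 * p $ j) *\<^sub>R axis j 1)"
  by (auto simp: fun_eq_iff mir_def vec_eq_iff axis_def)

lemma mir_bounded_linear: "bounded_linear (mir j)"
  unfolding mir_eq by (intro bounded_linear_intros bounded_linear_vec_nth)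

lemma mir_measurable [measurable]: "borel_fun (mir j)"
  using linear_continuous_on[OF mir_bounded_linear] by (rule borel_measurable_continuous_onI)

lemma lborel_mir: "distr lborel borel (mir j) = lborel"
  using lborel_linear_swaps(2,3) exhaust_2[of j] mir_pt by (metis (no_types, lifting) ext)

lemma nn_integral_mir: "borel_fun f \<Longrightarrow> (NNINT p. f (mir j p)) = (NNINT p. f p)" for f :: "_ \<Rightarrow> ennreal"
  by (subst (2) lborel_mir[symmetric, of j], subst nn_integral_distr) auto

lemma integral_mir: "borel_fun f \<Longrightarrow> (LBINT p. f (mir j p)) = (LBINT p. f p)" for f :: "_ \<Rightarrow> real"
  by (subst (2) lborel_mir[symmetric, of j], subst integral_distr) auto

lemma AE_mir:
  assumes "AE p in lborel. P p" and [measurable]: "Measurable.pred borel P" shows "AE p in lborel. P (mir j p)"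
  using assms(1) by (subst (asm) lborel_mir[symmetric, of j], subst (asm) AE_distr_iff) auto

lemma square_mir: "mir j p \<in> square r \<longleftrightarrow> p \<in> square r"
  using exhaust_2[of j] by (auto simp: square_def mir_nth)

lemma sqi_mir:
  assumes [measurable]: "borel_fun f"
  shows "sqi (square r) (\<lambda>p. f (mir j p)) = sqi (square r) f" "sqi UNIV (\<lambda>p. f (mir j p)) = sqi UNIV f"
proof -
  have "sqi (square r) (\<lambda>p. f (mir j p)) = (NNINT p. ennreal ((norm (f (mir j p)))^2) * indicator (square r) (mir j p))"
    unfolding sqi_def by (intro nn_integral_cong) (auto simp: indicator_def square_mir)
  also have "\<dots> = sqi (square r) f" unfolding sqi_def by (subst nn_integral_mir[of "\<lambda>p. ennreal ((norm (f p))^2) * indicator (square r) p"]) auto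
  finally show "sqi (square r) (\<lambda>p. f (mir j p)) = sqi (square r) f" .
  show "sqi UNIV (\<lambda>p. f (mir j p)) = sqi UNIV f"
    unfolding sqi_def by (subst nn_integral_mir[of "\<lambda>p. ennreal ((norm (f p))^2) * indicator UNIV p", symmetric]) auto
qed

lemma partial_mir:
  fixes f :: "real^2 \<Rightarrow> real"
  assumes "f differentiable at (mir j p)"
  shows "partial i (\<lambda>p. f (mir j p)) p = (if i = j then - partial i f (mir j p) else partial i f (mir j p))"
    and "(\<lambda>p. f (mir j p)) differentiable at p"
proof -
  have "(mir j has_derivative mir j) (at p)" by (rule bounded_linear_imp_has_derivative[OF mir_bounded_linear])
  from has_derivative_compose[OF this has_derivative_partial[OF assms]]
  have *: "((\<lambda>p. f (mir j p)) has_derivative (\<lambda>h. \<Sum>i\<in>UNIV. mir j h $ i *\<^sub>R partial i f (mir j p))) (at p)" .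
  then show "(\<lambda>p. f (mir j p)) differentiable at p" by (rule differentiableI)
  show "partial i (\<lambda>p. f (mir j p)) p = (if i = j then - partial i f (mir j p) else partial i f (mir j p))"
    using partialI[OF *, of i] exhaust_2[of i] exhaust_2[of j] by (auto simp: sum_2 mir_nth axis_def)
qed

lemma smooth_mir:
  fixes f :: "real^2 \<Rightarrow> real"
  assumes "smooth f" shows "smooth (\<lambda>p. f (mir j p))"
proof (rule smooth_coinduct[where X="{\<lambda>p. f (mir j p) |f. smooth f}"])
  fix g i assume "g \<in> {\<lambda>p. f (mir j p) |f. smooth (f :: real^2 \<Rightarrow> real)}"
  then obtain f :: "real^2 \<Rightarrow> real" where f: "g = (\<lambda>p. f (mir j p))" "smooth f" by auto
  have "partial i g = (\<lambda>p. (if i = j then (\<lambda>p. -1 * partial i f p) else partial i f) (mir j p))"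
    unfolding f(1) using partial_mir(1)[OF smooth_differentiable[OF f(2)]] by (auto simp: fun_eq_iff)
  then show "partial i g \<in> {\<lambda>p. f (mir j p) |f. smooth f}"
    using smooth_cmult[OF smooth_partial[OF f(2)], of "-1"] smooth_partial[OF f(2)] by (cases "i = j") auto
qed (use assms partial_mir(2)[OF smooth_differentiable] in auto)

text \<open>Oddness enters through the zero on the axis of reflection, the starting point of the
  one-dimensional inequality on each line.\<close>

lemma Hardy_smooth:
  fixes f :: "real^2 \<Rightarrow> real"
  assumes f: "f \<in> test_functions \<Omega>" and odd: "\<And>p. f (mir j p) = - f p"
  shows "sqi UNIV (\<lambda>p. f p / (1 + \<bar>p$j\<bar>)) \<le> 4 * sqi UNIV (partial j f)"
proof -
  note sm = test_functionsD(1)[OF f]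
  note [measurable] = smooth_measurable[OF sm] smooth_measurable[OF smooth_partial[OF sm]]
  note D = has_derivative_pt[OF smooth_differentiable[OF sm]]
  note C = smooth_continuous[OF smooth_partial[OF sm]]
  obtain r where r: "r > 0" "\<And>p. p \<notin> square r \<Longrightarrow> f p = 0"
    using compact_support_square test_functionsD(2)[OF f] by blast
  define R where "R = r + 1"
  have R: "R > 0" "\<And>x y. \<bar>x\<bar> \<ge> R \<Longrightarrow> f (pt x y) = 0" "\<And>x y. \<bar>y\<bar> \<ge> R \<Longrightarrow> f (pt x y) = 0"
    using r by (auto simp: R_def square_def)
  consider "j = 1" | "j = 2" using exhaust_2 by blast
  then show ?thesis
  proof cases
    case 1
    have z: "f (pt 0 y) = 0" for y using odd[of "pt 0 y"] by (simp add: 1 mir_pt)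
    have "(NNINT x. ennreal ((f (pt x y) / (1 + \<bar>x\<bar>))^2)) \<le> 4 * (NNINT x. ennreal ((partial 1 f (pt x y))^2))" for y
      by (rule Hardy_line[OF D(1) continuous_on_pt1[OF C] z R(1,2)])
    then have "(\<integral>\<^sup>+y. \<integral>\<^sup>+x. ennreal ((f (pt x y) / (1 + \<bar>x\<bar>))^2) \<partial>lborel \<partial>lborel) \<le> (NNINT y. 4 * (NNINT x. ennreal ((partial 1 f (pt x y))^2)))"
      by (rule nn_integral_mono)
    then show ?thesis unfolding sqi_def 1 real_norm_def power2_abs by (subst (1 2) nn_integral_plane(1)) (auto simp: nn_integral_cmult)
  next
    case 2
    have z: "f (pt x 0) = 0" for x using odd[of "pt x 0"] by (simp add: 2 mir_pt)
    have "(NNINT y. ennreal ((f (pt x y) / (1 + \<bar>y\<bar>))^2)) \<le> 4 * (NNINT y. ennreal ((partial 2 f (pt x y))^2))" for x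
      by (rule Hardy_line[OF D(2) continuous_on_pt2[OF C] z R(1,3)])
    then have "(\<integral>\<^sup>+x. \<integral>\<^sup>+y. ennreal ((f (pt x y) / (1 + \<bar>y\<bar>))^2) \<partial>lborel \<partial>lborel) \<le> (NNINT x. 4 * (NNINT y. ennreal ((partial 2 f (pt x y))^2)))"
      by (rule nn_integral_mono)
    then show ?thesis unfolding sqi_def 2 real_norm_def power2_abs by (subst (1 2) nn_integral_plane(2)) (auto simp: nn_integral_cmult)
  qed
qed

text \<open>\<psi> ranges over test functions of the whole plane: each approximant vanishes near the
  boundary of \<Omega> and is smooth everywhere, so integration by parts has no boundary term and A
  is the weak gradient of z across the boundary as well.\<close>

lemma appr_weak_derivative:
  assumes ap: "appr \<Omega> z A \<phi>" and \<psi>: "\<psi> \<in> test_functions \<Omega>'"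
  shows "(LBINT p. z p $ j * partial i \<psi> p) = - (LBINT p. A p $ i $ j * \<psi> p)"
proof -
  note D = apprD[OF ap]
  note [measurable] = D(1,2,5,6) test_functions_measurable[OF \<psi>] test_functions_measurable[OF test_functions_partial[OF \<psi>]]
  obtain r where r: "r > 0" "\<And>x. x \<notin> square r \<Longrightarrow> \<psi> x = 0"
    using compact_support_square test_functionsD(2)[OF \<psi>] by blast
  have cl: "closure {x. \<psi> x \<noteq> 0} \<subseteq> square r"
    using r(2) compact_imp_closed[OF compact_square] by (intro closure_minimal) auto
  have pz: "partial i \<psi> x = 0" if "x \<notin> square r" for x
  proof -
    have "(\<psi> has_derivative (\<lambda>_. 0)) (at x)"
      by (rule has_derivative_transform_within_open[of "\<lambda>_. 0" _ _ _ "- square r"])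
         (use that r compact_imp_closed[OF compact_square] in \<open>auto simp: open_Compl\<close>)
    from partialI[OF this] show ?thesis by simp
  qed
  have lim: "(\<lambda>n. LBINT p. w p * (F n p * 1)) \<longlonglongrightarrow> (LBINT p. w p * (G p * 1))"
    if w: "w \<in> test_functions \<Omega>'" and z: "\<And>x. x \<notin> square r \<Longrightarrow> w x = 0"
      and [measurable]: "\<And>n. borel_fun (F n)" "borel_fun G"
      and "\<And>n. sqi (square r) (F n) < top" "(\<lambda>n. sqi (square r) (\<lambda>p. F n p - G p)) \<longlonglongrightarrow> 0"
    for w F and G :: "real^2 \<Rightarrow> real"
  proof -
    obtain M where M: "\<And>x. norm (w x) \<le> M" using test_functions_bounded[OF w] by blast
    note [measurable] = test_functions_measurable[OF w]
    show ?thesis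
      by (rule L2_product_tendsto[where S="square r" and M=M and G="\<lambda>n x. 1"])
         (use that M sqi_finite_bounded[of "\<lambda>_. 1::real" 1 r] in \<open>auto simp: sqi_def\<close>)
  qed
  have "(\<lambda>n. LBINT p. partial i \<psi> p * (\<phi> n p $ j * 1)) \<longlonglongrightarrow> (LBINT p. partial i \<psi> p * (z p $ j * 1))"
  proof (rule lim[OF test_functions_partial[OF \<psi>] pz])
    show "sqi (square r) (\<lambda>p. \<phi> n p $ j) < top" for n
      using sqi_nth[of "square r" "\<phi> n" j] sqi_test_finite[OF D(4), of "square r" n] by (rule le_less_trans)
    have "sqi (square r) (\<lambda>p. (\<phi> n p - z p) $ j) \<le> sqi (square r) (\<lambda>p. \<phi> n p - z p)" for n by (rule sqi_nth)
    then show "(\<lambda>n. sqi (square r) (\<lambda>p. \<phi> n p $ j - z p $ j)) \<longlonglongrightarrow> 0"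
      by (intro ennreal_squeeze_0[OF D(7)]) simp
  qed auto
  moreover have "(\<lambda>n. LBINT p. \<psi> p * (grad (\<phi> n) p $ i $ j * 1)) \<longlonglongrightarrow> (LBINT p. \<psi> p * (A p $ i $ j * 1))"
  proof (rule lim[OF \<psi> r(2)])
    have le: "sqi (square r) (\<lambda>p. F p $ i $ j) \<le> sqi UNIV F" for F :: "real^2 \<Rightarrow> real^2^2"
    proof -
      have "sqi (square r) (\<lambda>p. F p $ i $ j) \<le> sqi (square r) F" by (rule sqi_mono) (auto simp: matrix_nth_le)
      also have "\<dots> \<le> sqi UNIV F" by (rule sqi_mono_set) auto
      finally show ?thesis .
    qed
    show "sqi (square r) (\<lambda>p. grad (\<phi> n) p $ i $ j) < top" for n
      using le[of "grad (\<phi> n)"] grad_finite[OF D(4), of UNIV n] by (rule le_less_trans)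
    have "sqi (square r) (\<lambda>p. grad (\<phi> n) p $ i $ j - A p $ i $ j) \<le> sqi UNIV (\<lambda>p. grad (\<phi> n) p - A p)" for n
      using le[of "\<lambda>p. grad (\<phi> n) p - A p"] by simp
    then show "(\<lambda>n. sqi (square r) (\<lambda>p. grad (\<phi> n) p $ i $ j - A p $ i $ j)) \<longlonglongrightarrow> 0"
      by (rule ennreal_squeeze_0[OF D(8)])
  qed auto
  moreover have "(LBINT p. partial i \<psi> p * (\<phi> n p $ j * 1)) = - (LBINT p. \<psi> p * (grad (\<phi> n) p $ i $ j * 1))" for n
    using integration_by_parts[OF smooth_nth[OF test_functionsD(1)[OF D(4)]] \<psi>, of n j i] by (simp add: grad_nth mult.commute)
  ultimately have "(LBINT p. partial i \<psi> p * (z p $ j * 1)) = - (LBINT p. \<psi> p * (A p $ i $ j * 1))"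
  proof -
    assume 1: "(\<lambda>n. LBINT p. partial i \<psi> p * (\<phi> n p $ j * 1)) \<longlonglongrightarrow> (LBINT p. partial i \<psi> p * (z p $ j * 1))"
      and 2: "(\<lambda>n. LBINT p. \<psi> p * (grad (\<phi> n) p $ i $ j * 1)) \<longlonglongrightarrow> (LBINT p. \<psi> p * (A p $ i $ j * 1))"
      and 3: "\<And>n. (LBINT p. partial i \<psi> p * (\<phi> n p $ j * 1)) = - (LBINT p. \<psi> p * (grad (\<phi> n) p $ i $ j * 1))"
    show ?thesis by (rule LIMSEQ_unique[OF 1[unfolded 3] tendsto_minus[OF 2]])
  qed
  then show ?thesis by (simp add: mult.commute)
qed

lemma sqi_UNIV_le:
  assumes "\<And>k::nat. sqi (square (real k)) f \<le> b" and [measurable]: "borel_fun f"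
  shows "sqi UNIV f \<le> b"
proof -
  have i: "ennreal ((norm (f p))^2) * indicator (square (real m)) p \<le> ennreal ((norm (f p))^2) * indicator (square (real n)) p"
    if "m \<le> n" for m n :: nat and p
    using square_mono[of "real m" "real n"] that by (intro mult_left_mono) (auto simp: indicator_def)
  have "incseq (\<lambda>k p. ennreal ((norm (f p))^2) * indicator (square (real k)) p)"
    using i by (simp add: incseq_def le_fun_def)
  moreover have "(SUP k. ennreal ((norm (f p))^2) * indicator (square (real k)) p) = ennreal ((norm (f p))^2)" for p
  proof -
    have "(\<lambda>k. ennreal ((norm (f p))^2) * indicator (square (real k)) p) \<longlonglongrightarrow> ennreal ((norm (f p))^2)"
      by (rule tendsto_eventually) (use eventually_in_square(1)[of p] in eventually_elim, simp)
    moreover have "incseq (\<lambda>k. ennreal ((norm (f p))^2) * indicator (square (real k)) p)"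
      using i by (simp add: incseq_def)
    ultimately show ?thesis by (metis (no_types, lifting) LIMSEQ_unique LIMSEQ_SUP)
  qed
  ultimately have "sqi UNIV f = (SUP k. sqi (square (real k)) f)"
    unfolding sqi_def by (subst nn_integral_monotone_convergence_SUP[symmetric]) auto
  then show ?thesis using assms(1) by (auto intro: SUP_least)
qed

lemma sqi_half_bound:
  fixes f g h :: "real^2 \<Rightarrow> real"
  assumes [measurable]: "borel_fun g" "borel_fun h" "S \<in> sets borel"
    and "\<And>x. f x = (g x + h x) / 2"
  shows "sqi S f \<le> (sqi S g + sqi S h) / 2"
proof -
  have "sqi S f \<le> (NNINT x. (ennreal ((norm (g x))^2) * indicator S x + ennreal ((norm (h x))^2) * indicator S x) / 2)"
    unfolding sqi_def
  proof (intro nn_integral_mono)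
    fix x
    have "((g x + h x) / 2)^2 \<le> ((g x)^2 + (h x)^2) / 2"
      using zero_le_power2[of "g x - h x"] by (simp add: power2_eq_square field_simps)
    then have "ennreal ((f x)^2) \<le> ennreal (((g x)^2 + (h x)^2) / 2)" unfolding assms(4) by (rule ennreal_leI)
    also have "\<dots> = (ennreal ((g x)^2) + ennreal ((h x)^2)) / 2"
      by (simp add: divide_ennreal[symmetric] ennreal_plus)
    finally show "ennreal ((norm (f x))^2) * indicator S x \<le> (ennreal ((norm (g x))^2) * indicator S x + ennreal ((norm (h x))^2) * indicator S x) / 2"
      by (auto simp: indicator_def)
  qed
  also have "\<dots> = (sqi S g + sqi S h) / 2"
    unfolding sqi_def by (simp add: nn_integral_divide nn_integral_add)
  finally show ?thesis .
qed

lemma ennreal_double_half: "((x::ennreal) + x) / 2 = x"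
  by (simp add: mult_2[symmetric] mult.commute[of 2] mult_divide_eq_ennreal)

text \<open>The approximants need not be odd, so the component i is replaced by its odd part. This
  destroys the vanishing divergence and the support in \<Omega>, but the scalar inequality on the
  plane asks for neither. The factor 8 is 4 from the line, doubled when the gradient of the
  approximant is compared with A.\<close>

lemma appr_Hardy:
  assumes ap: "appr \<Omega> z A \<phi>" and odd: "AE p in lborel. z (mir j p) $ i = - (z p $ i)"
  shows "sqi UNIV (\<lambda>p. z p $ i / (1 + \<bar>p$j\<bar>)) \<le> 8 * sqi UNIV (\<lambda>p. A p $ j $ i)"
proof (rule sqi_UNIV_le)
  note D = apprD[OF ap]
  note [measurable] = D(1,2,5,6)
  show "borel_fun (\<lambda>p. z p $ i / (1 + \<bar>p$j\<bar>))" by measurable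
  fix k :: nat
  define f where "f n = (\<lambda>p. (\<phi> n p $ i - \<phi> n (mir j p) $ i) / 2)" for n
  have [measurable]: "borel_fun (f n)" for n unfolding f_def by measurable
  have sm: "smooth (\<lambda>p. \<phi> n p $ i)" "smooth (\<lambda>p. \<phi> n (mir j p) $ i)" for n
    using smooth_nth[OF test_functionsD(1)[OF D(4)]] smooth_mir[of "\<lambda>p. \<phi> n p $ i"] by auto
  have ft: "f n \<in> test_functions UNIV" for n
  proof -
    obtain r where r: "r > 0" "\<And>x. x \<notin> square r \<Longrightarrow> \<phi> n x = 0"
      using compact_support_square test_functionsD(2)[OF D(4)[of n]] by blast
    show ?thesis
    proof (rule test_functionsI[where K="square r"])
      show "smooth (f n)" unfolding f_def using smooth_cmult[OF smooth_diff[OF sm[of n]], of "1/2"] by simp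
      show "f n x = 0" if "x \<notin> square r" for x using r(2)[of x] r(2)[of "mir j x"] that by (simp add: f_def square_mir)
    qed (use compact_imp_closed[OF compact_square] compact_imp_bounded[OF compact_square] in auto)
  qed
  have fo: "f n (mir j p) = - f n p" for n p by (simp add: f_def minus_divide_left)
  let ?g = "\<lambda>n. sqi UNIV (\<lambda>p. grad (\<phi> n) p - A p)"
  have pf: "sqi UNIV (partial j (f n)) \<le> 2 * ?g n + 2 * sqi UNIV (\<lambda>p. A p $ j $ i)" for n
  proof -
    let ?d = "partial j (\<lambda>p. \<phi> n p $ i)"
    have [measurable]: "borel_fun ?d" using smooth_measurable[OF smooth_partial[OF sm(1)]] .
    have "partial j (f n) p = (?d p + ?d (mir j p)) / 2" for p
    proof -
      have "f n = (\<lambda>p. (1/2) * (\<phi> n p $ i - \<phi> n (mir j p) $ i))" by (auto simp: f_def)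
      then have "partial j (f n) p = (1/2) * partial j (\<lambda>p. \<phi> n p $ i - \<phi> n (mir j p) $ i) p"
        using partial_cmult[OF smooth_differentiable[OF smooth_diff[OF sm[of n]]], of j "1/2" p] by simp
      also have "partial j (\<lambda>p. \<phi> n p $ i - \<phi> n (mir j p) $ i) p = ?d p - partial j (\<lambda>p. \<phi> n (mir j p) $ i) p"
        by (intro partial_diff smooth_differentiable sm)
      also have "partial j (\<lambda>p. \<phi> n (mir j p) $ i) p = - ?d (mir j p)"
        using partial_mir(1)[of "\<lambda>p. \<phi> n p $ i", OF smooth_differentiable[OF sm(1)]] by simp
      finally show ?thesis by simp
    qed
    then have "sqi UNIV (partial j (f n)) \<le> (sqi UNIV ?d + sqi UNIV (\<lambda>p. ?d (mir j p))) / 2"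
      by (intro sqi_half_bound) auto
    also have "sqi UNIV (\<lambda>p. ?d (mir j p)) = sqi UNIV ?d" by (rule sqi_mir) measurable
    also have "(sqi UNIV ?d + sqi UNIV ?d) / 2 = sqi UNIV ?d" by (rule ennreal_double_half)
    also have "sqi UNIV ?d \<le> 2 * sqi UNIV (\<lambda>p. ?d p - A p $ j $ i) + 2 * sqi UNIV (\<lambda>p. A p $ j $ i)"
      by (rule sqi_triangle_add) auto
    also have "sqi UNIV (\<lambda>p. ?d p - A p $ j $ i) \<le> ?g n"
      by (rule sqi_mono) (use matrix_nth_le[of "grad (\<phi> n) _ - A _" j i] in \<open>auto simp: grad_nth\<close>)
    finally show ?thesis by (simp add: add_mono mult_left_mono)
  qed
  have conv: "(\<lambda>n. sqi (square (real k)) (\<lambda>p. f n p - z p $ i)) \<longlonglongrightarrow> 0"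
  proof (rule ennreal_squeeze_0[OF D(7)])
    fix n
    let ?h = "\<lambda>p. \<phi> n p $ i - z p $ i"
    have "sqi (square (real k)) (\<lambda>p. f n p - z p $ i) = sqi (square (real k)) (\<lambda>p. (?h p + - ?h (mir j p)) / 2)"
      by (rule sqi_cong, use odd in eventually_elim) (simp add: f_def field_simps)
    also have "\<dots> \<le> (sqi (square (real k)) ?h + sqi (square (real k)) (\<lambda>p. - ?h (mir j p))) / 2"
      by (rule sqi_half_bound) auto
    also have "sqi (square (real k)) (\<lambda>p. - ?h (mir j p)) = sqi (square (real k)) (\<lambda>p. ?h (mir j p))"
      by (rule sqi_cong) auto
    also have "\<dots> = sqi (square (real k)) ?h" by (rule sqi_mir(1)[of ?h]) measurable
    also have "(sqi (square (real k)) ?h + sqi (square (real k)) ?h) / 2 = sqi (square (real k)) ?h" by (rule ennreal_double_half)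
    also have "\<dots> \<le> sqi (square (real k)) (\<lambda>p. \<phi> n p - z p)" using sqi_nth[of _ "\<lambda>p. \<phi> n p - z p" i] by simp
    finally show "sqi (square (real k)) (\<lambda>p. f n p - z p $ i) \<le> sqi (square (real k)) (\<lambda>p. \<phi> n p - z p)" .
  qed
  have Blim: "(\<lambda>n. 4 * (2 * ?g n + 2 * sqi UNIV (\<lambda>p. A p $ j $ i))) \<longlonglongrightarrow> 4 * (2 * 0 + 2 * sqi UNIV (\<lambda>p. A p $ j $ i))"
    by (intro ennreal_tendsto_cmult tendsto_add tendsto_const D(8)) auto
  have w: "ennreal ((norm (x / (1 + \<bar>p$j\<bar>)))^2) = ennreal (1 / (1 + \<bar>p$j\<bar>)^2) * ennreal ((norm x)^2)" for x :: real and p :: "real^2"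
    by (subst ennreal_mult[symmetric]) (auto simp: power_divide)
  have "sqi (square (real k)) (\<lambda>p. z p $ i / (1 + \<bar>p$j\<bar>)) \<le> 4 * (2 * 0 + 2 * sqi UNIV (\<lambda>p. A p $ j $ i))"
    unfolding sqi_def w
  proof (rule weighted_bound_closed[OF _ _ _ _ conv _ Blim[unfolded sqi_def]])
    fix n
    have "NNset (square (real k)) (\<lambda>p. ennreal (1 / (1 + \<bar>p$j\<bar>)^2) * ennreal ((norm (f n p))^2)) = sqi (square (real k)) (\<lambda>p. f n p / (1 + \<bar>p$j\<bar>))"
      unfolding sqi_def w ..
    also have "\<dots> \<le> sqi UNIV (\<lambda>p. f n p / (1 + \<bar>p$j\<bar>))" by (rule sqi_mono_set) auto
    also have "\<dots> \<le> 4 * sqi UNIV (partial j (f n))" by (rule Hardy_smooth[OF ft fo])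
    also have "\<dots> \<le> 4 * (2 * ?g n + 2 * sqi UNIV (\<lambda>p. A p $ j $ i))" by (intro mult_left_mono pf) auto
    finally show "NNset (square (real k)) (\<lambda>p. ennreal (1 / (1 + \<bar>p$j\<bar>)^2) * ennreal ((norm (f n p))^2))
      \<le> 4 * (2 * NNset UNIV (\<lambda>x. ennreal ((norm (grad (\<phi> n) x - A x))^2)) + 2 * NNset UNIV (\<lambda>x. ennreal ((norm (A x $ j $ i))^2)))"
      unfolding sqi_def .
  qed auto
  also have "4 * (2 * 0 + 2 * sqi UNIV (\<lambda>p. A p $ j $ i)) = 8 * sqi UNIV (\<lambda>p. A p $ j $ i)"
    by (simp add: mult.assoc[symmetric])
  finally show "sqi (square (real k)) (\<lambda>p. z p $ i / (1 + \<bar>p$j\<bar>)) \<le> 8 * sqi UNIV (\<lambda>p. A p $ j $ i)" .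
qed

text \<open>Each component has its own direction of oddness, and 1 + |p_j| \<le> 1 + |p| makes the
  weights comparable; 16 = 8 + 8.\<close>

lemma appr_Hardy_norm:
  assumes ap: "appr \<Omega> z A \<phi>" and odd: "\<And>i. \<exists>j. AE p in lborel. z (mir j p) $ i = - (z p $ i)"
  shows "sqi UNIV (\<lambda>p. z p /\<^sub>R (norm p + 1)) \<le> 16 * sqi UNIV A"
proof -
  note [measurable] = apprD(1,2)[OF ap]
  have c: "sqi UNIV (\<lambda>p. (z p /\<^sub>R (norm p + 1)) $ i) \<le> 8 * sqi UNIV A" for i
  proof -
    obtain j where j: "AE p in lborel. z (mir j p) $ i = - (z p $ i)" using odd by blast
    have "sqi UNIV (\<lambda>p. (z p /\<^sub>R (norm p + 1)) $ i) \<le> sqi UNIV (\<lambda>p. z p $ i / (1 + \<bar>p$j\<bar>))"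
    proof (rule sqi_mono, intro AE_I2 impI)
      fix p :: "real^2"
      have "1 + \<bar>p$j\<bar> \<le> norm p + 1" using component_le_norm_cart[of p j] by simp
      then show "norm ((z p /\<^sub>R (norm p + 1)) $ i) \<le> norm (z p $ i / (1 + \<bar>p$j\<bar>))"
        using mult_right_mono[OF le_imp_inverse_le, of "1 + \<bar>p$j\<bar>" "norm p + 1" "\<bar>z p $ i\<bar>"]
        by (simp add: abs_mult divide_inverse mult.commute[of _ "inverse _"] add_pos_nonneg)
    qed
    also have "\<dots> \<le> 8 * sqi UNIV (\<lambda>p. A p $ j $ i)" by (rule appr_Hardy[OF ap j])
    also have "\<dots> \<le> 8 * sqi UNIV A" by (intro mult_left_mono sqi_mono) (auto simp: matrix_nth_le)
    finally show ?thesis .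
  qed
  have "sqi UNIV (\<lambda>p. z p /\<^sub>R (norm p + 1)) = sqi UNIV (\<lambda>p. (z p /\<^sub>R (norm p + 1)) $ 1) + sqi UNIV (\<lambda>p. (z p /\<^sub>R (norm p + 1)) $ 2)"
    unfolding sqi_def norm_vec2_sq by (subst nn_integral_add[symmetric]) (auto simp: distrib_right)
  also have "\<dots> \<le> 8 * sqi UNIV A + 8 * sqi UNIV A" by (intro add_mono c)
  also have "\<dots> = 16 * sqi UNIV A" by (simp add: distrib_right[symmetric])
  finally show ?thesis .
qed

text \<open>Riesz-Fischer. Squared increments of size 16^-k remain summable after multiplication by
  4^k, so almost everywhere the increments themselves are at most a constant times 2^-k, and the
  subsequence converges. Fatou then shows that the pointwise limit is also the limit in L^2 of the
  whole sequence.\<close>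

lemma sqi_complete:
  fixes f :: "nat \<Rightarrow> real^2 \<Rightarrow> 'b::euclidean_space"
  assumes [measurable]: "\<And>n. borel_fun (f n)"
    and cau: "\<And>e. e > 0 \<Longrightarrow> \<exists>N. \<forall>m\<ge>N. \<forall>n\<ge>N. sqi UNIV (\<lambda>x. f m x - f n x) < e"
  obtains A where "borel_fun A" "(\<lambda>n. sqi UNIV (\<lambda>x. f n x - A x)) \<longlonglongrightarrow> 0"
proof -
  have "\<exists>N. \<forall>k. (\<forall>m\<ge>N k. \<forall>n\<ge>N k. sqi UNIV (\<lambda>x. f m x - f n x) < ennreal ((1/16)^k)) \<and> N k < N (Suc k)"
  proof (rule dependent_nat_choice)
    show "\<exists>N. \<forall>m\<ge>N. \<forall>n\<ge>N. sqi UNIV (\<lambda>x. f m x - f n x) < ennreal ((1/16)^0)" using cau by simp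
    fix M :: nat and k
    obtain N where "\<forall>m\<ge>N. \<forall>n\<ge>N. sqi UNIV (\<lambda>x. f m x - f n x) < ennreal ((1/16)^(Suc k))"
      using cau[of "ennreal ((1/16)^(Suc k))"] by auto
    then show "\<exists>N. (\<forall>m\<ge>N. \<forall>n\<ge>N. sqi UNIV (\<lambda>x. f m x - f n x) < ennreal ((1/16)^(Suc k))) \<and> M < N"
      by (intro exI[of _ "max N (Suc M)"]) auto
  qed
  then obtain r where r0: "\<And>k m n. m \<ge> r k \<Longrightarrow> n \<ge> r k \<Longrightarrow> sqi UNIV (\<lambda>x. f m x - f n x) < ennreal ((1/16)^k)" and inc: "\<And>k. r k < r (Suc k)"
    by blast
  have sm: "strict_mono r" using inc by (simp add: strict_mono_Suc_iff)
  have r: "sqi UNIV (\<lambda>x. f (r (Suc k)) x - f (r k) x) \<le> ennreal ((1/16)^k)" for k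
    using r0[of k "r (Suc k)" "r k"] inc[of k] by simp
  have "(NNINT x. (\<Sum>k. ennreal (4^k) * (ennreal ((norm (f (r (Suc k)) x - f (r k) x))^2) * indicator UNIV x)))
     = (\<Sum>k. ennreal (4^k) * sqi UNIV (\<lambda>x. f (r (Suc k)) x - f (r k) x))"
    unfolding sqi_def by (subst nn_integral_suminf) (auto simp: nn_integral_cmult)
  also have "\<dots> \<le> (\<Sum>k. ennreal ((1/4)^k))"
  proof (intro suminf_le)
    fix k
    have "ennreal (4^k) * sqi UNIV (\<lambda>x. f (r (Suc k)) x - f (r k) x) \<le> ennreal (4^k) * ennreal ((1/16)^k)"
      by (intro mult_left_mono r) auto
    also have "\<dots> = ennreal ((1/4)^k)"
      by (subst ennreal_mult[symmetric]) (auto simp: power_mult_distrib[symmetric])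
    finally show "ennreal (4^k) * sqi UNIV (\<lambda>x. f (r (Suc k)) x - f (r k) x) \<le> ennreal ((1/4)^k)" .
  qed auto
  also have "\<dots> = ennreal (\<Sum>k. (1/4)^k)"
    by (rule suminf_ennreal2) (auto intro: summable_geometric)
  also have "\<dots> < top" by (rule ennreal_less_top)
  finally have "AE x in lborel. (\<Sum>k. ennreal (4^k) * (ennreal ((norm (f (r (Suc k)) x - f (r k) x))^2) * indicator UNIV x)) \<noteq> \<infinity>"
    by (intro nn_integral_PInf_AE) auto
  then have conv: "AE x in lborel. convergent (\<lambda>k. f (r k) x)"
  proof eventually_elim
    case (elim x)
    let ?d = "\<lambda>k. norm (f (r (Suc k)) x - f (r k) x)"
    have "(\<Sum>k. ennreal (4^k * (?d k)^2)) \<noteq> top" using elim by (simp add: ennreal_mult)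
    then have "summable (\<lambda>k. 4^k * (?d k)^2)" by (intro summable_suminf_not_top) auto
    then have "(\<lambda>k. 4^k * (?d k)^2) \<longlonglongrightarrow> 0" by (rule summable_LIMSEQ_zero)
    then have "Bseq (\<lambda>k. 4^k * (?d k)^2)" by (intro convergent_imp_Bseq convergentI)
    then obtain C where C: "C > 0" "\<And>k. norm (4^k * (?d k)^2) \<le> C" by (auto elim: BseqE)
    have dk: "?d k \<le> sqrt C * (1/2)^k" for k
    proof -
      have "(2^k * ?d k)^2 \<le> (sqrt C)^2"
      proof -
        have "(2^k)^2 = (4::real)^k" by (simp add: power2_eq_square power_mult_distrib[symmetric])
        then show ?thesis using C(2)[of k] C(1) by (simp add: power_mult_distrib)
      qed
      then have "2^k * ?d k \<le> sqrt C" by (rule power2_le_imp_le) (use C in auto)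
      then show ?thesis by (simp add: field_simps power_divide)
    qed
    have "summable (\<lambda>k. sqrt C * (1/2)^k)" by (intro summable_mult summable_geometric) simp
    then have "summable (\<lambda>k. f (r (Suc k)) x - f (r k) x)"
      by (rule summable_comparison_test'[where N=0]) (rule dk)
    then have "convergent (\<lambda>n. \<Sum>k<n. f (r (Suc k)) x - f (r k) x)" by (simp add: summable_iff_convergent)
    then have "convergent (\<lambda>n. f (r n) x - f (r 0) x)" by (simp add: sum_lessThan_telescope[of "\<lambda>n. f (r n) x"])
    then show ?case by (simp add: convergent_diff_const_right_iff)
  qed
  define A where "A x = lim (\<lambda>k. f (r k) x)" for x
  have [measurable]: "borel_fun A" unfolding A_def by measurable
  have AE: "AE x in lborel. (\<lambda>k. f (r k) x) \<longlonglongrightarrow> A x"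
    using conv by eventually_elim (simp add: A_def convergent_LIMSEQ_iff)
  have bound: "sqi UNIV (\<lambda>x. f n x - A x) \<le> ennreal ((1/16)^k)" if n: "n \<ge> r k" for n k
  proof -
    have "sqi UNIV (\<lambda>x. f n x - A x) = (NNINT x. liminf (\<lambda>m. ennreal ((norm (f n x - f (r m) x))^2) * indicator UNIV x))"
      unfolding sqi_def
    proof (rule nn_integral_cong_AE, use AE in eventually_elim)
      fix x assume "(\<lambda>k. f (r k) x) \<longlonglongrightarrow> A x"
      then have "(\<lambda>m. ennreal ((norm (f n x - f (r m) x))^2)) \<longlonglongrightarrow> ennreal ((norm (f n x - A x))^2)"
        by (intro tendsto_intros)
      from lim_imp_Liminf[OF sequentially_bot this]
      show "ennreal ((norm (f n x - A x))^2) * indicator UNIV x = liminf (\<lambda>m. ennreal ((norm (f n x - f (r m) x))^2) * indicator UNIV x)" by simp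
    qed
    also have "\<dots> \<le> liminf (\<lambda>m. sqi UNIV (\<lambda>x. f n x - f (r m) x))"
      unfolding sqi_def by (rule nn_integral_liminf) auto
    also have "\<dots> \<le> liminf (\<lambda>m. ennreal ((1/16)^k))"
    proof (rule Liminf_mono, rule eventually_sequentiallyI[of k])
      fix m assume "k \<le> m"
      then have "r k \<le> r m" using sm by (simp add: strict_mono_less_eq)
      then show "sqi UNIV (\<lambda>x. f n x - f (r m) x) \<le> ennreal ((1/16)^k)" using r0[OF n] by (simp add: less_imp_le)
    qed
    also have "\<dots> = ennreal ((1/16)^k)" by (simp add: Liminf_const)
    finally show ?thesis .
  qed
  have "(\<lambda>n. sqi UNIV (\<lambda>x. f n x - A x)) \<longlonglongrightarrow> 0"
  proof (rule order_tendstoI)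
    fix a :: ennreal assume a: "0 < a"
    have "(\<lambda>k. ennreal ((1/16)^k)) \<longlonglongrightarrow> 0" by (subst ennreal_tendsto_0_iff) (auto intro: LIMSEQ_power_zero)
    then have "\<forall>\<^sub>F k in sequentially. ennreal ((1/16)^k) < a" using a by (rule order_tendstoD)
    then obtain k where k: "ennreal ((1/16)^k) < a" by (auto simp: eventually_sequentially)
    show "\<forall>\<^sub>F n in sequentially. sqi UNIV (\<lambda>x. f n x - A x) < a"
      by (rule eventually_sequentiallyI[of "r k"]) (use bound k le_less_trans in blast)
  qed auto
  then show ?thesis by (intro that[of A]) auto
qed

section \<open>Representatives on the whole plane\<close>

lemma AE_lebesgue_on:
  assumes "\<Omega> \<in> sets borel"
  shows "(AE x in lebesgue_on \<Omega>. P x) \<longleftrightarrow> (AE x\<in>\<Omega> in lborel. P x)"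
  using assms by (subst AE_restrict_space_iff) (auto simp: AE_completion_iff)

lemma lebesgue_measurable_AE:
  fixes f F :: "'a::euclidean_space \<Rightarrow> 'b::topological_space"
  assumes [measurable]: "borel_fun F" and eq: "AE x in lborel. f x = F x"
  shows "f \<in> borel_measurable lebesgue"
proof (rule measurableI)
  fix B :: "'b set" assume [measurable]: "B \<in> sets borel"
  have 1: "F \<in> borel_measurable lebesgue" by (rule measurable_completion) simp
  have "{x \<in> space lebesgue. f x \<in> B \<and> f x \<noteq> F x} \<in> sets lebesgue"
    by (rule sets_completion_AE[unfolded pred_def]) (use eq in \<open>eventually_elim, simp\<close>)
  moreover have "{x \<in> space lebesgue. f x \<noteq> F x} \<in> sets lebesgue"
    by (rule sets_completion_AE[unfolded pred_def]) (use eq in \<open>eventually_elim, simp\<close>)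
  moreover have "F -` B \<inter> space lebesgue \<in> sets lebesgue" using 1 by (rule measurable_sets) simp
  ultimately have "(F -` B \<inter> space lebesgue - {x \<in> space lebesgue. f x \<noteq> F x}) \<union> {x \<in> space lebesgue. f x \<in> B \<and> f x \<noteq> F x} \<in> sets lebesgue"
    by (intro sets.Un sets.Diff)
  also have "(F -` B \<inter> space lebesgue - {x \<in> space lebesgue. f x \<noteq> F x}) \<union> {x \<in> space lebesgue. f x \<in> B \<and> f x \<noteq> F x} = f -` B \<inter> space lebesgue"
    by auto
  finally show "f -` B \<inter> space lebesgue \<in> sets lebesgue" .
qed simp

lemma lebesgue_on_measurable_AE:
  fixes f F :: "'a::euclidean_space \<Rightarrow> 'b::real_normed_vector"
  assumes \<Omega>: "\<Omega> \<in> sets borel" and [measurable]: "borel_fun F" and eq: "AE x\<in>\<Omega> in lborel. f x = F x"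
  shows "f \<in> borel_measurable (lebesgue_on \<Omega>)"
proof -
  have "(\<lambda>x. if x \<in> \<Omega> then f x else F x) \<in> borel_measurable lebesgue"
    by (rule lebesgue_measurable_AE[of F]) (use eq in auto)
  then have "(\<lambda>x. if x \<in> \<Omega> then f x else F x) \<in> borel_measurable (lebesgue_on \<Omega>)"
    by (rule measurable_restrict_space1)
  then show ?thesis by (subst measurable_cong[of _ _ "\<lambda>x. if x \<in> \<Omega> then f x else F x"]) auto
qed

text \<open>The bridge between integrals over \<open>lebesgue_on \<Omega>\<close>, in which weak
  solutions are defined, and integrals of Borel functions over the plane, for which Fubini and
  reflections are available.\<close>

lemma integral_lebesgue_on:
  fixes f F :: "'a::euclidean_space \<Rightarrow> real"
  assumes \<Omega>: "\<Omega> \<in> sets borel" and [measurable]: "borel_fun F"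
    and eq: "AE x\<in>\<Omega> in lborel. f x = F x" and z: "AE x in lborel. x \<notin> \<Omega> \<longrightarrow> F x = 0"
  shows "(LINT x|lebesgue_on \<Omega>. f x) = (LINT x|lborel. F x)"
    and "integrable (lebesgue_on \<Omega>) f \<longleftrightarrow> integrable lborel F"
proof -
  have e: "AE x in lborel. indicator \<Omega> x *\<^sub>R f x = F x"
    using eq z by eventually_elim (auto simp: indicator_def)
  have m: "(\<lambda>x. indicator \<Omega> x *\<^sub>R f x) \<in> borel_measurable lebesgue"
    by (rule lebesgue_measurable_AE[OF _ e]) simp
  have m': "F \<in> borel_measurable lebesgue" by (rule measurable_completion) simp
  have "(LINT x|lebesgue_on \<Omega>. f x) = (LINT x|lebesgue. indicator \<Omega> x *\<^sub>R f x)"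
    using \<Omega> by (subst integral_restrict_space) auto
  also have "\<dots> = (LINT x|lebesgue. F x)"
    by (rule integral_cong_AE[OF m m']) (use e in \<open>simp add: AE_completion_iff\<close>)
  also have "\<dots> = (LINT x|lborel. F x)" by (rule integral_completion) simp
  finally show "(LINT x|lebesgue_on \<Omega>. f x) = (LINT x|lborel. F x)" .
  have "integrable (lebesgue_on \<Omega>) f \<longleftrightarrow> integrable lebesgue (\<lambda>x. indicator \<Omega> x *\<^sub>R f x)"
    using \<Omega> by (subst integrable_restrict_space) auto
  also have "\<dots> \<longleftrightarrow> integrable lebesgue F"
    by (rule integrable_cong_AE[OF m m']) (use e in \<open>simp add: AE_completion_iff\<close>)
  also have "\<dots> \<longleftrightarrow> integrable lborel F" by (rule integrable_completion) simp
  finally show "integrable (lebesgue_on \<Omega>) f \<longleftrightarrow> integrable lborel F" .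
qed

lemma nn_integral_lebesgue_on:
  assumes "S \<in> sets borel"
  shows "(\<integral>\<^sup>+x. f x \<partial>lebesgue_on S) = NNset S (\<lambda>x. f x)"
proof -
  have "(\<integral>\<^sup>+x. f x \<partial>lebesgue_on S) = (\<integral>\<^sup>+x. f x * indicator S x \<partial>lebesgue)"
    using assms by (subst nn_integral_restrict_space) auto
  then show ?thesis by (simp add: nn_integral_completion)
qed

lemma Lp_norm_2: "S \<in> sets borel \<Longrightarrow> (Lp_norm 2 S f)^2 = sqi S f"
proof -
  assume S: "S \<in> sets borel"
  have I: "(\<integral>\<^sup>+x. ennreal (norm (f x) powr 2) \<partial>lebesgue_on S) = sqi S f"
    unfolding nn_integral_lebesgue_on[OF S] sqi_def by simp
  show ?thesis
  proof (cases "sqi S f = \<infinity>")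
    case True then show ?thesis unfolding Lp_norm_def I Let_def by (simp add: power2_eq_square ennreal_top_mult)
  next
    case False
    then have "Lp_norm 2 S f = ennreal (sqrt (enn2real (sqi S f)))" unfolding Lp_norm_def I Let_def by (simp add: powr_half_sqrt)
    then have "(Lp_norm 2 S f)^2 = ennreal (enn2real (sqi S f))" by (simp add: ennreal_power)
    then show ?thesis using False by (simp add: less_top)
  qed
qed

lemma Lp_norm_2_tendsto:
  assumes "\<And>n. S n \<in> sets borel" shows "(\<lambda>n. Lp_norm 2 (S n) (f n)) \<longlonglongrightarrow> 0 \<longleftrightarrow> (\<lambda>n. sqi (S n) (f n)) \<longlonglongrightarrow> 0"
proof
  assume "(\<lambda>n. Lp_norm 2 (S n) (f n)) \<longlonglongrightarrow> 0"
  from ennreal_power2_tendsto_0[OF this] show "(\<lambda>n. sqi (S n) (f n)) \<longlonglongrightarrow> 0" by (simp add: Lp_norm_2 assms)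
next
  assume "(\<lambda>n. sqi (S n) (f n)) \<longlonglongrightarrow> 0"
  then show "(\<lambda>n. Lp_norm 2 (S n) (f n)) \<longlonglongrightarrow> 0"
    by (rule ennreal_square_tendsto_0[rotated]) (simp add: Lp_norm_2 assms)
qed

lemma grad_off_domain:
  assumes "\<phi> \<in> test_functions \<Omega>" "p \<notin> \<Omega>" shows "grad \<phi> p = 0"
  using assms grad_supported[OF assms(1)] by (auto simp: test_functions_def)

lemma vec_borelI:
  assumes "\<And>i. (\<lambda>x. f x $ i) \<in> borel_measurable M" shows "(f :: _ \<Rightarrow> 'a::euclidean_space^'n) \<in> borel_measurable M"
proof -
  have "(\<lambda>x. f x \<bullet> b) \<in> borel_measurable M" if "b \<in> Basis" for b
  proof -
    obtain i u where "b = axis i u" "u \<in> Basis" using \<open>b \<in> Basis\<close> by (auto simp: Basis_vec_def)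
    then have "(\<lambda>x. f x \<bullet> b) = (\<lambda>x. f x $ i \<bullet> u)" by (auto simp: inner_axis)
    then show ?thesis using assms[of i] by simp
  qed
  then show ?thesis by (subst borel_measurable_euclidean_space) auto
qed

text \<open>A field in \<open>H1 \<Omega>\<close> is only Lebesgue measurable on \<Omega>. Extended
  by zero, each component agrees almost everywhere with a Borel function, and the gradients of its
  approximants have a limit by completeness of L^2.\<close>

lemma H1_representation:
  assumes \<Omega>: "open \<Omega>" and u: "u \<in> H1 \<Omega>"
  obtains z A \<phi> where "appr \<Omega> z A \<phi>" "AE x\<in>\<Omega> in lborel. u x = z x" "AE x in lborel. x \<notin> \<Omega> \<longrightarrow> z x = 0"
proof -
  have [measurable]: "\<Omega> \<in> sets borel" using \<Omega> by simp
  obtain \<phi> where \<phi>: "\<And>n. \<phi> n \<in> solenoidal_test_functions \<Omega>"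
    "\<And>e. e > 0 \<Longrightarrow> \<exists>N. \<forall>m\<ge>N. \<forall>n\<ge>N. Lp_norm 2 \<Omega> (\<lambda>x. grad (\<phi> m) x - grad (\<phi> n) x) < ennreal e"
    "\<And>r. r > 0 \<Longrightarrow> (\<lambda>n. Lp_norm 2 (\<Omega> \<inter> ball 0 r) (\<lambda>x. \<phi> n x - u x)) \<longlonglongrightarrow> 0"
    and um: "u \<in> borel_measurable (lebesgue_on \<Omega>)"
    using u unfolding H1_def by blast
  note t = solenoidal_test[OF \<phi>(1)]
  note [measurable] = test_functions_measurable[OF t] grad_measurable[OF t]
  have um': "(\<lambda>x. indicator \<Omega> x *\<^sub>R u x) \<in> borel_measurable lebesgue"
    using um \<Omega> by (subst (asm) borel_measurable_restrict_space_iff) auto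
  have ex: "\<exists>g\<in>borel_measurable lborel. AE x in lborel. (indicator \<Omega> x *\<^sub>R u x) $ j = g x" for j
    by (intro completion_ex_borel_measurable_real measurable_nth2[OF um'])
  obtain g1 where g1: "g1 \<in> borel_measurable lborel" "AE x in lborel. (indicator \<Omega> x *\<^sub>R u x) $ 1 = g1 x"
    using ex[of 1] by (elim bexE) (rule that)
  obtain g2 where g2: "g2 \<in> borel_measurable lborel" "AE x in lborel. (indicator \<Omega> x *\<^sub>R u x) $ 2 = g2 x"
    using ex[of 2] by (elim bexE) (rule that)
  define z where "z x = pt (g1 x) (g2 x)" for x
  have [measurable]: "borel_fun z" unfolding z_def using g1(1) g2(1) by (intro measurable_pt') auto
  have ze: "AE x in lborel. z x = indicator \<Omega> x *\<^sub>R u x"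
    using g1(2) g2(2) by eventually_elim (simp add: z_def vec_eq_iff forall_2)
  have zconv: "(\<lambda>n. sqi (square r) (\<lambda>p. \<phi> n p - z p)) \<longlonglongrightarrow> 0" for r
  proof -
    define R where "R = max r 1"
    have R: "R > 0" "r \<le> R" by (auto simp: R_def)
    have "(\<lambda>n. sqi (\<Omega> \<inter> ball 0 (2*R)) (\<lambda>x. \<phi> n x - u x)) \<longlonglongrightarrow> 0"
      using \<phi>(3)[of "2*R"] R by (subst Lp_norm_2_tendsto[symmetric]) auto
    moreover have "sqi (square r) (\<lambda>p. \<phi> n p - z p) \<le> sqi (\<Omega> \<inter> ball 0 (2*R)) (\<lambda>x. \<phi> n x - u x)" for n
      unfolding sqi_def
    proof (rule nn_integral_mono_AE, use ze in eventually_elim)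
      fix x assume "z x = indicator \<Omega> x *\<^sub>R u x"
      then show "ennreal ((norm (\<phi> n x - z x))^2) * indicator (square r) x \<le> ennreal ((norm (\<phi> n x - u x))^2) * indicator (\<Omega> \<inter> ball 0 (2*R)) x"
        using test_functionsD(3)[OF t, of x n] square_ball[OF R(1)] square_mono[OF R(2)] by (auto simp: indicator_def)
    qed
    ultimately show ?thesis by (rule ennreal_squeeze_0)
  qed
  have cau: "\<exists>N. \<forall>m\<ge>N. \<forall>n\<ge>N. sqi UNIV (\<lambda>x. grad (\<phi> m) x - grad (\<phi> n) x) < e" if "e > 0" for e
  proof -
    \<comment> \<open>The Cauchy condition concerns norms while squares are needed; for a norm at
      most 1 the square is no larger than the norm.\<close>
    obtain d where d: "d > 0" "ennreal d \<le> e" "d \<le> 1"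
    proof (cases "e \<ge> 1")
      case True then show ?thesis by (intro that[of 1]) auto
    next
      case False
      then obtain c where "e = ennreal c" "c > 0" using \<open>e > 0\<close>
        by (metis ennreal_cases ennreal_less_zero_iff linear not_gr_zero top_greatest)
      then show ?thesis using False by (intro that[of c]) (auto simp: ennreal_ge_1)
    qed
    obtain N where N: "\<forall>m\<ge>N. \<forall>n\<ge>N. Lp_norm 2 \<Omega> (\<lambda>x. grad (\<phi> m) x - grad (\<phi> n) x) < ennreal d" using \<phi>(2)[OF d(1)] by blast
    have "sqi UNIV (\<lambda>x. grad (\<phi> m) x - grad (\<phi> n) x) < e" if "m \<ge> N" "n \<ge> N" for m n
    proof -
      let ?L = "Lp_norm 2 \<Omega> (\<lambda>x. grad (\<phi> m) x - grad (\<phi> n) x)"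
      have L: "?L < ennreal d" using N that by blast
      then have "?L \<le> 1" using d(3) by (meson ennreal_le_1 less_imp_le order_trans)
      have "sqi UNIV (\<lambda>x. grad (\<phi> m) x - grad (\<phi> n) x) = sqi \<Omega> (\<lambda>x. grad (\<phi> m) x - grad (\<phi> n) x)"
        by (rule sqi_supported) (simp add: grad_off_domain[OF t])
      also have "\<dots> = ?L^2" by (simp add: Lp_norm_2)
      also have "\<dots> \<le> ?L * 1" unfolding power2_eq_square using \<open>?L \<le> 1\<close> by (rule mult_left_mono) auto
      also have "\<dots> < ennreal d" using L by simp
      finally show ?thesis using d(2) by (rule less_le_trans)
    qed
    then show ?thesis by blast
  qed
  obtain A where A: "borel_fun A" "(\<lambda>n. sqi UNIV (\<lambda>x. grad (\<phi> n) x - A x)) \<longlonglongrightarrow> 0"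
    by (rule sqi_complete[of "\<lambda>n. grad (\<phi> n)"]) (use cau in auto)
  show ?thesis
  proof (rule that)
    show "appr \<Omega> z A \<phi>" unfolding appr_def using A \<phi>(1) zconv by auto
    show "AE x\<in>\<Omega> in lborel. u x = z x" "AE x in lborel. x \<notin> \<Omega> \<longrightarrow> z x = 0"
      using ze by (auto elim!: eventually_mono)
  qed
qed

lemma appr_grad_off_domain:
  assumes ap: "appr \<Omega> z A \<phi>" and \<Omega>: "open \<Omega>"
  shows "AE x in lborel. x \<notin> \<Omega> \<longrightarrow> A x = 0"
proof -
  note D = apprD[OF ap]
  note [measurable] = D(1,2,5,6)
  have [measurable]: "- \<Omega> \<in> sets borel" using \<Omega> by auto
  have "sqi (- \<Omega>) A \<le> sqi UNIV (\<lambda>x. grad (\<phi> n) x - A x)" for n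
  proof -
    have "sqi (- \<Omega>) A = sqi (- \<Omega>) (\<lambda>x. grad (\<phi> n) x - A x)"
      by (rule sqi_cong) (auto simp: grad_off_domain[OF D(4)])
    also have "\<dots> \<le> sqi UNIV (\<lambda>x. grad (\<phi> n) x - A x)" by (rule sqi_mono_set) auto
    finally show ?thesis .
  qed
  then have "sqi (- \<Omega>) A \<le> 0" using LIMSEQ_le_const[OF D(8)] by blast
  then have "AE x in lborel. ennreal ((norm (A x))^2) * indicator (- \<Omega>) x = 0"
    unfolding sqi_def by (subst (asm) le_zero_eq, subst (asm) nn_integral_0_iff_AE) auto
  then show ?thesis by eventually_elim (auto simp: indicator_def split: if_splits)
qed

lemma appr_H1:
  assumes ap: "appr \<Omega> z A \<phi>" and \<Omega>: "open \<Omega>" and uz: "AE x\<in>\<Omega> in lborel. u x = z x"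
  shows "u \<in> H1 \<Omega>"
  unfolding H1_def
proof (intro CollectI conjI exI[of _ \<phi>] allI impI)
  note D = apprD[OF ap]
  note [measurable] = D(1,2,5,6)
  have [measurable]: "\<Omega> \<in> sets borel" using \<Omega> by auto
  show "u \<in> borel_measurable (lebesgue_on \<Omega>)" by (rule lebesgue_on_measurable_AE[OF _ D(1) uz]) simp
  show "\<phi> n \<in> solenoidal_test_functions \<Omega>" for n by (rule D)
  show "(\<lambda>n. Lp_norm 2 (\<Omega> \<inter> ball 0 r) (\<lambda>x. \<phi> n x - u x)) \<longlonglongrightarrow> 0" if "r > 0" for r
  proof (subst Lp_norm_2_tendsto)
    show "(\<lambda>n. sqi (\<Omega> \<inter> ball 0 r) (\<lambda>x. \<phi> n x - u x)) \<longlonglongrightarrow> 0"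
    proof (rule ennreal_squeeze_0[OF D(7)[of r]])
      fix n
      have "sqi (\<Omega> \<inter> ball 0 r) (\<lambda>x. \<phi> n x - u x) = sqi (\<Omega> \<inter> ball 0 r) (\<lambda>x. \<phi> n x - z x)"
        by (rule sqi_cong, use uz in eventually_elim) auto
      also have "\<dots> \<le> sqi (square r) (\<lambda>x. \<phi> n x - z x)" by (rule sqi_mono_set) (auto intro: in_squareI)
      finally show "sqi (\<Omega> \<inter> ball 0 r) (\<lambda>x. \<phi> n x - u x) \<le> sqi (square r) (\<lambda>x. \<phi> n x - z x)" .
    qed
  qed auto
  fix e :: real assume e: "e > 0"
  have "(\<lambda>n. 2 * sqi UNIV (\<lambda>x. grad (\<phi> n) x - A x)) \<longlonglongrightarrow> 0" by (intro ennreal_mult_tendsto_0 D) auto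
  then have "\<forall>\<^sub>F n in sequentially. 2 * sqi UNIV (\<lambda>x. grad (\<phi> n) x - A x) < ennreal (e^2 / 2)"
    using e by (intro order_tendstoD) auto
  then obtain N where N: "\<And>n. n \<ge> N \<Longrightarrow> 2 * sqi UNIV (\<lambda>x. grad (\<phi> n) x - A x) < ennreal (e^2 / 2)"
    by (auto simp: eventually_sequentially)
  show "\<exists>N. \<forall>m\<ge>N. \<forall>n\<ge>N. Lp_norm 2 \<Omega> (\<lambda>x. grad (\<phi> m) x - grad (\<phi> n) x) < ennreal e"
  proof (intro exI[of _ N] allI impI)
    fix m n assume mn: "N \<le> m" "N \<le> n"
    have "(Lp_norm 2 \<Omega> (\<lambda>x. grad (\<phi> m) x - grad (\<phi> n) x))^2 = sqi \<Omega> (\<lambda>x. grad (\<phi> m) x - grad (\<phi> n) x)" by (simp add: Lp_norm_2)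
    also have "\<dots> \<le> sqi UNIV (\<lambda>x. grad (\<phi> m) x - grad (\<phi> n) x)" by (rule sqi_mono_set) auto
    also have "\<dots> \<le> 2 * sqi UNIV (\<lambda>x. grad (\<phi> m) x - A x) + 2 * sqi UNIV (\<lambda>x. grad (\<phi> n) x - A x)"
      by (rule sqi_triangle_diff) auto
    also have "\<dots> < ennreal (e^2 / 2) + ennreal (e^2 / 2)" by (intro add_strict_mono N mn)
    also have "\<dots> = (ennreal e)^2" using e by (simp add: ennreal_power flip: ennreal_plus)
    finally show "Lp_norm 2 \<Omega> (\<lambda>x. grad (\<phi> m) x - grad (\<phi> n) x) < ennreal e"
      by (meson leD leI power_mono zero_le)
  qed
qed

lemma L2_locally_integrable:
  fixes z :: "real^2 \<Rightarrow> real"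
  assumes [measurable]: "borel_fun z" and z: "\<And>r. sqi (square r) z < top"
    and \<Omega>: "\<Omega> \<in> sets borel" and eq: "AE x\<in>\<Omega> in lborel. f x = z x"
  shows "locally_integrable \<Omega> f"
  unfolding locally_integrable_def
proof (intro allI impI)
  fix K assume K: "compact K \<and> K \<subseteq> \<Omega>"
  then have [measurable]: "K \<in> sets borel" by (simp add: borel_compact)
  obtain r where "\<And>x. x \<in> K \<Longrightarrow> norm x \<le> r" using K compact_imp_bounded by (meson bounded_iff)
  then have r: "K \<subseteq> square r" using in_squareI by blast
  have "integrable lborel (\<lambda>x. indicator K x * z x)"
  proof (rule L2_pairing(2)[where f=z and g="\<lambda>_. 1::real" and S="square r"])
    show "AE x in lborel. \<bar>indicator K x * z x\<bar> \<le> indicator (square r) x * (norm (z x) * norm (1::real))"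
      using r by (intro AE_I2) (auto simp: indicator_def)
    show "sqi (square r) (\<lambda>_. 1::real) < top" by (rule sqi_finite_bounded[of _ 1]) simp
  qed (use z in auto)
  then have "integrable lebesgue (\<lambda>x. indicator K x * z x)" by (subst integrable_completion) auto
  moreover have e: "AE x in lborel. indicator K x *\<^sub>R f x = indicator K x * z x"
    using eq K by (auto elim!: eventually_mono simp: indicator_def)
  moreover have "(\<lambda>x. indicator K x *\<^sub>R f x) \<in> borel_measurable lebesgue" by (rule lebesgue_measurable_AE[OF _ e]) measurable
  ultimately show "f absolutely_integrable_on K"
    unfolding set_integrable_def
    by (subst integrable_cong_AE[of _ _ "\<lambda>x. indicator K x * z x"]) (auto simp: AE_completion_iff measurable_completion)
qed

lemma distr_partial_lborel:
  fixes z :: "real^2 \<Rightarrow> real"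
  assumes \<Omega>: "open \<Omega>" and [measurable]: "borel_fun z"
    and "AE x\<in>\<Omega> in lborel. g x = z x" and \<psi>: "\<psi> \<in> test_functions \<Omega>"
  shows "distr_partial \<Omega> i g \<psi> = - (LBINT x. z x * partial i \<psi> x)"
proof -
  note [measurable] = test_functions_measurable[OF test_functions_partial[OF \<psi>]]
  note z = test_functionsD(3)[OF test_functions_partial[OF \<psi>]]
  show ?thesis
    unfolding distr_partial_def using assms(3) \<Omega> by (subst integral_lebesgue_on(1)[where F="\<lambda>x. z x * partial i \<psi> x"]) (auto simp: z elim!: eventually_mono)
qed

lemma test_pairing_lborel:
  fixes B \<psi> :: "real^2 \<Rightarrow> real"
  assumes \<Omega>: "open \<Omega>" and [measurable]: "borel_fun B"
    and "AE x\<in>\<Omega> in lborel. h x = B x" and \<psi>: "\<psi> \<in> test_functions \<Omega>"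
  shows "(LINT x|lebesgue_on \<Omega>. h x * \<psi> x) = (LBINT x. B x * \<psi> x)"
proof -
  note [measurable] = test_functions_measurable[OF \<psi>]
  note z = test_functionsD(3)[OF \<psi>]
  show ?thesis
    using assms(3) \<Omega> by (subst integral_lebesgue_on(1)[where F="\<lambda>x. B x * \<psi> x"]) (auto simp: z elim!: eventually_mono)
qed

text \<open>Local integrability gives measurability on compact subsets only; countably many boxes
  with closures inside \<Omega> glue these pieces together.\<close>

lemma locally_integrable_borel:
  fixes f :: "real^2 \<Rightarrow> real"
  assumes \<Omega>: "open \<Omega>" and f: "locally_integrable \<Omega> f"
  obtains F where "borel_fun F" "AE x\<in>\<Omega> in lborel. f x = F x" "AE x in lborel. x \<notin> \<Omega> \<longrightarrow> F x = 0"
    "\<And>a b. cbox a b \<subseteq> \<Omega> \<Longrightarrow> set_integrable lborel (cbox a b) F"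
proof -
  obtain D where D: "countable D" "\<And>a b. (a,b) \<in> D \<Longrightarrow> cbox a b \<subseteq> \<Omega>" "\<Omega> = (\<Union>(a,b)\<in>D. box a b)"
    using open_countable_boxes[OF \<Omega>] by blast
  have m: "(\<lambda>x. indicator (cbox a b) x *\<^sub>R f x) \<in> borel_measurable lebesgue" if "cbox a b \<subseteq> \<Omega>" for a b
    using f that unfolding locally_integrable_def set_integrable_def by (meson borel_measurable_integrable compact_cbox)
  have "(\<lambda>x. indicator \<Omega> x * f x) \<in> borel_measurable lebesgue"
  proof (rule measurable_piecewise_restrict[where C="insert (- \<Omega>) ((\<lambda>(a,b). box a b) ` D)"])
    show "countable (insert (- \<Omega>) ((\<lambda>(a,b). box a b) ` D))" using D(1) by simp
    show "space lebesgue \<subseteq> \<Union> (insert (- \<Omega>) ((\<lambda>(a,b). box a b) ` D))" using D(3) by auto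
    fix S assume S: "S \<in> insert (- \<Omega>) ((\<lambda>(a,b). box a b) ` D)"
    then show "S \<inter> space lebesgue \<in> sets lebesgue" using \<Omega> by auto
    show "(\<lambda>x. indicator \<Omega> x * f x) \<in> borel_measurable (restrict_space lebesgue S)"
    proof (cases "S = - \<Omega>")
      case True
      then show ?thesis by (subst measurable_cong[of _ _ "\<lambda>_. 0"]) auto
    next
      case False
      then obtain a b where ab: "(a,b) \<in> D" "S = box a b" using S by auto
      have "(\<lambda>x. indicator (cbox a b) x *\<^sub>R f x) \<in> borel_measurable (restrict_space lebesgue S)"
        by (rule measurable_restrict_space1[OF m[OF D(2)[OF ab(1)]]])
      then show ?thesis
        using D(2)[OF ab(1)] box_subset_cbox[of a b] ab
        by (subst measurable_cong[of _ _ "\<lambda>x. indicator (cbox a b) x *\<^sub>R f x"]) (auto simp: indicator_def)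
    qed
  qed
  then obtain F where F: "F \<in> borel_measurable lborel" "AE x in lborel. indicator \<Omega> x * f x = F x"
    using completion_ex_borel_measurable_real by blast
  then have [measurable]: "borel_fun F" by simp
  show ?thesis
  proof (rule that)
    show "borel_fun F" by simp
    show "AE x\<in>\<Omega> in lborel. f x = F x" "AE x in lborel. x \<notin> \<Omega> \<longrightarrow> F x = 0"
      using F(2) by (auto elim!: eventually_mono)
    fix a b assume ab: "cbox a b \<subseteq> \<Omega>"
    have "integrable lebesgue (\<lambda>x. indicator (cbox a b) x *\<^sub>R f x)"
      using f ab unfolding locally_integrable_def set_integrable_def by (meson compact_cbox)
    then have "integrable lebesgue (\<lambda>x. indicator (cbox a b) x *\<^sub>R F x)"
      by (rule integrable_cong_AE_imp)
         (use F(2) ab in \<open>auto simp: AE_completion_iff measurable_completion indicator_def elim!: eventually_mono\<close>)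
    then show "set_integrable lborel (cbox a b) F"
      unfolding set_integrable_def by (subst (asm) integrable_completion) auto
  qed
qed

text \<open>\<open>wgrad\<close> is an arbitrary choice among weak gradients. Since A is one, the
  choice is a weak gradient too, and by the fundamental lemma two weak gradients agree almost
  everywhere.\<close>

lemma appr_wgrad:
  assumes ap: "appr \<Omega> z A \<phi>" and \<Omega>: "open \<Omega>" and uz: "AE x\<in>\<Omega> in lborel. u x = z x"
  shows "AE x\<in>\<Omega> in lborel. wgrad \<Omega> u x = A x"
proof -
  note D = apprD[OF ap]
  note [measurable] = D(1,2,5,6)
  have Ob: "\<Omega> \<in> sets borel" using \<Omega> by simp
  have uz': "AE x\<in>\<Omega> in lborel. u x $ j = z x $ j" for j using uz by (auto elim!: eventually_mono)
  have le: "sqi (square r) (\<lambda>x. A x $ i $ j) < top" for r i j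
  proof -
    have "sqi (square r) (\<lambda>x. A x $ i $ j) \<le> sqi (square r) A" by (rule sqi_mono) (auto simp: matrix_nth_le)
    also have "\<dots> \<le> sqi UNIV A" by (rule sqi_mono_set) auto
    finally show ?thesis using D(10) by (rule le_less_trans)
  qed
  have lu: "locally_integrable \<Omega> (\<lambda>x. u x $ j)" for j
    by (rule L2_locally_integrable[OF _ _ Ob uz']) (auto intro: le_less_trans[OF sqi_nth D(9)])
  have "\<forall>i j. weak_partial \<Omega> i (\<lambda>x. u x $ j) (\<lambda>x. A x $ i $ j)"
    unfolding weak_partial_def
  proof (intro allI conjI ballI lu)
    show "locally_integrable \<Omega> (\<lambda>x. A x $ i $ j)" for i j
      by (rule L2_locally_integrable[OF _ le Ob]) auto
    show "distr_partial \<Omega> i (\<lambda>x. u x $ j) \<psi> = (LINT x|lebesgue_on \<Omega>. A x $ i $ j * \<psi> x)" if \<psi>: "\<psi> \<in> test_functions \<Omega>" for i j \<psi>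
    proof -
      have "(LINT x|lebesgue_on \<Omega>. A x $ i $ j * \<psi> x) = (LBINT x. A x $ i $ j * \<psi> x)"
        by (rule test_pairing_lborel[OF \<Omega> _ _ \<psi>]) auto
      moreover have "distr_partial \<Omega> i (\<lambda>x. u x $ j) \<psi> = - (LBINT x. z x $ j * partial i \<psi> x)"
        by (rule distr_partial_lborel[OF \<Omega> _ uz' \<psi>]) measurable
      ultimately show ?thesis using appr_weak_derivative[OF ap \<psi>, of j i] by simp
    qed
  qed
  from someI[of "\<lambda>B. \<forall>i j. weak_partial \<Omega> i (\<lambda>x. u x $ j) (\<lambda>x. B x $ i $ j)", OF this]
  have W: "weak_partial \<Omega> i (\<lambda>x. u x $ j) (\<lambda>x. wgrad \<Omega> u x $ i $ j)" for i j
    unfolding wgrad_def by blast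
  have "AE x\<in>\<Omega> in lborel. wgrad \<Omega> u x $ i $ j = A x $ i $ j" for i j
  proof -
    have li: "locally_integrable \<Omega> (\<lambda>x. wgrad \<Omega> u x $ i $ j)" using W by (simp add: weak_partial_def)
    obtain B where B: "borel_fun B" "AE x\<in>\<Omega> in lborel. wgrad \<Omega> u x $ i $ j = B x"
      and "AE x in lborel. x \<notin> \<Omega> \<longrightarrow> B x = 0"
      and Bbox: "\<And>a b. cbox a b \<subseteq> \<Omega> \<Longrightarrow> set_integrable lborel (cbox a b) B" by (rule locally_integrable_borel[OF \<Omega> li]) (rule that)
    note [measurable] = B(1)
    have Ai: "set_integrable lborel (cbox a b) (\<lambda>x. A x $ i $ j)" for a b
    proof -
      obtain r where "\<And>x. x \<in> cbox a b \<Longrightarrow> norm x \<le> r" using bounded_cbox[of a b] by (meson bounded_iff)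
      then have r: "cbox a b \<subseteq> square r" using in_squareI by blast
      show ?thesis unfolding set_integrable_def
      proof (rule L2_pairing(2)[where f="\<lambda>x. A x $ i $ j" and g="\<lambda>_. 1::real" and S="square r"])
        show "AE x in lborel. \<bar>indicator (cbox a b) x *\<^sub>R A x $ i $ j\<bar> \<le> indicator (square r) x * (norm (A x $ i $ j) * norm (1::real))"
          using r by (intro AE_I2) (auto simp: indicator_def)
        show "sqi (square r) (\<lambda>_. 1::real) < top" by (rule sqi_finite_bounded[of _ 1]) simp
      qed (use le in auto)
    qed
    have bint: "integrable lborel (\<lambda>x. h x * \<psi> x)" if tf: "\<psi> \<in> test_functions \<Omega>" and hm: "borel_fun h"
      and h: "\<And>K. compact K \<Longrightarrow> K \<subseteq> \<Omega> \<Longrightarrow> set_integrable lborel K h" for h :: "real^2 \<Rightarrow> real" and \<psi>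
    proof -
      let ?K = "closure {x. \<psi> x \<noteq> 0}"
      obtain M where M: "\<And>x. norm (\<psi> x) \<le> M" by (rule test_functions_bounded[OF tf]) (rule that)
      note [measurable] = test_functions_measurable[OF tf] hm
      have "set_integrable lborel ?K h" using tf by (intro h) (auto simp: test_functions_def)
      then have "integrable lborel (\<lambda>x. M * (indicator ?K x *\<^sub>R h x))" unfolding set_integrable_def by (rule integrable_mult_right)
      then show ?thesis
      proof (rule Bochner_Integration.integrable_bound)
        show "AE x in lborel. norm (h x * \<psi> x) \<le> norm (M * (indicator ?K x *\<^sub>R h x))"
        proof (rule AE_I2)
          fix x show "norm (h x * \<psi> x) \<le> norm (M * (indicator ?K x *\<^sub>R h x))"
          proof (cases "x \<in> ?K")
            case True
            then show ?thesis using M[of x] using order_trans[OF abs_ge_zero M[of x, unfolded real_norm_def]] by (simp add: abs_mult mult.commute[of "\<bar>h x\<bar>"] mult_right_mono)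
          next
            case False then show ?thesis using zero_off_support[of x \<psi>] by simp
          qed
        qed
      qed measurable
    qed
    have Bloc: "set_integrable lborel K B" if "compact K" "K \<subseteq> \<Omega>" for K
    proof -
      have [measurable]: "K \<in> sets borel" using that(1) by (simp add: borel_compact)
      have "(\<lambda>x. wgrad \<Omega> u x $ i $ j) absolutely_integrable_on K" using W that by (simp add: weak_partial_def locally_integrable_def)
      then have "integrable lebesgue (\<lambda>x. indicator K x *\<^sub>R B x)"
        unfolding set_integrable_def
        by (rule integrable_cong_AE_imp)
           (use B(2) that in \<open>auto simp: AE_completion_iff measurable_completion indicator_def elim!: eventually_mono\<close>)
      then show ?thesis unfolding set_integrable_def by (subst (asm) integrable_completion) auto
    qed
    have Aloc: "set_integrable lborel K (\<lambda>x. A x $ i $ j)" if K: "compact K" for K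
    proof -
      have [measurable]: "K \<in> sets borel" using K by (simp add: borel_compact)
      obtain a where "K \<subseteq> cbox (-a) a" using bounded_subset_cbox_symmetric[OF compact_imp_bounded[OF K]] by blast
      then show ?thesis using set_integrable_subset[OF Ai] by simp
    qed
    have "AE x\<in>\<Omega> in lborel. B x - A x $ i $ j = 0"
    proof (rule fundamental_lemma[OF \<Omega>])
      show "set_integrable lborel (cbox a b) (\<lambda>x. B x - A x $ i $ j)" if "cbox a b \<subseteq> \<Omega>" for a b
        by (intro set_integral_diff(1) Bbox Ai that)
      fix \<psi> :: "real^2 \<Rightarrow> real" assume \<psi>: "\<psi> \<in> test_functions \<Omega>"
      have "distr_partial \<Omega> i (\<lambda>x. u x $ j) \<psi> = (LINT x|lebesgue_on \<Omega>. wgrad \<Omega> u x $ i $ j * \<psi> x)" using W \<psi> by (simp add: weak_partial_def)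
      then have "(LBINT x. B x * \<psi> x) = (LBINT x. A x $ i $ j * \<psi> x)"
      proof -
        assume "distr_partial \<Omega> i (\<lambda>x. u x $ j) \<psi> = (LINT x|lebesgue_on \<Omega>. wgrad \<Omega> u x $ i $ j * \<psi> x)"
        moreover have "(LINT x|lebesgue_on \<Omega>. wgrad \<Omega> u x $ i $ j * \<psi> x) = (LBINT x. B x * \<psi> x)"
          by (rule test_pairing_lborel[OF \<Omega> B(1,2) \<psi>])
        moreover have "distr_partial \<Omega> i (\<lambda>x. u x $ j) \<psi> = - (LBINT x. z x $ j * partial i \<psi> x)"
          by (rule distr_partial_lborel[OF \<Omega> _ uz' \<psi>]) measurable
        ultimately show ?thesis using appr_weak_derivative[OF ap \<psi>, of j i] by simp
      qed
      then show "(LBINT x. (B x - A x $ i $ j) * \<psi> x) = 0"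
        by (simp add: left_diff_distrib Bochner_Integration.integral_diff bint[OF \<psi>] Bloc Aloc B(1))
    qed measurable
    then show ?thesis using B(2) by eventually_elim auto
  qed
  note e = this
  show ?thesis using e[of 1 1] e[of 1 2] e[of 2 1] e[of 2 2]
    by eventually_elim (simp add: vec_eq_iff forall_2)
qed

section \<open>Linear combinations and bounded functionals\<close>

lemma partial_lincomb:
  assumes "smooth f" "smooth g"
  shows "partial i (\<lambda>x. f x + c *\<^sub>R g x) x = partial i f x + c *\<^sub>R partial i g x"
proof -
  have L: "bounded_linear (\<lambda>y. c *\<^sub>R y)" by (rule bounded_linear_scaleR_right)
  show ?thesis
    using assms partial_add[of f x "\<lambda>x. c *\<^sub>R g x" i] partial_linear[OF L, of g x i]
    by (simp add: smooth_differentiable smooth_linear[OF L])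
qed

lemma smooth_lincomb:
  assumes "smooth f" "smooth g" shows "smooth (\<lambda>x. f x + c *\<^sub>R g x)"
proof (rule smooth_coinduct[where X="{\<lambda>x. f x + c *\<^sub>R g x | f g. smooth f \<and> smooth g}"])
  fix h i assume "h \<in> {\<lambda>x. f x + c *\<^sub>R g x | f g. smooth f \<and> smooth g}"
  then obtain f g where h: "h = (\<lambda>x. f x + c *\<^sub>R g x)" "smooth f" "smooth g" by auto
  have "partial i h = (\<lambda>x. partial i f x + c *\<^sub>R partial i g x)" by (auto simp: h partial_lincomb)
  then show "partial i h \<in> {\<lambda>x. f x + c *\<^sub>R g x | f g. smooth f \<and> smooth g}" using h smooth_partial by blast
  show "h differentiable at x" for x unfolding h(1)
    by (intro differentiable_add differentiable_scaleR differentiable_const smooth_differentiable h)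
qed (use assms in auto)

lemma test_functions_lincomb:
  assumes f: "f \<in> test_functions \<Omega>" and g: "g \<in> test_functions \<Omega>"
  shows "(\<lambda>x. f x + c *\<^sub>R g x) \<in> test_functions \<Omega>"
proof (rule test_functionsI[where K="closure {x. f x \<noteq> 0} \<union> closure {x. g x \<noteq> 0}"])
  show "bounded (closure {x. f x \<noteq> 0} \<union> closure {x. g x \<noteq> 0})"
    using test_functionsD(2)[OF f] test_functionsD(2)[OF g] compact_imp_bounded by auto
  show "smooth (\<lambda>x. f x + c *\<^sub>R g x)" by (intro smooth_lincomb test_functionsD(1)[OF f] test_functionsD(1)[OF g])
  show "closure {x. f x \<noteq> 0} \<union> closure {x. g x \<noteq> 0} \<subseteq> \<Omega>" using f g by (simp add: test_functions_def)
  show "f x + c *\<^sub>R g x = 0" if "x \<notin> closure {x. f x \<noteq> 0} \<union> closure {x. g x \<noteq> 0}" for x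
    using that zero_off_support[of x f] zero_off_support[of x g] by simp
qed (intro closed_Un closed_closure)

lemma grad_lincomb:
  assumes "smooth \<phi>" "smooth \<xi>"
  shows "grad (\<lambda>x. \<phi> x + c *\<^sub>R \<xi> x) p = grad \<phi> p + c *\<^sub>R grad \<xi> p"
  using partial_lincomb[OF smooth_nth[OF assms(1)] smooth_nth[OF assms(2)], where c=c]
  by (simp add: vec_eq_iff grad_nth)

lemma solenoidal_lincomb:
  assumes "\<phi> \<in> solenoidal_test_functions \<Omega>" "\<xi> \<in> solenoidal_test_functions \<Omega>"
  shows "(\<lambda>x. \<phi> x + c *\<^sub>R \<xi> x) \<in> solenoidal_test_functions \<Omega>"
proof -
  note t = assms[THEN solenoidal_test]
  have s: "smooth \<phi>" "smooth \<xi>" using t by (auto dest: test_functionsD)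
  have "(\<Sum>i\<in>UNIV. partial i (\<lambda>y. (\<phi> y + c *\<^sub>R \<xi> y) $ i) x) = (\<Sum>i\<in>UNIV. partial i (\<lambda>y. \<phi> y $ i) x) + c * (\<Sum>i\<in>UNIV. partial i (\<lambda>y. \<xi> y $ i) x)" for x
    using partial_lincomb[OF smooth_nth[OF s(1)] smooth_nth[OF s(2)], where c=c and x=x]
    by (simp add: sum_2 algebra_simps)
  then show ?thesis
    using assms test_functions_lincomb[OF t, of c] by (simp add: solenoidal_test_functions_def)
qed

lemma sqi_cscale:
  fixes f :: "real^2 \<Rightarrow> 'b::euclidean_space"
  assumes [measurable]: "borel_fun f" "S \<in> sets borel"
  shows "sqi S (\<lambda>x. c *\<^sub>R f x) = ennreal (c^2) * sqi S f"
  using sqi_cmult[of "\<lambda>x. norm (f x)" S c] by (simp add: sqi_def power_mult_distrib)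

lemma appr_lincomb:
  assumes a: "appr \<Omega> z A \<phi>" and b: "appr \<Omega> y B \<xi>"
  shows "appr \<Omega> (\<lambda>x. z x + c *\<^sub>R y x) (\<lambda>x. A x + c *\<^sub>R B x) (\<lambda>n x. \<phi> n x + c *\<^sub>R \<xi> n x)"
proof -
  note [measurable] = apprD(1,2,5,6)[OF a] apprD(1,2,5,6)[OF b]
  have g: "grad (\<lambda>x. \<phi> n x + c *\<^sub>R \<xi> n x) p = grad (\<phi> n) p + c *\<^sub>R grad (\<xi> n) p" for n p
    by (intro grad_lincomb test_functionsD(1)[OF apprD(4)[OF a]] test_functionsD(1)[OF apprD(4)[OF b]])
  have key: "(\<lambda>n. sqi S (\<lambda>p. (f n p + c *\<^sub>R f' n p) - (h p + c *\<^sub>R h' p))) \<longlonglongrightarrow> 0"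
    if "(\<lambda>n. sqi S (\<lambda>p. f n p - h p)) \<longlonglongrightarrow> 0" "(\<lambda>n. sqi S (\<lambda>p. f' n p - h' p)) \<longlonglongrightarrow> 0"
      and [measurable]: "\<And>n. borel_fun (f n)" "\<And>n. borel_fun (f' n)" "borel_fun h" "borel_fun h'" "S \<in> sets borel"
    for S and f f' :: "nat \<Rightarrow> real^2 \<Rightarrow> 'b::euclidean_space" and h h'
  proof (rule ennreal_squeeze_0)
    have "(\<lambda>n. 2 * sqi S (\<lambda>p. f n p - h p) + 2 * (ennreal (c^2) * sqi S (\<lambda>p. f' n p - h' p))) \<longlonglongrightarrow> 0 + 0"
      by (intro tendsto_add ennreal_mult_tendsto_0 that) auto
    then show "(\<lambda>n. 2 * sqi S (\<lambda>p. f n p - h p) + 2 * (ennreal (c^2) * sqi S (\<lambda>p. f' n p - h' p))) \<longlonglongrightarrow> 0" by simp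
    have m: "borel_fun (\<lambda>p. f' n p - h' p)" for n by measurable
    show "sqi S (\<lambda>p. (f n p + c *\<^sub>R f' n p) - (h p + c *\<^sub>R h' p)) \<le> 2 * sqi S (\<lambda>p. f n p - h p) + 2 * (ennreal (c^2) * sqi S (\<lambda>p. f' n p - h' p))" for n
      unfolding sqi_cscale[OF m that(7), symmetric] by (rule sqi_triangle) (auto simp: algebra_simps)
  qed
  show ?thesis
    unfolding appr_def g
    by (intro conjI allI key apprD(7,8)[OF a] apprD(7,8)[OF b] solenoidal_lincomb apprD(3)[OF a] apprD(3)[OF b]) measurable
qed

lemma appr_test:
  assumes "\<Phi> \<in> solenoidal_test_functions \<Omega>" shows "appr \<Omega> \<Phi> (grad \<Phi>) (\<lambda>_. \<Phi>)"
  using assms test_functions_measurable[OF solenoidal_test[OF assms]] grad_measurable[OF solenoidal_test[OF assms]]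
  by (simp add: appr_def sqi_def)

lemma sqi_inner:
  fixes A :: "real^2 \<Rightarrow> 'b::euclidean_space"
  assumes [measurable]: "borel_fun A" and fin: "sqi UNIV A < top"
  shows "integrable lborel (\<lambda>x. A x \<bullet> A x)" "enn2real (sqi UNIV A) = (LBINT x. A x \<bullet> A x)"
    "sqi UNIV A = ennreal (LBINT x. A x \<bullet> A x)"
proof -
  have eq: "sqi UNIV A = (NNINT x. ennreal (A x \<bullet> A x))" by (simp add: sqi_def dot_square_norm)
  show i: "integrable lborel (\<lambda>x. A x \<bullet> A x)"
    using fin by (intro integrableI_nonneg) (auto simp: eq)
  show "sqi UNIV A = ennreal (LBINT x. A x \<bullet> A x)"
    unfolding eq by (intro nn_integral_eq_integral i) auto
  then show "enn2real (sqi UNIV A) = (LBINT x. A x \<bullet> A x)" by simp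
qed

lemma Dirichlet_norm_appr:
  assumes ap: "appr \<Omega> z A \<phi>" and \<Omega>: "open \<Omega>" and uz: "AE x\<in>\<Omega> in lborel. u x = z x"
  shows "(Dirichlet_norm \<Omega> u)^2 = (LBINT x. A x \<bullet> A x)" "Dirichlet_norm \<Omega> u \<ge> 0"
proof -
  have "sqi \<Omega> (wgrad \<Omega> u) = sqi \<Omega> A"
    using appr_wgrad[OF assms] by (intro sqi_cong) (auto elim!: eventually_mono)
  also have "\<dots> = sqi UNIV A"
    unfolding sqi_def using appr_grad_off_domain[OF ap \<Omega>] by (intro nn_integral_cong_AE) (auto simp: indicator_def elim!: eventually_mono)
  finally have "(Lp_norm 2 \<Omega> (wgrad \<Omega> u))^2 = sqi UNIV A" using \<Omega> by (simp add: Lp_norm_2)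
  then have "(Dirichlet_norm \<Omega> u)^2 = enn2real (sqi UNIV A)"
    unfolding Dirichlet_norm_def by (simp add: power2_eq_square flip: enn2real_mult)
  then show "(Dirichlet_norm \<Omega> u)^2 = (LBINT x. A x \<bullet> A x)"
    using sqi_inner(2)[OF apprD(2,10)[OF ap]] by simp
qed (simp add: Dirichlet_norm_def)

text \<open>Boundedness of f, applied to \<Phi> - u, in the squared form that
  \<open>test_with_limit\<close> requires.\<close>

lemma H1_dual_bound:
  assumes f: "f \<in> H1_dual \<Omega>" and ap: "appr \<Omega> z A \<phi>" and \<Omega>: "open \<Omega>" and uz: "AE x\<in>\<Omega> in lborel. u x = z x"
  obtains K :: ennreal where "K < top"
    "\<And>\<Phi>. \<Phi> \<in> solenoidal_test_functions \<Omega> \<Longrightarrow> ennreal ((f \<Phi> - f u)^2) \<le> K * sqi UNIV (\<lambda>p. grad \<Phi> p - A p)"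
proof -
  have u: "u \<in> H1 \<Omega>" by (rule appr_H1[OF ap \<Omega> uz])
  obtain C where C: "\<And>u. u \<in> H1 \<Omega> \<Longrightarrow> \<bar>f u\<bar> \<le> C * Dirichlet_norm \<Omega> u"
    using f unfolding H1_dual_def mem_Collect_eq by (elim conjE exE) (rule that, blast)
  have add: "\<forall>u\<in>H1 \<Omega>. \<forall>v\<in>H1 \<Omega>. f (\<lambda>x. u x + v x) = f u + f v"
    and scl: "\<forall>c. \<forall>u\<in>H1 \<Omega>. f (\<lambda>x. c *\<^sub>R u x) = c * f u"
    using f unfolding H1_dual_def mem_Collect_eq by simp_all
  have "ennreal ((f \<Phi> - f u)^2) \<le> ennreal (C^2) * sqi UNIV (\<lambda>p. grad \<Phi> p - A p)" if \<Phi>: "\<Phi> \<in> solenoidal_test_functions \<Omega>" for \<Phi>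
  proof -
    have ap': "appr \<Omega> (\<lambda>x. \<Phi> x + (-1) *\<^sub>R z x) (\<lambda>x. grad \<Phi> x + (-1) *\<^sub>R A x) (\<lambda>n x. \<Phi> x + (-1) *\<^sub>R \<phi> n x)"
      by (rule appr_lincomb[OF appr_test[OF \<Phi>] ap])
    have uz': "AE x\<in>\<Omega> in lborel. \<Phi> x + (-1) *\<^sub>R u x = \<Phi> x + (-1) *\<^sub>R z x"
      using uz by (auto elim!: eventually_mono)
    have \<Phi>1: "\<Phi> \<in> H1 \<Omega>" by (rule appr_H1[OF appr_test[OF \<Phi>] \<Omega>]) auto
    have mu: "(\<lambda>x. (-1) *\<^sub>R u x) \<in> H1 \<Omega>"
    proof -
      \<comment> \<open>-z is written as z - 2z, so that the lemma on linear combinations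
        applies.\<close>
      have "appr \<Omega> (\<lambda>x. z x + (-2) *\<^sub>R z x) (\<lambda>x. A x + (-2) *\<^sub>R A x) (\<lambda>n x. \<phi> n x + (-2) *\<^sub>R \<phi> n x)" by (rule appr_lincomb[OF ap ap])
      then show ?thesis by (rule appr_H1[OF _ \<Omega>]) (use uz in \<open>auto elim!: eventually_mono simp: scaleR_2\<close>)
    qed
    have "f (\<lambda>x. \<Phi> x + (-1) *\<^sub>R u x) = f \<Phi> + f (\<lambda>x. (-1) *\<^sub>R u x)" by (rule add[rule_format, OF \<Phi>1 mu])
    also have "f (\<lambda>x. (-1) *\<^sub>R u x) = - f u" using scl[rule_format, OF u, of "-1"] by simp
    finally have "\<bar>f \<Phi> - f u\<bar> \<le> C * Dirichlet_norm \<Omega> (\<lambda>x. \<Phi> x + (-1) *\<^sub>R u x)"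
      using C[OF appr_H1[OF ap' \<Omega> uz']] by simp
    then have "\<bar>f \<Phi> - f u\<bar>^2 \<le> (C * Dirichlet_norm \<Omega> (\<lambda>x. \<Phi> x + (-1) *\<^sub>R u x))^2" by (rule power_mono) simp
    also have "\<dots> = C^2 * (LBINT x. (grad \<Phi> x + (-1) *\<^sub>R A x) \<bullet> (grad \<Phi> x + (-1) *\<^sub>R A x))"
      unfolding power_mult_distrib Dirichlet_norm_appr(1)[OF ap' \<Omega> uz'] ..
    finally have "ennreal ((f \<Phi> - f u)^2) \<le> ennreal (C^2 * (LBINT x. (grad \<Phi> x + (-1) *\<^sub>R A x) \<bullet> (grad \<Phi> x + (-1) *\<^sub>R A x)))"
      by (intro ennreal_leI) simp
    also have "\<dots> = ennreal (C^2) * sqi UNIV (\<lambda>p. grad \<Phi> p + (-1) *\<^sub>R A p)"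
      unfolding sqi_inner(3)[OF apprD(2,10)[OF ap']] by (rule ennreal_mult'') (rule Bochner_Integration.integral_nonneg, simp)
    finally show ?thesis by simp
  qed
  then show ?thesis by (intro that[of "ennreal (C^2)"]) auto
qed

section \<open>The convection term on Borel representatives\<close>

definition advect :: "(real^2 \<Rightarrow> real^2) \<Rightarrow> (real^2 \<Rightarrow> real^2^2) \<Rightarrow> real^2 \<Rightarrow> real^2" where
  "advect b A p = (\<chi> j. \<Sum>i\<in>UNIV. b p $ i * A p $ i $ j)"

lemma advect_measurable [measurable]:
  assumes [measurable]: "borel_fun b" "borel_fun A"
  shows "borel_fun (advect b A)"
proof (rule vec_borelI)
  fix j
  have [measurable]: "borel_fun (\<lambda>p. A p $ i $ j)" "borel_fun (\<lambda>p. b p $ i)" for i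
    by (intro measurable_nth2 assms)+
  show "borel_fun (\<lambda>p. advect b A p $ j)" unfolding advect_def by simp
qed

lemma norm_advect: "norm (advect b A p) \<le> norm (b p) * norm (A p)"
proof -
  have "advect b A p = b p v* A p" by (simp add: advect_def vector_matrix_mult_def mult.commute)
  also have "norm (b p v* A p) \<le> norm (b p) * norm (A p)"
  proof -
    have "(b p v* A p) $ j = b p \<bullet> (transpose (A p) $ j)" for j
      by (simp add: vector_matrix_mult_def inner_vec_def transpose_def mult.commute)
    then have "\<bar>(b p v* A p) $ j\<bar> \<le> norm (b p) * norm (transpose (A p) $ j)" for j
      by (simp add: Cauchy_Schwarz_ineq2)
    then have "norm (b p v* A p) \<le> L2_set (\<lambda>j. norm (b p) * norm (transpose (A p) $ j)) UNIV"
      unfolding norm_vec_def by (intro L2_set_mono) auto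
    also have "\<dots> = norm (b p) * L2_set (\<lambda>j. norm (transpose (A p) $ j)) UNIV" by (simp add: L2_set_right_distrib)
    also have "L2_set (\<lambda>j. norm (transpose (A p) $ j)) UNIV = norm (A p)"
      by (simp add: norm_vec_def transpose_def L2_set_def sum_2 sum_nonneg)
    finally show ?thesis .
  qed
  finally show ?thesis .
qed

lemma advect_add: "advect (\<lambda>p. a p + c *\<^sub>R b p) A p = advect a A p + c *\<^sub>R advect b A p"
  "advect a (\<lambda>p. A p + c *\<^sub>R B p) p = advect a A p + c *\<^sub>R advect a B p"
  by (simp_all add: advect_def vec_eq_iff sum_2 algebra_simps)

lemma weak_solution_lborel:
  assumes f: "weak_solution \<Omega> f u" and ap: "appr \<Omega> z A \<phi>" and \<Omega>: "open \<Omega>" and uz: "AE x\<in>\<Omega> in lborel. u x = z x"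
    and \<Phi>: "\<Phi> \<in> solenoidal_test_functions \<Omega>"
  shows "(LBINT x. A x \<bullet> grad \<Phi> x) + (LBINT x. advect z A x \<bullet> \<Phi> x) = f \<Phi>"
proof -
  note t = solenoidal_test[OF \<Phi>]
  note [measurable] = apprD(1,2)[OF ap] test_functions_measurable[OF t] grad_measurable[OF t]
  have "(LINT x|lebesgue_on \<Omega>. wgrad \<Omega> u x \<bullet> grad \<Phi> x) = (LBINT x. A x \<bullet> grad \<Phi> x)"
    using appr_wgrad[OF ap \<Omega> uz] \<Omega> by (intro integral_lebesgue_on) (auto simp: grad_off_domain[OF t] elim!: eventually_mono)
  moreover have "(LINT x|lebesgue_on \<Omega>. convection \<Omega> u x \<bullet> \<Phi> x) = (LBINT x. advect z A x \<bullet> \<Phi> x)"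
  proof (rule integral_lebesgue_on)
    show "AE x\<in>\<Omega> in lborel. convection \<Omega> u x \<bullet> \<Phi> x = advect z A x \<bullet> \<Phi> x"
      using appr_wgrad[OF ap \<Omega> uz] uz by eventually_elim (simp add: convection_def advect_def)
  qed (use \<Omega> test_functionsD(3)[OF t] in auto)
  moreover have "(LINT x|lebesgue_on \<Omega>. wgrad \<Omega> u x \<bullet> grad \<Phi> x) + (LINT x|lebesgue_on \<Omega>. convection \<Omega> u x \<bullet> \<Phi> x) = f \<Phi>"
    using f \<Phi> unfolding weak_solution_def by blast
  ultimately show ?thesis by simp
qed

text \<open>The exceptional set is enclosed in a Borel null set, which dispenses with measurability
  of the predicate.\<close>

lemma AE_mir':
  assumes "AE p in lborel. P p" shows "AE p in lborel. P (mir j p)"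
proof -
  obtain N where N: "N \<in> null_sets lborel" "{p. \<not> P p} \<subseteq> N"
    using assms by (auto simp: eventually_ae_filter)
  have [measurable]: "N \<in> sets borel" using N(1) by auto
  have "AE p in lborel. p \<notin> N" using N(1) by (rule AE_not_in)
  then have "AE p in lborel. mir j p \<notin> N" by (rule AE_mir) measurable
  then show ?thesis using N(2) by (auto elim!: eventually_mono)
qed

lemma reflection_mir:
  assumes "reflection_invariant \<Omega>" shows "mir j p \<in> \<Omega> \<longleftrightarrow> p \<in> \<Omega>"
proof -
  have *: "mir j p \<in> \<Omega>" if "p \<in> \<Omega>" for p
  proof -
    have "pt (p$1) (p$2) = p" by (simp add: vec_eq_iff forall_2)
    then have "pt (p$1) (-(p$2)) \<in> \<Omega>" "pt (-(p$1)) (p$2) \<in> \<Omega>"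
      using assms that unfolding reflection_invariant_def by metis+
    then show ?thesis using exhaust_2[of j] mir_pt[of p] by metis
  qed
  show ?thesis using *[of p] *[of "mir j p"] by auto
qed

lemma odd_mir:
  assumes \<Omega>: "open \<Omega>" and R: "reflection_invariant \<Omega>" and uz: "AE x\<in>\<Omega> in lborel. u x = z x"
    and z0: "AE x in lborel. x \<notin> \<Omega> \<longrightarrow> z x = 0"
  shows "odd_x1 \<Omega> (\<lambda>x. u x $ i) \<Longrightarrow> AE p in lborel. z (mir 1 p) $ i = - (z p $ i)"
    and "odd_x2 \<Omega> (\<lambda>x. u x $ i) \<Longrightarrow> AE p in lborel. z (mir 2 p) $ i = - (z p $ i)"
proof -
  have *: "AE p in lborel. z (mir j p) $ i = - (z p $ i)"
    if "AE x\<in>\<Omega> in lborel. u x $ i = - u (mir j x) $ i" for j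
    using that uz z0 AE_mir'[OF uz, of j] AE_mir'[OF z0, of j]
    by eventually_elim (auto simp: reflection_mir[OF R])
  have pt: "pt (p$1) (p$2) = p" for p :: "real^2" by (simp add: vec_eq_iff forall_2)
  show "AE p in lborel. z (mir 1 p) $ i = - (z p $ i)" if "odd_x1 \<Omega> (\<lambda>x. u x $ i)"
    using that \<Omega> by (intro *) (simp add: odd_x1_def AE_lebesgue_on pt mir_pt)
  show "AE p in lborel. z (mir 2 p) $ i = - (z p $ i)" if "odd_x2 \<Omega> (\<lambda>x. u x $ i)"
    using that \<Omega> by (intro *) (simp add: odd_x2_def AE_lebesgue_on pt mir_pt)
qed

lemma weighted_sup_bound:
  assumes \<Omega>: "open \<Omega>" and uz: "AE x\<in>\<Omega> in lborel. u x = z x" and z0: "AE x in lborel. x \<notin> \<Omega> \<longrightarrow> z x = 0"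
    and "weighted_sup \<Omega> u \<le> ennreal \<delta>" "\<delta> \<ge> 0"
  shows "AE x in lborel. (norm x + 1) * norm (z x) \<le> \<delta>"
proof -
  have "AE x in lebesgue_on \<Omega>. ennreal ((norm x + 1) * norm (u x)) \<le> weighted_sup \<Omega> u"
    unfolding weighted_sup_def by (rule esssup_AE)
  then have "AE x\<in>\<Omega> in lborel. ennreal ((norm x + 1) * norm (u x)) \<le> weighted_sup \<Omega> u"
    using \<Omega> by (subst (asm) AE_lebesgue_on) auto
  with uz z0 show ?thesis
  proof eventually_elim
    case (elim x)
    show ?case
    proof (cases "x \<in> \<Omega>")
      case True
      then have "ennreal ((norm x + 1) * norm (z x)) \<le> ennreal \<delta>" using elim(1,3) assms(4) by (metis order_trans)
      then show ?thesis using \<open>\<delta> \<ge> 0\<close> by (simp add: ennreal_le_iff)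
    next
      case False then show ?thesis using elim(2) \<open>\<delta> \<ge> 0\<close> by simp
    qed
  qed
qed

section \<open>Uniqueness\<close>

lemma convection_test_zero:
  fixes f :: "real^2 \<Rightarrow> real"
  assumes f: "smooth f" and \<Phi>: "\<Phi> \<in> solenoidal_test_functions \<Omega>"
  shows "(\<Sum>i\<in>UNIV. LBINT p. \<Phi> p $ i * partial i f p) = 0"
proof -
  note t = solenoidal_test[OF \<Phi>]
  have i: "integrable lborel (\<lambda>p. f p * partial i (\<lambda>y. \<Phi> y $ i) p)" for i
    using test_functions_integrable[OF test_functions_mult[OF test_functions_partial[OF test_functions_nth[OF t, of i], of i] f]]
    by (simp add: mult.commute)
  have "(LBINT p. \<Phi> p $ i * partial i f p) = - (LBINT p. f p * partial i (\<lambda>y. \<Phi> y $ i) p)" for i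
    using integration_by_parts[OF f test_functions_nth[OF t, of i], of i] by (simp add: mult.commute)
  then have "(\<Sum>i\<in>UNIV. LBINT p. \<Phi> p $ i * partial i f p) = - (\<Sum>i\<in>UNIV. LBINT p. f p * partial i (\<lambda>y. \<Phi> y $ i) p)"
    by (simp add: sum_negf)
  also have "\<dots> = - (LBINT p. f p * (\<Sum>i\<in>UNIV. partial i (\<lambda>y. \<Phi> y $ i) p))"
    by (simp add: sum_2 distrib_left Bochner_Integration.integral_add[OF i i])
  also have "\<dots> = 0" using \<Phi> by (simp add: solenoidal_test_functions_def)
  finally show ?thesis .
qed

text \<open>For approximants of b and c the integrand is \<Phi> . grad of their inner product, which
  integrates to zero by the vanishing divergence of \<Phi>; products of L^2 limits on the support of
  \<Phi> give the claim. The transporting field \<Phi> is kept as the outer factor so that it can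
  later be replaced by a limit field.\<close>

lemma convection_test_antisym:
  assumes b: "appr \<Omega> b B \<xi>" and c: "appr \<Omega> c C \<eta>" and \<Phi>: "\<Phi> \<in> solenoidal_test_functions \<Omega>"
  shows "(LBINT p. (B p *v c p + C p *v b p) \<bullet> \<Phi> p) = 0"
proof -
  note t = solenoidal_test[OF \<Phi>]
  obtain r where r: "r > 0" "\<And>x. x \<notin> square r \<Longrightarrow> \<Phi> x = 0"
    by (rule compact_support_square[OF test_functionsD(2)[OF t]]) (rule that)
  obtain M where M: "M > 0" "\<And>x. norm (\<Phi> x) \<le> M" by (rule test_functions_bounded[OF t]) (rule that)
  have Mi: "\<bar>\<Phi> x $ i\<bar> \<le> M" for x i using M(2)[of x] Finite_Cartesian_Product.norm_nth_le[of "\<Phi> x" i] by simp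
  note [measurable] = test_functions_measurable[OF t] measurable_nth2
  have pair: "(\<lambda>n. LBINT p. \<Phi> p $ i * (grad (\<xi> n) p $ i $ j * \<eta> n p $ j)) \<longlonglongrightarrow> (LBINT p. \<Phi> p $ i * (B p $ i $ j * c p $ j))"
    and int: "integrable lborel (\<lambda>p. \<Phi> p $ i * (B p $ i $ j * c p $ j))"
    if b: "appr \<Omega> b B \<xi>" and c: "appr \<Omega> c C \<eta>" for b c B C \<xi> \<eta> i j
  proof -
    note [measurable] = apprD(1,2,5,6)[OF b] apprD(1,2,5,6)[OF c]
    have g2: "sqi S (\<lambda>x. f x $ i $ j) \<le> sqi UNIV f" for S and f :: "real^2 \<Rightarrow> real^2^2"
      by (rule order_trans[OF sqi_nth[where f="\<lambda>x. f x $ i"]]) (rule order_trans[OF sqi_nth sqi_mono_set], simp)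
    show "(\<lambda>n. LBINT p. \<Phi> p $ i * (grad (\<xi> n) p $ i $ j * \<eta> n p $ j)) \<longlonglongrightarrow> (LBINT p. \<Phi> p $ i * (B p $ i $ j * c p $ j))"
    proof (rule L2_product_tendsto[where S="square r" and M=M])
      show "(\<lambda>n. sqi (square r) (\<lambda>x. grad (\<xi> n) x $ i $ j - B x $ i $ j)) \<longlonglongrightarrow> 0"
        by (rule ennreal_squeeze_0[OF apprD(8)[OF b]])
          (use g2[where f="\<lambda>p. grad (\<xi> _) p - B p"] in \<open>simp\<close>)
      show "(\<lambda>n. sqi (square r) (\<lambda>x. \<eta> n x $ j - c x $ j)) \<longlonglongrightarrow> 0"
        by (rule ennreal_squeeze_0[OF apprD(7)[OF c, of r]])
          (use sqi_nth[where f="\<lambda>p. \<eta> _ p - c p"] in \<open>simp\<close>)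
      show "sqi (square r) (\<lambda>x. grad (\<xi> n) x $ i $ j) < top" for n
        by (rule le_less_trans[OF g2 grad_finite[OF apprD(4)[OF b]]])
      show "sqi (square r) (\<lambda>x. \<eta> n x $ j) < top" for n
        by (rule le_less_trans[OF sqi_nth sqi_test_finite[OF apprD(4)[OF c]]])
    qed (use Mi r in auto)
    show "integrable lborel (\<lambda>p. \<Phi> p $ i * (B p $ i $ j * c p $ j))"
    proof (rule L2_pairing(2)[where S="square r" and f="\<lambda>p. M * B p $ i $ j" and g="\<lambda>p. c p $ j"])
      show "AE x in lborel. \<bar>\<Phi> x $ i * (B x $ i $ j * c x $ j)\<bar> \<le> indicator (square r) x * (norm (M * B x $ i $ j) * norm (c x $ j))"
      proof (rule AE_I2)
        fix x
        show "\<bar>\<Phi> x $ i * (B x $ i $ j * c x $ j)\<bar> \<le> indicator (square r) x * (norm (M * B x $ i $ j) * norm (c x $ j))"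
        proof (cases "x \<in> square r")
          case True
          have "\<bar>\<Phi> x $ i\<bar> * \<bar>B x $ i $ j * c x $ j\<bar> \<le> M * \<bar>B x $ i $ j * c x $ j\<bar>" by (intro mult_right_mono Mi) simp
          then show ?thesis using True M(1) by (simp add: abs_mult ac_simps)
        qed (simp add: r)
      qed
      show "sqi (square r) (\<lambda>p. M * B p $ i $ j) < top"
        using le_less_trans[OF g2 apprD(10)[OF b], of "square r"] by (subst sqi_cmult) (auto simp: ennreal_mult_less_top)
      show "sqi (square r) (\<lambda>p. c p $ j) < top" by (rule le_less_trans[OF sqi_nth apprD(9)[OF c]])
    qed auto
  qed
  define T where "T n i j = (LBINT p. \<Phi> p $ i * (grad (\<xi> n) p $ i $ j * \<eta> n p $ j)) + (LBINT p. \<Phi> p $ i * (grad (\<eta> n) p $ i $ j * \<xi> n p $ j))" for n i j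
  define L where "L i j = (LBINT p. \<Phi> p $ i * (B p $ i $ j * c p $ j)) + (LBINT p. \<Phi> p $ i * (C p $ i $ j * b p $ j))" for i j
  have lim: "(\<lambda>n. T n i j) \<longlonglongrightarrow> L i j" for i j
    unfolding T_def L_def by (intro tendsto_add pair[OF b c] pair[OF c b])
  have T0: "(\<Sum>i\<in>UNIV. T n i j) = 0" for n j
  proof -
    note t1 = test_functions_nth[OF apprD(4)[OF b], of n j] and t2 = test_functions_nth[OF apprD(4)[OF c], of n j]
    have s: "smooth (\<lambda>p. \<xi> n p $ j)" "smooth (\<lambda>p. \<eta> n p $ j)" using t1 t2 by (auto dest: test_functionsD)
    have "T n i j = (LBINT p. \<Phi> p $ i * partial i (\<lambda>p. \<xi> n p $ j * \<eta> n p $ j) p)" for i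
    proof -
      have i1: "integrable lborel (\<lambda>p. \<Phi> p $ i * (partial i (\<lambda>p. \<xi> n p $ j) p * \<eta> n p $ j))"
        by (intro test_functions_integrable[OF test_functions_mult[OF test_functions_nth[OF t]]] smooth_mult smooth_partial s)
      have i2: "integrable lborel (\<lambda>p. \<Phi> p $ i * (partial i (\<lambda>p. \<eta> n p $ j) p * \<xi> n p $ j))"
        by (intro test_functions_integrable[OF test_functions_mult[OF test_functions_nth[OF t]]] smooth_mult smooth_partial s)
      show ?thesis unfolding T_def grad_nth Bochner_Integration.integral_add[OF i1 i2, symmetric]
        unfolding partial_mult[OF smooth_differentiable[OF s(1)] smooth_differentiable[OF s(2)]]
        by (rule Bochner_Integration.integral_cong) (auto simp: algebra_simps)
    qed
    then show ?thesis using convection_test_zero[OF smooth_mult[OF s] \<Phi>] by simp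
  qed
  have L0: "(\<Sum>i\<in>UNIV. L i j) = 0" for j
    by (rule LIMSEQ_unique[OF tendsto_sum[where f="\<lambda>i n. T n i j"]]) (use lim T0 in auto)
  have "(LBINT p. (B p *v c p + C p *v b p) \<bullet> \<Phi> p)
    = (LBINT p. (\<Sum>j\<in>UNIV. \<Sum>i\<in>UNIV. (\<Phi> p $ i * (B p $ i $ j * c p $ j)) + \<Phi> p $ i * (C p $ i $ j * b p $ j)))"
    by (rule Bochner_Integration.integral_cong) (simp_all add: inner_vec_def matrix_vector_mult_def sum_2 algebra_simps)
  also have "\<dots> = (\<Sum>j\<in>UNIV. \<Sum>i\<in>UNIV. L i j)"
    unfolding L_def by (simp add: sum_2 int[OF b c] int[OF c b])
  finally show ?thesis by (simp add: L0)
qed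

lemma mv_inner_advect: "(B p *v c p) \<bullet> z p = advect z B p \<bullet> c p"
  by (simp add: inner_vec_def matrix_vector_mult_def advect_def sum_2 algebra_simps)

lemma norm_matrix_vector: "norm (A *v x) \<le> norm x * norm (A :: real^2^2)"
proof -
  have "norm (A *v x) \<le> L2_set (\<lambda>i. norm (A $ i) * norm x) UNIV"
    unfolding norm_vec_def[of "A *v x"] by (intro L2_set_mono) (auto simp: matrix_mult_dot Cauchy_Schwarz_ineq2)
  also have "\<dots> = L2_set (\<lambda>i. norm (A $ i)) UNIV * norm x" by (rule L2_set_left_distrib[symmetric]) simp
  finally show ?thesis by (simp add: norm_vec_def[of A] mult.commute)
qed

text \<open>Antisymmetry holds for every transporting test field, so \<open>test_with_limit\<close>
  applies with value 0 and error constant 0. Admissibility is required of the sum of the two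
  products because their cancellation takes place under one integral.\<close>

lemma convection_antisym:
  assumes \<Omega>: "compact (- \<Omega>)" and z: "appr \<Omega> z A \<phi>" and H: "sqi UNIV (\<lambda>p. z p /\<^sub>R (norm p + 1)) < top"
    and b: "appr \<Omega> b B \<xi>" and c: "appr \<Omega> c C \<eta>"
    and a1: "admissible z \<phi> (\<lambda>p. norm (c p) * norm (B p))" and a2: "admissible z \<phi> (\<lambda>p. norm (b p) * norm (C p))"
    and i: "integrable lborel (\<lambda>p. advect z B p \<bullet> c p)" "integrable lborel (\<lambda>p. advect z C p \<bullet> b p)"
  shows "(LBINT p. advect z B p \<bullet> c p) + (LBINT p. advect z C p \<bullet> b p) = 0"
proof -
  note [measurable] = apprD(1,2,5,6)[OF b] apprD(1,2,5,6)[OF c] measurable_nth2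
  have m: "borel_fun (\<lambda>p. B p *v c p)"
    if [measurable]: "borel_fun B" "borel_fun c" for B :: "real^2 \<Rightarrow> real^2^2" and c :: "real^2 \<Rightarrow> real^2"
    by (rule vec_borelI) (simp add: matrix_vector_mult_def)
  have "(LBINT p. (B p *v c p + C p *v b p) \<bullet> z p) = 0"
  proof (rule test_with_limit[OF \<Omega> z H, where K=0])
    show "admissible z \<phi> (\<lambda>p. norm (c p) * norm (B p) + norm (b p) * norm (C p))"
      by (intro admissible_add a1 a2 apprD(1,5)[OF z])
    show "AE p in lborel. norm (B p *v c p + C p *v b p) \<le> norm (c p) * norm (B p) + norm (b p) * norm (C p)"
      by (intro AE_I2 norm_triangle_mono norm_matrix_vector)
  qed (auto simp: convection_test_antisym[OF b c] intro!: borel_measurable_add m)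
  then show ?thesis using i by (simp add: inner_add_left mv_inner_advect)
qed

text \<open>Both the functional f and the Dirichlet pairing with A are continuous in the Dirichlet
  norm of the test field; the two contributions make up the constant
  \<open>2 * K + 2 * sqi UNIV A\<close>.\<close>

lemma weak_solution_test:
  assumes \<Omega>: "compact (- \<Omega>)" "open \<Omega>" and f: "f \<in> H1_dual \<Omega>" and z: "appr \<Omega> z Z \<phi>" and H: "sqi UNIV (\<lambda>p. z p /\<^sub>R (norm p + 1)) < top"
    and uz: "AE x\<in>\<Omega> in lborel. u x = z x"
    and a: "appr \<Omega> a A \<xi>" and eq: "\<And>\<Phi>. \<Phi> \<in> solenoidal_test_functions \<Omega> \<Longrightarrow> (LBINT x. A x \<bullet> grad \<Phi> x) + (LBINT x. advect a A x \<bullet> \<Phi> x) = f \<Phi>"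
    and adm: "admissible z \<phi> (\<lambda>p. norm (a p) * norm (A p))"
  shows "(LBINT p. advect a A p \<bullet> z p) = f u - (LBINT p. A p \<bullet> Z p)"
proof -
  note [measurable] = apprD(1,2,5,6)[OF a] apprD(1,2,5,6)[OF z]
  obtain K :: ennreal where K: "K < top"
    "\<And>\<Phi>. \<Phi> \<in> solenoidal_test_functions \<Omega> \<Longrightarrow> ennreal ((f \<Phi> - f u)^2) \<le> K * sqi UNIV (\<lambda>p. grad \<Phi> p - Z p)"
    by (rule H1_dual_bound[OF f z \<Omega>(2) uz]) (rule that)
  show ?thesis
  proof (rule test_with_limit[OF \<Omega>(1) z H adm, where K="2 * K + 2 * sqi UNIV A"])
    show "AE p in lborel. norm (advect a A p) \<le> norm (a p) * norm (A p)" by (intro AE_I2 norm_advect)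
    show "2 * K + 2 * sqi UNIV A < top" using K(1) apprD(10)[OF a] by (simp add: ennreal_mult_less_top)
    fix \<Phi> assume \<Phi>: "\<Phi> \<in> solenoidal_test_functions \<Omega>"
    note t = solenoidal_test[OF \<Phi>]
    note [measurable] = test_functions_measurable[OF t] grad_measurable[OF t]
    have i1: "integrable lborel (\<lambda>x. A x \<bullet> grad \<Phi> x)"
      by (rule L2_pairing(2)[where S=UNIV and f=A and g="grad \<Phi>"]) (auto simp: Cauchy_Schwarz_ineq2 apprD(10)[OF a] grad_finite[OF t])
    have i2: "integrable lborel (\<lambda>x. A x \<bullet> Z x)"
      by (rule L2_pairing(2)[where S=UNIV and f=A and g=Z]) (auto simp: Cauchy_Schwarz_ineq2 apprD(10)[OF a] apprD(10)[OF z])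
    define d where "d = (LBINT x. A x \<bullet> (grad \<Phi> x - Z x))"
    have d: "ennreal (d^2) \<le> sqi UNIV A * sqi UNIV (\<lambda>p. grad \<Phi> p - Z p)"
      unfolding d_def by (rule L2_pairing(3)) (auto simp: Cauchy_Schwarz_ineq2)
    have de: "d = (LBINT x. A x \<bullet> grad \<Phi> x) - (LBINT x. A x \<bullet> Z x)"
      unfolding d_def using i1 i2 by (simp add: inner_diff_right)
    have "(LBINT p. advect a A p \<bullet> \<Phi> p) - (f u - (LBINT p. A p \<bullet> Z p)) = (f \<Phi> - f u) + (- d)"
      using eq[OF \<Phi>] by (simp add: de)
    then have "((LBINT p. advect a A p \<bullet> \<Phi> p) - (f u - (LBINT p. A p \<bullet> Z p)))^2 \<le> 2 * (f \<Phi> - f u)^2 + 2 * d^2"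
      unfolding \<open>_ = (f \<Phi> - f u) + (- d)\<close> using norm_sum_sq[of "f \<Phi> - f u" "- d"] by simp
    then have "ennreal (((LBINT p. advect a A p \<bullet> \<Phi> p) - (f u - (LBINT p. A p \<bullet> Z p)))^2) \<le> ennreal (2 * (f \<Phi> - f u)^2 + 2 * d^2)"
      by (rule ennreal_leI)
    also have "\<dots> = 2 * ennreal ((f \<Phi> - f u)^2) + 2 * ennreal (d^2)" by (simp add: ennreal_mult)
    also have "\<dots> \<le> 2 * (K * sqi UNIV (\<lambda>p. grad \<Phi> p - Z p)) + 2 * (sqi UNIV A * sqi UNIV (\<lambda>p. grad \<Phi> p - Z p))"
      by (intro add_mono mult_left_mono d K(2)[OF \<Phi>]) auto
    finally show "ennreal (((LBINT p. advect a A p \<bullet> \<Phi> p) - (f u - (LBINT p. A p \<bullet> Z p)))^2) \<le> (2 * K + 2 * sqi UNIV A) * sqi UNIV (\<lambda>p. grad \<Phi> p - Z p)"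
      by (simp add: distrib_right mult.assoc)
  qed measurable
qed

text \<open>The decay |c| \<le> M / (1 + |x|) is passed on to a, whose quotient by 1 + |x| is square
  integrable by Hardy's inequality. Cauchy-Schwarz with Y does the rest.\<close>

lemma trilinear:
  assumes [measurable]: "borel_fun a" "borel_fun Y" "borel_fun c"
    and c: "AE p in lborel. (norm p + 1) * norm (c p) \<le> M" and M: "M \<ge> 0"
    and Ha: "sqi UNIV (\<lambda>p. a p /\<^sub>R (norm p + 1)) < top" and Y: "sqi UNIV Y < top"
  shows "integrable lborel (\<lambda>p. advect a Y p \<bullet> c p)"
    and "integrable lborel (\<lambda>p. advect c Y p \<bullet> a p)"
    and "ennreal ((LBINT p. advect a Y p \<bullet> c p)^2) \<le> ennreal (M^2) * sqi UNIV (\<lambda>p. a p /\<^sub>R (norm p + 1)) * sqi UNIV Y"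
proof -
  let ?a = "\<lambda>p. M *\<^sub>R (a p /\<^sub>R (norm p + 1))"
  have key: "AE p in lborel. norm (a p) * (norm (Y p) * norm (c p)) \<le> norm (?a p) * norm (Y p)"
    using c
  proof eventually_elim
    case (elim p)
    have "norm (c p) \<le> M / (norm p + 1)" using elim by (simp add: pos_le_divide_eq mult.commute add_nonneg_pos)
    then have "norm (c p) * (norm (a p) * norm (Y p)) \<le> M / (norm p + 1) * (norm (a p) * norm (Y p))" by (rule mult_right_mono) simp
    then show ?case using M by (simp add: field_simps)
  qed
  have b1: "\<bar>advect a Y p \<bullet> c p\<bar> \<le> norm (a p) * (norm (Y p) * norm (c p))" for p
    using order_trans[OF Cauchy_Schwarz_ineq2 mult_right_mono[OF norm_advect]] by (simp add: mult.assoc)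
  have b2: "\<bar>advect c Y p \<bullet> a p\<bar> \<le> norm (a p) * (norm (Y p) * norm (c p))" for p
    using order_trans[OF Cauchy_Schwarz_ineq2[of "advect c Y p" "a p"] mult_right_mono[OF norm_advect[of c Y p], of "norm (a p)"]] by (simp add: ac_simps)
  have e1: "AE x in lborel. \<bar>advect a Y x \<bullet> c x\<bar> \<le> indicator UNIV x * (norm (?a x) * norm (Y x))"
    using key by eventually_elim (use b1 in \<open>auto intro: order_trans\<close>)
  have e2: "AE x in lborel. \<bar>advect c Y x \<bullet> a x\<bar> \<le> indicator UNIV x * (norm (?a x) * norm (Y x))"
    using key by eventually_elim (use b2 in \<open>auto intro: order_trans\<close>)
  have sa: "sqi UNIV ?a = ennreal (M^2) * sqi UNIV (\<lambda>p. a p /\<^sub>R (norm p + 1))" by (rule sqi_cscale) measurable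
  have fa: "sqi UNIV ?a < top" unfolding sa using Ha by (simp add: ennreal_mult_less_top)
  show "integrable lborel (\<lambda>p. advect a Y p \<bullet> c p)" by (rule L2_pairing(2)[OF _ _ _ _ e1 fa Y]) measurable
  show "integrable lborel (\<lambda>p. advect c Y p \<bullet> a p)" by (rule L2_pairing(2)[OF _ _ _ _ e2 fa Y]) measurable
  have "ennreal ((LBINT p. advect a Y p \<bullet> c p)^2) \<le> sqi UNIV ?a * sqi UNIV Y" by (rule L2_pairing(3)[OF _ _ _ _ e1]) measurable
  then show "ennreal ((LBINT p. advect a Y p \<bullet> c p)^2) \<le> ennreal (M^2) * sqi UNIV (\<lambda>p. a p /\<^sub>R (norm p + 1)) * sqi UNIV Y"
    unfolding sa .
qed

text \<open>The equation of u is tested with v, that of v with u and with v. The antisymmetry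
  relations remove all trilinear terms except ((u - v) . grad(u - v), v), and where testing u with
  itself would enter, the energy inequality is used in its place.\<close>

lemma energy_uniqueness:
  assumes \<Omega>: "compact (- \<Omega>)" "open \<Omega>" and f: "f \<in> H1_dual \<Omega>"
    and a: "appr \<Omega> a A \<phi>" and b: "appr \<Omega> b B \<xi>"
    and ua: "AE x\<in>\<Omega> in lborel. u x = a x" and vb: "AE x\<in>\<Omega> in lborel. v x = b x"
    and ea: "\<And>\<Phi>. \<Phi> \<in> solenoidal_test_functions \<Omega> \<Longrightarrow> (LBINT x. A x \<bullet> grad \<Phi> x) + (LBINT x. advect a A x \<bullet> \<Phi> x) = f \<Phi>"
    and eb: "\<And>\<Phi>. \<Phi> \<in> solenoidal_test_functions \<Omega> \<Longrightarrow> (LBINT x. B x \<bullet> grad \<Phi> x) + (LBINT x. advect b B x \<bullet> \<Phi> x) = f \<Phi>"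
    and Ha: "sqi UNIV (\<lambda>p. a p /\<^sub>R (norm p + 1)) < top" and Hb: "sqi UNIV (\<lambda>p. b p /\<^sub>R (norm p + 1)) < top"
    and Hw: "sqi UNIV (\<lambda>p. (a p + (-1) *\<^sub>R b p) /\<^sub>R (norm p + 1)) \<le> 16 * sqi UNIV (\<lambda>p. A p + (-1) *\<^sub>R B p)"
    and M: "AE p in lborel. (norm p + 1) * norm (b p) \<le> 1/8"
    and en: "(LBINT p. A p \<bullet> A p) \<le> f u"
  shows "AE p in lborel. a p = b p"
proof -
  note ma[measurable] = apprD(1,2,5,6)[OF a] and mb[measurable] = apprD(1,2,5,6)[OF b]
  have M0: "(1/8::real) \<ge> 0" by simp
  note A = apprD(10)[OF a] and B = apprD(10)[OF b]
  have nA: "sqi UNIV (\<lambda>p. norm (A p)) < top" "sqi UNIV (\<lambda>p. norm (B p)) < top" using A B by (simp_all add: sqi_def)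
  have adm1: "admissible b \<xi> (\<lambda>p. norm (a p) * norm (A p))" by (rule admissible_product[OF b M a Ha]) (use nA in auto)
  have adm2: "admissible b \<xi> (\<lambda>p. norm (b p) * norm (A p))" by (rule admissible_product[OF b M b Hb]) (use nA in auto)
  have adm3: "admissible b \<xi> (\<lambda>p. norm (a p) * norm (B p))" by (rule admissible_product[OF b M a Ha]) (use nA in auto)
  have adm4: "admissible b \<xi> (\<lambda>p. norm (b p) * norm (B p))" by (rule admissible_product[OF b M b Hb]) (use nA in auto)
  \<comment> \<open>The test field is now a, which has no pointwise decay; the decay of b instead
    puts |b| |B| into the weighted L^2 space.\<close>
  have adm5: "admissible a \<phi> (\<lambda>p. norm (b p) * norm (B p))"
  proof (rule admissible_L2[OF a Ha])
    have "sqi UNIV (\<lambda>p. (norm p + 1) * (norm (b p) * norm (B p))) \<le> sqi UNIV B"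
    proof (rule sqi_mono, use M in eventually_elim)
      fix p :: "real^2" assume "(norm p + 1) * norm (b p) \<le> 1/8"
      then have "(norm p + 1) * norm (b p) * norm (B p) \<le> 1 * norm (B p)" by (intro mult_right_mono) auto
      then show "p \<in> UNIV \<longrightarrow> norm ((norm p + 1) * (norm (b p) * norm (B p))) \<le> norm (B p)" by (simp add: abs_mult mult.assoc)
    qed
    then show "sqi UNIV (\<lambda>p. (norm p + 1) * (norm (b p) * norm (B p))) < top" using B by (rule le_less_trans)
  qed auto
  note Ta = trilinear[OF ma(1) _ mb(1) M M0 Ha] and Tb = trilinear[OF mb(1) _ mb(1) M M0 Hb]
  define N where "N x Y c = (LBINT p. advect x Y p \<bullet> c p)" for x Y and c :: "real^2 \<Rightarrow> real^2"
  have 1: "N a A b = f v - (LBINT p. A p \<bullet> B p)"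
    unfolding N_def by (rule weak_solution_test[OF \<Omega> f b Hb vb a ea adm1])
  have 2: "N b B a = f u - (LBINT p. A p \<bullet> B p)"
    unfolding N_def using weak_solution_test[OF \<Omega> f a Ha ua b eb adm5] by (simp add: inner_commute)
  have 3: "N b B b = f v - (LBINT p. B p \<bullet> B p)"
    unfolding N_def by (rule weak_solution_test[OF \<Omega> f b Hb vb b eb adm4])
  have 4: "N b B b = 0"
    using convection_antisym[OF \<Omega>(1) b Hb b b adm4 adm4 Tb(1)[OF mb(2) B] Tb(1)[OF mb(2) B]] by (simp add: N_def)
  have 5: "N b A b + N b B a = 0"
    using convection_antisym[OF \<Omega>(1) b Hb a b adm2 adm3 Tb(1)[OF ma(2) A] Ta(2)[OF mb(2) B]] by (simp add: N_def)
  have 6: "N a B b = 0"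
    using convection_antisym[OF \<Omega>(1) a Ha b b adm5 adm5 Ta(1)[OF mb(2) B] Ta(1)[OF mb(2) B]] by (simp add: N_def)
  define w where "w p = a p + (-1) *\<^sub>R b p" for p
  define W where "W p = A p + (-1) *\<^sub>R B p" for p
  have apw: "appr \<Omega> w W (\<lambda>n x. \<phi> n x + (-1) *\<^sub>R \<xi> n x)"
    unfolding w_def[abs_def] W_def[abs_def] by (rule appr_lincomb[OF a b])
  note mw[measurable] = apprD(1,2)[OF apw]
  note WF = apprD(10)[OF apw]
  have Hw': "sqi UNIV (\<lambda>p. w p /\<^sub>R (norm p + 1)) \<le> 16 * sqi UNIV W" using Hw by (simp add: w_def[abs_def] W_def[abs_def])
  have Hwf: "sqi UNIV (\<lambda>p. w p /\<^sub>R (norm p + 1)) < top" by (rule le_less_trans[OF Hw']) (use WF in \<open>auto simp: ennreal_mult_less_top\<close>)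
  note Tw = trilinear[OF mw(1) _ mb(1) M M0 Hwf]
  have lin: "N w W b = N a A b - N b A b - N a B b + N b B b"
  proof -
    have "advect w W p \<bullet> b p = advect a A p \<bullet> b p - advect b A p \<bullet> b p - advect a B p \<bullet> b p + advect b B p \<bullet> b p" for p
      unfolding w_def[abs_def] W_def[abs_def] advect_add by (simp add: inner_add_left inner_diff_left)
    then show ?thesis unfolding N_def
      using Ta(1)[OF ma(2) A] Tb(1)[OF ma(2) A] Ta(1)[OF mb(2) B] Tb(1)[OF mb(2) B] by simp
  qed
  have iAB: "integrable lborel (\<lambda>x. A x \<bullet> B x)"
    by (rule L2_pairing(2)[where S=UNIV and f=A and g=B]) (auto simp: Cauchy_Schwarz_ineq2 A B)
  define D where "D = (LBINT p. W p \<bullet> W p)"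
  have "D = (LBINT p. A p \<bullet> A p - 2 * (A p \<bullet> B p) + B p \<bullet> B p)"
    unfolding D_def W_def by (rule Bochner_Integration.integral_cong) (auto simp: inner_diff_left inner_diff_right inner_commute)
  also have "\<dots> = (LBINT p. A p \<bullet> A p) - 2 * (LBINT p. A p \<bullet> B p) + (LBINT p. B p \<bullet> B p)"
    using iAB sqi_inner(1)[OF ma(2) A] sqi_inner(1)[OF mb(2) B] by simp
  \<comment> \<open>By 5 and 6 the right side is \<open>N a A b + N b B a + N b B b\<close>, which
    1, 2 and 4 turn into f(u) + f(v) - 2 (A,B). Moreover f(v) = (B,B) by 3 and 4, and (A,A) \<le>
    f(u) is the energy inequality.\<close>
  finally have DN: "D \<le> N w W b" using en 1 2 3 4 5 6 lin by linarith
  have D0: "D \<ge> 0" unfolding D_def by (intro Bochner_Integration.integral_nonneg) simp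
  have sW: "sqi UNIV W = ennreal D" unfolding D_def by (rule sqi_inner(3)[OF mw(2) WF])
  have "ennreal ((N w W b)^2) \<le> ennreal ((1/8)^2) * sqi UNIV (\<lambda>p. w p /\<^sub>R (norm p + 1)) * sqi UNIV W"
    unfolding N_def by (rule Tw(3)[OF mw(2) WF])
  also have "\<dots> \<le> ennreal ((1/8)^2) * (16 * sqi UNIV W) * sqi UNIV W"
    by (intro mult_left_mono mult_right_mono Hw') auto
  also have "\<dots> = ennreal ((1/8)^2 * (16 * D) * D)"
    unfolding sW using D0 by (simp add: ennreal_mult ennreal_numeral[symmetric] del: ennreal_numeral)
  finally have "(N w W b)^2 \<le> (1/8)^2 * (16 * D) * D" using D0 by (subst (asm) ennreal_le_iff) auto
  moreover have "D^2 \<le> (N w W b)^2" using DN D0 by (intro power_mono)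
  \<comment> \<open>The square of the smallness constant 1/8 times the Hardy constant 16 is 1/4,
    less than 1.\<close>
  ultimately have "D^2 \<le> 1/4 * D^2" by (simp add: power2_eq_square)
  then have "D = 0" by (simp add: not_le)
  then have "sqi UNIV (\<lambda>p. w p /\<^sub>R (norm p + 1)) = 0" using Hw' sW by simp
  then have "AE p in lborel. ennreal ((norm (w p /\<^sub>R (norm p + 1)))^2) * indicator UNIV p = 0"
    unfolding sqi_def by (subst (asm) nn_integral_0_iff_AE) auto
  then show ?thesis
  proof eventually_elim
    case (elim p)
    moreover have "norm p + 1 > 0" by (simp add: add_nonneg_pos)
    ultimately show ?case by (simp add: w_def)
  qed
qed

lemma H1S_Hardy:
  assumes \<Omega>: "open \<Omega>" "reflection_invariant \<Omega>" and u: "u \<in> H1S \<Omega>"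
    and ap: "appr \<Omega> z A \<phi>" and uz: "AE x\<in>\<Omega> in lborel. u x = z x" and z0: "AE x in lborel. x \<notin> \<Omega> \<longrightarrow> z x = 0"
  shows "sqi UNIV (\<lambda>p. z p /\<^sub>R (norm p + 1)) \<le> 16 * sqi UNIV A" "sqi UNIV (\<lambda>p. z p /\<^sub>R (norm p + 1)) < top"
proof -
  show "sqi UNIV (\<lambda>p. z p /\<^sub>R (norm p + 1)) \<le> 16 * sqi UNIV A"
    by (rule appr_Hardy_norm[OF ap]) (use u odd_mir[OF \<Omega> uz z0] in \<open>unfold H1S_def, blast\<close>)
  also have "\<dots> < top" using apprD(10)[OF ap] by (simp add: ennreal_mult_less_top)
  finally show "sqi UNIV (\<lambda>p. z p /\<^sub>R (norm p + 1)) < top" .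
qed

text \<open>It remains to verify the Hardy inequalities for u, v and u - v, and to translate the
  hypotheses to representatives.\<close>

lemma exterior_property_U:
  assumes ext: "exterior_domain \<Omega>" and R: "reflection_invariant \<Omega>"
  shows "property_U \<Omega> (1/8)"
  unfolding property_U_def
proof (intro ballI allI impI, elim conjE)
  fix f u v
  assume f: "f \<in> H1_dual \<Omega>" and u: "symmetric_weak_solution \<Omega> f u" and v: "symmetric_weak_solution \<Omega> f v"
    and ss: "same_symmetry \<Omega> u v" and en: "energy_inequality \<Omega> f u" and ws: "weighted_sup \<Omega> v \<le> ennreal (1/8)"
  have \<Omega>: "compact (- \<Omega>)" "open \<Omega>" using ext by (auto simp: exterior_domain_def)
  have u1: "u \<in> H1S \<Omega>" "weak_solution \<Omega> f u" "u \<in> H1 \<Omega>" and v1: "v \<in> H1S \<Omega>" "weak_solution \<Omega> f v" "v \<in> H1 \<Omega>"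
    using u v by (auto simp: symmetric_weak_solution_def H1S_def)
  obtain a A \<phi> where a: "appr \<Omega> a A \<phi>" and ua: "AE x\<in>\<Omega> in lborel. u x = a x" and a0: "AE x in lborel. x \<notin> \<Omega> \<longrightarrow> a x = 0"
    by (rule H1_representation[OF \<Omega>(2) u1(3)]) (rule that)
  obtain b B \<xi> where b: "appr \<Omega> b B \<xi>" and vb: "AE x\<in>\<Omega> in lborel. v x = b x" and b0: "AE x in lborel. x \<notin> \<Omega> \<longrightarrow> b x = 0"
    by (rule H1_representation[OF \<Omega>(2) v1(3)]) (rule that)
  \<comment> \<open>Components of u - v are odd only if u and v are odd in the same direction; this
    is where the common symmetry enters.\<close>
  have odd: "\<exists>j. AE p in lborel. a (mir j p) $ i + (-1) *\<^sub>R b (mir j p) $ i = - (a p $ i + (-1) *\<^sub>R b p $ i)" for i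
  proof -
    have *: ?thesis if "AE p in lborel. a (mir j p) $ i = - (a p $ i)" "AE p in lborel. b (mir j p) $ i = - (b p $ i)" for j
      by (rule exI[of _ j], use that in eventually_elim) simp
    have "odd_x2 \<Omega> (\<lambda>x. u x $ i) \<and> odd_x2 \<Omega> (\<lambda>x. v x $ i) \<or> odd_x1 \<Omega> (\<lambda>x. u x $ i) \<and> odd_x1 \<Omega> (\<lambda>x. v x $ i)"
      using ss unfolding same_symmetry_def by blast
    then show ?thesis
      using *[OF odd_mir(1)[OF \<Omega>(2) R ua a0] odd_mir(1)[OF \<Omega>(2) R vb b0]] *[OF odd_mir(2)[OF \<Omega>(2) R ua a0] odd_mir(2)[OF \<Omega>(2) R vb b0]]
      by blast
  qed
  have Hw: "sqi UNIV (\<lambda>p. (a p + (-1) *\<^sub>R b p) /\<^sub>R (norm p + 1)) \<le> 16 * sqi UNIV (\<lambda>p. A p + (-1) *\<^sub>R B p)"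
    by (rule appr_Hardy_norm[OF appr_lincomb[OF a b]]) (use odd in simp)
  have "AE p in lborel. a p = b p"
  proof (rule energy_uniqueness[OF \<Omega> f a b ua vb _ _ _ _ Hw])
    show "(LBINT p. A p \<bullet> A p) \<le> f u"
      using en Dirichlet_norm_appr(1)[OF a \<Omega>(2) ua] by (simp add: energy_inequality_def)
    show "AE p in lborel. (norm p + 1) * norm (b p) \<le> 1/8"
      by (rule weighted_sup_bound[OF \<Omega>(2) vb b0 ws]) simp
  qed (intro H1S_Hardy[OF \<Omega>(2) R u1(1) a ua a0] H1S_Hardy[OF \<Omega>(2) R v1(1) b vb b0]
      weak_solution_lborel[OF u1(2) a \<Omega>(2) ua] weak_solution_lborel[OF v1(2) b \<Omega>(2) vb]; assumption)+
  with ua vb have "AE x\<in>\<Omega> in lborel. u x = v x" by eventually_elim simp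
  then show "AE x in lebesgue_on \<Omega>. u x = v x" using \<Omega>(2) by (subst AE_lebesgue_on) auto
qed

section \<open>Decay and integrability\<close>

text \<open>The exterior of the disc is connected, and it meets \<Omega> because it is unbounded
  while the complement of \<Omega> is bounded. If it also met the complement it would meet the
  boundary, which lies in the disc.\<close>

lemma exterior_contains:
  assumes ext: "exterior_domain \<Omega>" and R: "frontier \<Omega> \<subseteq> ball 0 R"
  shows "{x. R \<le> norm x} \<subseteq> \<Omega>"
proof (rule ccontr)
  assume "\<not> ?thesis"
  then obtain y where "R \<le> norm y" "y \<notin> \<Omega>" by blast
  then have "y \<in> - ball 0 R - \<Omega>" by simp
  then have ne: "- ball 0 R - \<Omega> \<noteq> {}" by blast
  have "2 \<le> DIM(real^2)" by simp
  then have c: "connected (- ball (0::real^2) R)" by (intro connected_complement_bounded_convex) auto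
  have "\<not> bounded (- ball (0::real^2) R)"
    using not_bounded_UNIV bounded_Un[of "ball (0::real^2) R" "- ball 0 R"] by simp
  moreover have "bounded (- \<Omega>)" using ext by (simp add: exterior_domain_def compact_imp_bounded)
  ultimately have "- ball 0 R \<inter> \<Omega> \<noteq> {}" using bounded_subset by blast
  then have "- ball 0 R \<inter> frontier \<Omega> \<noteq> {}" by (rule connected_Int_frontier[OF c _ ne])
  then show False using R by auto
qed

lemma powr_le_one_plus:
  assumes "0 \<le> (t::real)" "0 < r" "r \<le> q" shows "t powr r \<le> 1 + t powr q"
proof (cases "t \<le> 1")
  case True
  then have "t powr r \<le> 1" using assms by (intro powr_le1) auto
  then show ?thesis by (simp add: add_increasing2)
next
  case False
  then have "t powr r \<le> t powr q" using assms by (intro powr_mono) auto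
  then show ?thesis by simp
qed

lemma emeasure_square: "r \<ge> 0 \<Longrightarrow> emeasure lborel (square r) = ennreal (4 * r^2)"
  by (subst square_cbox, subst emeasure_lborel_cbox_eq)
    (auto simp: Basis_vec_def inner_axis UNIV_2 axis_eq_axis power2_eq_square prod.UNION_disjoint)

text \<open>The elementary bound s^r \<le> 1 + s^q, applied to s = \<rho>^2 t: on the annulus at
  radius \<rho> the natural size of a function of the decay class 2 is \<rho>^-2.\<close>

lemma powr_scale:
  fixes \<rho> t r q :: real
  assumes "\<rho> > 0" "1 < r" "r \<le> q" "t \<ge> 0"
  shows "t powr r \<le> \<rho> powr (- 2 * r) * (1 + \<rho> powr (2 * q) * t powr q)"
proof -
  have "(\<rho>^2 * t) powr r \<le> 1 + (\<rho>^2 * t) powr q" using assms by (intro powr_le_one_plus) auto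
  moreover have "(\<rho>^2) powr s = \<rho> powr (2 * s)" for s
    using powr_powr[of \<rho> 2 s] assms by simp
  ultimately have "\<rho> powr (2 * r) * t powr r \<le> 1 + \<rho> powr (2 * q) * t powr q" using assms by (simp add: powr_mult)
  then have "\<rho> powr (- 2 * r) * (\<rho> powr (2 * r) * t powr r) \<le> \<rho> powr (- 2 * r) * (1 + \<rho> powr (2 * q) * t powr q)" by (intro mult_left_mono) auto
  moreover have "\<rho> powr (- 2 * r) * \<rho> powr (2 * r) = 1" using assms by (simp flip: powr_add)
  ultimately show ?thesis by (simp flip: mult.assoc)
qed

lemma annuli_cover:
  fixes x :: "'a::real_normed_vector"
  assumes "R > 0" "R \<le> norm x"
  obtains j :: nat where "4 ^ j * R \<le> norm x" "norm x \<le> 4 * (4 ^ j * R)"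
proof -
  have "\<exists>n::nat. norm x / R < 4 ^ n" by (rule real_arch_pow) simp
  then have ex: "\<exists>n::nat. norm x < 4 ^ n * R" using \<open>R > 0\<close> by (simp add: field_simps)
  define n where "n = (LEAST n::nat. norm x < 4 ^ n * R)"
  have n: "norm x < 4 ^ n * R" unfolding n_def using ex by (rule LeastI_ex)
  then have "n \<noteq> 0" using assms by (intro notI) simp
  then obtain j where j: "n = Suc j" by (cases n) auto
  then have "\<not> norm x < 4 ^ j * R" using not_less_Least[of j "\<lambda>n. norm x < 4 ^ n * R"] by (simp add: n_def[symmetric])
  then show ?thesis using n j by (intro that[of j]) auto
qed

text \<open>An annulus lies in a square of area 64 \<rho>^2; together with the rescaled bound its
  integral is at most (64 + C) \<rho>^(2 - 2r). Annuli at the radii 4^j R cover the exterior and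
  these bounds form a geometric series. Inside the disc t^r \<le> 1 + t^q suffices.\<close>

lemma decay_imp_Lp:
  fixes h :: "real^2 \<Rightarrow> real"
  assumes R: "R > 0" and [measurable]: "borel_fun h" "\<Omega> \<in> sets borel" and h: "\<And>x. h x \<ge> 0"
    and inner: "NNset (\<Omega> \<inter> ball 0 R) (\<lambda>x. ennreal (h x powr q)) < top"
    and outer: "\<And>\<rho>. \<rho> \<ge> R \<Longrightarrow> (NNINT x. ennreal (h x powr q) * indicator {x. \<rho> \<le> norm x \<and> norm x \<le> 4 * \<rho>} x) \<le> ennreal (C * \<rho> powr (2 - 2 * q))"
    and C: "C \<ge> 0" and r: "1 < r" "r \<le> q"
  shows "NNset \<Omega> (\<lambda>x. ennreal (h x powr r)) < top"
proof -
  define ann where "ann \<rho> = {x::real^2. \<rho> \<le> norm x \<and> norm x \<le> 4 * \<rho>}" for \<rho>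
  have [measurable]: "ann \<rho> \<in> sets borel" for \<rho> unfolding ann_def by measurable
  have sq: "ann \<rho> \<subseteq> square (4 * \<rho>)" for \<rho> using in_squareI by (auto simp: ann_def)
  have annulus: "NNset (ann \<rho>) (\<lambda>x. ennreal (h x powr r)) \<le> ennreal ((64 + C) * \<rho> powr (2 - 2 * r))" if \<rho>: "\<rho> \<ge> R" for \<rho>
  proof -
    have \<rho>0: "\<rho> > 0" using R \<rho> by simp
    have "NNset (ann \<rho>) (\<lambda>x. ennreal (h x powr r))
      \<le> (NNINT x. ennreal (\<rho> powr (- 2 * r)) * (indicator (ann \<rho>) x + ennreal (\<rho> powr (2 * q)) * (ennreal (h x powr q) * indicator (ann \<rho>) x)))"
    proof (rule nn_integral_mono)
      fix x
      have "ennreal (h x powr r) \<le> ennreal (\<rho> powr (- 2 * r) * (1 + \<rho> powr (2 * q) * h x powr q))"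
        by (rule ennreal_leI[OF powr_scale[OF \<rho>0 r h]])
      also have "\<dots> = ennreal (\<rho> powr (- 2 * r)) * (1 + ennreal (\<rho> powr (2 * q)) * ennreal (h x powr q))"
        by (simp add: ennreal_mult)
      finally show "ennreal (h x powr r) * indicator (ann \<rho>) x
        \<le> ennreal (\<rho> powr (- 2 * r)) * (indicator (ann \<rho>) x + ennreal (\<rho> powr (2 * q)) * (ennreal (h x powr q) * indicator (ann \<rho>) x))"
        by (auto simp: indicator_def)
    qed
    also have "\<dots> = ennreal (\<rho> powr (- 2 * r)) * (emeasure lborel (ann \<rho>) + ennreal (\<rho> powr (2 * q)) * NNset (ann \<rho>) (\<lambda>x. ennreal (h x powr q)))"
      by (simp add: nn_integral_cmult nn_integral_add)
    also have "\<dots> \<le> ennreal (\<rho> powr (- 2 * r)) * (ennreal (64 * \<rho>^2) + ennreal (\<rho> powr (2 * q)) * ennreal (C * \<rho> powr (2 - 2 * q)))"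
    proof (intro mult_left_mono add_mono)
      have "emeasure lborel (ann \<rho>) \<le> emeasure lborel (square (4 * \<rho>))" by (rule emeasure_mono[OF sq]) simp
      also have "\<dots> = ennreal (64 * \<rho>^2)" using \<rho>0 by (subst emeasure_square) (auto simp: power_mult_distrib)
      finally show "emeasure lborel (ann \<rho>) \<le> ennreal (64 * \<rho>^2)" .
      show "NNset (ann \<rho>) (\<lambda>x. ennreal (h x powr q)) \<le> ennreal (C * \<rho> powr (2 - 2 * q))"
        unfolding ann_def by (rule outer[OF \<rho>])
    qed auto
    also have "\<dots> = ennreal (\<rho> powr (- 2 * r) * (64 * \<rho>^2 + \<rho> powr (2 * q) * (C * \<rho> powr (2 - 2 * q))))"
      using C by (simp add: ennreal_mult)
    also have "\<rho> powr (2 * q) * (C * \<rho> powr (2 - 2 * q)) = C * \<rho>^2"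
      using \<rho>0 by (simp add: mult.left_commute powr_add[symmetric])
    also have "\<rho> powr (- 2 * r) * (64 * \<rho>^2 + C * \<rho>^2) = (64 + C) * \<rho> powr (2 - 2 * r)"
    proof -
      have "\<rho> powr (2 - 2 * r) = \<rho> powr (- 2 * r) * \<rho>^2" using \<rho>0 powr_add[of \<rho> "-2*r" 2] by simp
      then show ?thesis by (simp add: algebra_simps)
    qed
    finally show ?thesis .
  qed
  \<comment> \<open>Successive radii grow by the factor 4; the resulting ratio is below 1 because r
    > 1.\<close>
  define a where "a = (4::real) powr (2 - 2 * r)"
  have a: "0 \<le> a" "a < 1" unfolding a_def using r powr_less_mono[of "2 - 2 * r" 0 4] by auto
  define K where "K = (64 + C) * R powr (2 - 2 * r)"
  have Kj: "(64 + C) * (4 ^ j * R) powr (2 - 2 * r) = K * a ^ j" for j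
    using R by (simp add: K_def a_def powr_mult powr_power mult.commute flip: powr_realpow) (simp add: powr_powr mult.commute)
  have "NNset \<Omega> (\<lambda>x. ennreal (h x powr r))
    \<le> (NNINT x. (1 + ennreal (h x powr q)) * indicator (\<Omega> \<inter> ball 0 R) x + (\<Sum>j. ennreal (h x powr r) * indicator (ann (4 ^ j * R)) x))"
  proof (rule nn_integral_mono)
    fix x
    show "ennreal (h x powr r) * indicator \<Omega> x \<le> (1 + ennreal (h x powr q)) * indicator (\<Omega> \<inter> ball 0 R) x + (\<Sum>j. ennreal (h x powr r) * indicator (ann (4 ^ j * R)) x)"
    proof (cases "norm x < R")
      case True
      have "ennreal (h x powr r) \<le> ennreal (1 + h x powr q)" using r h by (intro ennreal_leI powr_le_one_plus) auto
      then show ?thesis using True by (auto simp: indicator_def ennreal_plus intro: add_increasing2)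
    next
      case False
      then obtain j where "4 ^ j * R \<le> norm x" "norm x \<le> 4 * (4 ^ j * R)" using annuli_cover[OF R, of x] by auto
      then have "ennreal (h x powr r) * indicator \<Omega> x \<le> (\<Sum>j\<in>{j}. ennreal (h x powr r) * indicator (ann (4 ^ j * R)) x)"
        by (auto simp: ann_def indicator_def)
      also have "\<dots> \<le> (\<Sum>j. ennreal (h x powr r) * indicator (ann (4 ^ j * R)) x)" by (rule sum_le_suminf) auto
      finally show ?thesis by (rule add_increasing[rotated]) simp
    qed
  qed
  also have "\<dots> = emeasure lborel (\<Omega> \<inter> ball 0 R) + NNset (\<Omega> \<inter> ball 0 R) (\<lambda>x. ennreal (h x powr q))
     + (\<Sum>j. NNset (ann (4 ^ j * R)) (\<lambda>x. ennreal (h x powr r)))"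
  proof -
    let ?f = "\<lambda>j x. ennreal (h x powr r) * indicator (ann (4 ^ j * R)) x" and ?D = "\<Omega> \<inter> ball (0::real^2) R"
    have D: "?D \<in> sets lborel" by simp
    have hm: "(\<lambda>x. ennreal (h x powr s)) \<in> borel_measurable lborel" for s by measurable
    have m1: "?f j \<in> borel_measurable lborel" for j
      by (intro borel_measurable_times_ennreal hm borel_measurable_indicator) simp
    have m2: "(\<lambda>x. \<Sum>j. ?f j x) \<in> borel_measurable lborel" by (rule borel_measurable_suminf_order[OF m1])
    have m3: "(\<lambda>x. (1 + ennreal (h x powr q)) * indicator ?D x) \<in> borel_measurable lborel"
      by (intro borel_measurable_times_ennreal hm borel_measurable_indicator D borel_measurable_add borel_measurable_const)
    note m = m1 m2 m3
    have "NNset ?D (\<lambda>x. 1 + ennreal (h x powr q)) = emeasure lborel ?D + NNset ?D (\<lambda>x. ennreal (h x powr q))"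
      using D hm[of q] by (simp add: distrib_right nn_integral_add borel_measurable_times_ennreal borel_measurable_indicator)
    then show ?thesis by (simp only: nn_integral_add[OF m(3,2)] nn_integral_suminf[OF m(1)])
  qed
  also have "\<dots> < top"
  proof -
    have "emeasure lborel (\<Omega> \<inter> ball 0 R) \<le> emeasure lborel (square R)"
      by (rule emeasure_mono) (auto intro: in_squareI)
    also have "\<dots> < top" using R by (simp add: emeasure_square)
    finally have 1: "emeasure lborel (\<Omega> \<inter> ball 0 R) < top" .
    have K0: "K \<ge> 0" using C by (simp add: K_def)
    have "(\<Sum>j. NNset (ann (4 ^ j * R)) (\<lambda>x. ennreal (h x powr r))) \<le> (\<Sum>j. ennreal (K * a ^ j))"
    proof (rule suminf_le)
      show "NNset (ann (4 ^ j * R)) (\<lambda>x. ennreal (h x powr r)) \<le> ennreal (K * a ^ j)" for j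
        using annulus[of "4 ^ j * R"] R by (simp add: Kj)
    qed auto
    also have "\<dots> = ennreal (\<Sum>j. K * a ^ j)"
      using a K0 by (intro suminf_ennreal2 summable_mult summable_geometric) auto
    finally have "(\<Sum>j. NNset (ann (4 ^ j * R)) (\<lambda>x. ennreal (h x powr r))) < top" by (rule le_less_trans) simp
    then show ?thesis using 1 inner by (simp add: less_top[symmetric])
  qed
  finally show ?thesis .
qed

lemma Lp_norm_finite:
  assumes "S \<in> sets borel"
  shows "Lp_norm p S g < \<infinity> \<longleftrightarrow> (NNset S (\<lambda>x. ennreal (norm (g x) powr p))) < top"
  unfolding Lp_norm_def Let_def nn_integral_lebesgue_on[OF assms] by (auto simp: less_top)

lemma Lp_norm_bound:
  assumes S: "S \<in> sets borel" and p: "p > 0" and le: "Lp_norm p S g \<le> ennreal b" and b: "b \<ge> 0"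
  shows "NNset S (\<lambda>x. ennreal (norm (g x) powr p)) \<le> ennreal (b powr p)"
proof -
  let ?I = "NNset S (\<lambda>x. ennreal (norm (g x) powr p))"
  have "Lp_norm p S g < \<infinity>" using le by (rule le_less_trans) simp
  then have fin: "?I < top" using Lp_norm_finite[OF S] by blast
  then have "Lp_norm p S g = ennreal (enn2real ?I powr (1 / p))"
    unfolding Lp_norm_def Let_def nn_integral_lebesgue_on[OF S] by auto
  then have "enn2real ?I powr (1 / p) \<le> b" using le b by simp
  then have "(enn2real ?I powr (1 / p)) powr p \<le> b powr p" using p by (intro powr_mono2) auto
  then have "enn2real ?I \<le> b powr p" using p by (simp add: powr_powr)
  then have "ennreal (enn2real ?I) \<le> ennreal (b powr p)" by (rule ennreal_leI)
  then show ?thesis unfolding ennreal_enn2real[OF fin] .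
qed

text \<open>The supremum in the norm bounds the L^q norm on each annulus by K divided by the weight,
  and the q-th power of that quotient is K^q \<pi> \<rho>^(2 - 2q), the decay required by
  \<open>decay_imp_Lp\<close>. Annuli with \<rho> \<ge> R lie in \<Omega>, so on them g may be
  replaced by its Borel representative.\<close>

lemma chi_imp_Lp:
  fixes g :: "real^2 \<Rightarrow> 'b::euclidean_space"
  assumes ext: "exterior_domain \<Omega>" and R: "R > 0" "frontier \<Omega> \<subseteq> ball 0 R" and q: "q > 2"
    and g: "chi_norm R q 2 \<Omega> g < \<infinity>" and [measurable]: "borel_fun G"
    and eq: "AE x\<in>\<Omega> in lborel. g x = G x" and r: "1 < r" "r \<le> q"
  shows "NNset \<Omega> (\<lambda>x. ennreal (norm (g x) powr r)) < top" "in_Lp r \<Omega> g"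
proof -
  have [measurable]: "\<Omega> \<in> sets borel" using ext by (simp add: exterior_domain_def)
  have cong: "NNset S (\<lambda>x. ennreal (norm (g x) powr s)) = NNset S (\<lambda>x. ennreal (norm (G x) powr s))"
    if "S \<subseteq> \<Omega>" for S s
    using eq that by (intro nn_integral_cong_AE) (auto simp: indicator_def elim!: eventually_mono)
  define c where "c \<rho> = \<rho> powr (2 - 2 / q) / pi powr (1 / q)" for \<rho>
  have c0: "c \<rho> > 0" if "\<rho> > 0" for \<rho> using that by (simp add: c_def)
  define N where "N = (SUP \<rho>\<in>{R..}. ennreal (c \<rho>) * Lp_norm q {x. \<rho> \<le> norm x \<and> norm x \<le> 4 * \<rho>} g)"
  have chi: "chi_norm R q 2 \<Omega> g = ennreal (c R) * Lp_norm q (\<Omega> \<inter> ball 0 R) g + N"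
    by (simp add: chi_norm_def c_def N_def)
  have Nf: "N < top" and Lf: "ennreal (c R) * Lp_norm q (\<Omega> \<inter> ball 0 R) g < top"
    using g unfolding chi by (auto simp: less_top)
  define K where "K = enn2real N"
  have NK: "N = ennreal K" "K \<ge> 0" using Nf by (auto simp: K_def)
  have fin: "Lp_norm q (\<Omega> \<inter> ball 0 R) g < \<infinity>"
    using Lf c0[OF R(1)] by (auto simp: ennreal_mult_less_top)
  have "NNset \<Omega> (\<lambda>x. ennreal (norm (G x) powr r)) < top"
  proof (rule decay_imp_Lp[OF R(1), where h="\<lambda>x. norm (G x)" and q=q and C="K powr q * pi"])
    have "NNset (\<Omega> \<inter> ball 0 R) (\<lambda>x. ennreal (norm (g x) powr q)) < top"
      using fin by (subst (asm) Lp_norm_finite) auto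
    then show "NNset (\<Omega> \<inter> ball 0 R) (\<lambda>x. ennreal (norm (G x) powr q)) < top" by (subst (asm) cong) auto
    fix \<rho> assume \<rho>: "\<rho> \<ge> R"
    then have \<rho>0: "\<rho> > 0" using R by simp
    let ?S = "{x::real^2. \<rho> \<le> norm x \<and> norm x \<le> 4 * \<rho>}"
    have "ennreal (c \<rho>) * Lp_norm q ?S g \<le> ennreal K"
      unfolding NK(1)[symmetric] N_def using \<rho> by (intro SUP_upper) simp
    then have "ennreal (inverse (c \<rho>)) * (ennreal (c \<rho>) * Lp_norm q ?S g) \<le> ennreal (inverse (c \<rho>)) * ennreal K" by (rule mult_left_mono) simp
    then have "Lp_norm q ?S g \<le> ennreal (K / c \<rho>)"
      using c0[OF \<rho>0] NK(2) by (simp add: mult.assoc[symmetric] ennreal_mult[symmetric] divide_inverse mult.commute)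
    then have "NNset ?S (\<lambda>x. ennreal (norm (g x) powr q)) \<le> ennreal ((K / c \<rho>) powr q)"
      by (intro Lp_norm_bound) (use q NK(2) c0[OF \<rho>0] in auto)
    also have "(K / c \<rho>) powr q = K powr q * pi * \<rho> powr (2 - 2 * q)"
    proof -
      have "c \<rho> powr q = \<rho> powr (2 * q - 2) / pi" using \<rho>0 q by (simp add: c_def powr_divide powr_powr algebra_simps)
      moreover have "\<rho> powr (2 - 2 * q) = 1 / \<rho> powr (2 * q - 2)" using powr_minus_divide[of \<rho> "2 * q - 2"] by simp
      ultimately show ?thesis using NK(2) c0[OF \<rho>0] by (simp add: powr_divide)
    qed
    finally show "NNset ?S (\<lambda>x. ennreal (norm (G x) powr q)) \<le> ennreal (K powr q * pi * \<rho> powr (2 - 2 * q))"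
      using exterior_contains[OF ext R(2)] \<rho> by (subst (asm) cong) auto
  qed (use r in auto)
  then show *: "NNset \<Omega> (\<lambda>x. ennreal (norm (g x) powr r)) < top" by (subst cong) auto
  have "g \<in> borel_measurable (lebesgue_on \<Omega>)" by (rule lebesgue_on_measurable_AE[OF _ _ eq]) measurable
  then show "in_Lp r \<Omega> g" using * by (simp add: in_Lp_def Lp_norm_finite[unfolded infinity_ennreal_def])
qed

section \<open>Fields of the other symmetry classes\<close>

lemma L2_test_integrable:
  fixes g :: "real^2 \<Rightarrow> real"
  assumes [measurable]: "borel_fun g" and g: "sqi UNIV g < top" and \<psi>: "\<psi> \<in> test_functions \<Omega>"
  shows "integrable lborel (\<lambda>p. g p * \<psi> p)"
proof -
  note [measurable] = test_functions_measurable[OF \<psi>]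
  show ?thesis by (rule L2_pairing(2)[OF _ _ _ _ _ g sqi_test_finite[OF \<psi>]]) (auto simp: abs_mult)
qed

lemma L2_fundamental:
  fixes g :: "real^2 \<Rightarrow> real"
  assumes [measurable]: "borel_fun g" and g: "sqi UNIV g < top"
    and z: "\<And>\<psi>. \<psi> \<in> test_functions UNIV \<Longrightarrow> (LBINT p. g p * \<psi> p) = 0"
  shows "AE p in lborel. g p = 0"
proof -
  have "set_integrable lborel (cbox a b) g" for a b
  proof -
    obtain r where "\<And>x. x \<in> cbox a b \<Longrightarrow> norm x \<le> r" using bounded_cbox[of a b] by (meson bounded_iff)
    then have r: "cbox a b \<subseteq> square r" using in_squareI by blast
    show ?thesis unfolding set_integrable_def
    proof (rule L2_pairing(2)[where f=g and g="\<lambda>_. 1::real" and S="square r"])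
      show "AE x in lborel. \<bar>indicator (cbox a b) x *\<^sub>R g x\<bar> \<le> indicator (square r) x * (norm (g x) * norm (1::real))"
        using r by (intro AE_I2) (auto simp: indicator_def)
      show "sqi (square r) (\<lambda>_. 1::real) < top" by (rule sqi_finite_bounded[of _ 1]) simp
      show "sqi (square r) g < top" by (rule le_less_trans[OF sqi_mono_set g]) simp
    qed auto
  qed
  then have "AE x\<in>UNIV in lborel. g x = 0" by (intro fundamental_lemma z) auto
  then show ?thesis by simp
qed

lemma sqi_zero_AE:
  fixes f :: "real^2 \<Rightarrow> 'b::euclidean_space"
  assumes [measurable]: "borel_fun f" and "sqi UNIV f = 0"
  shows "AE p in lborel. f p = 0"
proof -
  have "AE p in lborel. ennreal ((norm (f p))^2) * indicator UNIV p = 0"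
    using assms(2) unfolding sqi_def by (subst (asm) nn_integral_0_iff_AE) auto
  then show ?thesis by eventually_elim simp
qed

lemma sqi_entry: "sqi S (\<lambda>x. f x $ i $ j) \<le> sqi S f" for f :: "real^2 \<Rightarrow> real^2^2"
  by (rule order_trans[OF sqi_nth[where f="\<lambda>x. f x $ i"] sqi_nth])

lemma appr_entry:
  assumes ap: "appr \<Omega> z A \<phi>"
  shows "borel_fun (\<lambda>p. A p $ i $ j)" "sqi UNIV (\<lambda>p. A p $ i $ j) < top"
  using apprD(2)[OF ap] le_less_trans[OF sqi_entry apprD(10)[OF ap]] by (auto intro: measurable_nth2)

lemma test_functions_mir:
  fixes \<psi> :: "real^2 \<Rightarrow> real"
  assumes "\<psi> \<in> test_functions UNIV" shows "(\<lambda>p. \<psi> (mir k p)) \<in> test_functions UNIV"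
proof -
  obtain r where r: "r > 0" "\<And>x. x \<notin> square r \<Longrightarrow> \<psi> x = 0"
    by (rule compact_support_square[OF test_functionsD(2)[OF assms]]) (rule that)
  show ?thesis
    by (rule test_functionsI[where K="square r"])
      (use r test_functionsD(1)[OF assms] in \<open>auto simp: square_mir compact_square compact_imp_closed compact_imp_bounded intro: smooth_mir\<close>)
qed

text \<open>Differentiating in the direction of oddness yields an even function, differentiating in
  the other direction an odd one. As A is only a weak gradient, the comparison is made by reflecting
  the test function, whose derivative changes sign exactly in direction k.\<close>

lemma appr_parity:
  assumes ap: "appr \<Omega> z A \<phi>" and odd: "AE p in lborel. z (mir k p) $ j = - (z p $ j)"
  shows "AE p in lborel. A p $ i $ j = (if i = k then 1 else -1) * A (mir k p) $ i $ j"
proof -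
  define \<sigma> :: real where "\<sigma> = (if i = k then 1 else -1)"
  note [measurable] = apprD(1,2)[OF ap] appr_entry(1)[OF ap] measurable_nth2
  note e = appr_entry[OF ap, of i j]
  have m: "borel_fun (\<lambda>p. A (mir k p) $ i $ j)"
    using measurable_compose[OF mir_measurable e(1)] by simp
  have f: "sqi UNIV (\<lambda>p. A (mir k p) $ i $ j) < top" using e(2) sqi_mir(2)[OF e(1), of k] by simp
  have "AE p in lborel. A p $ i $ j + (- \<sigma>) * A (mir k p) $ i $ j = 0"
  proof (rule L2_fundamental)
    show "borel_fun (\<lambda>p. A p $ i $ j + (- \<sigma>) * A (mir k p) $ i $ j)" using e(1) m by measurable
    have "sqi UNIV (\<lambda>p. A p $ i $ j + (- \<sigma>) * A (mir k p) $ i $ j) \<le> 2 * sqi UNIV (\<lambda>p. A p $ i $ j) + 2 * sqi UNIV (\<lambda>p. (- \<sigma>) * A (mir k p) $ i $ j)"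
      using e(1) m by (intro sqi_triangle) auto
    also have "\<dots> < top" using e(2) f m by (subst sqi_cmult) (auto simp: ennreal_mult_less_top)
    finally show "sqi UNIV (\<lambda>p. A p $ i $ j + (- \<sigma>) * A (mir k p) $ i $ j) < top" .
    fix \<psi> :: "real^2 \<Rightarrow> real" assume \<psi>: "\<psi> \<in> test_functions UNIV"
    note \<psi>' = test_functions_mir[OF \<psi>, of k]
    note [measurable] = test_functions_measurable[OF \<psi>] test_functions_measurable[OF \<psi>'] test_functions_measurable[OF test_functions_partial[OF \<psi>]]
    have pm: "partial i (\<lambda>p. \<psi> (mir k p)) p = - \<sigma> * partial i \<psi> (mir k p)" for p
      using partial_mir(1)[OF smooth_differentiable[OF test_functionsD(1)[OF \<psi>]], of i k p] by (simp add: \<sigma>_def)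
    have "(LBINT p. A (mir k p) $ i $ j * \<psi> p) = (LBINT p. A p $ i $ j * \<psi> (mir k p))"
      using integral_mir[of "\<lambda>p. A p $ i $ j * \<psi> (mir k p)" k] by simp
    also have "\<dots> = - (LBINT p. z p $ j * partial i (\<lambda>p. \<psi> (mir k p)) p)"
      using appr_weak_derivative[OF ap \<psi>', of j i] by simp
    also have "\<dots> = \<sigma> * (LBINT p. z p $ j * partial i \<psi> (mir k p))"
      by (simp add: pm mult.left_commute[of _ \<sigma>])
    also have "(LBINT p. z p $ j * partial i \<psi> (mir k p)) = (LBINT p. z (mir k p) $ j * partial i \<psi> p)"
      using integral_mir[of "\<lambda>p. z p $ j * partial i \<psi> (mir k p)" k] by simp
    also have "\<dots> = (LBINT p. - (z p $ j * partial i \<psi> p))"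
    proof (rule integral_cong_AE)
      show "AE p in lborel. z (mir k p) $ j * partial i \<psi> p = - (z p $ j * partial i \<psi> p)"
        using odd by eventually_elim simp
    qed measurable
    also have "\<dots> = (LBINT p. A p $ i $ j * \<psi> p)"
      using appr_weak_derivative[OF ap \<psi>, of j i] by simp
    finally have "(LBINT p. A (mir k p) $ i $ j * \<psi> p) = \<sigma> * (LBINT p. A p $ i $ j * \<psi> p)" .
    moreover have "\<sigma> * \<sigma> = 1" by (simp add: \<sigma>_def)
    ultimately have "(LBINT p. A p $ i $ j * \<psi> p) - \<sigma> * (LBINT p. A (mir k p) $ i $ j * \<psi> p) = 0" by (simp flip: mult.assoc)
    then show "(LBINT p. (A p $ i $ j + (- \<sigma>) * A (mir k p) $ i $ j) * \<psi> p) = 0"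
      using L2_test_integrable[OF e \<psi>] L2_test_integrable[OF m f \<psi>] by (simp add: left_diff_distrib mult.assoc)
  qed
  then show ?thesis by eventually_elim (simp add: \<sigma>_def)
qed

lemma parity_integral_zero:
  fixes g h :: "real^2 \<Rightarrow> real"
  assumes [measurable]: "borel_fun g" "borel_fun h"
    and g: "AE p in lborel. g p = s * g (mir k p)" and h: "AE p in lborel. h p = t * h (mir k p)" and "s * t = -1"
  shows "(LBINT p. g p * h p) = 0"
proof -
  have "(LBINT p. g p * h p) = (LBINT p. - (g (mir k p) * h (mir k p)))"
  proof (rule integral_cong_AE)
    show "AE p in lborel. g p * h p = - (g (mir k p) * h (mir k p))"
      using g h
    proof eventually_elim
      case (elim p)
      have "g p * h p = (s * t) * (g (mir k p) * h (mir k p))" unfolding elim(1)[symmetric] by (subst elim(1), subst elim(2)) simp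
      then show ?case by (simp add: \<open>s * t = -1\<close>)
    qed
  qed measurable
  also have "\<dots> = - (LBINT p. g p * h p)" using integral_mir[of "\<lambda>p. g p * h p" k] by simp
  finally show ?thesis by simp
qed

lemma square_tendsto:
  fixes x :: "nat \<Rightarrow> real"
  assumes "\<And>n. ennreal ((x n - l)^2) \<le> Y n" "Y \<longlonglongrightarrow> 0"
  shows "x \<longlonglongrightarrow> l"
proof -
  have "(\<lambda>n. ennreal ((x n - l)^2)) \<longlonglongrightarrow> ennreal 0" using ennreal_squeeze_0[OF assms(2,1)] by simp
  then have "(\<lambda>n. (x n - l)^2) \<longlonglongrightarrow> 0" by (rule tendsto_ennrealD) auto
  then have "(\<lambda>n. sqrt ((x n - l)^2)) \<longlonglongrightarrow> sqrt 0" by (rule tendsto_real_sqrt)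
  then have "(\<lambda>n. x n - l) \<longlonglongrightarrow> 0" by (simp add: tendsto_rabs_zero_iff)
  then show ?thesis by (rule Lim_null[THEN iffD2])
qed

lemma appr_entry_pairing:
  fixes g :: "real^2 \<Rightarrow> real"
  assumes ap: "appr \<Omega> z A \<phi>" and [measurable]: "borel_fun g" and g: "sqi UNIV g < top"
  shows "(\<lambda>n. LBINT p. g p * partial i (\<lambda>y. \<phi> n y $ j) p) \<longlonglongrightarrow> (LBINT p. g p * A p $ i $ j)"
proof (rule square_tendsto)
  note e = appr_entry[OF ap, of i j]
  show "(\<lambda>n. sqi UNIV g * sqi UNIV (\<lambda>p. grad (\<phi> n) p - A p)) \<longlonglongrightarrow> 0"
    by (rule ennreal_mult_tendsto_0[OF apprD(8)[OF ap] g])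
  fix n
  have e': "borel_fun (\<lambda>p. grad (\<phi> n) p $ i $ j)" "sqi UNIV (\<lambda>p. grad (\<phi> n) p $ i $ j) < top"
    by (rule appr_entry[OF appr_test[OF apprD(3)[OF ap]]])+
  have ii: "integrable lborel (\<lambda>p. g p * h p)" if [measurable]: "borel_fun h" and h: "sqi UNIV h < top" for h :: "real^2 \<Rightarrow> real"
    by (rule L2_pairing(2)[OF _ _ _ _ _ g h]) (auto simp: abs_mult)
  have "ennreal (((LBINT p. g p * partial i (\<lambda>y. \<phi> n y $ j) p) - (LBINT p. g p * A p $ i $ j))^2)
    = ennreal ((LBINT p. g p * (grad (\<phi> n) p $ i $ j - A p $ i $ j))^2)"
    using ii[OF e] ii[OF e'] by (simp add: right_diff_distrib grad_nth)
  also have "\<dots> \<le> sqi UNIV g * sqi UNIV (\<lambda>p. grad (\<phi> n) p $ i $ j - A p $ i $ j)"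
    using e(1) e'(1) by (intro L2_pairing(3)) (auto simp: abs_mult)
  also have "\<dots> \<le> sqi UNIV g * sqi UNIV (\<lambda>p. grad (\<phi> n) p - A p)"
    using sqi_entry[of UNIV "\<lambda>p. grad (\<phi> n) p - A p" i j] by (intro mult_left_mono) auto
  finally show "ennreal (((LBINT p. g p * partial i (\<lambda>y. \<phi> n y $ j) p) - (LBINT p. g p * A p $ i $ j))^2)
    \<le> sqi UNIV g * sqi UNIV (\<lambda>p. grad (\<phi> n) p - A p)" .
qed

text \<open>On the approximants f is given by the explicit formula; both sides are continuous in the
  Dirichlet norm.\<close>

lemma force_pairing:
  assumes f: "force_of \<Omega> F G H f" and \<Omega>: "open \<Omega>" and ap: "appr \<Omega> z A \<phi>" and uz: "AE x\<in>\<Omega> in lborel. u x = z x"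
    and F: "borel_fun F'" "sqi UNIV F' < top" "AE x\<in>\<Omega> in lborel. F x = F' x"
    and G: "borel_fun G'" "sqi UNIV G' < top" "AE x\<in>\<Omega> in lborel. G x = G' x"
    and H: "borel_fun H'" "sqi UNIV H' < top" "AE x\<in>\<Omega> in lborel. H x = H' x"
  shows "f u = - (LBINT p. F' p * A p $ 1 $ 1) - (LBINT p. G' p * A p $ 2 $ 1) - (LBINT p. H' p * A p $ 2 $ 1)
    + (LBINT p. F' p * A p $ 2 $ 2) - (LBINT p. G' p * A p $ 1 $ 2) + (LBINT p. H' p * A p $ 1 $ 2)"
proof -
  have fd: "f \<in> H1_dual \<Omega>" using f by (simp add: force_of_def)
  obtain K :: ennreal where K: "K < top"
    "\<And>\<Phi>. \<Phi> \<in> solenoidal_test_functions \<Omega> \<Longrightarrow> ennreal ((f \<Phi> - f u)^2) \<le> K * sqi UNIV (\<lambda>p. grad \<Phi> p - A p)"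
    by (rule H1_dual_bound[OF fd ap \<Omega> uz]) (rule that)
  have 1: "(\<lambda>n. f (\<phi> n)) \<longlonglongrightarrow> f u"
    by (rule square_tendsto[OF K(2)[OF apprD(3)[OF ap]] ennreal_mult_tendsto_0[OF apprD(8)[OF ap] K(1)]])
  have "f (\<phi> n) = - (LBINT p. F' p * partial 1 (\<lambda>y. \<phi> n y $ 1) p) - (LBINT p. G' p * partial 2 (\<lambda>y. \<phi> n y $ 1) p) - (LBINT p. H' p * partial 2 (\<lambda>y. \<phi> n y $ 1) p)
    + (LBINT p. F' p * partial 2 (\<lambda>y. \<phi> n y $ 2) p) - (LBINT p. G' p * partial 1 (\<lambda>y. \<phi> n y $ 2) p) + (LBINT p. H' p * partial 1 (\<lambda>y. \<phi> n y $ 2) p)" for n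
  proof -
    note t = test_functions_nth[OF apprD(4)[OF ap, of n]]
    show ?thesis
      using f apprD(3)[OF ap, of n] unfolding force_of_def Let_def
      by (simp add: distr_partial_lborel[OF \<Omega> F(1,3) t] distr_partial_lborel[OF \<Omega> G(1,3) t] distr_partial_lborel[OF \<Omega> H(1,3) t])
  qed
  then show ?thesis
    by (intro LIMSEQ_unique[OF 1]) (simp, intro tendsto_intros appr_entry_pairing[OF ap] F G H)
qed

lemma appr_divergence_free:
  assumes ap: "appr \<Omega> z A \<phi>" shows "AE p in lborel. A p $ 1 $ 1 + A p $ 2 $ 2 = 0"
proof (rule sqi_zero_AE)
  note e = appr_entry(1)[OF ap]
  show "borel_fun (\<lambda>p. A p $ 1 $ 1 + A p $ 2 $ 2)" using e by measurable
  have "(\<lambda>n. sqi UNIV (\<lambda>p. A p $ 1 $ 1 + A p $ 2 $ 2)) \<longlonglongrightarrow> 0"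
  proof (rule ennreal_squeeze_0)
    show "(\<lambda>n. 4 * sqi UNIV (\<lambda>p. grad (\<phi> n) p - A p)) \<longlonglongrightarrow> 0" by (rule ennreal_mult_tendsto_0[OF apprD(8)[OF ap]]) simp
    fix n
    have e': "borel_fun (\<lambda>p. grad (\<phi> n) p $ i $ j)" for i j
      by (rule appr_entry[OF appr_test[OF apprD(3)[OF ap]]])
    have d: "grad (\<phi> n) p $ 1 $ 1 + grad (\<phi> n) p $ 2 $ 2 = 0" for p
      using apprD(3)[OF ap, of n] by (simp add: solenoidal_test_functions_def grad_nth sum_2)
    have "sqi UNIV (\<lambda>p. A p $ 1 $ 1 + A p $ 2 $ 2)
      \<le> 2 * sqi UNIV (\<lambda>p. (grad (\<phi> n) p - A p) $ 1 $ 1) + 2 * sqi UNIV (\<lambda>p. (grad (\<phi> n) p - A p) $ 2 $ 2)"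
    proof (rule sqi_triangle')
      show "AE p\<in>UNIV in lborel. norm (A p $ 1 $ 1 + A p $ 2 $ 2) \<le> norm ((grad (\<phi> n) p - A p) $ 1 $ 1 + (grad (\<phi> n) p - A p) $ 2 $ 2)"
      proof (intro AE_I2 impI)
        fix p
        have "(grad (\<phi> n) p - A p) $ 1 $ 1 + (grad (\<phi> n) p - A p) $ 2 $ 2 = - (A p $ 1 $ 1 + A p $ 2 $ 2)" using d[of p] by simp
        then show "norm (A p $ 1 $ 1 + A p $ 2 $ 2) \<le> norm ((grad (\<phi> n) p - A p) $ 1 $ 1 + (grad (\<phi> n) p - A p) $ 2 $ 2)"
          by (simp only: norm_minus_cancel order_refl)
      qed
    qed (use e e' in \<open>auto intro: borel_measurable_diff\<close>)
    also have "\<dots> \<le> 2 * sqi UNIV (\<lambda>p. grad (\<phi> n) p - A p) + 2 * sqi UNIV (\<lambda>p. grad (\<phi> n) p - A p)"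
      by (intro add_mono mult_left_mono sqi_entry) auto
    also have "\<dots> = 4 * sqi UNIV (\<lambda>p. grad (\<phi> n) p - A p)" by (simp flip: distrib_right)
    finally show "sqi UNIV (\<lambda>p. A p $ 1 $ 1 + A p $ 2 $ 2) \<le> 4 * sqi UNIV (\<lambda>p. grad (\<phi> n) p - A p)" .
  qed
  then show "sqi UNIV (\<lambda>p. A p $ 1 $ 1 + A p $ 2 $ 2) = 0" by (simp add: LIMSEQ_const_iff)
qed

text \<open>If the derivative in the direction of oddness vanishes, Hardy's inequality forces the
  component to vanish, and then all its weak derivatives.\<close>

lemma component_zero:
  assumes ap: "appr \<Omega> z A \<phi>" and odd: "AE p in lborel. z (mir k p) $ j = - (z p $ j)" and A0: "AE p in lborel. A p $ k $ j = 0"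
  shows "AE p in lborel. A p $ i $ j = 0"
proof -
  note [measurable] = apprD(1,2)[OF ap] measurable_nth2
  have "sqi UNIV (\<lambda>p. A p $ k $ j) = 0"
    unfolding sqi_def using A0 by (subst nn_integral_0_iff_AE) (auto intro!: appr_entry[OF ap] elim!: eventually_mono)
  then have "sqi UNIV (\<lambda>p. z p $ j / (1 + \<bar>p$k\<bar>)) = 0" using appr_Hardy[OF ap odd] by simp
  then have "AE p in lborel. z p $ j / (1 + \<bar>p$k\<bar>) = 0" by (intro sqi_zero_AE) auto
  then have z: "AE p in lborel. z p $ j = 0"
  proof eventually_elim
    case (elim p)
    moreover have "1 + \<bar>p$k\<bar> > 0" by (simp add: add_pos_nonneg)
    ultimately show ?case by simp
  qed
  show ?thesis
  proof (rule L2_fundamental[OF appr_entry[OF ap]])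
    fix \<psi> :: "real^2 \<Rightarrow> real" assume \<psi>: "\<psi> \<in> test_functions UNIV"
    have "(LBINT p. z p $ j * partial i \<psi> p) = 0"
      using z by (intro integral_eq_zero_AE) (auto elim!: eventually_mono)
    then show "(LBINT p. A p $ i $ j * \<psi> p) = 0" using appr_weak_derivative[OF ap \<psi>, of j i] by simp
  qed
qed

text \<open>F is even and G, H are odd in each variable. If the component j of u is odd in the
  variable other than x_j, then every product of its derivatives with F, G, H occurring in the force
  is odd in that variable and integrates to zero. Otherwise, the excluded class aside, both
  components are odd in the same variable x_j, and the divergence condition makes the component j
  vanish.\<close>

lemma vanishing_force:
  assumes f: "force_of \<Omega> F G H f" and \<Omega>: "open \<Omega>" and ap: "appr \<Omega> z A \<phi>" and uz: "AE x\<in>\<Omega> in lborel. u x = z x"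
    and F: "borel_fun F'" "sqi UNIV F' < top" "AE x\<in>\<Omega> in lborel. F x = F' x"
    and G: "borel_fun G'" "sqi UNIV G' < top" "AE x\<in>\<Omega> in lborel. G x = G' x"
    and H: "borel_fun H'" "sqi UNIV H' < top" "AE x\<in>\<Omega> in lborel. H x = H' x"
    and sF: "\<And>k. AE p in lborel. F' p = 1 * F' (mir k p)"
    and sG: "\<And>k. AE p in lborel. G' p = (-1) * G' (mir k p)"
    and sH: "\<And>k. AE p in lborel. H' p = (-1) * H' (mir k p)"
    and odd1: "AE p in lborel. z (mir k1 p) $ 1 = - (z p $ 1)" and odd2: "AE p in lborel. z (mir k2 p) $ 2 = - (z p $ 2)"
    and k: "\<not> (k1 = 1 \<and> k2 = 2)"
  shows "f u = 0"
proof -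
  have par: "(LBINT p. g p * A p $ i $ j) = 0"
    if "borel_fun g" "AE p in lborel. g p = s * g (mir l p)" "AE p in lborel. z (mir l p) $ j = - (z p $ j)"
      "s * (if i = l then 1 else -1) = -1" for g i j l s
    by (rule parity_integral_zero[OF that(1) appr_entry(1)[OF ap] that(2) appr_parity[OF ap that(3)] that(4)])
  have zero: "(LBINT p. g p * A p $ i $ j) = 0" if "AE p in lborel. A p $ i $ j = 0" for g :: "real^2 \<Rightarrow> real" and i j
    using that by (intro integral_eq_zero_AE) (auto elim!: eventually_mono)
  note dv = appr_divergence_free[OF ap]
  \<comment> \<open>The two terms of the divergence have opposite parity in the common variable and
    add up to zero, so each is both even and odd.\<close>
  have dz: "AE p in lborel. A p $ 1 $ 1 = 0 \<and> A p $ 2 $ 2 = 0"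
    if s: "(if 1 = l then 1 else -1) = - (if (2::2) = l then 1 else (-1::real))"
      and o: "AE p in lborel. z (mir l p) $ 1 = - (z p $ 1)" "AE p in lborel. z (mir l p) $ 2 = - (z p $ 2)" for l
    using dv AE_mir'[OF dv, of l] appr_parity[OF ap o(1), of 1] appr_parity[OF ap o(2), of 2]
  proof eventually_elim
    case (elim p)
    then show ?case using s by (auto split: if_splits)
  qed
  have F1: "(LBINT p. F' p * A p $ 1 $ 1) = 0 \<and> (LBINT p. G' p * A p $ 2 $ 1) = 0 \<and> (LBINT p. H' p * A p $ 2 $ 1) = 0"
  proof (cases "k1 = 2")
    case True
    note o = odd1[unfolded True]
    show ?thesis using par[OF F(1) sF[of 2] o] par[OF G(1) sG[of 2] o, of 2] par[OF H(1) sH[of 2] o, of 2] by simp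
  next
    case False
    then have k12: "k1 = 1" "k2 = 1" using k exhaust_2 by blast+
    have A: "AE p in lborel. A p $ 1 $ 1 = 0 \<and> A p $ 2 $ 2 = 0"
      by (rule dz[OF _ odd1[unfolded k12] odd2[unfolded k12]]) simp
    then have A1: "AE p in lborel. A p $ 1 $ 1 = 0" by (auto elim!: eventually_mono)
    then show ?thesis using zero[OF A1] zero[OF component_zero[OF ap odd1[unfolded k12] A1]] by simp
  qed
  have F2: "(LBINT p. F' p * A p $ 2 $ 2) = 0 \<and> (LBINT p. G' p * A p $ 1 $ 2) = 0 \<and> (LBINT p. H' p * A p $ 1 $ 2) = 0"
  proof (cases "k2 = 1")
    case True
    note o = odd2[unfolded True]
    show ?thesis using par[OF F(1) sF[of 1] o, of 2] par[OF G(1) sG[of 1] o, of 1] par[OF H(1) sH[of 1] o, of 1] by simp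
  next
    case False
    then have k12: "k1 = 2" "k2 = 2" using k exhaust_2 by blast+
    have A: "AE p in lborel. A p $ 1 $ 1 = 0 \<and> A p $ 2 $ 2 = 0"
      by (rule dz[OF _ odd1[unfolded k12] odd2[unfolded k12]]) simp
    then have A2: "AE p in lborel. A p $ 2 $ 2 = 0" by (auto elim!: eventually_mono)
    then show ?thesis using zero[OF A2] zero[OF component_zero[OF ap odd2[unfolded k12] A2]] by simp
  qed
  show ?thesis using force_pairing[OF f \<Omega> ap uz F G H] F1 F2 by simp
qed

lemma zero_of_energy:
  assumes \<Omega>: "open \<Omega>" "reflection_invariant \<Omega>" and u: "u \<in> H1S \<Omega>"
    and ap: "appr \<Omega> z A \<phi>" and uz: "AE x\<in>\<Omega> in lborel. u x = z x" and z0: "AE x in lborel. x \<notin> \<Omega> \<longrightarrow> z x = 0"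
    and en: "energy_inequality \<Omega> f u" "f u = 0"
  shows "AE x in lborel. z x = 0" "AE x in lborel. A x = 0"
proof -
  note [measurable] = apprD(1,2)[OF ap]
  have "(LBINT x. A x \<bullet> A x) \<le> 0"
    using en Dirichlet_norm_appr(1)[OF ap \<Omega>(1) uz] by (simp add: energy_inequality_def)
  then have A: "sqi UNIV A = 0" using sqi_inner(3)[OF apprD(2,10)[OF ap]] by (simp add: ennreal_neg)
  then show "AE x in lborel. A x = 0" by (rule sqi_zero_AE[OF apprD(2)[OF ap]])
  have "sqi UNIV (\<lambda>p. z p /\<^sub>R (norm p + 1)) = 0" using H1S_Hardy(1)[OF \<Omega> u ap uz z0] A by simp
  then have "AE p in lborel. z p /\<^sub>R (norm p + 1) = 0" by (intro sqi_zero_AE) auto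
  then show "AE x in lborel. z x = 0"
  proof eventually_elim
    case (elim p)
    moreover have "norm p + 1 > 0" by (simp add: add_nonneg_pos)
    ultimately show ?case by simp
  qed
qed

lemma weighted_sup_le:
  assumes \<Omega>: "open \<Omega>" and [measurable]: "borel_fun z" and uz: "AE x\<in>\<Omega> in lborel. u x = z x"
    and le: "AE x\<in>\<Omega> in lborel. ennreal ((norm x + 1) * norm (z x)) \<le> c"
  shows "weighted_sup \<Omega> u \<le> c"
  unfolding weighted_sup_def
proof (rule esssup_I)
  have b: "\<Omega> \<in> sets borel" using \<Omega> by simp
  have "(\<lambda>x. (norm x + 1) * norm (u x)) \<in> borel_measurable (lebesgue_on \<Omega>)"
    by (rule lebesgue_on_measurable_AE[OF b, of "\<lambda>x. (norm x + 1) * norm (z x)"]) (use uz in \<open>auto elim!: eventually_mono\<close>)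
  then show "(\<lambda>x. ennreal ((norm x + 1) * norm (u x))) \<in> borel_measurable (lebesgue_on \<Omega>)" by simp
  show "AE x in lebesgue_on \<Omega>. ennreal ((norm x + 1) * norm (u x)) \<le> c"
    using uz le unfolding AE_lebesgue_on[OF b] by eventually_elim simp
qed

lemma in_LpI:
  fixes g G :: "real^2 \<Rightarrow> 'b::euclidean_space"
  assumes \<Omega>: "open \<Omega>" and [measurable]: "borel_fun G" and eq: "AE x\<in>\<Omega> in lborel. g x = G x"
    and fin: "NNset \<Omega> (\<lambda>x. ennreal (norm (G x) powr r)) < top"
  shows "in_Lp r \<Omega> g"
proof -
  have b: "\<Omega> \<in> sets borel" using \<Omega> by simp
  have "NNset \<Omega> (\<lambda>x. ennreal (norm (g x) powr r)) = NNset \<Omega> (\<lambda>x. ennreal (norm (G x) powr r))"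
    using eq by (intro nn_integral_cong_AE) (auto simp: indicator_def elim!: eventually_mono)
  then show ?thesis
    using fin lebesgue_on_measurable_AE[OF b _ eq] Lp_norm_finite[OF b, of r g] by (simp add: in_Lp_def)
qed

text \<open>Since q > 2, the exponent 2 lies in the range of \<open>chi_imp_Lp\<close>; square
  integrability is what allows the force to be paired with limits of gradients.\<close>

lemma chi_L2_representation:
  fixes F :: "real^2 \<Rightarrow> real"
  assumes ext: "exterior_domain \<Omega>" and R: "R > 0" "frontier \<Omega> \<subseteq> ball 0 R" and q: "q > 2" and F: "in_chi R q 2 \<Omega> F"
  obtains F' where "borel_fun F'" "sqi UNIV F' < top" "AE x\<in>\<Omega> in lborel. F x = F' x"
    "AE x in lborel. x \<notin> \<Omega> \<longrightarrow> F' x = 0"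
proof -
  have \<Omega>: "open \<Omega>" using ext by (simp add: exterior_domain_def)
  have li: "locally_integrable \<Omega> F" and chi: "chi_norm R q 2 \<Omega> F < \<infinity>" using F by (auto simp: in_chi_def)
  obtain F' where F': "borel_fun F'" "AE x\<in>\<Omega> in lborel. F x = F' x" "AE x in lborel. x \<notin> \<Omega> \<longrightarrow> F' x = 0"
    "\<And>a b. cbox a b \<subseteq> \<Omega> \<Longrightarrow> set_integrable lborel (cbox a b) F'"
    by (rule locally_integrable_borel[OF \<Omega> li]) (rule that)
  have "NNset \<Omega> (\<lambda>x. ennreal (norm (F x) powr 2)) < top"
    by (rule chi_imp_Lp(1)[OF ext R q chi F'(1,2)]) (use q in auto)
  also have "NNset \<Omega> (\<lambda>x. ennreal (norm (F x) powr 2)) = sqi UNIV F'"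
    unfolding sqi_def
  proof (rule nn_integral_cong_AE)
    have "\<bar>y\<bar> powr 2 = y^2" for y :: real by (cases "y = 0") auto
    then show "AE x in lborel. ennreal (norm (F x) powr 2) * indicator \<Omega> x = ennreal ((norm (F' x))^2) * indicator UNIV x"
      using F'(2,3) by (auto simp: indicator_def elim!: eventually_elim2)
  qed
  finally show ?thesis using F' by (intro that)
qed

lemma symmetric_representation:
  fixes F F' :: "real^2 \<Rightarrow> real"
  assumes R: "reflection_invariant \<Omega>" and FF: "AE x\<in>\<Omega> in lborel. F x = F' x" and F0: "AE x in lborel. x \<notin> \<Omega> \<longrightarrow> F' x = 0"
    and s: "AE x\<in>\<Omega> in lborel. F x = s * F (mir k x)"
  shows "AE x in lborel. F' x = s * F' (mir k x)"
  using s FF F0 AE_mir'[OF FF, of k] AE_mir'[OF F0, of k]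
  by eventually_elim (auto simp: reflection_mir[OF R])

lemma force_symmetries_mir:
  assumes \<Omega>: "open \<Omega>" and S: "force_symmetries \<Omega> F G H"
  shows "AE x\<in>\<Omega> in lborel. F x = 1 * F (mir k x)" "AE x\<in>\<Omega> in lborel. G x = (-1) * G (mir k x)"
    "AE x\<in>\<Omega> in lborel. H x = (-1) * H (mir k x)"
proof -
  have pt: "p = pt (p$1) (p$2)" for p :: "real^2" by (simp add: vec_eq_iff forall_2)
  have "AE x\<in>\<Omega> in lborel. F x = F (mir k x) \<and> G x = - G (mir k x) \<and> H x = - H (mir k x)"
    using S \<Omega> unfolding force_symmetries_def AE_lebesgue_on[OF borel_open[OF \<Omega>]]
  proof (elim eventually_mono)
    fix x assume *: "x \<in> \<Omega> \<longrightarrow> (\<forall>x1 x2. x = pt x1 x2 \<longrightarrow>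
       F (pt x1 x2) = F (pt x1 (- x2)) \<and> F (pt x1 (- x2)) = F (pt (- x1) x2) \<and>
       F (pt x1 x2) = - F (pt x2 x1) \<and> - F (pt x2 x1) = - F (pt (- x2) (- x1)) \<and>
       G (pt x1 x2) = - G (pt x1 (- x2)) \<and> - G (pt x1 (- x2)) = - G (pt (- x1) x2) \<and>
       G (pt x1 x2) = G (pt x2 x1) \<and> G (pt x2 x1) = G (pt (- x2) (- x1)) \<and>
       H (pt x1 x2) = - H (pt x1 (- x2)) \<and> - H (pt x1 (- x2)) = - H (pt (- x1) x2) \<and>
       H (pt x1 x2) = - H (pt x2 x1) \<and> - H (pt x2 x1) = - H (pt (- x2) (- x1)))"
    show "x \<in> \<Omega> \<longrightarrow> F x = F (mir k x) \<and> G x = - G (mir k x) \<and> H x = - H (mir k x)"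
    proof
      assume "x \<in> \<Omega>"
      from *[rule_format, OF this pt] have "F x = F (mir 1 x) \<and> G x = - G (mir 1 x) \<and> H x = - H (mir 1 x)"
        "F x = F (mir 2 x) \<and> G x = - G (mir 2 x) \<and> H x = - H (mir 2 x)"
        unfolding mir_pt pt[symmetric] by auto
      then show "F x = F (mir k x) \<and> G x = - G (mir k x) \<and> H x = - H (mir k x)" using exhaust_2[of k] by auto
    qed
  qed
  then show "AE x\<in>\<Omega> in lborel. F x = 1 * F (mir k x)" "AE x\<in>\<Omega> in lborel. G x = (-1) * G (mir k x)"
    "AE x\<in>\<Omega> in lborel. H x = (-1) * H (mir k x)"
    by (auto elim!: eventually_mono)
qed

lemma velocity_symmetries_odd:
  assumes \<Omega>: "open \<Omega>" and S: "velocity_symmetries \<Omega> v"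
  shows "odd_x1 \<Omega> (\<lambda>x. v x $ 1)" "odd_x2 \<Omega> (\<lambda>x. v x $ 2)"
proof -
  have pt: "p = pt (p$1) (p$2)" for p :: "real^2" by (simp add: vec_eq_iff forall_2)
  show "odd_x1 \<Omega> (\<lambda>x. v x $ 1)"
    using S unfolding velocity_symmetries_def odd_x1_def
    by (rule eventually_mono) (drule spec, drule spec, drule mp, rule pt, simp)
  show "odd_x2 \<Omega> (\<lambda>x. v x $ 2)"
    using S unfolding velocity_symmetries_def odd_x2_def
    by (rule eventually_mono) (drule spec, drule spec, drule mp, rule pt, simp)
qed

section \<open>Conclusion by cases on the symmetry class of u\<close>

theorem corollary1:
  fixes \<Omega> :: "(real^2) set" and \<mu> :: real
  assumes "\<mu> > 0"
    and "exterior_domain \<Omega>"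
    and "Holder_boundary (2 + \<mu>) \<Omega>"
    and "reflection_invariant \<Omega>"
  shows "\<exists>\<delta>>0. property_U \<Omega> \<delta> \<and>
    (\<forall>q R \<beta> \<gamma>. q > 2 \<and> R > 0 \<and> frontier \<Omega> \<subseteq> ball 0 R \<and> \<beta> > 0 \<and> \<gamma> > 0 \<and> property_Y R q \<Omega> \<beta> \<gamma> \<longrightarrow>
      (\<forall>F G H f u.
         in_chi R q 2 \<Omega> F \<and> in_chi R q 2 \<Omega> G \<and> in_chi R q 2 \<Omega> H \<and>
         force_symmetries \<Omega> F G H \<and> force_of \<Omega> F G H f \<and>
         symmetric_weak_solution \<Omega> f u \<and> energy_inequality \<Omega> f u \<and>
         chi_norm R q 2 \<Omega> F + chi_norm R q 2 \<Omega> G + chi_norm R q 2 \<Omega> H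
           \<le> ennreal (min \<beta> (inverse \<gamma> * \<delta>)) \<longrightarrow>
         weighted_sup \<Omega> u < \<infinity> \<and>
         (\<forall>r. 1 < r \<and> r \<le> q \<longrightarrow> in_Lp r \<Omega> (wgrad \<Omega> u))))"
proof (rule exI[of _ "1/8"], intro conjI allI impI, goal_cases)
  case 1 show ?case by simp
next
  case 2 show ?case by (rule exterior_property_U[OF assms(2,4)])
next
  fix q R \<beta> \<gamma> F G H f u
  assume "q > 2 \<and> R > 0 \<and> frontier \<Omega> \<subseteq> ball 0 R \<and> \<beta> > 0 \<and> \<gamma> > 0 \<and> property_Y R q \<Omega> \<beta> \<gamma>"
  then have q: "q > 2" and R: "R > 0" "frontier \<Omega> \<subseteq> ball 0 R" and \<gamma>: "\<gamma> > 0" and Y: "property_Y R q \<Omega> \<beta> \<gamma>" by auto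
  assume "in_chi R q 2 \<Omega> F \<and> in_chi R q 2 \<Omega> G \<and> in_chi R q 2 \<Omega> H \<and>
         force_symmetries \<Omega> F G H \<and> force_of \<Omega> F G H f \<and>
         symmetric_weak_solution \<Omega> f u \<and> energy_inequality \<Omega> f u \<and>
         chi_norm R q 2 \<Omega> F + chi_norm R q 2 \<Omega> G + chi_norm R q 2 \<Omega> H
           \<le> ennreal (min \<beta> (inverse \<gamma> * (1/8)))"
  then have F: "in_chi R q 2 \<Omega> F" and G: "in_chi R q 2 \<Omega> G" and H: "in_chi R q 2 \<Omega> H"
    and fs: "force_symmetries \<Omega> F G H" and f: "force_of \<Omega> F G H f" and u: "symmetric_weak_solution \<Omega> f u"
    and en: "energy_inequality \<Omega> f u"
    and S: "chi_norm R q 2 \<Omega> F + chi_norm R q 2 \<Omega> G + chi_norm R q 2 \<Omega> H \<le> ennreal (min \<beta> (inverse \<gamma> * (1/8)))" by auto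
  note ext = assms(2) and refl = assms(4)
  have \<Omega>: "open \<Omega>" using ext by (simp add: exterior_domain_def)
  have uS: "u \<in> H1S \<Omega>" "u \<in> H1 \<Omega>" using u by (auto simp: symmetric_weak_solution_def H1S_def)
  obtain a A \<phi> where a: "appr \<Omega> a A \<phi>" and ua: "AE x\<in>\<Omega> in lborel. u x = a x" and a0: "AE x in lborel. x \<notin> \<Omega> \<longrightarrow> a x = 0"
    by (rule H1_representation[OF \<Omega> uS(2)]) (rule that)
  have "weighted_sup \<Omega> u < \<infinity> \<and> (\<forall>r. 1 < r \<and> r \<le> q \<longrightarrow> in_Lp r \<Omega> (wgrad \<Omega> u))"
  \<comment> \<open>This class, with u_1 odd in x_1 and u_2 odd in x_2, is that of the solution
    given by Property (Y). A symmetric weak solution may a priori belong to another class, where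
    uniqueness cannot compare the two.\<close>
  proof (cases "odd_x1 \<Omega> (\<lambda>x. u x $ 1) \<and> odd_x2 \<Omega> (\<lambda>x. u x $ 2)")
    case True
    let ?S = "chi_norm R q 2 \<Omega> F + chi_norm R q 2 \<Omega> G + chi_norm R q 2 \<Omega> H"
    have "?S \<le> ennreal \<beta>" by (rule order_trans[OF S]) (simp add: ennreal_leI)
    then obtain v where v: "small_solution R q \<Omega> f (ennreal \<gamma> * ?S) v" "velocity_symmetries \<Omega> v" "symmetric_weak_solution \<Omega> f v"
      using Y F G H fs f unfolding property_Y_def Let_def by blast
    have vS: "v \<in> H1 \<Omega>" using v(3) by (simp add: symmetric_weak_solution_def H1S_def)
    obtain b B \<xi> where b: "appr \<Omega> b B \<xi>" and vb: "AE x\<in>\<Omega> in lborel. v x = b x"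
      by (rule H1_representation[OF \<Omega> vS]) (rule that)
    have vchi: "chi_norm R q 2 \<Omega> (wgrad \<Omega> v) < \<infinity>" and vsup: "weighted_sup \<Omega> v < \<infinity>"
      using v(1) by (auto simp: small_solution_def in_chi_def)
    \<comment> \<open>The factor \<gamma> of the estimate for v cancels the inverse of \<gamma> in
      the smallness condition, leaving exactly the threshold of the uniqueness property.\<close>
    have "weighted_sup \<Omega> v \<le> weighted_sup \<Omega> v + chi_norm R q 2 \<Omega> (wgrad \<Omega> v)" by simp
    also have "\<dots> \<le> ennreal \<gamma> * ?S" using v(1) by (simp add: small_solution_def)
    also have "\<dots> \<le> ennreal \<gamma> * ennreal (inverse \<gamma> * (1/8))"
      by (intro mult_left_mono order_trans[OF S] ennreal_leI) auto
    also have "\<dots> = ennreal (1/8)" using \<gamma> by (simp add: ennreal_mult[symmetric])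
    finally have sup: "weighted_sup \<Omega> v \<le> ennreal (1/8)" .
    have ss: "same_symmetry \<Omega> u v"
      using True velocity_symmetries_odd[OF \<Omega> v(2)] unfolding same_symmetry_def by (simp add: forall_2)
    have fd: "f \<in> H1_dual \<Omega>" using f by (simp add: force_of_def)
    have "AE x in lebesgue_on \<Omega>. u x = v x"
      using exterior_property_U[OF ext refl] fd u v(3) ss en sup unfolding property_U_def by blast
    then have uv: "AE x\<in>\<Omega> in lborel. u x = v x" using \<Omega> by (subst (asm) AE_lebesgue_on) auto
    have ub: "AE x\<in>\<Omega> in lborel. u x = b x" using uv vb by eventually_elim auto
    have "AE x in lebesgue_on \<Omega>. ennreal ((norm x + 1) * norm (v x)) \<le> weighted_sup \<Omega> v"
      unfolding weighted_sup_def by (rule esssup_AE)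
    then have "AE x\<in>\<Omega> in lborel. ennreal ((norm x + 1) * norm (v x)) \<le> weighted_sup \<Omega> v"
      using \<Omega> by (subst (asm) AE_lebesgue_on) auto
    with vb have "AE x\<in>\<Omega> in lborel. ennreal ((norm x + 1) * norm (b x)) \<le> weighted_sup \<Omega> v"
      by eventually_elim auto
    then have "weighted_sup \<Omega> u \<le> weighted_sup \<Omega> v" by (rule weighted_sup_le[OF \<Omega> apprD(1)[OF b] ub])
    then have 1: "weighted_sup \<Omega> u < \<infinity>" using vsup by (rule le_less_trans)
    have wv: "AE x\<in>\<Omega> in lborel. wgrad \<Omega> v x = B x" by (rule appr_wgrad[OF b \<Omega> vb])
    \<comment> \<open>As u = v almost everywhere, B represents both weak gradients, so integrability
      passes from the chosen gradient of v to that of u.\<close>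
    have "in_Lp r \<Omega> (wgrad \<Omega> u)" if r: "1 < r" "r \<le> q" for r
    proof (rule in_LpI[OF \<Omega> apprD(2)[OF b] appr_wgrad[OF b \<Omega> ub]])
      have "NNset \<Omega> (\<lambda>x. ennreal (norm (wgrad \<Omega> v x) powr r)) < top"
        by (rule chi_imp_Lp(1)[OF ext R q vchi apprD(2)[OF b] wv r])
      also have "NNset \<Omega> (\<lambda>x. ennreal (norm (wgrad \<Omega> v x) powr r)) = NNset \<Omega> (\<lambda>x. ennreal (norm (B x) powr r))"
        using wv by (intro nn_integral_cong_AE) (auto simp: indicator_def elim!: eventually_mono)
      finally show "NNset \<Omega> (\<lambda>x. ennreal (norm (B x) powr r)) < top" .
    qed
    with 1 show ?thesis by blast
  next
    case False
    obtain F' where F': "borel_fun F'" "sqi UNIV F' < top" "AE x\<in>\<Omega> in lborel. F x = F' x" "AE x in lborel. x \<notin> \<Omega> \<longrightarrow> F' x = 0"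
      by (rule chi_L2_representation[OF ext R q F]) (rule that)
    obtain G' where G': "borel_fun G'" "sqi UNIV G' < top" "AE x\<in>\<Omega> in lborel. G x = G' x" "AE x in lborel. x \<notin> \<Omega> \<longrightarrow> G' x = 0"
      by (rule chi_L2_representation[OF ext R q G]) (rule that)
    obtain H' where H': "borel_fun H'" "sqi UNIV H' < top" "AE x\<in>\<Omega> in lborel. H x = H' x" "AE x in lborel. x \<notin> \<Omega> \<longrightarrow> H' x = 0"
      by (rule chi_L2_representation[OF ext R q H]) (rule that)
    have or: "odd_x2 \<Omega> (\<lambda>x. u x $ i) \<or> odd_x1 \<Omega> (\<lambda>x. u x $ i)" for i using uS(1) by (simp add: H1S_def)
    note o1 = odd_mir(1)[OF \<Omega> refl ua a0] and o2 = odd_mir(2)[OF \<Omega> refl ua a0]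
    note fm = force_symmetries_mir[OF \<Omega> fs]
    note vf = vanishing_force[OF f \<Omega> a ua F'(1-3) G'(1-3) H'(1-3) symmetric_representation[OF refl F'(3,4) fm(1)]
        symmetric_representation[OF refl G'(3,4) fm(2)] symmetric_representation[OF refl H'(3,4) fm(3)]]
    \<comment> \<open>The three remaining combinations of oddness are exactly those allowed in
      \<open>vanishing_force\<close>.\<close>
    have "f u = 0"
    proof (cases "odd_x1 \<Omega> (\<lambda>x. u x $ 1)")
      case True
      then have "odd_x1 \<Omega> (\<lambda>x. u x $ 2)" using False or[of 2] by blast
      then show ?thesis using vf[OF o1[OF True] o1] by simp
    next
      case no: False
      then have 1: "odd_x2 \<Omega> (\<lambda>x. u x $ 1)" using or[of 1] by blast
      from or[of 2] show ?thesis
      proof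
        assume "odd_x2 \<Omega> (\<lambda>x. u x $ 2)" then show ?thesis using vf[OF o2[OF 1] o2] by simp
      next
        assume "odd_x1 \<Omega> (\<lambda>x. u x $ 2)" then show ?thesis using vf[OF o2[OF 1] o1] by simp
      qed
    qed
    note z = zero_of_energy[OF \<Omega> refl uS(1) a ua a0 en this]
    have "weighted_sup \<Omega> u \<le> 0"
      by (rule weighted_sup_le[OF \<Omega> apprD(1)[OF a] ua]) (use z(1) in \<open>auto elim!: eventually_mono\<close>)
    moreover have "in_Lp r \<Omega> (wgrad \<Omega> u)" for r
    proof (rule in_LpI[OF \<Omega>, of "\<lambda>_. 0"])
      show "AE x\<in>\<Omega> in lborel. wgrad \<Omega> u x = 0" using appr_wgrad[OF a \<Omega> ua] z(2) by eventually_elim simp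
    qed auto
    ultimately show ?thesis by simp
  qed
  then show "weighted_sup \<Omega> u < \<infinity>" and "\<And>r. 1 < r \<and> r \<le> q \<Longrightarrow> in_Lp r \<Omega> (wgrad \<Omega> u)" by auto
qed

end
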